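(* Let $G$ be a profinite group, let $\mathcal{S}=\{S_x\}_{x\in X}$ be a family of subgroups of $G$ continuously indexed by a profinite space $X$, let $\pi$ be a non-empty set of primes, and let $A$ be a finite $\pi$-primary $G$-module. There is a natural bijection between $H^2(G,\mathcal{S};A)$ and the set of equivalence classes of relative extensions of $(G,\mathcal{S})$ by $A$.
   Context: All homomorphisms between topological groups or modules are continuous, $\mathrm{Hom}$-groups consist of continuous homomorphisms, and $G$-modules have continuous action. **Continuously indexed families.** The family $\{S_x\}_{x\in X}$ is continuously indexed by the profinite space $X$ if for every open subset $U\subseteq G$ the set $\{x\in X: S_x\subseteq U\}$ is open in $X$; equivalently the set $\{(g,x)\in G\times X: g\in S_x\}$, also denoted $\mathcal{S}$, is closed in $G\times X$. **Relative cohomology.** $\mathbb{Z}_\pi=\prod_{p\in\pi}\mathbb{Z}_p$; for a profinite space $Z$, $\mathbb{Z}_\pi[\![Z]\!]$ is the free profinite $\mathbb{Z}_\pi$-module on $Z$. The set $G/\mathcal{S}=\bigsqcup_{x\in X}G/S_x$ has the quotient topology from $G\times X$ and is a profinite $G$-space. Let $\mathrm{ev}\colon\mathbb{Z}_\pi[\![G/\mathcal{S}]\!]\to\mathbb{Z}_\pi$ be the augmentation, $\Delta=\ker(\mathrm{ev})$, and $\mathrm{in}\colon\Delta\to\mathbb{Z}_\pi[\![G/\mathcal{S}]\!]$ the inclusion, giving a short exact sequence $0\to\Delta\to\mathbb{Z}_\pi[\![G/\mathcal{S}]\!]\to\mathbb{Z}_\pi\to0$. For a discrete $\pi$-primary $G$-module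 $A$ define $$H^n(G,\mathcal{S};A)=H^{n-1}(G;\mathrm{Hom}(\Delta,A))=\mathrm{Ext}^{n-1}_G(\mathbb{Z}_\pi,\mathrm{Hom}(\Delta,A)),$$ where $\mathrm{Hom}(\Delta,A)$ is a discrete $\pi$-primary $G$-module with the diagonal action $(g\cdot f)(m)=gf(g^{-1}m)$. **Relative extensions.** A relative extension of $(G,\mathcal{S})$ by $A$ is a pair $(E,q)$ where $0\to A\to E\xrightarrow{p}G\to1$ is a continuous extension of $G$ by $A$ (of profinite groups, inducing the given $G$-action on $A$) and $q\colon\mathcal{S}\to E$ is a continuous map such that each restriction $q_x\colon S_x\to E$ ($x\in X$) is a homomorphism with $pq_x=\mathrm{id}_{S_x}$. Two relative extensions $(E,q)$ and $(\widetilde E,\tilde q)$ are equivalent if there are a (continuous) equivalence of extensions $f\colon E\to\widetilde E$ and a continuous function $X\to A$, $x\mapsto a_x$, such that $\tilde q_x(s)=a_x\cdot f(q_x(s))\cdot a_x^{-1}$ for all $x\in X$, $s\in S_x$. **The natural bijection.** Let $C_n(G)=\mathbb{Z}_\pi[\![G]\!][\![G^{n}]\!]$ be the standard profinite resolution of $\mathbb{Z}_\pi$ (free on symbols $[g_1,\dots,g_n]$), and put $C^n(G;A)=\mathrm{Hom}_G(C_n(G),A)$, $C^n(\mathcal{S};A)=\mathrm{Hom}_G(C_n(G),\mathrm{Hom}(\mathbb{Z}_\pi[\![G/\mathcal{S}]\!],A))$, $C^{n+1}(G,\mathcal{S};A)=\mathrm{Hom}_G(C_n(G),\mathrm{Hom}(\Delta,A))$,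 with coboundaries $d$ given by precomposition with the boundary maps of $C_\bullet(G)$ and the induced maps $\mathrm{ev}^*\colon C^n(G;A)\to C^n(\mathcal{S};A)$, $\mathrm{in}^*\colon C^n(\mathcal{S};A)\to C^{n+1}(G,\mathcal{S};A)$. The natural bijection referred to is induced by the following construction. Given a cocycle $\xi\in C^2(G,\mathcal{S};A)$, choose $\eta\in C^1(\mathcal{S};A)$ with $\mathrm{in}^*\eta=\xi$, and let $\zeta\in C^2(G;A)$ be the unique cochain with $\mathrm{ev}^*\zeta=d\eta$. Let $E_\zeta$ be the space $A\times G$ with multiplication $(a_1,g_1)\star(a_2,g_2)=(a_1+g_1a_2+\zeta([g_1,g_2]),g_1g_2)$ (with $A$ embedded by $a\mapsto(a-\zeta([1,1]),1)$), and $q_x(s)=(-\eta([s])(1S_x),s)$. The class $[\xi]$ corresponds to the class of $(E_\zeta,q)$. *)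

theory Defs
  imports
    "HOL-Analysis.Analysis"
    "HOL-Algebra.FiniteProduct"
    "HOL-Algebra.Product_Groups"
    "HOL-Algebra.Elementary_Groups"
    "HOL-Computational_Algebra.Primes"
    "HOL-Library.Disjoint_Sets"
begin

section \<open>Topological groups and profinite spaces\<close>

text \<open>
  Abelian groups are \<open>comm_group\<close>s and hence written multiplicatively: for a module \<open>M\<close>,
  \<open>x \<otimes>\<^bsub>M\<^esub> y\<close> is the sum, \<open>\<one>\<^bsub>M\<^esub>\<close> is zero and \<open>inv\<^bsub>M\<^esub> x\<close> is \<open>- x\<close>.
\<close>

record 'a tgroup = "'a monoid" +
  topo :: "'a topology"

definition profinite_space :: "'a topology \<Rightarrow> bool" where
  "profinite_space T \<longleftrightarrow>
     compact_space T \<and> Hausdorff_space T \<and> (\<forall>C. connectedin T C \<longrightarrow> (\<exists>a. C \<subseteq> {a}))"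

definition topological_group :: "'a tgroup \<Rightarrow> bool" where
  "topological_group G \<longleftrightarrow>
     group G \<and> topspace (topo G) = carrier G \<and>
     continuous_map (prod_topology (topo G) (topo G)) (topo G) (\<lambda>(x, y). x \<otimes>\<^bsub>G\<^esub> y) \<and>
     continuous_map (topo G) (topo G) (\<lambda>x. inv\<^bsub>G\<^esub> x)"

definition profinite_group :: "'a tgroup \<Rightarrow> bool" where
  "profinite_group G \<longleftrightarrow> topological_group G \<and> profinite_space (topo G)"

definition discrete_group :: "'a monoid \<Rightarrow> 'a tgroup" where
  "discrete_group G = \<lparr>carrier = carrier G, monoid.mult = monoid.mult G, one = one G,
     topo = discrete_topology (carrier G)\<rparr>"

definition tprod :: "'i set \<Rightarrow> ('i \<Rightarrow> 'a tgroup) \<Rightarrow> ('i \<Rightarrow> 'a) tgroup" where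
  "tprod I M = \<lparr>carrier = carrier (product_group I M), monoid.mult = monoid.mult (product_group I M),
     one = one (product_group I M), topo = product_topology (\<lambda>i. topo (M i)) I\<rparr>"

definition tsub :: "'a tgroup \<Rightarrow> 'a set \<Rightarrow> 'a tgroup" where
  "tsub M H = M\<lparr>carrier := carrier M \<inter> H, topo := subtopology (topo M) H\<rparr>"

text \<open>
  Continuous homomorphisms. They are extensional, so that equality in a \<open>Hom\<close>-group is equality
  of homomorphisms.
\<close>

definition chom :: "'a tgroup \<Rightarrow> 'b tgroup \<Rightarrow> ('a \<Rightarrow> 'b) set" where
  "chom M N = {f \<in> hom M N \<inter> extensional (carrier M). continuous_map (topo M) (topo N) f}"

definition quot_topology :: "'a topology \<Rightarrow> ('a \<Rightarrow> 'b) \<Rightarrow> 'b topology" where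
  "quot_topology T q =
     topology (\<lambda>U. U \<subseteq> q ` topspace T \<and> openin T {x \<in> topspace T. q x \<in> U})"

lemma openin_quot_topology:
  "openin (quot_topology T q) U \<longleftrightarrow> U \<subseteq> q ` topspace T \<and> openin T {x \<in> topspace T. q x \<in> U}"
proof -
  let ?P = "\<lambda>U. U \<subseteq> q ` topspace T \<and> openin T {x \<in> topspace T. q x \<in> U}"
  have "istopology ?P"
    unfolding istopology_def
  proof (intro conjI allI impI)
    fix U V assume U: "?P U" and V: "?P V"
    have "{x \<in> topspace T. q x \<in> U \<inter> V} =
        {x \<in> topspace T. q x \<in> U} \<inter> {x \<in> topspace T. q x \<in> V}" by auto
    then show "openin T {x \<in> topspace T. q x \<in> U \<inter> V}" using U V by auto
    show "U \<inter> V \<subseteq> q ` topspace T" using U by auto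
  next
    fix K assume K: "\<forall>U\<in>K. ?P U"
    have "{x \<in> topspace T. q x \<in> \<Union>K} = (\<Union>U\<in>K. {x \<in> topspace T. q x \<in> U})" by auto
    moreover have "openin T (\<Union>U\<in>K. {x \<in> topspace T. q x \<in> U})" using K by blast
    ultimately show "openin T {x \<in> topspace T. q x \<in> \<Union>K}" by simp
    show "\<Union>K \<subseteq> q ` topspace T" using K by blast
  qed
  then show ?thesis unfolding quot_topology_def by (simp add: topology_inverse')
qed

lemma topspace_quot_topology [simp]: "topspace (quot_topology T q) = q ` topspace T"
proof -
  have *: "{x \<in> topspace T. q x \<in> q ` topspace T} = topspace T" by auto
  have "openin (quot_topology T q) (q ` topspace T)"
    unfolding openin_quot_topology * by simp
  then show ?thesis
    by (metis openin_quot_topology openin_subset openin_topspace subset_antisym)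
qed

lemma quotient_map_quot_topology: "quotient_map T (quot_topology T q) q"
  by (simp add: quotient_map_def openin_quot_topology)

section \<open>\<open>G\<close>-modules and continuously indexed families\<close>

definition gmodule :: "'g tgroup \<Rightarrow> 'a tgroup \<Rightarrow> ('g \<Rightarrow> 'a \<Rightarrow> 'a) \<Rightarrow> bool" where
  "gmodule G A act \<longleftrightarrow>
     comm_group A \<and> topological_group A \<and>
     (\<forall>g\<in>carrier G. act g \<in> hom A A) \<and>
     (\<forall>a\<in>carrier A. act \<one>\<^bsub>G\<^esub> a = a) \<and>
     (\<forall>g\<in>carrier G. \<forall>h\<in>carrier G. \<forall>a\<in>carrier A. act (g \<otimes>\<^bsub>G\<^esub> h) a = act g (act h a)) \<and>
     continuous_map (prod_topology (topo G) (topo A)) (topo A) (\<lambda>(g, a). act g a)"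

definition finite_primary_gmodule ::
    "nat set \<Rightarrow> 'g tgroup \<Rightarrow> 'a tgroup \<Rightarrow> ('g \<Rightarrow> 'a \<Rightarrow> 'a) \<Rightarrow> bool" where
  "finite_primary_gmodule \<pi> G A act \<longleftrightarrow>
     gmodule G A act \<and> topo A = discrete_topology (carrier A) \<and> finite (carrier A) \<and>
     (\<forall>p. prime p \<and> p dvd order A \<longrightarrow> p \<in> \<pi>)"

text \<open>Subgroups of a profinite group are closed by convention.\<close>

definition continuously_indexed :: "'g tgroup \<Rightarrow> 'x topology \<Rightarrow> ('x \<Rightarrow> 'g set) \<Rightarrow> bool" where
  "continuously_indexed G X S \<longleftrightarrow>
     (\<forall>x\<in>topspace X. subgroup (S x) G \<and> closedin (topo G) (S x)) \<and>
     (\<forall>U. openin (topo G) U \<longrightarrow> openin X {x \<in> topspace X. S x \<subseteq> U})"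

definition total_family :: "'x topology \<Rightarrow> ('x \<Rightarrow> 'g set) \<Rightarrow> ('g \<times> 'x) set" where
  "total_family X S = {(g, x). x \<in> topspace X \<and> g \<in> S x}"

text \<open>
  The space \<open>\<Squnion>\<^sub>x G / S\<^sub>x\<close>; the second component of a point is its index \<open>x\<close>.
\<close>

definition coset_space ::
    "'g tgroup \<Rightarrow> 'x topology \<Rightarrow> ('x \<Rightarrow> 'g set) \<Rightarrow> ('g set \<times> 'x) topology" where
  "coset_space G X S = quot_topology (prod_topology (topo G) X) (\<lambda>(g, x). (g <#\<^bsub>G\<^esub> S x, x))"

definition coset_space_act :: "'g tgroup \<Rightarrow> 'g \<Rightarrow> 'g set \<times> 'x \<Rightarrow> 'g set \<times> 'x" where
  "coset_space_act G g = (\<lambda>(C, x). (g <#\<^bsub>G\<^esub> C, x))"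

section \<open>\<open>\<int>\<^sub>\<pi>\<close> and free profinite modules\<close>

text \<open>
  Only the additive topological group of \<open>\<int>\<^sub>\<pi>\<close> and the element \<open>1\<close> are needed: \<open>1\<close> generates
  a dense subgroup, so continuous additive maps between the modules below (profinite
  \<open>\<int>\<^sub>\<pi>\<close>-modules, or discrete \<open>\<pi>\<close>-primary ones) are automatically \<open>\<int>\<^sub>\<pi>\<close>-linear.
\<close>

definition Zp :: "nat \<Rightarrow> (nat \<Rightarrow> int) tgroup" where
  "Zp p = tsub (tprod UNIV (\<lambda>k. discrete_group (integer_mod_group (p ^ k))))
     {a. \<forall>k. a (Suc k) mod int p ^ k = a k}"

definition Zpi :: "nat set \<Rightarrow> (nat \<Rightarrow> nat \<Rightarrow> int) tgroup" where
  "Zpi \<pi> = tprod \<pi> Zp"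

definition Zpi_unit :: "nat set \<Rightarrow> nat \<Rightarrow> nat \<Rightarrow> int" where
  "Zpi_unit \<pi> = (\<lambda>p\<in>\<pi>. \<lambda>k. 1 mod int p ^ k)"

definition clopen_partitions :: "'y topology \<Rightarrow> 'y set set set" where
  "clopen_partitions Y =
     {P. finite P \<and> partition_on (topspace Y) P \<and> (\<forall>U\<in>P. openin Y U \<and> closedin Y U)}"

text \<open>
  \<open>pf_free R Y\<close> is \<open>R\<lbrakk>Y\<rbrakk>\<close>, the free profinite \<open>R\<close>-module on the profinite space \<open>Y\<close>, as the
  inverse limit of the free modules \<open>R[P]\<close> over the finite discrete quotients \<open>P\<close> of \<open>Y\<close>,
  i.e. over the finite partitions of \<open>Y\<close> into clopen sets. An element \<open>m\<close> has the coefficient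
  \<open>m P U\<close> at the basis element \<open>U\<close> of \<open>R[P]\<close>, and \<open>R[P] \<rightarrow> R[Q]\<close> adds up the coefficients of all
  \<open>U \<in> P\<close> lying in the same \<open>V \<in> Q\<close>. With \<open>R = \<int>\<^sub>\<pi>\<close> and \<open>Y = G\<close> this is the additive group of
  the completed group ring \<open>\<int>\<^sub>\<pi>\<lbrakk>G\<rbrakk>\<close>.
\<close>

definition pf_free :: "'r tgroup \<Rightarrow> 'y topology \<Rightarrow> ('y set set \<Rightarrow> 'y set \<Rightarrow> 'r) tgroup" where
  "pf_free R Y = tsub (tprod (clopen_partitions Y) (\<lambda>P. tprod P (\<lambda>_. R)))
     {m. \<forall>P\<in>clopen_partitions Y. \<forall>Q\<in>clopen_partitions Y. refines (topspace Y) P Q \<longrightarrow>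
          (\<forall>V\<in>Q. m Q V = (\<Otimes>\<^bsub>R\<^esub>U\<in>{U \<in> P. U \<subseteq> V}. m P U))}"

text \<open>The element \<open>r y\<close> of \<open>R\<lbrakk>Y\<rbrakk>\<close>, for \<open>r \<in> R\<close> and \<open>y \<in> Y\<close>.\<close>

definition dirac :: "'r tgroup \<Rightarrow> 'y topology \<Rightarrow> 'r \<Rightarrow> 'y \<Rightarrow> 'y set set \<Rightarrow> 'y set \<Rightarrow> 'r" where
  "dirac R Y r y = (\<lambda>P\<in>clopen_partitions Y. \<lambda>U\<in>P. if y \<in> U then r else \<one>\<^bsub>R\<^esub>)"

text \<open>
  The action of \<open>G\<close> on \<open>R\<lbrakk>Y\<rbrakk>\<close> induced by an action \<open>\<alpha>\<close> of \<open>G\<close> on the space \<open>Y\<close>; it sends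
  \<open>r y\<close> to \<open>r (\<alpha> g y)\<close>.
\<close>

definition pf_free_act ::
    "'g tgroup \<Rightarrow> 'y topology \<Rightarrow> ('g \<Rightarrow> 'y \<Rightarrow> 'y) \<Rightarrow> 'g \<Rightarrow>
     ('y set set \<Rightarrow> 'y set \<Rightarrow> 'r) \<Rightarrow> 'y set set \<Rightarrow> 'y set \<Rightarrow> 'r" where
  "pf_free_act G Y \<alpha> g m = (\<lambda>P\<in>clopen_partitions Y. \<lambda>U\<in>P.
     m ((`) (\<alpha> (inv\<^bsub>G\<^esub> g)) ` P) (\<alpha> (inv\<^bsub>G\<^esub> g) ` U))"

type_synonym 'y zfree = "'y set set \<Rightarrow> 'y set \<Rightarrow> nat \<Rightarrow> nat \<Rightarrow> int"

text \<open>
  The augmentation of \<open>R\<lbrakk>Y\<rbrakk>\<close> for nonempty \<open>Y\<close>: the coefficient at the one-point quotient of \<open>Y\<close>.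
\<close>

definition augm :: "'y topology \<Rightarrow> ('y set set \<Rightarrow> 'y set \<Rightarrow> 'r) \<Rightarrow> 'r" where
  "augm Y m = m {topspace Y} (topspace Y)"

section \<open>The standard resolution and continuous cohomology\<close>

definition power_top :: "'g tgroup \<Rightarrow> nat \<Rightarrow> (nat \<Rightarrow> 'g) topology" where
  "power_top G n = product_topology (\<lambda>_. topo G) {..<n}"

definition tuple :: "'g list \<Rightarrow> nat \<Rightarrow> 'g" where
  "tuple gs = (\<lambda>i\<in>{..<length gs}. gs ! i)"

type_synonym 'g cplx = "(nat \<Rightarrow> 'g) set set \<Rightarrow> (nat \<Rightarrow> 'g) set \<Rightarrow> 'g zfree"

definition std_res :: "nat set \<Rightarrow> 'g tgroup \<Rightarrow> nat \<Rightarrow> 'g cplx tgroup" where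
  "std_res \<pi> G n = pf_free (pf_free (Zpi \<pi>) (topo G)) (power_top G n)"

text \<open>\<open>G\<close> acts on \<open>\<int>\<^sub>\<pi>\<lbrakk>G\<rbrakk>\<lbrakk>G\<^sup>n\<rbrakk>\<close> through the coefficients in \<open>\<int>\<^sub>\<pi>\<lbrakk>G\<rbrakk>\<close>.\<close>

definition std_act :: "'g tgroup \<Rightarrow> nat \<Rightarrow> 'g \<Rightarrow> 'g cplx \<Rightarrow> 'g cplx" where
  "std_act G n g m = (\<lambda>P\<in>clopen_partitions (power_top G n). \<lambda>U\<in>P.
     pf_free_act G (topo G) (\<lambda>h k. h \<otimes>\<^bsub>G\<^esub> k) g (m P U))"

text \<open>The free generator \<open>[g\<^sub>1, \<dots>, g\<^sub>n]\<close> of \<open>C\<^sub>n(G)\<close>, for the list \<open>gs\<close> of the \<open>g\<^sub>i\<close>.\<close>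

definition symb :: "nat set \<Rightarrow> 'g tgroup \<Rightarrow> 'g list \<Rightarrow> 'g cplx" where
  "symb \<pi> G gs = dirac (pf_free (Zpi \<pi>) (topo G)) (power_top G (length gs))
     (dirac (Zpi \<pi>) (topo G) (Zpi_unit \<pi>) \<one>\<^bsub>G\<^esub>) (tuple gs)"

definition homG ::
    "'g tgroup \<Rightarrow> 'm tgroup \<Rightarrow> ('g \<Rightarrow> 'm \<Rightarrow> 'm) \<Rightarrow> 'n tgroup \<Rightarrow> ('g \<Rightarrow> 'n \<Rightarrow> 'n) \<Rightarrow> ('m \<Rightarrow> 'n) set"
  where
  "homG G M actM N actN =
     {f \<in> chom M N. \<forall>g\<in>carrier G. \<forall>m\<in>carrier M. f (actM g m) = actN g (f m)}"

text \<open>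
  \<open>[g\<^sub>1, \<dots>, g\<^sub>i\<^sub>+\<^sub>1 g\<^sub>i\<^sub>+\<^sub>2, \<dots>, g\<^sub>n]\<close>, with the list positions counted from \<open>0\<close>.
\<close>

definition merge :: "'g tgroup \<Rightarrow> nat \<Rightarrow> 'g list \<Rightarrow> 'g list" where
  "merge G i gs = take i gs @ (gs ! i \<otimes>\<^bsub>G\<^esub> gs ! Suc i) # drop (Suc (Suc i)) gs"

text \<open>
  The boundary map \<open>\<partial>: C\<^sub>n\<^sub>+\<^sub>1(G) \<rightarrow> C\<^sub>n(G)\<close>, determined on the free generators by
  \<open>\<partial>[g\<^sub>1, \<dots>, g\<^sub>n\<^sub>+\<^sub>1] = g\<^sub>1[g\<^sub>2, \<dots>, g\<^sub>n\<^sub>+\<^sub>1]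
     + \<Sum>\<^sub>i (- 1)\<^sup>i [g\<^sub>1, \<dots>, g\<^sub>i g\<^sub>i\<^sub>+\<^sub>1, \<dots>, g\<^sub>n\<^sub>+\<^sub>1] + (- 1)\<^sup>n\<^sup>+\<^sup>1 [g\<^sub>1, \<dots>, g\<^sub>n]\<close>.
\<close>

definition boundary :: "nat set \<Rightarrow> 'g tgroup \<Rightarrow> nat \<Rightarrow> 'g cplx \<Rightarrow> 'g cplx" where
  "boundary \<pi> G n = (THE f.
     f \<in> homG G (std_res \<pi> G (Suc n)) (std_act G (Suc n)) (std_res \<pi> G n) (std_act G n) \<and>
     (\<forall>gs\<in>lists (carrier G). length gs = Suc n \<longrightarrow>
       f (symb \<pi> G gs) =
         std_act G n (hd gs) (symb \<pi> G (tl gs))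
         \<otimes>\<^bsub>std_res \<pi> G n\<^esub>
         (\<Otimes>\<^bsub>std_res \<pi> G n\<^esub>i\<in>{..<n}.
            symb \<pi> G (merge G i gs) [^]\<^bsub>std_res \<pi> G n\<^esub> ((- 1) ^ Suc i :: int))
         \<otimes>\<^bsub>std_res \<pi> G n\<^esub>
         symb \<pi> G (butlast gs) [^]\<^bsub>std_res \<pi> G n\<^esub> ((- 1) ^ Suc n :: int)))"

text \<open>
  \<open>Hom\<^sub>G(C\<^sub>n(G), N)\<close> with pointwise addition; \<open>N\<close> is a topological abelian group with the
  \<open>G\<close>-action \<open>act\<close>.
\<close>

definition cochains ::
    "nat set \<Rightarrow> 'g tgroup \<Rightarrow> nat \<Rightarrow> 'n tgroup \<Rightarrow> ('g \<Rightarrow> 'n \<Rightarrow> 'n) \<Rightarrow> ('g cplx \<Rightarrow> 'n) monoid" where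
  "cochains \<pi> G n N act =
     \<lparr>carrier = homG G (std_res \<pi> G n) (std_act G n) N act,
      monoid.mult = (\<lambda>f h. \<lambda>c\<in>carrier (std_res \<pi> G n). f c \<otimes>\<^bsub>N\<^esub> h c),
      one = (\<lambda>c\<in>carrier (std_res \<pi> G n). \<one>\<^bsub>N\<^esub>)\<rparr>"

definition cobdry ::
    "nat set \<Rightarrow> 'g tgroup \<Rightarrow> nat \<Rightarrow> ('g cplx \<Rightarrow> 'n) \<Rightarrow> 'g cplx \<Rightarrow> 'n" where
  "cobdry \<pi> G n f = compose (carrier (std_res \<pi> G (Suc n))) f (boundary \<pi> G n)"

definition cocycles ::
    "nat set \<Rightarrow> 'g tgroup \<Rightarrow> nat \<Rightarrow> 'n tgroup \<Rightarrow> ('g \<Rightarrow> 'n \<Rightarrow> 'n) \<Rightarrow> ('g cplx \<Rightarrow> 'n) monoid" where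
  "cocycles \<pi> G n N act = (cochains \<pi> G n N act)
     \<lparr>carrier := kernel (cochains \<pi> G n N act) (cochains \<pi> G (Suc n) N act) (cobdry \<pi> G n)\<rparr>"

definition coboundaries ::
    "nat set \<Rightarrow> 'g tgroup \<Rightarrow> nat \<Rightarrow> 'n tgroup \<Rightarrow> ('g \<Rightarrow> 'n \<Rightarrow> 'n) \<Rightarrow> ('g cplx \<Rightarrow> 'n) set" where
  "coboundaries \<pi> G n N act =
     (case n of 0 \<Rightarrow> {one (cochains \<pi> G 0 N act)}
      | Suc k \<Rightarrow> cobdry \<pi> G k ` carrier (cochains \<pi> G k N act))"

definition cohomology ::
    "nat set \<Rightarrow> 'g tgroup \<Rightarrow> nat \<Rightarrow> 'n tgroup \<Rightarrow> ('g \<Rightarrow> 'n \<Rightarrow> 'n) \<Rightarrow> ('g cplx \<Rightarrow> 'n) set monoid" where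
  "cohomology \<pi> G n N act = cocycles \<pi> G n N act Mod coboundaries \<pi> G n N act"

definition cohomology_class ::
    "nat set \<Rightarrow> 'g tgroup \<Rightarrow> nat \<Rightarrow> 'n tgroup \<Rightarrow> ('g \<Rightarrow> 'n \<Rightarrow> 'n) \<Rightarrow> ('g cplx \<Rightarrow> 'n) \<Rightarrow> ('g cplx \<Rightarrow> 'n) set"
  where
  "cohomology_class \<pi> G n N act f =
     coboundaries \<pi> G n N act #>\<^bsub>cocycles \<pi> G n N act\<^esub> f"

section \<open>Relative cohomology\<close>

definition hom_module :: "'m tgroup \<Rightarrow> 'a tgroup \<Rightarrow> ('m \<Rightarrow> 'a) tgroup" where
  "hom_module M A = discrete_group
     \<lparr>carrier = chom M A,
      monoid.mult = (\<lambda>f h. \<lambda>m\<in>carrier M. f m \<otimes>\<^bsub>A\<^esub> h m),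
      one = (\<lambda>m\<in>carrier M. \<one>\<^bsub>A\<^esub>)\<rparr>"

definition hom_act ::
    "'g tgroup \<Rightarrow> 'm tgroup \<Rightarrow> ('g \<Rightarrow> 'm \<Rightarrow> 'm) \<Rightarrow> ('g \<Rightarrow> 'a \<Rightarrow> 'a) \<Rightarrow> 'g \<Rightarrow> ('m \<Rightarrow> 'a) \<Rightarrow> 'm \<Rightarrow> 'a" where
  "hom_act G M actM act g f = (\<lambda>m\<in>carrier M. act g (f (actM (inv\<^bsub>G\<^esub> g) m)))"

type_synonym ('g, 'x) zcosets = "('g set \<times> 'x) zfree"

definition Zcosets ::
    "nat set \<Rightarrow> 'g tgroup \<Rightarrow> 'x topology \<Rightarrow> ('x \<Rightarrow> 'g set) \<Rightarrow> ('g, 'x) zcosets tgroup" where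
  "Zcosets \<pi> G X S = pf_free (Zpi \<pi>) (coset_space G X S)"

definition Zcosets_act ::
    "'g tgroup \<Rightarrow> 'x topology \<Rightarrow> ('x \<Rightarrow> 'g set) \<Rightarrow> 'g \<Rightarrow> ('g, 'x) zcosets \<Rightarrow> ('g, 'x) zcosets" where
  "Zcosets_act G X S = pf_free_act G (coset_space G X S) (coset_space_act G)"

definition Delta ::
    "nat set \<Rightarrow> 'g tgroup \<Rightarrow> 'x topology \<Rightarrow> ('x \<Rightarrow> 'g set) \<Rightarrow> ('g, 'x) zcosets tgroup" where
  "Delta \<pi> G X S =
     tsub (Zcosets \<pi> G X S) (kernel (Zcosets \<pi> G X S) (Zpi \<pi>) (augm (coset_space G X S)))"

abbreviation "HomZ \<pi> G X S A \<equiv> hom_module (Zcosets \<pi> G X S) A"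
abbreviation "HomZ_act \<pi> G X S act \<equiv> hom_act G (Zcosets \<pi> G X S) (Zcosets_act G X S) act"
abbreviation "HomDelta \<pi> G X S A \<equiv> hom_module (Delta \<pi> G X S) A"
abbreviation "HomDelta_act \<pi> G X S act \<equiv> hom_act G (Delta \<pi> G X S) (Zcosets_act G X S) act"

text \<open>\<open>C\<^sup>n(\<S>; A)\<close>.\<close>

definition family_cochains ::
    "nat set \<Rightarrow> 'g tgroup \<Rightarrow> 'x topology \<Rightarrow> ('x \<Rightarrow> 'g set) \<Rightarrow> 'a tgroup \<Rightarrow> ('g \<Rightarrow> 'a \<Rightarrow> 'a) \<Rightarrow> nat \<Rightarrow>
     ('g cplx \<Rightarrow> ('g, 'x) zcosets \<Rightarrow> 'a) monoid" where
  "family_cochains \<pi> G X S A act n =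
     cochains \<pi> G n (HomZ \<pi> G X S A) (HomZ_act \<pi> G X S act)"

text \<open>
  The relative groups in degree \<open>n \<ge> 1\<close>; the shift \<open>n - 1\<close> is the one in
  \<open>H\<^sup>n(G, \<S>; A) = H\<^sup>n\<^sup>-\<^sup>1(G; Hom(\<Delta>, A))\<close>.
\<close>

definition rel_cocycles ::
    "nat set \<Rightarrow> 'g tgroup \<Rightarrow> 'x topology \<Rightarrow> ('x \<Rightarrow> 'g set) \<Rightarrow> 'a tgroup \<Rightarrow> ('g \<Rightarrow> 'a \<Rightarrow> 'a) \<Rightarrow> nat \<Rightarrow>
     ('g cplx \<Rightarrow> ('g, 'x) zcosets \<Rightarrow> 'a) monoid" where
  "rel_cocycles \<pi> G X S A act n =
     cocycles \<pi> G (n - 1) (HomDelta \<pi> G X S A) (HomDelta_act \<pi> G X S act)"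

definition rel_cohomology ::
    "nat set \<Rightarrow> 'g tgroup \<Rightarrow> 'x topology \<Rightarrow> ('x \<Rightarrow> 'g set) \<Rightarrow> 'a tgroup \<Rightarrow> ('g \<Rightarrow> 'a \<Rightarrow> 'a) \<Rightarrow> nat \<Rightarrow>
     ('g cplx \<Rightarrow> ('g, 'x) zcosets \<Rightarrow> 'a) set monoid" where
  "rel_cohomology \<pi> G X S A act n =
     cohomology \<pi> G (n - 1) (HomDelta \<pi> G X S A) (HomDelta_act \<pi> G X S act)"

definition rel_class ::
    "nat set \<Rightarrow> 'g tgroup \<Rightarrow> 'x topology \<Rightarrow> ('x \<Rightarrow> 'g set) \<Rightarrow> 'a tgroup \<Rightarrow> ('g \<Rightarrow> 'a \<Rightarrow> 'a) \<Rightarrow> nat \<Rightarrow>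
     ('g cplx \<Rightarrow> ('g, 'x) zcosets \<Rightarrow> 'a) \<Rightarrow> ('g cplx \<Rightarrow> ('g, 'x) zcosets \<Rightarrow> 'a) set" where
  "rel_class \<pi> G X S A act n =
     cohomology_class \<pi> G (n - 1) (HomDelta \<pi> G X S A) (HomDelta_act \<pi> G X S act)"

definition in_star ::
    "nat set \<Rightarrow> 'g tgroup \<Rightarrow> 'x topology \<Rightarrow> ('x \<Rightarrow> 'g set) \<Rightarrow> nat \<Rightarrow>
     ('g cplx \<Rightarrow> ('g, 'x) zcosets \<Rightarrow> 'a) \<Rightarrow> 'g cplx \<Rightarrow> ('g, 'x) zcosets \<Rightarrow> 'a" where
  "in_star \<pi> G X S n \<eta> =
     (\<lambda>c\<in>carrier (std_res \<pi> G n). restrict (\<eta> c) (carrier (Delta \<pi> G X S)))"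

text \<open>
  The identification \<open>A \<cong> Hom(\<int>\<^sub>\<pi>, A)\<close>: the homomorphism \<open>\<lambda> \<mapsto> \<lambda> a\<close>.
\<close>

definition Zpi_scale :: "nat set \<Rightarrow> 'a tgroup \<Rightarrow> 'a \<Rightarrow> (nat \<Rightarrow> nat \<Rightarrow> int) \<Rightarrow> 'a" where
  "Zpi_scale \<pi> A a = (THE f. f \<in> chom (Zpi \<pi>) A \<and> f (Zpi_unit \<pi>) = a)"

definition ev_star ::
    "nat set \<Rightarrow> 'g tgroup \<Rightarrow> 'x topology \<Rightarrow> ('x \<Rightarrow> 'g set) \<Rightarrow> 'a tgroup \<Rightarrow> nat \<Rightarrow>
     ('g cplx \<Rightarrow> 'a) \<Rightarrow> 'g cplx \<Rightarrow> ('g, 'x) zcosets \<Rightarrow> 'a" where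
  "ev_star \<pi> G X S A n \<zeta> =
     (\<lambda>c\<in>carrier (std_res \<pi> G n).
        compose (carrier (Zcosets \<pi> G X S)) (Zpi_scale \<pi> A (\<zeta> c)) (augm (coset_space G X S)))"

section \<open>Relative extensions\<close>

text \<open>
  The data \<open>A \<rightarrow> E \<rightarrow> G\<close> and \<open>q: \<S> \<rightarrow> E\<close>, where \<open>q x s\<close> is \<open>q\<^sub>x(s)\<close>. Values of the maps outside
  their domains are irrelevant; the equivalence relation below ignores them.
\<close>

record ('a, 'g, 'x, 'e) rel_ext =
  ext_group :: "'e tgroup"
  ext_incl :: "'a \<Rightarrow> 'e"
  ext_proj :: "'e \<Rightarrow> 'g"
  ext_sec :: "'x \<Rightarrow> 'g \<Rightarrow> 'e"

definition relative_extension ::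
    "'g tgroup \<Rightarrow> 'x topology \<Rightarrow> ('x \<Rightarrow> 'g set) \<Rightarrow> 'a tgroup \<Rightarrow> ('g \<Rightarrow> 'a \<Rightarrow> 'a) \<Rightarrow>
     ('a, 'g, 'x, 'e) rel_ext \<Rightarrow> bool" where
  "relative_extension G X S A act R \<longleftrightarrow>
     profinite_group (ext_group R) \<and>
     ext_incl R \<in> mon A (ext_group R) \<and> continuous_map (topo A) (topo (ext_group R)) (ext_incl R) \<and>
     ext_proj R \<in> epi (ext_group R) G \<and> continuous_map (topo (ext_group R)) (topo G) (ext_proj R) \<and>
     ext_incl R ` carrier A = kernel (ext_group R) G (ext_proj R) \<and>
     (\<forall>e\<in>carrier (ext_group R). \<forall>a\<in>carrier A.
        e \<otimes>\<^bsub>ext_group R\<^esub> ext_incl R a \<otimes>\<^bsub>ext_group R\<^esub> inv\<^bsub>ext_group R\<^esub> e = ext_incl R (act (ext_proj R e) a)) \<and>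
     continuous_map (subtopology (prod_topology (topo G) X) (total_family X S)) (topo (ext_group R))
       (\<lambda>(s, x). ext_sec R x s) \<and>
     (\<forall>x\<in>topspace X. ext_sec R x \<in> hom (G\<lparr>carrier := S x\<rparr>) (ext_group R) \<and>
        (\<forall>s\<in>S x. ext_proj R (ext_sec R x s) = s))"

definition rel_ext_equivalent ::
    "'x topology \<Rightarrow> ('x \<Rightarrow> 'g set) \<Rightarrow> 'a tgroup \<Rightarrow>
     ('a, 'g, 'x, 'e) rel_ext \<Rightarrow> ('a, 'g, 'x, 'f) rel_ext \<Rightarrow> bool" where
  "rel_ext_equivalent X S A R R' \<longleftrightarrow>
     (\<exists>f t. f \<in> iso (ext_group R) (ext_group R') \<and>
        homeomorphic_map (topo (ext_group R)) (topo (ext_group R')) f \<and>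
        (\<forall>a\<in>carrier A. f (ext_incl R a) = ext_incl R' a) \<and>
        (\<forall>e\<in>carrier (ext_group R). ext_proj R' (f e) = ext_proj R e) \<and>
        continuous_map X (topo A) t \<and>
        (\<forall>x\<in>topspace X. \<forall>s\<in>S x.
           ext_sec R' x s =
             ext_incl R' (t x) \<otimes>\<^bsub>ext_group R'\<^esub> f (ext_sec R x s) \<otimes>\<^bsub>ext_group R'\<^esub> inv\<^bsub>ext_group R'\<^esub> (ext_incl R' (t x))))"

text \<open>
  The equivalence classes are formed among the relative extensions whose underlying set lies in
  \<open>'a \<times> 'g\<close>; \<open>relative_extension_representative\<close> below shows that every relative extension, on any
  type, is equivalent to one of these.
\<close>

definition rel_ext_rel ::
    "'g tgroup \<Rightarrow> 'x topology \<Rightarrow> ('x \<Rightarrow> 'g set) \<Rightarrow> 'a tgroup \<Rightarrow> ('g \<Rightarrow> 'a \<Rightarrow> 'a) \<Rightarrow>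
     ('a, 'g, 'x, 'a \<times> 'g) rel_ext rel" where
  "rel_ext_rel G X S A act = {(R, R'). relative_extension G X S A act R \<and>
     relative_extension G X S A act R' \<and> rel_ext_equivalent X S A R R'}"

definition rel_ext_classes ::
    "'g tgroup \<Rightarrow> 'x topology \<Rightarrow> ('x \<Rightarrow> 'g set) \<Rightarrow> 'a tgroup \<Rightarrow> ('g \<Rightarrow> 'a \<Rightarrow> 'a) \<Rightarrow>
     ('a, 'g, 'x, 'a \<times> 'g) rel_ext set set" where
  "rel_ext_classes G X S A act =
     {R. relative_extension G X S A act R} // rel_ext_rel G X S A act"

lemma relative_extension_representative:
  fixes R :: "('a, 'g, 'x, 'e) rel_ext"
  assumes G: "profinite_group G" and A: "gmodule G A act"
    and R: "relative_extension G X S A act R"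
  shows "\<exists>R' :: ('a, 'g, 'x, 'a \<times> 'g) rel_ext.
    relative_extension G X S A act R' \<and> rel_ext_equivalent X S A R R'"
proof -
  let ?E = "ext_group R" and ?i = "ext_incl R" and ?p = "ext_proj R"
  interpret G: group G using G by (simp add: profinite_group_def topological_group_def)
  interpret A: comm_group A using A by (simp add: gmodule_def)
  interpret E: group ?E
    using R by (simp add: relative_extension_def profinite_group_def topological_group_def)
  have topE: "topspace (topo ?E) = carrier ?E"
    and multE: "continuous_map (prod_topology (topo ?E) (topo ?E)) (topo ?E) (\<lambda>(x, y). x \<otimes>\<^bsub>?E\<^esub> y)"
    and invE: "continuous_map (topo ?E) (topo ?E) (\<lambda>x. inv\<^bsub>?E\<^esub> x)"
    and profE: "profinite_space (topo ?E)"
    using R by (auto simp: relative_extension_def profinite_group_def topological_group_def)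
  have topA: "topspace (topo A) = carrier A"
    using A by (simp add: gmodule_def topological_group_def)
  have ihom: "?i \<in> hom A ?E" and iinj: "inj_on ?i (carrier A)"
    and icont: "continuous_map (topo A) (topo ?E) ?i"
    and phom: "?p \<in> hom ?E G" and psurj: "?p ` carrier ?E = carrier G"
    and pcont: "continuous_map (topo ?E) (topo G) ?p"
    and ker: "?i ` carrier A = kernel ?E G ?p"
    and conj: "\<And>e a. e \<in> carrier ?E \<Longrightarrow> a \<in> carrier A \<Longrightarrow>
      e \<otimes>\<^bsub>?E\<^esub> ?i a \<otimes>\<^bsub>?E\<^esub> inv\<^bsub>?E\<^esub> e = ?i (act (?p e) a)"
    and qcont: "continuous_map (subtopology (prod_topology (topo G) X) (total_family X S)) (topo ?E)
       (\<lambda>(s, x). ext_sec R x s)"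
    and qhom: "\<And>x. x \<in> topspace X \<Longrightarrow> ext_sec R x \<in> hom (G\<lparr>carrier := S x\<rparr>) ?E"
    and pq: "\<And>x s. x \<in> topspace X \<Longrightarrow> s \<in> S x \<Longrightarrow> ?p (ext_sec R x s) = s"
    using R by (auto simp: relative_extension_def mon_def epi_def)
  interpret p: group_hom ?E G ?p
    using phom by (simp add: group_hom_def group_hom_axioms_def G.is_group E.is_group)
  define sec where "sec g = (SOME e. e \<in> carrier ?E \<and> ?p e = g)" for g
  have sec: "sec g \<in> carrier ?E" "?p (sec g) = g" if "g \<in> carrier G" for g
  proof -
    have "\<exists>e. e \<in> carrier ?E \<and> ?p e = g" using psurj that by (metis imageE)
    then have "sec g \<in> carrier ?E \<and> ?p (sec g) = g" unfolding sec_def by (rule someI_ex)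
    then show "sec g \<in> carrier ?E" "?p (sec g) = g" by auto
  qed
  define t where "t e = (inv_into (carrier A) ?i (e \<otimes>\<^bsub>?E\<^esub> inv\<^bsub>?E\<^esub> sec (?p e)), ?p e)" for e
  have tinj: "inj_on t (carrier ?E)"
  proof (rule inj_onI)
    fix e e' assume e: "e \<in> carrier ?E" "e' \<in> carrier ?E" and eq: "t e = t e'"
    have p: "?p e = ?p e'" using eq by (simp add: t_def)
    have k: "d \<otimes>\<^bsub>?E\<^esub> inv\<^bsub>?E\<^esub> sec (?p d) \<in> ?i ` carrier A" if "d \<in> carrier ?E" for d
      using that sec[of "?p d"] by (simp add: ker kernel_def)
    have "e \<otimes>\<^bsub>?E\<^esub> inv\<^bsub>?E\<^esub> sec (?p e) = e' \<otimes>\<^bsub>?E\<^esub> inv\<^bsub>?E\<^esub> sec (?p e')"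
      using eq k[OF e(1)] k[OF e(2)] by (auto simp: t_def dest: inv_into_injective)
    then show "e = e'" using p e sec(1)[of "?p e"] by simp
  qed
  define T where "T = quot_topology (topo ?E) t"
  have topT: "topspace T = t ` carrier ?E" by (simp add: T_def topE)
  have thomeo: "homeomorphic_map (topo ?E) T t"
    using tinj by (simp add: homeomorphic_map_def T_def quotient_map_quot_topology topE)
  then obtain u where hmaps: "homeomorphic_maps (topo ?E) T t u"
    by (auto simp: homeomorphic_map_maps)
  have ut [simp]: "u (t e) = e" if "e \<in> carrier ?E" for e
    using hmaps that by (simp add: homeomorphic_maps_def topE)
  have ucar: "u y \<in> carrier ?E" "t (u y) = y" if "y \<in> t ` carrier ?E" for y
    using that by auto
  have tcont: "continuous_map (topo ?E) T t" and ucont: "continuous_map T (topo ?E) u"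
    using hmaps by (auto simp: homeomorphic_maps_def)
  define E' where "E' = \<lparr>carrier = t ` carrier ?E,
    monoid.mult = (\<lambda>y z. t (u y \<otimes>\<^bsub>?E\<^esub> u z)), one = t \<one>\<^bsub>?E\<^esub>, topo = T\<rparr>"
  have carE': "carrier E' = t ` carrier ?E" and topoE': "topo E' = T"
    and oneE': "\<one>\<^bsub>E'\<^esub> = t \<one>\<^bsub>?E\<^esub>" and multE': "\<And>y z. y \<otimes>\<^bsub>E'\<^esub> z = t (u y \<otimes>\<^bsub>?E\<^esub> u z)"
    by (auto simp: E'_def)
  have mE': "t e \<otimes>\<^bsub>E'\<^esub> t e' = t (e \<otimes>\<^bsub>?E\<^esub> e')" if "e \<in> carrier ?E" "e' \<in> carrier ?E" for e e'
    using that by (simp add: multE')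
  have tiso: "t \<in> iso ?E E'"
    using tinj by (auto simp: iso_def hom_def carE' mE' bij_betw_def)
  have groupE': "group E'"
  proof (rule groupI)
    fix x assume "x \<in> carrier E'"
    then obtain e where e: "e \<in> carrier ?E" "x = t e" by (auto simp: carE')
    then show "\<one>\<^bsub>E'\<^esub> \<otimes>\<^bsub>E'\<^esub> x = x" by (simp add: oneE' mE')
    show "\<exists>y\<in>carrier E'. y \<otimes>\<^bsub>E'\<^esub> x = \<one>\<^bsub>E'\<^esub>"
      using e by (intro bexI[of _ "t (inv\<^bsub>?E\<^esub> e)"]) (simp_all add: oneE' mE' carE')
  qed (auto simp: carE' mE' oneE' E.m_assoc)
  interpret E': group E' by (rule groupE')
  have tinv: "inv\<^bsub>E'\<^esub> (t e) = t (inv\<^bsub>?E\<^esub> e)" if "e \<in> carrier ?E" for e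
    using that by (intro E'.inv_equality) (auto simp: mE' oneE' carE')
  have tgE': "topological_group E'"
    unfolding topological_group_def topoE'
  proof (intro conjI groupE')
    show "topspace T = carrier E'" by (simp add: topT carE')
    have "continuous_map (prod_topology T T) (prod_topology (topo ?E) (topo ?E))
        (\<lambda>z. (u (fst z), u (snd z)))"
      by (intro continuous_map_pairedI continuous_map_compose[unfolded comp_def, OF _ ucont])
        (rule continuous_map_fst continuous_map_snd)+
    from continuous_map_compose[OF continuous_map_compose[OF this multE] tcont]
    show "continuous_map (prod_topology T T) T (\<lambda>(x, y). x \<otimes>\<^bsub>E'\<^esub> y)"
      by (simp add: comp_def multE' case_prod_unfold)
    have "continuous_map T T (\<lambda>x. t (inv\<^bsub>?E\<^esub> (u x)))"
      using continuous_map_compose[OF continuous_map_compose[OF ucont invE] tcont]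
      by (simp add: comp_def)
    then show "continuous_map T T (\<lambda>x. inv\<^bsub>E'\<^esub> x)"
      by (rule continuous_map_eq) (auto simp: topT tinv)
  qed
  have profT: "profinite_space T"
    unfolding profinite_space_def
  proof (intro conjI allI impI)
    have hs: "topo ?E homeomorphic_space T" using hmaps by (auto simp: homeomorphic_space_def)
    show "compact_space T"
      using profE homeomorphic_compact_space[OF hs] by (simp add: profinite_space_def)
    show "Hausdorff_space T"
      using profE homeomorphic_Hausdorff_space[OF hs] by (simp add: profinite_space_def)
    fix C assume C: "connectedin T C"
    have "connectedin (topo ?E) (u ` C)" using C ucont connectedin_continuous_map_image by blast
    then obtain a where a: "u ` C \<subseteq> {a}" using profE by (auto simp: profinite_space_def)
    have "C \<subseteq> t ` carrier ?E" using connectedin_subset_topspace[OF C] by (simp add: topT)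
    then have "C \<subseteq> {t a}" using a ucar(2) by fastforce
    then show "\<exists>a. C \<subseteq> {a}" by blast
  qed
  define R' where "R' = \<lparr>ext_group = E', ext_incl = t \<circ> ?i, ext_proj = ?p \<circ> u,
    ext_sec = (\<lambda>x s. t (ext_sec R x s))\<rparr>"
  have R': "ext_group R' = E'" "ext_incl R' = t \<circ> ?i" "ext_proj R' = ?p \<circ> u"
    "ext_sec R' = (\<lambda>x s. t (ext_sec R x s))"
    by (auto simp: R'_def)
  have icar: "?i a \<in> carrier ?E" if "a \<in> carrier A" for a
    using ihom that by (auto simp: hom_def)
  have pcar: "?p e \<in> carrier G" if "e \<in> carrier ?E" for e
    using phom that by (auto simp: hom_def)
  have qcar: "ext_sec R x s \<in> carrier ?E" if "x \<in> topspace X" "s \<in> S x" for x s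
    using qhom[OF that(1)] that(2) by (auto simp: hom_def)
  have "relative_extension G X S A act R'"
    unfolding relative_extension_def R' topoE'
  proof (intro conjI ballI)
    show "profinite_group E'" using tgE' profT by (simp add: profinite_group_def topoE')
    show "t \<circ> ?i \<in> mon A E'"
      using ihom iinj tinj icar unfolding mon_def hom_def
      by (auto simp: carE' mE' intro!: comp_inj_on inj_on_subset[OF tinj])
    show "continuous_map (topo A) T (t \<circ> ?i)" using icont tcont by (rule continuous_map_compose)
    show "?p \<circ> u \<in> epi E' G"
      using psurj pcar by (auto simp: epi_def hom_def carE' mE' image_image)
    show "continuous_map T (topo G) (?p \<circ> u)" using ucont pcont by (rule continuous_map_compose)
    show "(t \<circ> ?i) ` carrier A = kernel E' G (?p \<circ> u)"
    proof -
      have "(t \<circ> ?i) ` carrier A = t ` kernel ?E G ?p" by (simp add: image_comp flip: ker)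
      also have "\<dots> = kernel E' G (?p \<circ> u)" by (auto simp: kernel_def carE')
      finally show ?thesis .
    qed
  next
    fix y a assume "y \<in> carrier E'" and a: "a \<in> carrier A"
    then obtain e where e: "e \<in> carrier ?E" "y = t e" by (auto simp: carE')
    then show "y \<otimes>\<^bsub>E'\<^esub> (t \<circ> ?i) a \<otimes>\<^bsub>E'\<^esub> inv\<^bsub>E'\<^esub> y = (t \<circ> ?i) (act ((?p \<circ> u) y) a)"
      using a icar[OF a] by (simp add: tinv mE' conj)
  next
    show "continuous_map (subtopology (prod_topology (topo G) X) (total_family X S)) T
        (\<lambda>(s, x). t (ext_sec R x s))"
      using continuous_map_compose[OF qcont tcont] by (simp add: comp_def case_prod_unfold)
  next
    fix x assume x: "x \<in> topspace X"
    show "(\<lambda>s. t (ext_sec R x s)) \<in> hom (G\<lparr>carrier := S x\<rparr>) E'"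
      using qhom[OF x] qcar[OF x] by (auto simp: hom_def carE' mE')
    fix s assume "s \<in> S x"
    then show "(?p \<circ> u) (t (ext_sec R x s)) = s" using x by (simp add: qcar pq)
  qed
  moreover have "rel_ext_equivalent X S A R R'"
    unfolding rel_ext_equivalent_def R'
  proof (intro exI[of _ t] exI[of _ "\<lambda>_. \<one>\<^bsub>A\<^esub>"] conjI ballI)
    show "homeomorphic_map (topo ?E) (topo E') t" using thomeo by (simp add: topoE')
    show "continuous_map X (topo A) (\<lambda>_. \<one>\<^bsub>A\<^esub>)" by (simp add: topA)
    have i1: "?i \<one>\<^bsub>A\<^esub> = \<one>\<^bsub>?E\<^esub>" using ihom by (rule hom_one) unfold_locales
    fix x s assume "x \<in> topspace X" "s \<in> S x"
    then show "t (ext_sec R x s) = (t \<circ> ?i) \<one>\<^bsub>A\<^esub> \<otimes>\<^bsub>E'\<^esub> t (ext_sec R x s) \<otimes>\<^bsub>E'\<^esub> inv\<^bsub>E'\<^esub> ((t \<circ> ?i) \<one>\<^bsub>A\<^esub>)"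
      using qcar[of x s] by (simp add: i1 mE' tinv)
  qed (use tiso in simp_all)
  ultimately show ?thesis by blast
qed

text \<open>The relative extension \<open>(E\<^sub>\<zeta>, q)\<close> constructed from \<open>\<eta>\<close> and \<open>\<zeta>\<close>.\<close>

definition cocycle_group ::
    "nat set \<Rightarrow> 'g tgroup \<Rightarrow> 'a tgroup \<Rightarrow> ('g \<Rightarrow> 'a \<Rightarrow> 'a) \<Rightarrow> ('g cplx \<Rightarrow> 'a) \<Rightarrow> ('a \<times> 'g) tgroup" where
  "cocycle_group \<pi> G A act \<zeta> =
     \<lparr>carrier = carrier A \<times> carrier G,
      monoid.mult = (\<lambda>(a\<^sub>1, g\<^sub>1) (a\<^sub>2, g\<^sub>2).
        (a\<^sub>1 \<otimes>\<^bsub>A\<^esub> act g\<^sub>1 a\<^sub>2 \<otimes>\<^bsub>A\<^esub> \<zeta> (symb \<pi> G [g\<^sub>1, g\<^sub>2]), g\<^sub>1 \<otimes>\<^bsub>G\<^esub> g\<^sub>2)),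
      one = (inv\<^bsub>A\<^esub> \<zeta> (symb \<pi> G [\<one>\<^bsub>G\<^esub>, \<one>\<^bsub>G\<^esub>]), \<one>\<^bsub>G\<^esub>),
      topo = prod_topology (topo A) (topo G)\<rparr>"

definition cocycle_rel_ext ::
    "nat set \<Rightarrow> 'g tgroup \<Rightarrow> 'x topology \<Rightarrow> ('x \<Rightarrow> 'g set) \<Rightarrow> 'a tgroup \<Rightarrow> ('g \<Rightarrow> 'a \<Rightarrow> 'a) \<Rightarrow>
     ('g cplx \<Rightarrow> ('g, 'x) zcosets \<Rightarrow> 'a) \<Rightarrow> ('g cplx \<Rightarrow> 'a) \<Rightarrow> ('a, 'g, 'x, 'a \<times> 'g) rel_ext" where
  "cocycle_rel_ext \<pi> G X S A act \<eta> \<zeta> =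
     \<lparr>ext_group = cocycle_group \<pi> G A act \<zeta>,
      ext_incl = (\<lambda>a. (a \<otimes>\<^bsub>A\<^esub> inv\<^bsub>A\<^esub> \<zeta> (symb \<pi> G [\<one>\<^bsub>G\<^esub>, \<one>\<^bsub>G\<^esub>]), \<one>\<^bsub>G\<^esub>)),
      ext_proj = snd,
      ext_sec = (\<lambda>x s. (inv\<^bsub>A\<^esub> \<eta> (symb \<pi> G [s])
        (dirac (Zpi \<pi>) (coset_space G X S) (Zpi_unit \<pi>) (\<one>\<^bsub>G\<^esub> <#\<^bsub>G\<^esub> S x, x)), s))\<rparr>"

end

theory Submission
  imports Defs "HOL-Number_Theory.Cong"
begin

text \<open>
  On the symbols \<open>[g]\<close>, a cochain \<open>\<eta> \<in> C\<^sup>1(\<S>; A)\<close> is a continuous function \<open>u(g, kS\<^sub>x)\<close>; its image in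
  \<open>C\<^sup>2(G, \<S>; A)\<close> is a cocycle exactly when \<open>d\<eta>([g, h])\<close> does not depend on the coset, and this
  constant value is \<open>\<zeta>([g, h])\<close>. Two such functions \<open>u, u'\<close> give the same class exactly when
  \<open>u'(g, y) - u(g, y) = b(g) + g w(g\<^sup>-\<^sup>1 y) - w(y)\<close> with \<open>b\<close> and \<open>w\<close> continuous; an isomorphism of the
  extensions of the form \<open>(a, g) \<mapsto> (a - b(g), g)\<close> together with \<open>a\<^sub>x = w(S\<^sub>x)\<close> is the same data.

  For surjectivity let \<open>(E, q)\<close> be a relative extension. Since \<open>A\<close> is finite and the subgroups
  \<open>q\<^sub>x(S\<^sub>x)\<close> meet it trivially, there is a continuous \<open>\<kappa>: E \<times> X \<rightarrow> A\<close> which is \<open>A\<close>-equivariant and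
  invariant under right translation of the fibre over \<open>x\<close> by \<open>q\<^sub>x(S\<^sub>x)\<close>. With a continuous section
  \<open>s\<close> of \<open>E \<rightarrow> G\<close>, the difference \<open>\<kappa>(s(g)e, x) - g \<kappa>(e, x)\<close> depends on \<open>e\<close> only through the coset of
  \<open>p(e)\<close>, and defines \<open>\<eta>\<close>.
\<close>

section \<open>Profinite spaces\<close>

text \<open>The modules are genuine inverse limits, so the passage to functions rests on two facts:
  \<open>dirac\<close> elements generate topologically, which gives uniqueness, and continuous
  functions on the space extend to homomorphisms, which gives existence. Compactness enters through
  \<open>openin_all\<close>: a jointly continuous \<open>u(g, y)\<close> with values in
  \<open>A\<close> becomes a continuous map from \<open>G\<close> to the discrete group of
  homomorphisms, since equality at all \<open>y\<close> is an open condition on \<open>g\<close>.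
  The augmentation splits, hence cochains on \<open>Delta\<close> lift, and two lifts differ by
  constants.

  For surjectivity the obstacle is that the choices over the single fibres have to vary continuously
  with \<open>x\<close>. A free action of a finite group on the fibrewise quotients of
  \<open>E\<close> has a clopen transversal, assembled from finitely many local ones, and
  \<open>\<kappa>\<close> measures the position relative to it. The same lemma with trivial
  subgroups gives the section \<open>s\<close>. The difference in the overview is then, up to sign,
  a formal coboundary of \<open>\<kappa>\<close>; its own coboundary sees only the failure of
  \<open>s\<close> to be multiplicative, which is the factor set of \<open>E\<close>.\<close>

lemma openin_all:
  assumes Y: "compact_space Y" and W: "openin (prod_topology X Y) W"
  shows "openin X {x \<in> topspace X. \<forall>y\<in>topspace Y. (x, y) \<in> W}"
proof -
  \<comment> \<open>The tube lemma in closed form: projection along a compact factor is a closed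
    map, and the set in question is the complement of the projection of \<open>?C\<close>.\<close>
  let ?C = "topspace (prod_topology X Y) - W"
  have "closedin (prod_topology X Y) ?C" using W by blast
  then have "closedin X (fst ` ?C)"
    using closed_map_fst[OF Y] unfolding closed_map_def by blast
  moreover have "{x \<in> topspace X. \<forall>y\<in>topspace Y. (x, y) \<in> W} = topspace X - fst ` ?C"
    by force
  ultimately show ?thesis by (simp add: openin_diff)
qed

lemma openin_locally:
  assumes "\<And>x. x \<in> U \<Longrightarrow> \<exists>V. openin X V \<and> x \<in> V \<and> V \<subseteq> U"
  shows "openin X U"
  using assms openin_subopen by metis

text \<open>The factor \<open>topspace X\<close> covers the empty index set, where the bare
  intersection would be \<open>UNIV\<close>.\<close>

lemma openin_finite_INT:
  assumes "finite I" "\<And>i. i \<in> I \<Longrightarrow> openin X (B i)"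
  shows "openin X (topspace X \<inter> (\<Inter>i\<in>I. B i))"
  using assms
proof (induction I)
  case (insert i I)
  have "topspace X \<inter> (\<Inter>j\<in>insert i I. B j) = B i \<inter> (topspace X \<inter> (\<Inter>j\<in>I. B j))" by auto
  then show ?case using insert by (simp add: openin_Int)
qed simp

lemma continuous_map_discreteI:
  assumes "\<And>x. x \<in> topspace X \<Longrightarrow> f x \<in> D"
    and "\<And>x. x \<in> topspace X \<Longrightarrow> \<exists>V. openin X V \<and> x \<in> V \<and> (\<forall>x'\<in>V. f x' = f x)"
  shows "continuous_map X (discrete_topology D) f"
  unfolding continuous_map_def
proof (intro conjI allI impI)
  fix U show "openin X {x \<in> topspace X. f x \<in> U}"
  proof (rule openin_locally)
    fix x assume x: "x \<in> {x \<in> topspace X. f x \<in> U}"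
    then obtain V where V: "openin X V" "x \<in> V" "\<forall>x'\<in>V. f x' = f x" using assms(2) by auto
    then have "V \<subseteq> {x \<in> topspace X. f x \<in> U}" using x openin_subset by fastforce
    then show "\<exists>V. openin X V \<and> x \<in> V \<and> V \<subseteq> {x \<in> topspace X. f x \<in> U}" using V by blast
  qed
qed (use assms in auto)

lemma openin_discrete_fibre:
  assumes "continuous_map X (discrete_topology D) f"
  shows "openin X {x \<in> topspace X. f x = d}"
proof -
  have "openin X {x \<in> topspace X. f x \<in> {d} \<inter> D}"
    using assms unfolding continuous_map_def openin_discrete_topology by blast
  moreover have "{x \<in> topspace X. f x \<in> {d} \<inter> D} = {x \<in> topspace X. f x = d}"
    using assms by (auto simp: continuous_map_def)
  ultimately show ?thesis by simp
qed

lemma openin_discrete_eq: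
  assumes f: "continuous_map X (discrete_topology D) f"
    and g: "continuous_map X (discrete_topology D) g"
  shows "openin X {x \<in> topspace X. f x = g x}"
proof (rule openin_locally)
  fix x assume x: "x \<in> {x \<in> topspace X. f x = g x}"
  let ?V = "{y \<in> topspace X. f y = f x} \<inter> {y \<in> topspace X. g y = f x}"
  have "openin X ?V" using openin_discrete_fibre[OF f] openin_discrete_fibre[OF g] by blast
  then show "\<exists>V. openin X V \<and> x \<in> V \<and> V \<subseteq> {x \<in> topspace X. f x = g x}"
    using x by (intro exI[of _ ?V]) auto
qed

text \<open>By the cut wire fence theorem, closed sets of a compact Hausdorff space can be separated
  by a clopen set unless some connected set meets both; here connected sets have at most one
  point.\<close>

lemma profinite_clopen_separation:
  assumes X: "profinite_space X" and C: "closedin X C" and D: "closedin X D" and CD: "C \<inter> D = {}"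
  obtains K where "openin X K" "closedin X K" "C \<subseteq> K" "K \<inter> D = {}"
proof -
  have "separated_between X C D"
  proof (rule cut_wire_fence_theorem)
    fix T assume "connectedin X T"
    then obtain a where "T \<subseteq> {a}" using X by (auto simp: profinite_space_def)
    then show "disjnt T C \<or> disjnt T D" using CD by (auto simp: disjnt_def)
  qed (use X C D in \<open>auto simp: profinite_space_def\<close>)
  then obtain U where "closedin X U" "openin X U" "C \<subseteq> U" "D \<subseteq> topspace X - U"
    unfolding separated_between by blast
  then show ?thesis using that[of U] by blast
qed

text \<open>Only the fibres of \<open>F\<close> matter, so its values may lie in a set without
  topology, for instance among functions, as in \<open>extensible_discrete\<close>.\<close>

lemma clopen_partition_fibres:
  assumes Y: "compact_space Y"
    and F: "\<And>y. y \<in> topspace Y \<Longrightarrow> openin Y {z \<in> topspace Y. F z = F y}"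
  shows "(\<lambda>y. {z \<in> topspace Y. F z = F y}) ` topspace Y \<in> clopen_partitions Y"
proof -
  let ?P = "(\<lambda>y. {z \<in> topspace Y. F z = F y}) ` topspace Y"
  have un: "\<Union>?P = topspace Y" by auto
  have part: "partition_on (topspace Y) ?P"
    by (rule partition_onI) (auto simp: un disjnt_def)
  have op: "openin Y U" if "U \<in> ?P" for U using that F by auto
  have cl: "closedin Y U" if "U \<in> ?P" for U
  proof -
    have "topspace Y - U = \<Union>(?P - {U})" using that by auto
    moreover have "openin Y (\<Union>(?P - {U}))" using op by blast
    ultimately show ?thesis using that by (auto simp: closedin_def)
  qed
  obtain \<F> where "finite \<F>" "\<F> \<subseteq> ?P" "topspace Y \<subseteq> \<Union>\<F>"
    using Y op un unfolding compact_space_alt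
    by (metis (no_types, lifting) order_refl)
  \<comment> \<open>A subcover of a partition is the whole partition, so compactness makes the
    partition finite.\<close>
  moreover have "?P \<subseteq> \<F>"
  proof
    fix U assume U: "U \<in> ?P"
    then obtain y where y: "y \<in> topspace Y" "U = {z \<in> topspace Y. F z = F y}" by auto
    then obtain V where V: "V \<in> \<F>" "y \<in> V" using \<open>topspace Y \<subseteq> \<Union>\<F>\<close> by auto
    then have "V \<in> ?P" using \<open>\<F> \<subseteq> ?P\<close> by auto
    then have "V = U" using V y by auto
    then show "U \<in> \<F>" using V by simp
  qed
  ultimately have "finite ?P" using finite_subset by blast
  then show ?thesis using part op cl by (auto simp: clopen_partitions_def)
qed

section \<open>Topological abelian groups\<close>

text \<open>Hausdorffness makes the set where two continuous homomorphisms agree closed, so that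
  they can be compared on generators. The class is stable under products and subgroups, from which
  \<open>Zpi\<close> and \<open>pf_free\<close> are built.\<close>

definition hausdorff_abelian :: "'a tgroup \<Rightarrow> bool" where
  "hausdorff_abelian M \<longleftrightarrow> comm_group M \<and> topological_group M \<and> Hausdorff_space (topo M)"

lemma hausdorff_abelianD:
  assumes "hausdorff_abelian M"
  shows "comm_group M" "group M" "topological_group M" "Hausdorff_space (topo M)"
    "topspace (topo M) = carrier M"
  using assms by (auto simp: hausdorff_abelian_def topological_group_def)

lemma topspace_topological_group: "topological_group M \<Longrightarrow> topspace (topo M) = carrier M"
  by (simp add: topological_group_def)

section \<open>Continuity of expressions built from group operations\<close>

lemma continuous_map_group_mult:
  assumes "topological_group M" "continuous_map T (topo M) f" "continuous_map T (topo M) h"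
  shows "continuous_map T (topo M) (\<lambda>x. f x \<otimes>\<^bsub>M\<^esub> h x)"
proof -
  have "continuous_map T (topo M) ((\<lambda>(x, y). x \<otimes>\<^bsub>M\<^esub> y) \<circ> (\<lambda>x. (f x, h x)))"
    using assms unfolding topological_group_def
    by (intro continuous_map_compose[of _ "prod_topology (topo M) (topo M)"])
      (auto intro: continuous_map_pairedI)
  then show ?thesis by (simp add: comp_def)
qed

lemma continuous_map_group_inv:
  assumes "topological_group M" "continuous_map T (topo M) f"
  shows "continuous_map T (topo M) (\<lambda>x. inv\<^bsub>M\<^esub> f x)"
  using continuous_map_compose[OF assms(2), of "topo M" "\<lambda>x. inv\<^bsub>M\<^esub> x"] assms(1)
  by (simp add: topological_group_def comp_def)

lemma continuous_map_group_nat_pow: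
  assumes M: "topological_group M" and f: "continuous_map T (topo M) f"
  shows "continuous_map T (topo M) (\<lambda>x. f x [^]\<^bsub>M\<^esub> (n::nat))"
proof (induction n)
  case 0
  interpret group M using M by (simp add: topological_group_def)
  show ?case using M by (simp add: topological_group_def)
next
  case (Suc n)
  then show ?case using continuous_map_group_mult[OF M Suc f] by simp
qed

lemma continuous_map_group_int_pow:
  assumes M: "topological_group M" and f: "continuous_map T (topo M) f"
  shows "continuous_map T (topo M) (\<lambda>x. f x [^]\<^bsub>M\<^esub> (n::int))"
proof (cases "n < 0")
  case True
  show ?thesis unfolding int_pow_def2 if_P[OF True]
    by (rule continuous_map_group_inv[OF M continuous_map_group_nat_pow[OF M f]])
next
  case False
  show ?thesis unfolding int_pow_def2 if_not_P[OF False]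
    by (rule continuous_map_group_nat_pow[OF M f])
qed

lemma continuous_map_finprod:
  assumes M: "topological_group M" "comm_group M" and "finite I"
    and f: "\<And>i. i \<in> I \<Longrightarrow> continuous_map T (topo M) (f i)"
  shows "continuous_map T (topo M) (\<lambda>x. \<Otimes>\<^bsub>M\<^esub>i\<in>I. f i x)"
  using \<open>finite I\<close> f
proof (induction I)
  case empty
  interpret comm_group M by fact
  show ?case using M by (simp add: topological_group_def)
next
  case (insert i I)
  interpret comm_group M by fact
  have c: "continuous_map T (topo M) (\<lambda>x. f i x \<otimes>\<^bsub>M\<^esub> (\<Otimes>\<^bsub>M\<^esub>j\<in>I. f j x))"
    using insert by (intro continuous_map_group_mult M) auto
  have "f j x \<in> carrier M" if "j \<in> insert i I" "x \<in> topspace T" for j x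
    using continuous_map_image_subset_topspace[OF insert.prems[OF that(1)]] that M(1)
    by (auto simp: topological_group_def)
  then show ?case
    using insert by (intro continuous_map_eq[OF c]) (auto simp: Pi_def)
qed

section \<open>Products, subgroups and discrete groups\<close>

lemma tprod_sel [simp]:
  "carrier (tprod I M) = (\<Pi>\<^sub>E i\<in>I. carrier (M i))"
  "x \<otimes>\<^bsub>tprod I M\<^esub> y = (\<lambda>i\<in>I. x i \<otimes>\<^bsub>M i\<^esub> y i)"
  "\<one>\<^bsub>tprod I M\<^esub> = (\<lambda>i\<in>I. \<one>\<^bsub>M i\<^esub>)"
  "topo (tprod I M) = product_topology (\<lambda>i. topo (M i)) I"
  by (simp_all add: tprod_def)

lemma tsub_sel [simp]:
  "carrier (tsub M H) = carrier M \<inter> H"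
  "x \<otimes>\<^bsub>tsub M H\<^esub> y = x \<otimes>\<^bsub>M\<^esub> y"
  "\<one>\<^bsub>tsub M H\<^esub> = \<one>\<^bsub>M\<^esub>"
  "topo (tsub M H) = subtopology (topo M) H"
  by (simp_all add: tsub_def)

lemma discrete_group_sel [simp]:
  "carrier (discrete_group K) = carrier K"
  "x \<otimes>\<^bsub>discrete_group K\<^esub> y = x \<otimes>\<^bsub>K\<^esub> y"
  "\<one>\<^bsub>discrete_group K\<^esub> = \<one>\<^bsub>K\<^esub>"
  "topo (discrete_group K) = discrete_topology (carrier K)"
  by (simp_all add: discrete_group_def)

lemma group_tprod:
  assumes "\<And>i. i \<in> I \<Longrightarrow> group (M i)"
  shows "group (tprod I M)"
proof -
  interpret P: group "product_group I M" using assms by simp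
  show ?thesis
  proof (rule groupI)
    fix x assume x: "x \<in> carrier (tprod I M)"
    show "\<exists>y\<in>carrier (tprod I M). y \<otimes>\<^bsub>tprod I M\<^esub> x = \<one>\<^bsub>tprod I M\<^esub>"
      using P.l_inv_ex[of x] x by simp
    show "\<one>\<^bsub>tprod I M\<^esub> \<otimes>\<^bsub>tprod I M\<^esub> x = x" using P.l_one[of x] x by simp
  next
    fix x y z assume "x \<in> carrier (tprod I M)" "y \<in> carrier (tprod I M)" "z \<in> carrier (tprod I M)"
    then show "x \<otimes>\<^bsub>tprod I M\<^esub> y \<otimes>\<^bsub>tprod I M\<^esub> z = x \<otimes>\<^bsub>tprod I M\<^esub> (y \<otimes>\<^bsub>tprod I M\<^esub> z)"
      using P.m_assoc[of x y z] by simp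
  next
    fix x y assume "x \<in> carrier (tprod I M)" "y \<in> carrier (tprod I M)"
    then show "x \<otimes>\<^bsub>tprod I M\<^esub> y \<in> carrier (tprod I M)" using P.m_closed[of x y] by simp
  next
    show "\<one>\<^bsub>tprod I M\<^esub> \<in> carrier (tprod I M)" using P.one_closed by simp
  qed
qed

lemma inv_tprod:
  assumes "\<And>i. i \<in> I \<Longrightarrow> group (M i)" and "x \<in> carrier (tprod I M)"
  shows "inv\<^bsub>tprod I M\<^esub> x = (\<lambda>i\<in>I. inv\<^bsub>M i\<^esub> x i)"
proof (rule group.inv_equality[OF group_tprod])
  show "(\<lambda>i\<in>I. inv\<^bsub>M i\<^esub> x i) \<otimes>\<^bsub>tprod I M\<^esub> x = \<one>\<^bsub>tprod I M\<^esub>"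
    using assms by (auto simp: PiE_iff group.l_inv)
  show "(\<lambda>i\<in>I. inv\<^bsub>M i\<^esub> x i) \<in> carrier (tprod I M)"
    using assms by (auto simp: PiE_iff)
qed (use assms in auto)

lemma hausdorff_abelian_tprod:
  assumes "\<And>i. i \<in> I \<Longrightarrow> hausdorff_abelian (M i)"
  shows "hausdorff_abelian (tprod I M)"
proof -
  note M = hausdorff_abelianD[OF assms]
  have g: "group (tprod I M)" using M by (intro group_tprod)
  have proj: "continuous_map (product_topology (\<lambda>i. topo (M i)) I) (topo (M i)) (\<lambda>x. x i)" if "i \<in> I" for i
    using continuous_map_product_projection[OF that] .
  have ts: "topspace (product_topology (\<lambda>i. topo (M i)) I) = (\<Pi>\<^sub>E i\<in>I. carrier (M i))"
    using M(5) by (auto simp: PiE_def Pi_def)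
  have m: "continuous_map (prod_topology (topo (tprod I M)) (topo (tprod I M))) (topo (tprod I M))
      (\<lambda>z. fst z \<otimes>\<^bsub>tprod I M\<^esub> snd z)"
    unfolding tprod_sel continuous_map_componentwise
  proof (intro conjI ballI)
    fix i assume i: "i \<in> I"
    let ?T = "prod_topology (product_topology (\<lambda>i. topo (M i)) I) (product_topology (\<lambda>i. topo (M i)) I)"
    have "continuous_map ?T (topo (M i)) (\<lambda>z. fst z i \<otimes>\<^bsub>M i\<^esub> snd z i)"
      by (intro continuous_map_group_mult M(3) i
          continuous_map_compose[OF continuous_map_fst proj[OF i], unfolded comp_def]
          continuous_map_compose[OF continuous_map_snd proj[OF i], unfolded comp_def])
    then show "continuous_map ?T (topo (M i)) (\<lambda>z. (\<lambda>i\<in>I. fst z i \<otimes>\<^bsub>M i\<^esub> snd z i) i)"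
      using i by simp
  qed auto
  have "continuous_map (topo (tprod I M)) (topo (tprod I M)) (\<lambda>x. \<lambda>i\<in>I. inv\<^bsub>M i\<^esub> x i)"
    unfolding tprod_sel continuous_map_componentwise
  proof (intro conjI ballI)
    fix i assume i: "i \<in> I"
    show "continuous_map (product_topology (\<lambda>i. topo (M i)) I) (topo (M i)) (\<lambda>x. (\<lambda>i\<in>I. inv\<^bsub>M i\<^esub> x i) i)"
      using continuous_map_group_inv[OF M(3)[OF i] proj[OF i]] i by simp
  qed auto
  then have i: "continuous_map (topo (tprod I M)) (topo (tprod I M)) (\<lambda>x. inv\<^bsub>tprod I M\<^esub> x)"
    by (rule continuous_map_eq) (use M(2) ts in \<open>simp add: inv_tprod\<close>)
  have "comm_group (tprod I M)"
  proof (rule group.group_comm_groupI[OF g])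
    fix x y assume xy: "x \<in> carrier (tprod I M)" "y \<in> carrier (tprod I M)"
    have "x i \<otimes>\<^bsub>M i\<^esub> y i = y i \<otimes>\<^bsub>M i\<^esub> x i" if "i \<in> I" for i
    proof -
      interpret comm_group "M i" using M(1)[OF that] .
      show ?thesis using xy that by (intro m_comm) auto
    qed
    then show "x \<otimes>\<^bsub>tprod I M\<^esub> y = y \<otimes>\<^bsub>tprod I M\<^esub> x" by auto
  qed
  then show ?thesis
    using g m i ts M(4)
    by (simp add: hausdorff_abelian_def topological_group_def case_prod_unfold
        Hausdorff_space_product_topology del: topspace_product_topology)
qed

text \<open>\<open>H\<close> is typically the solution set of some conditions and may reach outside
  the carrier, hence the form \<open>carrier M \<inter> H\<close>.\<close>

lemma group_tsub:
  assumes "group M" "subgroup (carrier M \<inter> H) M"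
  shows "group (tsub M H)"
proof -
  interpret M: group M by fact
  interpret H: subgroup "carrier M \<inter> H" M by fact
  show ?thesis
  proof (rule groupI)
    fix x assume "x \<in> carrier (tsub M H)"
    then show "\<exists>y\<in>carrier (tsub M H). y \<otimes>\<^bsub>tsub M H\<^esub> x = \<one>\<^bsub>tsub M H\<^esub>"
      using H.m_inv_closed[of x] by (intro bexI[of _ "inv\<^bsub>M\<^esub> x"]) auto
  qed (use H.m_closed H.one_closed in \<open>auto simp: M.m_assoc\<close>)
qed

lemma inv_tsub:
  assumes "group M" "subgroup (carrier M \<inter> H) M" "x \<in> carrier M \<inter> H"
  shows "inv\<^bsub>tsub M H\<^esub> x = inv\<^bsub>M\<^esub> x"
proof (rule group.inv_equality[OF group_tsub])
  interpret M: group M by fact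
  interpret H: subgroup "carrier M \<inter> H" M by fact
  show "inv\<^bsub>M\<^esub> x \<otimes>\<^bsub>tsub M H\<^esub> x = \<one>\<^bsub>tsub M H\<^esub>" using assms by simp
  show "inv\<^bsub>M\<^esub> x \<in> carrier (tsub M H)" using assms H.m_inv_closed[of x] by simp
qed (use assms in auto)

lemma hausdorff_abelian_tsub:
  assumes M: "hausdorff_abelian M" and H: "subgroup (carrier M \<inter> H) M"
  shows "hausdorff_abelian (tsub M H)"
proof -
  note hM = hausdorff_abelianD[OF M]
  interpret M: comm_group M using hM by simp
  have g: "group (tsub M H)" using group_tsub[OF hM(2) H] .
  have ts: "topspace (topo (tsub M H)) = carrier M \<inter> H" using hM by simp
  have "comm_group (tsub M H)"
    using g by (rule group.group_comm_groupI) (simp add: M.m_comm)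
  moreover have "continuous_map (prod_topology (topo (tsub M H)) (topo (tsub M H))) (topo (tsub M H))
      (\<lambda>z. fst z \<otimes>\<^bsub>tsub M H\<^esub> snd z)"
    unfolding tsub_sel
  proof (rule continuous_map_into_subtopology)
    show "continuous_map (prod_topology (subtopology (topo M) H) (subtopology (topo M) H)) (topo M)
      (\<lambda>z. fst z \<otimes>\<^bsub>M\<^esub> snd z)"
      by (intro continuous_map_group_mult hM continuous_map_into_fulltopology[OF continuous_map_fst]
          continuous_map_into_fulltopology[OF continuous_map_snd])
    show "(\<lambda>z. fst z \<otimes>\<^bsub>M\<^esub> snd z) \<in> topspace (prod_topology (subtopology (topo M) H) (subtopology (topo M) H)) \<rightarrow> H"
      using ts subgroup.m_closed[OF H] by auto
  qed
  moreover have "continuous_map (topo (tsub M H)) (topo (tsub M H)) (\<lambda>x. inv\<^bsub>tsub M H\<^esub> x)"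
  proof -
    have "continuous_map (topo (tsub M H)) (topo (tsub M H)) (\<lambda>x. inv\<^bsub>M\<^esub> x)"
      unfolding tsub_sel
      by (intro continuous_map_into_subtopology continuous_map_group_inv hM
          continuous_map_from_subtopology continuous_map_id[unfolded id_def])
        (use ts subgroup.m_inv_closed[OF H] in auto)
    then show ?thesis
      by (rule continuous_map_eq) (use hM H ts in \<open>simp add: inv_tsub\<close>)
  qed
  ultimately show ?thesis
    using g ts hM by (simp add: hausdorff_abelian_def topological_group_def case_prod_unfold
        Hausdorff_space_subtopology)
qed

lemma comm_group_discrete_group:
  assumes "comm_group K" shows "comm_group (discrete_group K)"
proof -
  interpret K: comm_group K by fact
  have "group (discrete_group K)"
    by (rule groupI) (auto simp: K.m_assoc)
  then show ?thesis by (rule group.group_comm_groupI) (simp add: K.m_comm)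
qed

lemma hausdorff_abelian_discrete:
  assumes "comm_group K" "topo K = discrete_topology (carrier K)"
  shows "hausdorff_abelian K"
proof -
  interpret K: comm_group K by fact
  show ?thesis
    using assms by (auto simp: hausdorff_abelian_def topological_group_def simp flip: prod_topology_discrete_topology)
qed

lemma hausdorff_abelian_discrete_group:
  "comm_group K \<Longrightarrow> hausdorff_abelian (discrete_group K)"
  using hausdorff_abelian_discrete[of "discrete_group K"] comm_group_discrete_group[of K] by simp

subsection \<open>Continuous homomorphisms and topological generation\<close>

lemma chomD:
  assumes "f \<in> chom M N"
  shows "f \<in> hom M N" "f \<in> extensional (carrier M)" "continuous_map (topo M) (topo N) f"
    "x \<in> carrier M \<Longrightarrow> f x \<in> carrier N"
    "x \<in> carrier M \<Longrightarrow> y \<in> carrier M \<Longrightarrow> f (x \<otimes>\<^bsub>M\<^esub> y) = f x \<otimes>\<^bsub>N\<^esub> f y"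
  using assms by (simp_all add: chom_def hom_def Pi_iff)

lemma chom_group_hom:
  "group M \<Longrightarrow> group N \<Longrightarrow> f \<in> chom M N \<Longrightarrow> group_hom M N f"
  by (simp add: group_hom_def group_hom_axioms_def chom_def)

lemma chom_restrictI:
  assumes "topspace (topo M) = carrier M" "group M"
    and "\<And>x. x \<in> carrier M \<Longrightarrow> f x \<in> carrier N"
    and "\<And>x y. x \<in> carrier M \<Longrightarrow> y \<in> carrier M \<Longrightarrow> f (x \<otimes>\<^bsub>M\<^esub> y) = f x \<otimes>\<^bsub>N\<^esub> f y"
    and "continuous_map (topo M) (topo N) f"
  shows "restrict f (carrier M) \<in> chom M N"
proof -
  interpret group M by fact
  have "continuous_map (topo M) (topo N) (restrict f (carrier M))"
    using assms(5) by (rule continuous_map_eq) (simp add: assms)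
  then show ?thesis using assms by (auto simp: chom_def hom_def)
qed

lemma chom_compose:
  assumes "group M" "topspace (topo M) = carrier M" "f \<in> chom M N" "h \<in> chom N K"
  shows "compose (carrier M) h f \<in> chom M K"
proof -
  have "continuous_map (topo M) (topo K) (\<lambda>x. h (f x))"
    using continuous_map_compose[OF chomD(3)[OF assms(3)] chomD(3)[OF assms(4)]] by (simp add: comp_def)
  then have "restrict (\<lambda>x. h (f x)) (carrier M) \<in> chom M K"
    using chomD[OF assms(3)] chomD[OF assms(4)] by (intro chom_restrictI assms) auto
  then show ?thesis by (simp add: compose_def)
qed

text \<open>Phrased through closed subgroups instead of closures: any property that cuts out a
  closed subgroup then passes at once from the generators to the whole group.\<close>

definition topgen :: "'a tgroup \<Rightarrow> 'a set \<Rightarrow> bool" where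
  "topgen M B \<longleftrightarrow> B \<subseteq> carrier M \<and>
     (\<forall>C. subgroup C M \<and> closedin (topo M) C \<and> B \<subseteq> C \<longrightarrow> C = carrier M)"

lemma closed_subgroup_vimage:
  assumes "group M" "group N" "f \<in> hom M N" "continuous_map (topo M) (topo N) f"
    "topspace (topo M) = carrier M" "subgroup H N" "closedin (topo N) H"
  shows "subgroup {x \<in> carrier M. f x \<in> H} M" "closedin (topo M) {x \<in> carrier M. f x \<in> H}"
proof -
  interpret group_hom M N f using assms by (simp add: group_hom_def group_hom_axioms_def)
  interpret H: subgroup H N by fact
  show "subgroup {x \<in> carrier M. f x \<in> H} M"
    by (rule G.subgroupI) (auto intro: exI[of _ "\<one>\<^bsub>M\<^esub>"])
  show "closedin (topo M) {x \<in> carrier M. f x \<in> H}"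
    using assms closedin_continuous_map_preimage by fastforce
qed

lemma topgen_image_subset:
  assumes "topgen M B" "group M" "group N" "f \<in> hom M N" "continuous_map (topo M) (topo N) f"
    "topspace (topo M) = carrier M" "subgroup H N" "closedin (topo N) H"
    and "\<And>b. b \<in> B \<Longrightarrow> f b \<in> H" and "x \<in> carrier M"
  shows "f x \<in> H"
proof -
  have "{x \<in> carrier M. f x \<in> H} = carrier M"
    using assms(1,9) closed_subgroup_vimage[OF assms(2-8)] by (auto simp: topgen_def)
  then show ?thesis using assms(10) by blast
qed

lemma hom_eq_on_topgen:
  assumes B: "topgen M B" and M: "hausdorff_abelian M" and N: "hausdorff_abelian N"
    and f: "f \<in> hom M N" "continuous_map (topo M) (topo N) f"
    and h: "h \<in> hom M N" "continuous_map (topo M) (topo N) h"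
    and eq: "\<And>b. b \<in> B \<Longrightarrow> f b = h b" and x: "x \<in> carrier M"
  shows "f x = h x"
proof -
  note hM = hausdorff_abelianD[OF M] note hN = hausdorff_abelianD[OF N]
  interpret F: group_hom M N f using f hM hN by (simp add: group_hom_def group_hom_axioms_def)
  interpret H: group_hom M N h using h hM hN by (simp add: group_hom_def group_hom_axioms_def)
  let ?E = "{x \<in> carrier M. f x = h x}"
  have "subgroup ?E M" by (rule F.G.subgroupI) auto
  moreover have "closedin (topo M) ?E"
    using closedin_continuous_maps_eq[OF hN(4) f(2) h(2)] hM by simp
  moreover have "B \<subseteq> ?E" using eq B by (auto simp: topgen_def)
  ultimately have "?E = carrier M" using B unfolding topgen_def by blast
  then show ?thesis using x by blast
qed

lemma chom_eqI:
  assumes "topgen M B" "hausdorff_abelian M" "hausdorff_abelian N" "f \<in> chom M N" "h \<in> chom M N"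
    and "\<And>b. b \<in> B \<Longrightarrow> f b = h b"
  shows "f = h"
proof (rule extensionalityI)
  fix x assume "x \<in> carrier M"
  then show "f x = h x"
    using assms(6) hom_eq_on_topgen[OF assms(1-3) chomD(1,3)[OF assms(4)] chomD(1,3)[OF assms(5)]]
    by blast
qed (rule chomD(2)[OF assms(4)], rule chomD(2)[OF assms(5)])

section \<open>The group \<open>\<int>\<^sub>\<pi>\<close>\<close>

text \<open>A basic neighbourhood in a product restricts finitely many coordinates, so a closed set
  contains every point that it approximates on finite sets of coordinates. Density in
  \<open>Zpi\<close> and in \<open>pf_free\<close> is shown this way.\<close>

lemma closedin_product_topology_memI:
  assumes C: "closedin (product_topology T I) C" and r: "r \<in> topspace (product_topology T I)"
    and approx: "\<And>F V. finite F \<Longrightarrow> F \<subseteq> I \<Longrightarrow> (\<And>i. i \<in> F \<Longrightarrow> openin (T i) (V i) \<and> r i \<in> V i) \<Longrightarrow>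
      \<exists>c\<in>C. \<forall>i\<in>F. c i \<in> V i"
  shows "r \<in> C"
proof (rule ccontr)
  assume "r \<notin> C"
  then have op: "openin (product_topology T I) (topspace (product_topology T I) - C)"
    "r \<in> topspace (product_topology T I) - C"
    using C r by (auto simp: closedin_def)
  from openin_product_topology_alt[THEN iffD1, OF op(1), rule_format, OF op(2)]
  obtain V where V: "finite {i \<in> I. V i \<noteq> topspace (T i)}" "\<forall>i\<in>I. openin (T i) (V i)"
    "r \<in> Pi\<^sub>E I V" "Pi\<^sub>E I V \<subseteq> topspace (product_topology T I) - C"
    by blast
  let ?F = "{i \<in> I. V i \<noteq> topspace (T i)}"
  obtain c where c: "c \<in> C" "\<forall>i\<in>?F. c i \<in> V i"
    using approx[of ?F V] V by (auto simp: PiE_iff)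
  have ct: "c \<in> (\<Pi>\<^sub>E i\<in>I. topspace (T i))" using C c(1) closedin_subset by fastforce
  have "c i \<in> V i" if "i \<in> I" for i
    using c(2) ct that by (cases "V i = topspace (T i)") auto
  then have "c \<in> Pi\<^sub>E I V" using ct by (simp add: PiE_iff)
  then show False using V c by blast
qed

definition Zp_coherent :: "nat \<Rightarrow> (nat \<Rightarrow> int) set" where
  "Zp_coherent p = {a. \<forall>k. a (Suc k) mod int p ^ k = a k}"

lemma Zp_alt: "Zp p = tsub (tprod UNIV (\<lambda>k. discrete_group (integer_mod_group (p ^ k)))) (Zp_coherent p)"
  by (simp add: Zp_def Zp_coherent_def)

lemma carrier_Zp:
  assumes "p > 0"
  shows "carrier (Zp p) = {a. (\<forall>k. 0 \<le> a k \<and> a k < int p ^ k) \<and> (\<forall>k. a (Suc k) mod int p ^ k = a k)}"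
  using assms by (auto simp: Zp_def carrier_integer_mod_group PiE_def Pi_def)

lemma mult_Zp: "a \<otimes>\<^bsub>Zp p\<^esub> b = (\<lambda>k. (a k + b k) mod int p ^ k)"
  by (simp add: Zp_def fun_eq_iff)

lemma one_Zp: "\<one>\<^bsub>Zp p\<^esub> = (\<lambda>k. 0)"
  by (simp add: Zp_def fun_eq_iff)

lemma hausdorff_abelian_mod_group: "hausdorff_abelian (discrete_group (integer_mod_group n))"
  by (simp add: hausdorff_abelian_discrete_group)

lemma Zp_subgroup:
  assumes p: "p > 0"
  defines "P \<equiv> tprod UNIV (\<lambda>k. discrete_group (integer_mod_group (p ^ k)))"
  shows "subgroup (carrier P \<inter> Zp_coherent p) P"
proof -
  have hP: "hausdorff_abelian P"
    unfolding P_def by (intro hausdorff_abelian_tprod hausdorff_abelian_mod_group)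
  interpret P: group P using hausdorff_abelianD[OF hP] by simp
  have inv: "inv\<^bsub>P\<^esub> x = (\<lambda>k. (- x k) mod int p ^ k)" if "x \<in> carrier P" for x
  proof (rule P.inv_equality)
    show "(\<lambda>k. (- x k) mod int p ^ k) \<otimes>\<^bsub>P\<^esub> x = \<one>\<^bsub>P\<^esub>"
      by (auto simp: P_def mod_simps)
    show "(\<lambda>k. (- x k) mod int p ^ k) \<in> carrier P"
      using p by (auto simp: P_def carrier_integer_mod_group)
  qed fact
  show ?thesis
  proof (rule P.subgroupI)
    have "\<one>\<^bsub>P\<^esub> \<in> Zp_coherent p" by (simp add: Zp_coherent_def P_def)
    then show "carrier P \<inter> Zp_coherent p \<noteq> {}" using P.one_closed by blast
  next
    fix a assume a: "a \<in> carrier P \<inter> Zp_coherent p"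
    have "(- a (Suc k)) mod int p ^ Suc k mod int p ^ k = (- a k) mod int p ^ k" for k
    proof -
      have "(- a (Suc k)) mod int p ^ Suc k mod int p ^ k = (- a (Suc k)) mod int p ^ k"
        by (simp add: mod_mod_cancel le_imp_power_dvd)
      also have "\<dots> = (- (a (Suc k) mod int p ^ k)) mod int p ^ k" by (simp add: mod_simps)
      also have "\<dots> = (- a k) mod int p ^ k" using a by (simp add: Zp_coherent_def)
      finally show ?thesis .
    qed
    then have "inv\<^bsub>P\<^esub> a \<in> Zp_coherent p" using a by (simp add: inv Zp_coherent_def)
    then show "inv\<^bsub>P\<^esub> a \<in> carrier P \<inter> Zp_coherent p" using a by simp
  next
    fix a b assume ab: "a \<in> carrier P \<inter> Zp_coherent p" "b \<in> carrier P \<inter> Zp_coherent p"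
    have "(a (Suc k) + b (Suc k)) mod int p ^ Suc k mod int p ^ k = (a k + b k) mod int p ^ k" for k
    proof -
      have "(a (Suc k) + b (Suc k)) mod int p ^ Suc k mod int p ^ k = (a (Suc k) + b (Suc k)) mod int p ^ k"
        by (simp add: mod_mod_cancel le_imp_power_dvd)
      also have "\<dots> = (a (Suc k) mod int p ^ k + b (Suc k) mod int p ^ k) mod int p ^ k"
        by (simp add: mod_simps)
      also have "\<dots> = (a k + b k) mod int p ^ k" using ab by (simp add: Zp_coherent_def)
      finally show ?thesis .
    qed
    then have "a \<otimes>\<^bsub>P\<^esub> b \<in> Zp_coherent p" by (simp add: P_def Zp_coherent_def)
    then show "a \<otimes>\<^bsub>P\<^esub> b \<in> carrier P \<inter> Zp_coherent p" using ab by simp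
  qed simp
qed

lemma hausdorff_abelian_Zp: "p > 0 \<Longrightarrow> hausdorff_abelian (Zp p)"
  unfolding Zp_alt
  by (intro hausdorff_abelian_tsub hausdorff_abelian_tprod hausdorff_abelian_mod_group Zp_subgroup)

lemma hausdorff_abelian_Zpi: "\<forall>p\<in>\<pi>. prime p \<Longrightarrow> hausdorff_abelian (Zpi \<pi>)"
  unfolding Zpi_def by (intro hausdorff_abelian_tprod hausdorff_abelian_Zp) (auto simp: prime_gt_0_nat)

lemma Zp_mod:
  assumes "p > 0" "a \<in> carrier (Zp p)" "k \<le> K"
  shows "a K mod int p ^ k = a k"
  using assms(3)
proof (induction K rule: dec_induct)
  case base
  show ?case using assms by (simp add: carrier_Zp)
next
  case (step K)
  have "a (Suc K) mod int p ^ k = a (Suc K) mod int p ^ K mod int p ^ k"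
    using step by (simp add: mod_mod_cancel le_imp_power_dvd)
  also have "\<dots> = a k" using assms step by (simp add: carrier_Zp)
  finally show ?case .
qed

text \<open>Coherence replaces finitely many coordinate conditions by a single one: the coordinate
  at \<open>K\<close> determines all lower ones.\<close>

lemma Zp_openin_nbhd:
  assumes p: "p > 0" and V: "openin (topo (Zp p)) V" and a: "a \<in> V"
  obtains K where "\<And>b. b \<in> carrier (Zp p) \<Longrightarrow> b K = a K \<Longrightarrow> b \<in> V"
proof -
  let ?T = "\<lambda>k. discrete_topology (carrier (integer_mod_group (p ^ k)))"
  obtain W where W: "openin (product_topology ?T UNIV) W" "V = W \<inter> Zp_coherent p"
    using V by (auto simp: Zp_alt openin_subtopology)
  then obtain U where U: "finite {i. U i \<noteq> topspace (?T i)}" "a \<in> Pi\<^sub>E UNIV U" "Pi\<^sub>E UNIV U \<subseteq> W"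
    using a unfolding openin_product_topology_alt by (auto simp del: topspace_discrete_topology)
  let ?F = "{i. U i \<noteq> topspace (?T i)}"
  obtain K where K: "\<And>i. i \<in> ?F \<Longrightarrow> i \<le> K"
    using U(1) finite_nat_set_iff_bounded_le by metis
  have aZ: "a \<in> carrier (Zp p)"
    using V a openin_subset hausdorff_abelianD[OF hausdorff_abelian_Zp[OF p]] by blast
  have "b \<in> V" if b: "b \<in> carrier (Zp p)" "b K = a K" for b
  proof -
    have "b i \<in> U i" for i
    proof (cases "i \<in> ?F")
      case True
      then have "b i = a i" using Zp_mod[OF p b(1) K] Zp_mod[OF p aZ K] b(2) by metis
      then show ?thesis using U(2) by auto
    next
      case False
      then show ?thesis using b by (auto simp: Zp_def PiE_iff)
    qed
    then have "b \<in> W" using U(3) by auto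
    then show ?thesis using b(1) W(2) by (simp add: Zp_alt)
  qed
  then show ?thesis using that by blast
qed

lemma carrier_Zpi: "carrier (Zpi \<pi>) = (\<Pi>\<^sub>E p\<in>\<pi>. carrier (Zp p))"
  by (simp add: Zpi_def)

lemma mult_Zpi: "p \<in> \<pi> \<Longrightarrow> (r \<otimes>\<^bsub>Zpi \<pi>\<^esub> s) p k = (r p k + s p k) mod int p ^ k"
  by (simp add: Zpi_def mult_Zp)

lemma Zpi_unit_closed: "\<forall>p\<in>\<pi>. prime p \<Longrightarrow> Zpi_unit \<pi> \<in> carrier (Zpi \<pi>)"
  by (auto simp: carrier_Zpi Zpi_unit_def carrier_Zp prime_gt_0_nat mod_mod_cancel le_imp_power_dvd)

lemma Zpi_unit_pow:
  assumes "\<forall>p\<in>\<pi>. prime p" "p \<in> \<pi>"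
  shows "(Zpi_unit \<pi> [^]\<^bsub>Zpi \<pi>\<^esub> (n::nat)) p k = int n mod int p ^ k"
proof -
  interpret group "Zpi \<pi>" using hausdorff_abelianD hausdorff_abelian_Zpi assms by blast
  show ?thesis
  proof (induction n)
    case 0
    then show ?case using assms by (simp add: Zpi_def one_Zp)
  next
    case (Suc n)
    then show ?case using assms by (simp add: mult_Zpi Zpi_unit_def mod_simps add.commute)
  qed
qed

text \<open>The solution is a natural number so that it can serve as the exponent of
  \<open>Zpi_unit\<close> in \<open>topgen_Zpi\<close>.\<close>

lemma chinese_remainder_prime_powers:
  fixes u :: "nat \<Rightarrow> int"
  assumes "finite F" "\<forall>p\<in>F. prime p"
  obtains n :: nat where "\<And>p. p \<in> F \<Longrightarrow> [int n = u p] (mod int p ^ e p)"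
proof -
  have "\<exists>x. \<forall>i\<in>F. [x = nat (u i mod int i ^ e i)] (mod i ^ e i)"
    using assms by (intro chinese_remainder_nat) (auto intro: primes_coprime)
  then obtain n where n: "\<And>p. p \<in> F \<Longrightarrow> [n = nat (u p mod int p ^ e p)] (mod p ^ e p)" by blast
  have "[int n = u p] (mod int p ^ e p)" if "p \<in> F" for p
  proof -
    have "p > 0" using assms that prime_gt_0_nat by blast
    then have nn: "u p mod int p ^ e p \<ge> 0" by simp
    have "[int n = int (nat (u p mod int p ^ e p))] (mod int (p ^ e p))"
      using n[OF that] cong_int_iff by blast
    then show ?thesis using nn by (simp add: cong_def)
  qed
  then show ?thesis using that by blast
qed

text \<open>The multiples of the unit are dense: by the Chinese remainder theorem one natural number
  approximates \<open>r\<close> at finitely many primes \<open>p\<close>, modulo any prescribed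
  powers \<open>p ^ K p\<close>.\<close>

lemma topgen_Zpi:
  assumes \<pi>: "\<forall>p\<in>\<pi>. prime p"
  shows "topgen (Zpi \<pi>) {Zpi_unit \<pi>}"
  unfolding topgen_def
proof (intro conjI allI impI)
  have pos: "p > 0" if "p \<in> \<pi>" for p using \<pi> that prime_gt_0_nat by blast
  interpret Z: group "Zpi \<pi>" using hausdorff_abelianD hausdorff_abelian_Zpi \<pi> by blast
  show "{Zpi_unit \<pi>} \<subseteq> carrier (Zpi \<pi>)" using Zpi_unit_closed[OF \<pi>] by simp
  fix C assume "subgroup C (Zpi \<pi>) \<and> closedin (topo (Zpi \<pi>)) C \<and> {Zpi_unit \<pi>} \<subseteq> C"
  then have C: "subgroup C (Zpi \<pi>)" "closedin (topo (Zpi \<pi>)) C" "Zpi_unit \<pi> \<in> C" by auto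
  have pow: "Zpi_unit \<pi> [^]\<^bsub>Zpi \<pi>\<^esub> (n::nat) \<in> C" for n
    by (induction n) (use C subgroup.one_closed subgroup.m_closed in \<open>auto simp: nat_pow_def\<close>)
  show "C = carrier (Zpi \<pi>)"
  proof
    show "C \<subseteq> carrier (Zpi \<pi>)" using C(1) by (rule subgroup.subset)
    show "carrier (Zpi \<pi>) \<subseteq> C"
    proof
      fix r assume r: "r \<in> carrier (Zpi \<pi>)"
      show "r \<in> C"
      proof (rule closedin_product_topology_memI)
        show "closedin (product_topology (\<lambda>p. topo (Zp p)) \<pi>) C" using C(2) by (simp add: Zpi_def)
        show "r \<in> topspace (product_topology (\<lambda>p. topo (Zp p)) \<pi>)"
          using r hausdorff_abelianD(5)[OF hausdorff_abelian_Zpi[OF \<pi>]] by (simp add: Zpi_def)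
        fix F V assume F: "finite F" "F \<subseteq> \<pi>" "\<And>p. p \<in> F \<Longrightarrow> openin (topo (Zp p)) (V p) \<and> r p \<in> V p"
        have "\<exists>K. \<forall>b\<in>carrier (Zp p). b K = r p K \<longrightarrow> b \<in> V p" if "p \<in> F" for p
          using Zp_openin_nbhd[of p "V p" "r p"] F that pos by (metis subsetD)
        then obtain K where K: "\<And>p b. p \<in> F \<Longrightarrow> b \<in> carrier (Zp p) \<Longrightarrow> b (K p) = r p (K p) \<Longrightarrow> b \<in> V p"
          by metis
        obtain n where n: "\<And>p. p \<in> F \<Longrightarrow> [int n = r p (K p)] (mod int p ^ K p)"
          using chinese_remainder_prime_powers[of F "\<lambda>p. r p (K p)" K] F \<pi> by blast
        let ?c = "Zpi_unit \<pi> [^]\<^bsub>Zpi \<pi>\<^esub> n"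
        have "?c p \<in> V p" if p: "p \<in> F" for p
        proof (rule K[OF p])
          have "?c \<in> carrier (Zpi \<pi>)" using Zpi_unit_closed[OF \<pi>] by simp
          then show "?c p \<in> carrier (Zp p)" using p F by (auto simp: carrier_Zpi)
          have "r p \<in> carrier (Zp p)" using p F r by (auto simp: carrier_Zpi)
          then have "r p (K p) mod int p ^ K p = r p (K p)" using F p pos by (auto simp: carrier_Zp)
          moreover have "?c p (K p) = int n mod int p ^ K p" using p F \<pi> by (intro Zpi_unit_pow) auto
          ultimately show "?c p (K p) = r p (K p)" using n[OF p] by (simp add: cong_def)
        qed
        then show "\<exists>c\<in>C. \<forall>i\<in>F. c i \<in> V i" using pow by blast
      qed
    qed
  qed
qed

text \<open>Being \<open>\<pi>\<close>-primary with a bounded exponent. In contrast to finiteness,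
  this passes from \<open>A\<close> to the groups of homomorphisms into \<open>A\<close>.\<close>

definition pi_torsion :: "nat set \<Rightarrow> 'a tgroup \<Rightarrow> bool" where
  "pi_torsion \<pi> N \<longleftrightarrow> (\<exists>e>0. (\<forall>p. prime p \<and> p dvd e \<longrightarrow> p \<in> \<pi>) \<and> (\<forall>a\<in>carrier N. a [^]\<^bsub>N\<^esub> (e::nat) = \<one>\<^bsub>N\<^esub>))"

lemma Zpi_coordinate_continuous:
  assumes "p \<in> \<pi>"
  shows "continuous_map (topo (Zpi \<pi>)) (discrete_topology (carrier (integer_mod_group (p ^ k)))) (\<lambda>r. r p k)"
proof -
  have 1: "continuous_map (topo (Zpi \<pi>)) (topo (Zp p)) (\<lambda>r. r p)"
    using continuous_map_product_projection[OF assms] by (simp add: Zpi_def)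
  have 2: "continuous_map (topo (Zp p)) (discrete_topology (carrier (integer_mod_group (p ^ k)))) (\<lambda>a. a k)"
    unfolding Zp_def tsub_sel tprod_sel
    using continuous_map_from_subtopology[OF continuous_map_product_projection[of k UNIV "\<lambda>k. topo (discrete_group (integer_mod_group (p ^ k)))"]]
    by simp
  show ?thesis using continuous_map_compose[OF 1 2] by (simp add: comp_def)
qed

text \<open>An exponent \<open>e\<close> that kills \<open>N\<close> lets \<open>r\<close> act
  through its residue modulo \<open>e\<close>. The Chinese remainder theorem assembles that residue
  from the coordinates \<open>r p (m p)\<close>, where \<open>p\<close> runs over the primes
  dividing \<open>e\<close> and \<open>p ^ m p\<close> is the exact power of \<open>p\<close> in
  \<open>e\<close>. Only finitely many coordinates are involved, hence continuity.\<close>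

lemma Zpi_hom_exists:
  assumes \<pi>: "\<forall>p\<in>\<pi>. prime p" and N: "comm_group N" "topo N = discrete_topology (carrier N)"
    and tor: "pi_torsion \<pi> N" and a: "a \<in> carrier N"
  obtains f where "f \<in> chom (Zpi \<pi>) N" "f (Zpi_unit \<pi>) = a"
proof -
  interpret N: comm_group N by fact
  note hZ = hausdorff_abelianD[OF hausdorff_abelian_Zpi[OF \<pi>]]
  obtain e :: nat where e: "e > 0" "\<And>p. prime p \<Longrightarrow> p dvd e \<Longrightarrow> p \<in> \<pi>"
    "\<And>b. b \<in> carrier N \<Longrightarrow> b [^]\<^bsub>N\<^esub> e = \<one>\<^bsub>N\<^esub>"
    using tor by (auto simp: pi_torsion_def)
  define F where "F = prime_factors e"
  have F: "finite F" "\<forall>p\<in>F. prime p" "F \<subseteq> \<pi>"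
    using e(1,2) by (auto simp: F_def)
  define m where "m p = multiplicity p e" for p
  define lift where "lift r n \<longleftrightarrow> (\<forall>p\<in>F. [n = r p (m p)] (mod int p ^ m p))" for r :: "nat \<Rightarrow> nat \<Rightarrow> int" and n
  have lift_ex: "\<exists>n. lift r n" for r
    using chinese_remainder_prime_powers[of F "\<lambda>p. r p (m p)" m] F unfolding lift_def by metis
  have lift_unique: "a [^]\<^bsub>N\<^esub> n = a [^]\<^bsub>N\<^esub> n'" if "lift r n" "lift r n'" for r n n'
  proof -
    \<comment> \<open>Divisibility by \<open>e\<close> is tested one prime at a time; primes outside
      \<open>F\<close> do not divide \<open>e\<close>.\<close>
    have "int e dvd n - n'"
    proof (cases "n = n'")
      case False
      have "multiplicity p e \<le> multiplicity p (nat \<bar>n - n'\<bar>)" if p: "prime p" for p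
      proof (cases "p \<in> F")
        case True
        have "[n = n'] (mod int p ^ m p)" using \<open>lift r n\<close> \<open>lift r n'\<close> True unfolding lift_def
          by (meson cong_sym cong_trans)
        then have "int (p ^ m p) dvd n - n'" by (simp add: cong_iff_dvd_diff)
        then have "p ^ m p dvd nat \<bar>n - n'\<bar>" by (metis dvd_abs_iff int_dvd_int_iff nat_0_le abs_ge_zero)
        then show ?thesis unfolding m_def using False p by (intro multiplicity_geI) (auto simp: prime_gt_1_nat)
      next
        case False
        then show ?thesis using p e(1) by (simp add: F_def not_dvd_imp_multiplicity_0 prime_factors_dvd)
      qed
      then have "e dvd nat \<bar>n - n'\<bar>" using e(1) by (intro multiplicity_le_imp_dvd) auto
      then show ?thesis by (metis abs_ge_zero dvd_abs_iff int_dvd_int_iff nat_0_le)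
    qed simp
    then obtain k where k: "n = n' + int e * k" by (metis add.commute diff_add_cancel dvdE)
    have "a [^]\<^bsub>N\<^esub> (int e * k) = \<one>\<^bsub>N\<^esub>"
      using N.int_pow_pow[of a "int e" k] a e(3)[of a] by (simp add: int_pow_int)
    then show ?thesis using a by (simp add: k N.int_pow_mult)
  qed
  define f where "f r = a [^]\<^bsub>N\<^esub> (SOME n. lift r n)" for r
  have f: "f r = a [^]\<^bsub>N\<^esub> n" if "lift r n" for r n
    using lift_unique[OF _ that] someI_ex[OF lift_ex[of r]] unfolding f_def by blast
  have 1: "f (r \<otimes>\<^bsub>Zpi \<pi>\<^esub> s) = f r \<otimes>\<^bsub>N\<^esub> f s" for r s
  proof -
    obtain n n' where n: "lift r n" "lift s n'" using lift_ex by blast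
    have "lift (r \<otimes>\<^bsub>Zpi \<pi>\<^esub> s) (n + n')"
      using n F(3) unfolding lift_def by (auto simp: mult_Zpi subset_iff intro!: cong_add)
    then show ?thesis using f n a by (simp add: N.int_pow_mult)
  qed
  have 2: "f (Zpi_unit \<pi>) = a"
  proof -
    have "lift (Zpi_unit \<pi>) 1" using F(3) by (auto simp: lift_def Zpi_unit_def)
    then show ?thesis using f a by simp
  qed
  have 3: "continuous_map (topo (Zpi \<pi>)) (topo N) f"
    unfolding N(2)
  proof (rule continuous_map_discreteI)
    show "f r \<in> carrier N" for r using a by (simp add: f_def)
    fix r assume r: "r \<in> topspace (topo (Zpi \<pi>))"
    let ?V = "topspace (topo (Zpi \<pi>)) \<inter> (\<Inter>p\<in>F. {s \<in> topspace (topo (Zpi \<pi>)). s p (m p) = r p (m p)})"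
    have "openin (topo (Zpi \<pi>)) {s \<in> topspace (topo (Zpi \<pi>)). s p (m p) = r p (m p)}" if "p \<in> F" for p
      using openin_discrete_fibre[OF Zpi_coordinate_continuous] that F(3) by blast
    then have "openin (topo (Zpi \<pi>)) ?V" by (rule openin_finite_INT[OF F(1)])
    moreover have "f s = f r" if "s \<in> ?V" for s
    proof -
      obtain n where n: "lift r n" using lift_ex by blast
      then have "lift s n" using that by (simp add: lift_def)
      then show ?thesis using n f by simp
    qed
    moreover have "r \<in> ?V" using r by blast
    ultimately show "\<exists>V. openin (topo (Zpi \<pi>)) V \<and> r \<in> V \<and> (\<forall>s\<in>V. f s = f r)"
      by (intro exI[of _ ?V] conjI ballI)
  qed
  have "restrict f (carrier (Zpi \<pi>)) \<in> chom (Zpi \<pi>) N"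
    by (rule chom_restrictI) (use hZ 1 3 a in \<open>auto simp: f_def\<close>)
  then show ?thesis using that[of "restrict f (carrier (Zpi \<pi>))"] 2 Zpi_unit_closed[OF \<pi>] by simp
qed

text \<open>Existence, together with uniqueness on the dense subgroup generated by the unit, makes
  the definite description in \<open>Zpi_scale\<close> meaningful.\<close>

lemma Zpi_scale:
  assumes \<pi>: "\<forall>p\<in>\<pi>. prime p" and N: "comm_group N" "topo N = discrete_topology (carrier N)"
    and tor: "pi_torsion \<pi> N" and a: "a \<in> carrier N"
  shows "Zpi_scale \<pi> N a \<in> chom (Zpi \<pi>) N" "Zpi_scale \<pi> N a (Zpi_unit \<pi>) = a"
    "f \<in> chom (Zpi \<pi>) N \<Longrightarrow> f (Zpi_unit \<pi>) = a \<Longrightarrow> f = Zpi_scale \<pi> N a"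
proof -
  have un: "f = h" if "f \<in> chom (Zpi \<pi>) N" "f (Zpi_unit \<pi>) = a" "h \<in> chom (Zpi \<pi>) N" "h (Zpi_unit \<pi>) = a" for f h
    using that by (intro chom_eqI[OF topgen_Zpi[OF \<pi>] hausdorff_abelian_Zpi[OF \<pi>]
        hausdorff_abelian_discrete[OF N]]) auto
  have "\<exists>!f. f \<in> chom (Zpi \<pi>) N \<and> f (Zpi_unit \<pi>) = a"
    using Zpi_hom_exists[OF assms] un by metis
  from theI'[OF this]
  have "Zpi_scale \<pi> N a \<in> chom (Zpi \<pi>) N \<and> Zpi_scale \<pi> N a (Zpi_unit \<pi>) = a"
    by (simp add: Zpi_scale_def)
  then show "Zpi_scale \<pi> N a \<in> chom (Zpi \<pi>) N" "Zpi_scale \<pi> N a (Zpi_unit \<pi>) = a"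
    "f \<in> chom (Zpi \<pi>) N \<Longrightarrow> f (Zpi_unit \<pi>) = a \<Longrightarrow> f = Zpi_scale \<pi> N a"
    using un by blast+
qed

section \<open>Free profinite modules\<close>

lemma clopen_partitionsD:
  assumes "P \<in> clopen_partitions Y"
  shows "finite P" "partition_on (topspace Y) P" "U \<in> P \<Longrightarrow> openin Y U" "U \<in> P \<Longrightarrow> closedin Y U"
    "U \<in> P \<Longrightarrow> U \<noteq> {}" "\<Union>P = topspace Y"
    "U \<in> P \<Longrightarrow> V \<in> P \<Longrightarrow> y \<in> U \<Longrightarrow> y \<in> V \<Longrightarrow> U = V"
  using assms by (auto simp: clopen_partitions_def partition_on_def disjoint_def)

lemma clopen_partitions_cover:
  assumes "P \<in> clopen_partitions Y" "y \<in> topspace Y"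
  obtains U where "U \<in> P" "y \<in> U"
  using assms clopen_partitionsD(6) by blast

lemma clopen_partitions_homeomorphic_image:
  assumes h: "homeomorphic_map Y Z \<beta>" and P: "P \<in> clopen_partitions Y"
  shows "(`) \<beta> ` P \<in> clopen_partitions Z"
proof -
  have inj: "inj_on \<beta> (topspace Y)" and surj: "\<beta> ` topspace Y = topspace Z"
    using h by (auto simp: homeomorphic_eq_everything_map)
  have sub: "U \<subseteq> topspace Y" if "U \<in> P" for U using clopen_partitionsD(3)[OF P that] openin_subset by blast
  have "partition_on (topspace Z) ((`) \<beta> ` P)"
  proof (rule partition_onI)
    show "\<Union>((`) \<beta> ` P) = topspace Z" using clopen_partitionsD(6)[OF P] surj
      by (simp flip: image_Union)
    show "{} \<notin> (`) \<beta> ` P" using clopen_partitionsD(5)[OF P] by blast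
    fix p q assume pq: "p \<in> (`) \<beta> ` P" "q \<in> (`) \<beta> ` P" "p \<noteq> q"
    then obtain U V where UV: "U \<in> P" "V \<in> P" "p = \<beta> ` U" "q = \<beta> ` V" "U \<noteq> V" by blast
    then have "U \<inter> V = {}" using clopen_partitionsD(7)[OF P] by blast
    then show "disjnt p q"
      using UV sub inj_on_image_Int[OF inj, of U V] by (simp add: disjnt_def)
  qed
  moreover have "openin Z (\<beta> ` U) \<and> closedin Z (\<beta> ` U)" if "U \<in> P" for U
    using h that clopen_partitionsD(3,4)[OF P that]
    by (metis homeomorphic_eq_everything_map open_map_def closed_map_def)
  ultimately show ?thesis using clopen_partitionsD(1)[OF P] by (auto simp: clopen_partitions_def)
qed

text \<open>Points are put in one block when they lie in the same members of all the given
  partitions; there are finitely many such members, so the blocks are open.\<close>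

lemma clopen_partitions_common_refinement:
  assumes Y: "compact_space Y" and F: "finite F" "F \<subseteq> clopen_partitions Y"
  obtains P where "P \<in> clopen_partitions Y" "\<And>Q. Q \<in> F \<Longrightarrow> refines (topspace Y) P Q"
proof -
  define f where "f y = {V \<in> \<Union>F. y \<in> V}" for y
  have fin: "finite (\<Union>F)" using F clopen_partitionsD(1) by blast
  have op: "openin Y {z \<in> topspace Y. f z = f y}" for y
  proof -
    have eq: "{z \<in> topspace Y. f z = f y} =
        topspace Y \<inter> (\<Inter>V\<in>\<Union>F. {z \<in> topspace Y. z \<in> V \<longleftrightarrow> y \<in> V})"
      by (auto simp: f_def set_eq_iff)
    have "openin Y {z \<in> topspace Y. z \<in> V \<longleftrightarrow> y \<in> V}" if "V \<in> \<Union>F" for V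
    proof -
      have V: "openin Y V" "openin Y (topspace Y - V)"
        using that F(2) clopen_partitionsD(3,4) by blast+
      have "{z \<in> topspace Y. z \<in> V \<longleftrightarrow> y \<in> V} = (if y \<in> V then V else topspace Y - V)"
        using openin_subset[OF V(1)] by auto
      then show ?thesis using V by simp
    qed
    then show ?thesis unfolding eq by (rule openin_finite_INT[OF fin])
  qed
  let ?P = "(\<lambda>y. {z \<in> topspace Y. f z = f y}) ` topspace Y"
  have P: "?P \<in> clopen_partitions Y" using clopen_partition_fibres[OF Y op] by simp
  have "refines (topspace Y) ?P Q" if Q: "Q \<in> F" for Q
    unfolding refines_def
  proof (intro conjI ballI)
    have Qc: "Q \<in> clopen_partitions Y" using Q F by blast
    show "partition_on (topspace Y) ?P" "partition_on (topspace Y) Q"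
      using clopen_partitionsD(2) P Qc by blast+
    fix U assume "U \<in> ?P"
    then obtain y where y: "y \<in> topspace Y" "U = {z \<in> topspace Y. f z = f y}" by blast
    obtain V where V: "V \<in> Q" "y \<in> V" using clopen_partitions_cover[OF Qc y(1)] .
    have "z \<in> V" if "z \<in> U" for z
    proof -
      have "V \<in> f y" using V Q by (auto simp: f_def)
      then have "V \<in> f z" using that y by simp
      then show ?thesis by (simp add: f_def)
    qed
    then show "\<exists>V\<in>Q. U \<subseteq> V" using V by blast
  qed
  then show ?thesis using that P by blast
qed

locale free_module =
  fixes R :: "'r tgroup" and Y :: "'y topology"
  assumes R: "hausdorff_abelian R"
begin

sublocale R: comm_group R using hausdorff_abelianD[OF R] by simp

abbreviation cp where "cp \<equiv> clopen_partitions Y"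
abbreviation M where "M \<equiv> pf_free R Y"

text \<open>The ambient product of the inverse limit and the compatibility conditions are kept
  apart: group structure and closedness are proved for the product first and then passed to the
  solution set.\<close>

definition full where "full = tprod cp (\<lambda>P. tprod P (\<lambda>_. R))"

definition coherent where
  "coherent = {m. \<forall>P\<in>cp. \<forall>Q\<in>cp. refines (topspace Y) P Q \<longrightarrow>
     (\<forall>V\<in>Q. m Q V = (\<Otimes>\<^bsub>R\<^esub>U\<in>{U \<in> P. U \<subseteq> V}. m P U))}"

lemma M_alt: "M = tsub full coherent"
  by (simp add: pf_free_def full_def coherent_def)

lemma full: "hausdorff_abelian full"
  unfolding full_def by (intro hausdorff_abelian_tprod R)

lemma carrier_full: "carrier full = (\<Pi>\<^sub>E P\<in>cp. P \<rightarrow>\<^sub>E carrier R)"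
  by (simp add: full_def)

lemma mult_full: "P \<in> cp \<Longrightarrow> U \<in> P \<Longrightarrow> (m \<otimes>\<^bsub>full\<^esub> n) P U = m P U \<otimes>\<^bsub>R\<^esub> n P U"
  by (simp add: full_def)

lemma one_full: "P \<in> cp \<Longrightarrow> U \<in> P \<Longrightarrow> \<one>\<^bsub>full\<^esub> P U = \<one>\<^bsub>R\<^esub>"
  by (simp add: full_def)

lemma full_coeff: "m \<in> carrier full \<Longrightarrow> P \<in> cp \<Longrightarrow> U \<in> P \<Longrightarrow> m P U \<in> carrier R"
  by (auto simp: carrier_full PiE_iff)

lemma full_eqI:
  assumes "m \<in> carrier full" "n \<in> carrier full" "\<And>P U. P \<in> cp \<Longrightarrow> U \<in> P \<Longrightarrow> m P U = n P U"
  shows "m = n"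
proof (rule PiE_ext[of _ cp "\<lambda>P. P \<rightarrow>\<^sub>E carrier R"])
  fix P assume P: "P \<in> cp"
  show "m P = n P"
    by (rule PiE_ext[of _ P "\<lambda>_. carrier R"]) (use assms P in \<open>auto simp: carrier_full PiE_iff\<close>)
qed (use assms in \<open>auto simp: carrier_full\<close>)

lemma subgroup_coherent: "subgroup (carrier full \<inter> coherent) full"
proof -
  interpret F: group full using hausdorff_abelianD[OF full] by simp
  have inv: "(inv\<^bsub>full\<^esub> m) P U = inv\<^bsub>R\<^esub> (m P U)" if "m \<in> carrier full" "P \<in> cp" "U \<in> P" for m P U
  proof -
    have "(inv\<^bsub>full\<^esub> m) P U \<otimes>\<^bsub>R\<^esub> m P U = \<one>\<^bsub>R\<^esub>"
      using F.l_inv[OF that(1)] mult_full[OF that(2,3), of "inv\<^bsub>full\<^esub> m" m] one_full[OF that(2,3)] by simp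
    then show ?thesis using that full_coeff F.inv_closed R.inv_equality by metis
  qed
  show ?thesis
  proof (rule F.subgroupI)
    have "\<one>\<^bsub>full\<^esub> \<in> coherent"
      unfolding coherent_def by (auto simp: one_full intro!: R.finprod_one_eqI[symmetric])
    then show "carrier full \<inter> coherent \<noteq> {}" using F.one_closed by blast
  next
    fix m n assume m: "m \<in> carrier full \<inter> coherent" and n: "n \<in> carrier full \<inter> coherent"
    have "m \<otimes>\<^bsub>full\<^esub> n \<in> coherent"
      unfolding coherent_def
    proof (intro CollectI ballI impI)
      fix P Q V assume P: "P \<in> cp" and Q: "Q \<in> cp" and ref: "refines (topspace Y) P Q" and V: "V \<in> Q"
      have "(\<Otimes>\<^bsub>R\<^esub>U\<in>{U \<in> P. U \<subseteq> V}. (m \<otimes>\<^bsub>full\<^esub> n) P U) = (\<Otimes>\<^bsub>R\<^esub>U\<in>{U \<in> P. U \<subseteq> V}. m P U \<otimes>\<^bsub>R\<^esub> n P U)"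
        using m n P by (intro R.finprod_cong) (auto simp: mult_full full_coeff)
      also have "\<dots> = (\<Otimes>\<^bsub>R\<^esub>U\<in>{U \<in> P. U \<subseteq> V}. m P U) \<otimes>\<^bsub>R\<^esub> (\<Otimes>\<^bsub>R\<^esub>U\<in>{U \<in> P. U \<subseteq> V}. n P U)"
        using m n P by (intro R.finprod_multf) (auto simp: full_coeff)
      also have "\<dots> = m Q V \<otimes>\<^bsub>R\<^esub> n Q V"
        using m n P Q ref V unfolding coherent_def by auto
      finally show "(m \<otimes>\<^bsub>full\<^esub> n) Q V = (\<Otimes>\<^bsub>R\<^esub>U\<in>{U \<in> P. U \<subseteq> V}. (m \<otimes>\<^bsub>full\<^esub> n) P U)"
        using Q V by (simp add: mult_full)
    qed
    then show "m \<otimes>\<^bsub>full\<^esub> n \<in> carrier full \<inter> coherent" using m n by simp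
  next
    fix m assume m: "m \<in> carrier full \<inter> coherent"
    have "inv\<^bsub>full\<^esub> m \<in> coherent"
      unfolding coherent_def
    proof (intro CollectI ballI impI)
      fix P Q V assume P: "P \<in> cp" and Q: "Q \<in> cp" and ref: "refines (topspace Y) P Q" and V: "V \<in> Q"
      let ?A = "{U \<in> P. U \<subseteq> V}"
      have "(\<Otimes>\<^bsub>R\<^esub>U\<in>?A. (inv\<^bsub>full\<^esub> m) P U) \<otimes>\<^bsub>R\<^esub> (\<Otimes>\<^bsub>R\<^esub>U\<in>?A. m P U) = (\<Otimes>\<^bsub>R\<^esub>U\<in>?A. (inv\<^bsub>full\<^esub> m) P U \<otimes>\<^bsub>R\<^esub> m P U)"
        using m P by (intro R.finprod_multf[symmetric]) (auto simp: full_coeff)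
      also have "\<dots> = \<one>\<^bsub>R\<^esub>"
        using m P by (intro R.finprod_one_eqI) (auto simp: inv full_coeff)
      finally have "(\<Otimes>\<^bsub>R\<^esub>U\<in>?A. (inv\<^bsub>full\<^esub> m) P U) \<otimes>\<^bsub>R\<^esub> m Q V = \<one>\<^bsub>R\<^esub>"
        using m P Q ref V unfolding coherent_def by auto
      moreover have "(\<Otimes>\<^bsub>R\<^esub>U\<in>?A. (inv\<^bsub>full\<^esub> m) P U) \<in> carrier R"
        using m P by (intro R.finprod_closed) (auto simp: full_coeff)
      ultimately have "inv\<^bsub>R\<^esub> (m Q V) = (\<Otimes>\<^bsub>R\<^esub>U\<in>?A. (inv\<^bsub>full\<^esub> m) P U)"
        using m Q V by (intro R.inv_equality) (auto simp: full_coeff)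
      then show "(inv\<^bsub>full\<^esub> m) Q V = (\<Otimes>\<^bsub>R\<^esub>U\<in>?A. (inv\<^bsub>full\<^esub> m) P U)" using m Q V by (simp add: inv)
    qed
    then show "inv\<^bsub>full\<^esub> m \<in> carrier full \<inter> coherent" using m by simp
  qed simp
qed

lemma hausdorff_abelian_M: "hausdorff_abelian M"
  unfolding M_alt by (intro hausdorff_abelian_tsub full subgroup_coherent)

sublocale M: comm_group M using hausdorff_abelianD[OF hausdorff_abelian_M] by simp

lemma topspace_M: "topspace (topo M) = carrier M"
  using hausdorff_abelianD[OF hausdorff_abelian_M] by simp

lemma carrier_M: "carrier M = carrier full \<inter> coherent"
  by (simp add: M_alt)

lemma coeff: "m \<in> carrier M \<Longrightarrow> P \<in> cp \<Longrightarrow> U \<in> P \<Longrightarrow> m P U \<in> carrier R"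
  by (simp add: carrier_M full_coeff)

lemma M_eqI:
  "m \<in> carrier M \<Longrightarrow> n \<in> carrier M \<Longrightarrow> (\<And>P U. P \<in> cp \<Longrightarrow> U \<in> P \<Longrightarrow> m P U = n P U) \<Longrightarrow> m = n"
  by (rule full_eqI) (auto simp: carrier_M)

lemma mult_M: "P \<in> cp \<Longrightarrow> U \<in> P \<Longrightarrow> (m \<otimes>\<^bsub>M\<^esub> n) P U = m P U \<otimes>\<^bsub>R\<^esub> n P U"
  by (simp add: M_alt mult_full)

lemma one_M: "P \<in> cp \<Longrightarrow> U \<in> P \<Longrightarrow> \<one>\<^bsub>M\<^esub> P U = \<one>\<^bsub>R\<^esub>"
  by (simp add: M_alt one_full)

lemma M_coherent:
  "m \<in> carrier M \<Longrightarrow> P \<in> cp \<Longrightarrow> Q \<in> cp \<Longrightarrow> refines (topspace Y) P Q \<Longrightarrow> V \<in> Q \<Longrightarrow>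
    m Q V = (\<Otimes>\<^bsub>R\<^esub>U\<in>{U \<in> P. U \<subseteq> V}. m P U)"
  by (simp add: carrier_M coherent_def)

lemma memM_I:
  assumes "m \<in> (\<Pi>\<^sub>E P\<in>cp. P \<rightarrow>\<^sub>E carrier R)"
    and "\<And>P Q V. P \<in> cp \<Longrightarrow> Q \<in> cp \<Longrightarrow> refines (topspace Y) P Q \<Longrightarrow> V \<in> Q \<Longrightarrow>
      m Q V = (\<Otimes>\<^bsub>R\<^esub>U\<in>{U \<in> P. U \<subseteq> V}. m P U)"
  shows "m \<in> carrier M"
  using assms by (simp add: carrier_M carrier_full coherent_def)

lemma finprod_M:
  assumes "finite I" "\<And>i. i \<in> I \<Longrightarrow> m i \<in> carrier M" "P \<in> cp" "U \<in> P"
  shows "(\<Otimes>\<^bsub>M\<^esub>i\<in>I. m i) P U = (\<Otimes>\<^bsub>R\<^esub>i\<in>I. m i P U)"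
  using assms(1,2)
proof (induction I)
  case empty
  then show ?case using assms by (simp add: one_M)
next
  case (insert i I)
  then show ?case using assms(3,4)
    by (subst M.finprod_insert; (subst R.finprod_insert)?) (auto simp: mult_M coeff)
qed

lemma continuous_map_coeff:
  assumes "P \<in> cp" "U \<in> P"
  shows "continuous_map (topo M) (topo R) (\<lambda>m. m P U)"
proof -
  have 1: "continuous_map (topo full) (product_topology (\<lambda>_. topo R) P) (\<lambda>m. m P)"
    using continuous_map_product_projection[OF assms(1), of "\<lambda>P. product_topology (\<lambda>_. topo R) P"]
    by (simp add: full_def)
  have 2: "continuous_map (product_topology (\<lambda>_. topo R) P) (topo R) (\<lambda>c. c U)"
    using continuous_map_product_projection[OF assms(2), of "\<lambda>_. topo R"] by simp
  show ?thesis
    using continuous_map_from_subtopology[OF continuous_map_compose[OF 1 2]] by (simp add: comp_def M_alt)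
qed

lemma continuous_map_into_M:
  assumes f: "\<And>x. x \<in> topspace T \<Longrightarrow> f x \<in> carrier M"
    and c: "\<And>P U. P \<in> cp \<Longrightarrow> U \<in> P \<Longrightarrow> continuous_map T (topo R) (\<lambda>x. f x P U)"
  shows "continuous_map T (topo M) f"
proof -
  have ff: "f x \<in> (\<Pi>\<^sub>E P\<in>cp. P \<rightarrow>\<^sub>E carrier R)" if "x \<in> topspace T" for x
    using f[OF that] by (simp add: carrier_M carrier_full)
  have "continuous_map T (topo full) f"
    unfolding full_def tprod_sel continuous_map_componentwise
  proof (intro conjI ballI)
    show "f ` topspace T \<subseteq> extensional cp" using ff by (auto simp: PiE_iff)
    fix P assume P: "P \<in> cp"
    show "(\<lambda>x. f x P) ` topspace T \<subseteq> extensional P" using ff P by (auto simp: PiE_iff)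
    fix U assume U: "U \<in> P"
    show "continuous_map T (topo R) (\<lambda>x. f x P U)" using c P U by blast
  qed
  then show ?thesis
    unfolding M_alt tsub_sel by (rule continuous_map_into_subtopology) (use f in \<open>auto simp: carrier_M\<close>)
qed

lemma dirac_coeff: "P \<in> cp \<Longrightarrow> U \<in> P \<Longrightarrow> dirac R Y r y P U = (if y \<in> U then r else \<one>\<^bsub>R\<^esub>)"
  by (simp add: dirac_def)

lemma dirac_closed [simp]:
  assumes r: "r \<in> carrier R" and y: "y \<in> topspace Y"
  shows "dirac R Y r y \<in> carrier M"
proof (rule memM_I)
  show "dirac R Y r y \<in> (\<Pi>\<^sub>E P\<in>cp. P \<rightarrow>\<^sub>E carrier R)" using r by (auto simp: dirac_def)
  fix P Q V assume P: "P \<in> cp" and Q: "Q \<in> cp" and ref: "refines (topspace Y) P Q" and V: "V \<in> Q"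
  obtain U where U: "U \<in> P" "y \<in> U" using clopen_partitions_cover[OF P y] .
  obtain W where W: "W \<in> Q" "U \<subseteq> W" using ref U by (auto simp: refines_def)
  have "(\<Otimes>\<^bsub>R\<^esub>U\<in>{U \<in> P. U \<subseteq> V}. dirac R Y r y P U) = (if y \<in> V then r else \<one>\<^bsub>R\<^esub>)"
  proof (cases "y \<in> V")
    case True
    then have "U \<subseteq> V" using clopen_partitionsD(7)[OF Q W(1) V] U W by blast
    have "(\<Otimes>\<^bsub>R\<^esub>U\<in>{U \<in> P. U \<subseteq> V}. dirac R Y r y P U) = (\<Otimes>\<^bsub>R\<^esub>W\<in>{U \<in> P. U \<subseteq> V}. if U = W then r else \<one>\<^bsub>R\<^esub>)"
      using P U r clopen_partitionsD(7)[OF P] by (intro R.finprod_cong') (auto simp: dirac_coeff)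
    also have "\<dots> = r"
      using R.finprod_singleton[of U "{U \<in> P. U \<subseteq> V}" "\<lambda>_. r"] U \<open>U \<subseteq> V\<close> r clopen_partitionsD(1)[OF P] by simp
    finally show ?thesis using True by simp
  next
    case False
    have "(\<Otimes>\<^bsub>R\<^esub>U\<in>{U \<in> P. U \<subseteq> V}. dirac R Y r y P U) = \<one>\<^bsub>R\<^esub>"
      using P False by (intro R.finprod_one_eqI) (auto simp: dirac_coeff)
    then show ?thesis using False by simp
  qed
  then show "dirac R Y r y Q V = (\<Otimes>\<^bsub>R\<^esub>U\<in>{U \<in> P. U \<subseteq> V}. dirac R Y r y P U)"
    using Q V by (simp add: dirac_coeff)
qed

lemma dirac_mult:
  assumes "r \<in> carrier R" "s \<in> carrier R" "y \<in> topspace Y"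
  shows "dirac R Y (r \<otimes>\<^bsub>R\<^esub> s) y = dirac R Y r y \<otimes>\<^bsub>M\<^esub> dirac R Y s y"
  using assms by (intro M_eqI) (auto simp: mult_M dirac_coeff)

text \<open>Each coefficient switches between \<open>r\<close> and zero along a clopen set
  \<open>U\<close>, so it is continuous on both of the open parts.\<close>

lemma continuous_map_dirac:
  "continuous_map (prod_topology (topo R) Y) (topo M) (\<lambda>(r, y). dirac R Y r y)"
proof (rule continuous_map_into_M)
  show "\<And>x. x \<in> topspace (prod_topology (topo R) Y) \<Longrightarrow> (case x of (r, y) \<Rightarrow> dirac R Y r y) \<in> carrier M"
    using hausdorff_abelianD(5)[OF R] by auto
  fix P U assume P: "P \<in> cp" and U: "U \<in> P"
  have "continuous_map (prod_topology (topo R) Y) (topo R) (\<lambda>x. if snd x \<in> U then fst x else \<one>\<^bsub>R\<^esub>)"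
    unfolding continuous_map_def
  proof (intro conjI allI impI)
    show "(\<lambda>x. if snd x \<in> U then fst x else \<one>\<^bsub>R\<^esub>) \<in> topspace (prod_topology (topo R) Y) \<rightarrow> topspace (topo R)"
      by (auto simp: hausdorff_abelianD(5)[OF R])
    fix W assume W: "openin (topo R) W"
    have "{x \<in> topspace (prod_topology (topo R) Y). (if snd x \<in> U then fst x else \<one>\<^bsub>R\<^esub>) \<in> W}
        = W \<times> U \<union> topspace (topo R) \<times> (if \<one>\<^bsub>R\<^esub> \<in> W then topspace Y - U else {})"
      using openin_subset[OF W] openin_subset[OF clopen_partitionsD(3)[OF P U]] by auto
    also have "openin (prod_topology (topo R) Y) \<dots>"
      using W clopen_partitionsD(3,4)[OF P U] by (intro openin_Un) (auto simp: openin_prod_Times_iff)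
    finally show "openin (prod_topology (topo R) Y)
      {x \<in> topspace (prod_topology (topo R) Y). (if snd x \<in> U then fst x else \<one>\<^bsub>R\<^esub>) \<in> W}" .
  qed
  then show "continuous_map (prod_topology (topo R) Y) (topo R) (\<lambda>x. (case x of (r, y) \<Rightarrow> dirac R Y r y) P U)"
    using P U by (simp add: dirac_coeff case_prod_unfold)
qed

lemma continuous_map_diracI:
  assumes "continuous_map T (topo R) f" "continuous_map T Y h"
  shows "continuous_map T (topo M) (\<lambda>x. dirac R Y (f x) (h x))"
  using continuous_map_compose[OF continuous_map_pairedI[OF assms] continuous_map_dirac] by (simp add: comp_def)

lemma dirac_chom:
  assumes "y \<in> topspace Y"
  shows "(\<lambda>r. dirac R Y r y) \<in> hom R M" "continuous_map (topo R) (topo M) (\<lambda>r. dirac R Y r y)"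
  using assms hausdorff_abelianD(5)[OF R] continuous_map_diracI[of "topo R" "\<lambda>x. x" "\<lambda>_. y"]
  by (auto simp: hom_def dirac_mult)

text \<open>At finitely many partitions an element \<open>m\<close> coincides with a finite sum of
  \<open>dirac\<close> elements: take a common refinement \<open>P\<close>, place the coefficient
  \<open>m P U\<close> at a point of each block \<open>U\<close>, and recover the coarser
  coefficients from coherence of \<open>m\<close>.\<close>

lemma topgen_dirac:
  assumes Y: "compact_space Y" and B: "topgen R B"
  shows "topgen M {dirac R Y b y | b y. b \<in> B \<and> y \<in> topspace Y}"
  unfolding topgen_def
proof (intro conjI allI impI)
  have BR: "B \<subseteq> carrier R" using B by (simp add: topgen_def)
  then show "{dirac R Y b y | b y. b \<in> B \<and> y \<in> topspace Y} \<subseteq> carrier M" by auto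
  fix C assume "subgroup C M \<and> closedin (topo M) C \<and> {dirac R Y b y | b y. b \<in> B \<and> y \<in> topspace Y} \<subseteq> C"
  then have C: "subgroup C M" "closedin (topo M) C"
    and BC: "\<And>b y. b \<in> B \<Longrightarrow> y \<in> topspace Y \<Longrightarrow> dirac R Y b y \<in> C" by auto
  interpret C: subgroup C M by fact
  \<comment> \<open>For fixed \<open>y\<close> the coefficients \<open>r\<close> with
    \<open>dirac R Y r y\<close> in \<open>C\<close> form a closed subgroup of \<open>R\<close> that
    contains \<open>B\<close>.\<close>
  have dC: "dirac R Y r y \<in> C" if "r \<in> carrier R" "y \<in> topspace Y" for r y
    by (rule topgen_image_subset[OF B R.is_group M.is_group dirac_chom[OF that(2)] hausdorff_abelianD(5)[OF R] C])
      (use BC that in blast)+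
  have fC: "(\<Otimes>\<^bsub>M\<^esub>i\<in>I. m i) \<in> C" if "finite I" "\<And>i. i \<in> I \<Longrightarrow> m i \<in> C" for I and m :: "'y set \<Rightarrow> _"
    using that
  proof (induction I)
    case (insert i I)
    then have "m i \<in> carrier M" "m \<in> I \<rightarrow> carrier M" by auto
    then show ?case using insert by simp
  qed simp
  obtain C0 where C0: "closedin (topo full) C0" "C = C0 \<inter> coherent"
    using C(2) by (auto simp: M_alt closedin_subtopology)
  show "C = carrier M"
  proof
    show "carrier M \<subseteq> C"
    proof
      fix m assume m: "m \<in> carrier M"
      have "m \<in> C0"
      proof (rule closedin_product_topology_memI)
        show "closedin (product_topology (\<lambda>P. topo (tprod P (\<lambda>_. R))) cp) C0"
          using C0(1) by (simp add: full_def)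
        show "m \<in> topspace (product_topology (\<lambda>P. topo (tprod P (\<lambda>_. R))) cp)"
          using m hausdorff_abelianD(5)[OF full] by (simp add: carrier_M full_def)
        fix F V assume F: "finite F" "F \<subseteq> cp"
          and V: "\<And>P. P \<in> F \<Longrightarrow> openin (topo (tprod P (\<lambda>_. R))) (V P) \<and> m P \<in> V P"
        obtain P where P: "P \<in> cp" "\<And>Q. Q \<in> F \<Longrightarrow> refines (topspace Y) P Q"
          using clopen_partitions_common_refinement[OF Y F] by blast
        define pt where "pt U = (SOME y. y \<in> U)" for U :: "'y set"
        have pt: "pt U \<in> U" "pt U \<in> topspace Y" if "U \<in> P" for U
        proof -
          show "pt U \<in> U" using clopen_partitionsD(5)[OF P(1) that] unfolding pt_def by (meson someI_ex ex_in_conv)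
          then show "pt U \<in> topspace Y" using clopen_partitionsD(6)[OF P(1)] that by blast
        qed
        let ?c = "\<Otimes>\<^bsub>M\<^esub>U\<in>P. dirac R Y (m P U) (pt U)"
        have "?c \<in> C" using clopen_partitionsD(1)[OF P(1)] pt m P by (intro fC dC coeff) auto
        moreover have "?c Q = m Q" if Q: "Q \<in> F" for Q
        proof (rule PiE_ext[of _ Q "\<lambda>_. carrier R"])
          have Qc: "Q \<in> cp" using Q F by blast
          show "?c Q \<in> Q \<rightarrow>\<^sub>E carrier R" "m Q \<in> Q \<rightarrow>\<^sub>E carrier R"
            using \<open>?c \<in> C\<close> C.mem_carrier m Qc by (auto simp: carrier_M carrier_full PiE_iff)
          fix W assume W: "W \<in> Q"
          have ref: "pt U \<in> W \<longleftrightarrow> U \<subseteq> W" if U: "U \<in> P" for U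
          proof -
            obtain W' where W': "W' \<in> Q" "U \<subseteq> W'" using P(2)[OF Q] U by (auto simp: refines_def)
            then show ?thesis using clopen_partitionsD(7)[OF Qc W'(1) W, of "pt U"] pt(1)[OF U] by blast
          qed
          have "?c Q W = (\<Otimes>\<^bsub>R\<^esub>U\<in>P. dirac R Y (m P U) (pt U) Q W)"
            using clopen_partitionsD(1)[OF P(1)] pt m P Qc W by (intro finprod_M dirac_closed coeff) auto
          also have "\<dots> = (\<Otimes>\<^bsub>R\<^esub>U\<in>{U \<in> P. U \<subseteq> W}. m P U)"
            using clopen_partitionsD(1)[OF P(1)] m P Qc W ref
            by (intro R.finprod_mono_neutral_cong_right) (auto simp: dirac_coeff coeff)
          also have "\<dots> = m Q W" using M_coherent[OF m P(1) Qc P(2)[OF Q] W] by simp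
          finally show "?c Q W = m Q W" .
        qed
        ultimately show "\<exists>c\<in>C0. \<forall>Q\<in>F. c Q \<in> V Q" using V C0(2) by (intro bexI[of _ ?c]) auto
      qed
      then show "m \<in> C" using C0(2) m by (simp add: carrier_M)
    qed
  qed (rule C.subset)
qed

text \<open>The universal property for data that are constant on the blocks of a finite clopen
  partition: the coefficient at each block is sent through its own \<open>k U\<close> and the
  results are added up.\<close>

lemma extend_partition:
  assumes N: "topological_group N" "comm_group N" and P: "P \<in> cp"
    and k: "\<And>U. U \<in> P \<Longrightarrow> k U \<in> chom R N"
  obtains f where "f \<in> chom M N"
    "\<And>r y U. r \<in> carrier R \<Longrightarrow> U \<in> P \<Longrightarrow> y \<in> U \<Longrightarrow> f (dirac R Y r y) = k U r"
proof -
  interpret N: comm_group N by fact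
  define f where "f m = (\<Otimes>\<^bsub>N\<^esub>U\<in>P. k U (m P U))" for m
  note fin = clopen_partitionsD(1)[OF P]
  have kN: "k U (m P U) \<in> carrier N" if "m \<in> carrier M" "U \<in> P" for m U
    using chomD(4)[OF k[OF that(2)] coeff[OF that(1) P that(2)]] .
  have 1: "f (m \<otimes>\<^bsub>M\<^esub> n) = f m \<otimes>\<^bsub>N\<^esub> f n" if m: "m \<in> carrier M" and n: "n \<in> carrier M" for m n
  proof -
    have "f (m \<otimes>\<^bsub>M\<^esub> n) = (\<Otimes>\<^bsub>N\<^esub>U\<in>P. k U (m P U) \<otimes>\<^bsub>N\<^esub> k U (n P U))"
      unfolding f_def
    proof (rule N.finprod_cong')
      fix U assume U: "U \<in> P"
      show "k U ((m \<otimes>\<^bsub>M\<^esub> n) P U) = k U (m P U) \<otimes>\<^bsub>N\<^esub> k U (n P U)"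
        using chomD(5)[OF k[OF U] coeff[OF m P U] coeff[OF n P U]] by (simp add: mult_M[OF P U])
    qed (use kN m n in auto)
    then show ?thesis unfolding f_def using kN m n by (simp add: N.finprod_multf)
  qed
  have 2: "continuous_map (topo M) (topo N) f"
    unfolding f_def
  proof (rule continuous_map_finprod[OF N fin])
    fix U assume U: "U \<in> P"
    show "continuous_map (topo M) (topo N) (\<lambda>m. k U (m P U))"
      using continuous_map_compose[OF continuous_map_coeff[OF P U] chomD(3)[OF k[OF U]]] by (simp add: comp_def)
  qed
  have 3: "f (dirac R Y r y) = k U r" if r: "r \<in> carrier R" and U: "U \<in> P" "y \<in> U" for r y U
  proof -
    have one: "k V \<one>\<^bsub>R\<^esub> = \<one>\<^bsub>N\<^esub>" if "V \<in> P" for V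
      using hom_one[OF chomD(1)[OF k[OF that]]] R.is_group N.is_group by simp
    have "f (dirac R Y r y) = (\<Otimes>\<^bsub>N\<^esub>V\<in>P. if U = V then k V r else \<one>\<^bsub>N\<^esub>)"
      unfolding f_def
    proof (rule N.finprod_cong')
      fix V assume V: "V \<in> P"
      show "k V (dirac R Y r y P V) = (if U = V then k V r else \<one>\<^bsub>N\<^esub>)"
        using clopen_partitionsD(7)[OF P U(1) V U(2)] U one[OF V] by (auto simp: dirac_coeff[OF P V])
    qed (use chomD(4)[OF k] r in auto)
    also have "\<dots> = k U r"
      using U fin chomD(4)[OF k] r by (intro N.finprod_singleton) auto
    finally show ?thesis .
  qed
  have fN: "f m \<in> carrier N" if "m \<in> carrier M" for m
    unfolding f_def using kN that by (intro N.finprod_closed) auto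
  have "restrict f (carrier M) \<in> chom M N"
    by (rule chom_restrictI[OF topspace_M M.is_group fN 1 2])
  moreover have "restrict f (carrier M) (dirac R Y r y) = k U r" if "r \<in> carrier R" "U \<in> P" "y \<in> U" for r y U
  proof -
    have "y \<in> topspace Y" using clopen_partitionsD(6)[OF P] that by blast
    then show ?thesis using 3 that by simp
  qed
  ultimately show ?thesis using that by blast
qed

text \<open>Each compatibility condition equates two continuous functions into the Hausdorff group
  \<open>R\<close>. Closedness is what lets the universal property descend from the product to
  \<open>pf_free\<close>.\<close>

lemma closedin_coherent: "closedin (topo full) (carrier full \<inter> coherent)"
proof -
  note hF = hausdorff_abelianD[OF full] and hR = hausdorff_abelianD[OF R]
  define J where "J = {(P, Q, V). P \<in> cp \<and> Q \<in> cp \<and> refines (topspace Y) P Q \<and> V \<in> Q}"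
  define E where "E = (\<lambda>(P, Q, V). {m \<in> topspace (topo full). m Q V = (\<Otimes>\<^bsub>R\<^esub>U\<in>{U \<in> P. U \<subseteq> V}. m P U)})"
  have c: "continuous_map (topo full) (topo R) (\<lambda>m. m P U)" if "P \<in> cp" "U \<in> P" for P U
  proof -
    have 1: "continuous_map (topo full) (product_topology (\<lambda>_. topo R) P) (\<lambda>m. m P)"
      using continuous_map_product_projection[OF that(1), of "\<lambda>P. product_topology (\<lambda>_. topo R) P"]
      by (simp add: full_def)
    have 2: "continuous_map (product_topology (\<lambda>_. topo R) P) (topo R) (\<lambda>c. c U)"
      using continuous_map_product_projection[OF that(2), of "\<lambda>_. topo R"] by simp
    show ?thesis using continuous_map_compose[OF 1 2] by (simp add: comp_def)
  qed
  have "closedin (topo full) (E j)" if jJ: "j \<in> J" for j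
  proof -
    obtain P Q V where j: "j = (P, Q, V)" "P \<in> cp" "Q \<in> cp" "V \<in> Q"
      using jJ by (auto simp: J_def)
    have "continuous_map (topo full) (topo R) (\<lambda>m. \<Otimes>\<^bsub>R\<^esub>U\<in>{U \<in> P. U \<subseteq> V}. m P U)"
      using clopen_partitionsD(1)[OF j(2)] c j by (intro continuous_map_finprod hR) auto
    from closedin_continuous_maps_eq[OF hR(4) c[OF j(3,4)] this]
    show ?thesis by (simp add: E_def j)
  qed
  \<comment> \<open>The whole space is inserted to keep the intersected family nonempty.\<close>
  then have "closedin (topo full) (\<Inter>(insert (topspace (topo full)) (E ` J)))"
    by (intro closedin_Inter) auto
  moreover have "\<Inter>(insert (topspace (topo full)) (E ` J)) = carrier full \<inter> coherent"
    using hF(5) by (auto simp: E_def J_def coherent_def)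
  ultimately show ?thesis by simp
qed

end

section \<open>Relabelling the space, changing the coefficients, and the augmentation\<close>

context free_module
begin

text \<open>Coefficients are pulled back along \<open>\<beta>\<close>, so points move by the inverse
  of \<open>\<beta>\<close>. This is the shape of \<open>pf_free_act\<close>, where
  \<open>\<beta>\<close> is the action of an inverse element.\<close>

lemma relabel:
  assumes h: "homeomorphic_map Y Y \<beta>"
  defines "act \<equiv> \<lambda>m. \<lambda>P\<in>cp. \<lambda>U\<in>P. m ((`) \<beta> ` P) (\<beta> ` U)"
  shows "\<And>m. m \<in> carrier M \<Longrightarrow> act m \<in> carrier M"
    and "act \<in> hom M M" and "continuous_map (topo M) (topo M) act"
    and "\<And>r y. r \<in> carrier R \<Longrightarrow> y \<in> topspace Y \<Longrightarrow> act (dirac R Y r (\<beta> y)) = dirac R Y r y"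
proof -
  have inj: "inj_on \<beta> (topspace Y)" and im: "\<beta> ` topspace Y = topspace Y"
    using h by (auto simp: homeomorphic_eq_everything_map)
  note bP = clopen_partitions_homeomorphic_image[OF h]
  have sub: "U \<subseteq> topspace Y" if "P \<in> cp" "U \<in> P" for P U
    using clopen_partitionsD(6)[OF that(1)] that(2) by blast
  show closed: "act m \<in> carrier M" if m: "m \<in> carrier M" for m
  proof (rule memM_I)
    show "act m \<in> (\<Pi>\<^sub>E P\<in>cp. P \<rightarrow>\<^sub>E carrier R)"
      unfolding act_def using coeff[OF m bP] by auto
    fix P Q V assume P: "P \<in> cp" and Q: "Q \<in> cp" and ref: "refines (topspace Y) P Q" and V: "V \<in> Q"
    have ref': "refines (topspace Y) ((`) \<beta> ` P) ((`) \<beta> ` Q)"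
      unfolding refines_def
    proof (intro conjI ballI)
      show "partition_on (topspace Y) ((`) \<beta> ` P)" "partition_on (topspace Y) ((`) \<beta> ` Q)"
        using clopen_partitionsD(2) bP[OF P] bP[OF Q] by blast+
      fix W assume "W \<in> (`) \<beta> ` P"
      then obtain U where U: "U \<in> P" "W = \<beta> ` U" by blast
      then obtain V where "V \<in> Q" "U \<subseteq> V" using ref by (auto simp: refines_def)
      then show "\<exists>V\<in>(`) \<beta> ` Q. W \<subseteq> V" using U by blast
    qed
    have eq: "{W \<in> (`) \<beta> ` P. W \<subseteq> \<beta> ` V} = (`) \<beta> ` {U \<in> P. U \<subseteq> V}"
      using inj_on_image_subset_iff[OF inj sub[OF P] sub[OF Q V]] by auto
    have injP: "inj_on ((`) \<beta>) {U \<in> P. U \<subseteq> V}"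
      by (rule inj_on_subset[OF inj_on_image_Pow[OF inj]]) (use sub[OF P] in auto)
    have "act m Q V = (\<Otimes>\<^bsub>R\<^esub>W\<in>(`) \<beta> ` {U \<in> P. U \<subseteq> V}. m ((`) \<beta> ` P) W)"
      using M_coherent[OF m bP[OF P] bP[OF Q] ref', of "\<beta> ` V"] Q V by (simp add: act_def eq)
    also have "\<dots> = (\<Otimes>\<^bsub>R\<^esub>U\<in>{U \<in> P. U \<subseteq> V}. m ((`) \<beta> ` P) (\<beta> ` U))"
      using coeff[OF m bP[OF P]] by (intro R.finprod_reindex injP) auto
    also have "\<dots> = (\<Otimes>\<^bsub>R\<^esub>U\<in>{U \<in> P. U \<subseteq> V}. act m P U)"
      using coeff[OF m bP[OF P]] P by (intro R.finprod_cong') (auto simp: act_def)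
    finally show "act m Q V = (\<Otimes>\<^bsub>R\<^esub>U\<in>{U \<in> P. U \<subseteq> V}. act m P U)" .
  qed
  have act: "act m P U = m ((`) \<beta> ` P) (\<beta> ` U)" if "P \<in> cp" "U \<in> P" for m P U
    using that by (simp add: act_def)
  show "act \<in> hom M M"
  proof (rule homI)
    fix m n assume m: "m \<in> carrier M" and n: "n \<in> carrier M"
    show "act (m \<otimes>\<^bsub>M\<^esub> n) = act m \<otimes>\<^bsub>M\<^esub> act n"
    proof (rule M_eqI)
      fix P U assume "P \<in> cp" "U \<in> P"
      then show "act (m \<otimes>\<^bsub>M\<^esub> n) P U = (act m \<otimes>\<^bsub>M\<^esub> act n) P U"
        using mult_M[OF bP, of P "\<beta> ` U" m n] by (simp add: act mult_M)
    qed (use m n closed in auto)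
  qed (rule closed)
  show "continuous_map (topo M) (topo M) act"
  proof (rule continuous_map_into_M)
    fix P U assume PU: "P \<in> cp" "U \<in> P"
    show "continuous_map (topo M) (topo R) (\<lambda>m. act m P U)"
      using continuous_map_coeff[OF bP[OF PU(1)], of "\<beta> ` U"] PU by (simp add: act)
  qed (use closed topspace_M in auto)
  show "act (dirac R Y r (\<beta> y)) = dirac R Y r y" if r: "r \<in> carrier R" and y: "y \<in> topspace Y" for r y
  proof (rule M_eqI)
    have by': "\<beta> y \<in> topspace Y" using im y by blast
    show "act (dirac R Y r (\<beta> y)) \<in> carrier M" using closed r by' by simp
    show "dirac R Y r y \<in> carrier M" using r y by simp
    fix P U assume PU: "P \<in> cp" "U \<in> P"
    have "\<beta> y \<in> \<beta> ` U \<longleftrightarrow> y \<in> U" using inj_on_image_mem_iff[OF inj y sub[OF PU]] .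
    then show "act (dirac R Y r (\<beta> y)) P U = dirac R Y r y P U"
      using PU dirac_coeff[OF bP[OF PU(1)], of "\<beta> ` U" r "\<beta> y"] by (simp add: act dirac_coeff)
  qed
qed

text \<open>Source of \<open>std_act\<close>, in which \<open>G\<close> moves only the
  coefficients.\<close>

lemma map_coeff:
  assumes k: "k \<in> hom R R" "continuous_map (topo R) (topo R) k"
  defines "f \<equiv> \<lambda>m. \<lambda>P\<in>cp. \<lambda>U\<in>P. k (m P U)"
  shows "\<And>m. m \<in> carrier M \<Longrightarrow> f m \<in> carrier M"
    and "f \<in> hom M M" and "continuous_map (topo M) (topo M) f"
    and "\<And>r y. r \<in> carrier R \<Longrightarrow> y \<in> topspace Y \<Longrightarrow> f (dirac R Y r y) = dirac R Y (k r) y"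
proof -
  interpret k: group_hom R R k using k R.is_group by (simp add: group_hom_def group_hom_axioms_def)
  have kfin: "k (\<Otimes>\<^bsub>R\<^esub>i\<in>I. c i) = (\<Otimes>\<^bsub>R\<^esub>i\<in>I. k (c i))" if "finite I" "\<And>i. i \<in> I \<Longrightarrow> c i \<in> carrier R"
    for I and c :: "'y set \<Rightarrow> 'r"
    using that by (induction I) (auto simp: Pi_def)
  show closed: "f m \<in> carrier M" if m: "m \<in> carrier M" for m
  proof (rule memM_I)
    show "f m \<in> (\<Pi>\<^sub>E P\<in>cp. P \<rightarrow>\<^sub>E carrier R)"
      unfolding f_def using coeff[OF m] by auto
    fix P Q V assume P: "P \<in> cp" and Q: "Q \<in> cp" and ref: "refines (topspace Y) P Q" and V: "V \<in> Q"
    have "f m Q V = (\<Otimes>\<^bsub>R\<^esub>U\<in>{U \<in> P. U \<subseteq> V}. k (m P U))"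
      using kfin[of "{U \<in> P. U \<subseteq> V}" "m P"] clopen_partitionsD(1)[OF P] coeff[OF m P] Q V
      by (simp add: f_def M_coherent[OF m P Q ref V])
    also have "\<dots> = (\<Otimes>\<^bsub>R\<^esub>U\<in>{U \<in> P. U \<subseteq> V}. f m P U)"
      using coeff[OF m P] P by (intro R.finprod_cong') (auto simp: f_def)
    finally show "f m Q V = (\<Otimes>\<^bsub>R\<^esub>U\<in>{U \<in> P. U \<subseteq> V}. f m P U)" .
  qed
  have f: "f m P U = k (m P U)" if "P \<in> cp" "U \<in> P" for m P U
    using that by (simp add: f_def)
  show "f \<in> hom M M"
  proof (rule homI)
    fix m n assume m: "m \<in> carrier M" and n: "n \<in> carrier M"
    show "f (m \<otimes>\<^bsub>M\<^esub> n) = f m \<otimes>\<^bsub>M\<^esub> f n"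
    proof (rule M_eqI)
      fix P U assume "P \<in> cp" "U \<in> P"
      then show "f (m \<otimes>\<^bsub>M\<^esub> n) P U = (f m \<otimes>\<^bsub>M\<^esub> f n) P U"
        using coeff m n by (simp add: f mult_M)
    qed (use m n closed in auto)
  qed (rule closed)
  show "continuous_map (topo M) (topo M) f"
  proof (rule continuous_map_into_M)
    fix P U assume PU: "P \<in> cp" "U \<in> P"
    show "continuous_map (topo M) (topo R) (\<lambda>m. f m P U)"
      using continuous_map_compose[OF continuous_map_coeff[OF PU] k(2)] PU by (simp add: f comp_def)
  qed (use closed topspace_M in auto)
  show "f (dirac R Y r y) = dirac R Y (k r) y" if r: "r \<in> carrier R" and y: "y \<in> topspace Y" for r y
    using r y closed by (intro M_eqI) (auto simp: f dirac_coeff)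
qed

lemma augm:
  assumes "topspace Y \<noteq> {}"
  shows "augm Y \<in> hom M R" "continuous_map (topo M) (topo R) (augm Y)"
    "\<And>r y. y \<in> topspace Y \<Longrightarrow> augm Y (dirac R Y r y) = r"
proof -
  have cp: "{topspace Y} \<in> cp"
    using partition_on_space[OF assms] by (simp add: clopen_partitions_def)
  show "augm Y \<in> hom M R" using cp by (auto simp: augm_def hom_def mult_M coeff)
  show "continuous_map (topo M) (topo R) (augm Y)"
    using continuous_map_coeff[OF cp, of "topspace Y"] by (simp add: augm_def[abs_def])
  show "augm Y (dirac R Y r y) = r" if "y \<in> topspace Y" for r y
    using cp that by (simp add: augm_def dirac_coeff)
qed

end

text \<open>\<open>h\<close> is constant on the blocks of a finite clopen partition, its fibres; on
  each block the coefficient acts as a scalar on that constant value, which may be read off at any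
  point of the block.\<close>

lemma Zpi_free_extend:
  assumes \<pi>: "\<forall>p\<in>\<pi>. prime p" and Y: "compact_space Y"
    and N: "comm_group N" "topo N = discrete_topology (carrier N)" and tor: "pi_torsion \<pi> N"
    and h: "continuous_map Y (topo N) h"
  obtains f where "f \<in> chom (pf_free (Zpi \<pi>) Y) N"
    "\<And>y. y \<in> topspace Y \<Longrightarrow> f (dirac (Zpi \<pi>) Y (Zpi_unit \<pi>) y) = h y"
proof -
  interpret free_module "Zpi \<pi>" Y by unfold_locales (rule hausdorff_abelian_Zpi[OF \<pi>])
  define P where "P = (\<lambda>y. {z \<in> topspace Y. h z = h y}) ` topspace Y"
  have P: "P \<in> cp"
    unfolding P_def using h by (intro clopen_partition_fibres Y openin_discrete_fibre) (simp add: N)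
  define k where "k U = Zpi_scale \<pi> N (h (SOME y. y \<in> U))" for U
  have some: "(SOME y. y \<in> U) \<in> U" if "U \<in> P" for U
    using clopen_partitionsD(5)[OF P that] by (meson someI_ex ex_in_conv)
  have hN: "h y \<in> carrier N" if "y \<in> topspace Y" for y
    using continuous_map_image_subset_topspace[OF h] that by (auto simp: N)
  have top: "(SOME y. y \<in> U) \<in> topspace Y" if "U \<in> P" for U
    using some[OF that] clopen_partitionsD(6)[OF P] that by blast
  have k: "k U \<in> chom (Zpi \<pi>) N" if "U \<in> P" for U
    unfolding k_def by (intro Zpi_scale(1)[OF \<pi> N tor] hN top that)
  obtain f where f: "f \<in> chom M N"
    "\<And>r y U. r \<in> carrier (Zpi \<pi>) \<Longrightarrow> U \<in> P \<Longrightarrow> y \<in> U \<Longrightarrow> f (dirac (Zpi \<pi>) Y r y) = k U r"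
    using extend_partition[OF hausdorff_abelianD(3)[OF hausdorff_abelian_discrete[OF N]] N(1) P, of k] k
    by blast
  have "f (dirac (Zpi \<pi>) Y (Zpi_unit \<pi>) y) = h y" if y: "y \<in> topspace Y" for y
  proof -
    let ?U = "{z \<in> topspace Y. h z = h y}"
    have U: "?U \<in> P" "y \<in> ?U" using y by (auto simp: P_def)
    have "h (SOME y. y \<in> ?U) = h y" using some[OF U(1)] by simp
    moreover have "k ?U (Zpi_unit \<pi>) = h (SOME y. y \<in> ?U)"
      unfolding k_def by (rule Zpi_scale(2)[OF \<pi> N tor hN[OF top[OF U(1)]]])
    ultimately show ?thesis using f(2)[OF Zpi_unit_closed[OF \<pi>] U] by simp
  qed
  then show ?thesis using that f(1) by blast
qed

section \<open>The modules \<open>\<int>\<^sub>\<pi>\<lbrakk>\<Gamma>\<rbrakk>\<lbrakk>Z\<rbrakk>\<close>\<close>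

locale double_free =
  fixes \<pi> :: "nat set" and \<Gamma> :: "'g topology" and Z :: "'z topology"
  assumes \<pi>: "\<forall>p\<in>\<pi>. prime p" and \<Gamma>: "compact_space \<Gamma>" and Z: "compact_space Z"
begin

sublocale L: free_module "Zpi \<pi>" \<Gamma>
  by unfold_locales (rule hausdorff_abelian_Zpi[OF \<pi>])

sublocale D: free_module "pf_free (Zpi \<pi>) \<Gamma>" Z
  by unfold_locales (rule L.hausdorff_abelian_M)

definition unit :: "'g \<Rightarrow> 'g zfree" where
  "unit g = dirac (Zpi \<pi>) \<Gamma> (Zpi_unit \<pi>) g"

text \<open>The group element \<open>g\<close> times the free generator at \<open>z\<close>.
  Together these generate topologically as a group, so that no module structure over the completed
  group ring has to be set up.\<close>

definition gen :: "'g \<Rightarrow> 'z \<Rightarrow> 'z set set \<Rightarrow> 'z set \<Rightarrow> 'g zfree" where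
  "gen g z = dirac (pf_free (Zpi \<pi>) \<Gamma>) Z (unit g) z"

lemma unit_closed: "g \<in> topspace \<Gamma> \<Longrightarrow> unit g \<in> carrier L.M"
  unfolding unit_def by (rule L.dirac_closed[OF Zpi_unit_closed[OF \<pi>]])

lemma gen_closed: "g \<in> topspace \<Gamma> \<Longrightarrow> z \<in> topspace Z \<Longrightarrow> gen g z \<in> carrier D.M"
  unfolding gen_def by (rule D.dirac_closed[OF unit_closed])

lemma continuous_map_unit:
  assumes "continuous_map T \<Gamma> f"
  shows "continuous_map T (topo L.M) (\<lambda>x. unit (f x))"
  unfolding unit_def using assms Zpi_unit_closed[OF \<pi>] hausdorff_abelianD(5)[OF L.R]
  by (intro L.continuous_map_diracI) auto

lemma continuous_map_gen:
  assumes "continuous_map T \<Gamma> f" "continuous_map T Z h"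
  shows "continuous_map T (topo D.M) (\<lambda>x. gen (f x) (h x))"
  unfolding gen_def by (intro D.continuous_map_diracI continuous_map_unit assms)

lemma topgen_gen: "topgen D.M {gen g z | g z. g \<in> topspace \<Gamma> \<and> z \<in> topspace Z}"
proof -
  have "topgen D.M {dirac L.M Z b y | b y. b \<in> {unit g | g. g \<in> topspace \<Gamma>} \<and> y \<in> topspace Z}"
    using L.topgen_dirac[OF \<Gamma> topgen_Zpi[OF \<pi>]] by (intro D.topgen_dirac[OF Z]) (simp add: unit_def)
  moreover have "{dirac L.M Z b y | b y. b \<in> {unit g | g. g \<in> topspace \<Gamma>} \<and> y \<in> topspace Z}
      = {gen g z | g z. g \<in> topspace \<Gamma> \<and> z \<in> topspace Z}"
    by (auto simp: gen_def)
  ultimately show ?thesis by simp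
qed

text \<open>
  The boundary maps need the universal property also for the non-discrete target \<open>C\<^sub>n(G)\<close>; it passes
  from discrete modules to products and to closed subgroups.
\<close>

definition extensible :: "'n tgroup \<Rightarrow> bool" where
  "extensible N \<longleftrightarrow> hausdorff_abelian N \<and>
    (\<forall>\<phi>. continuous_map (prod_topology \<Gamma> Z) (topo N) (\<lambda>(g, z). \<phi> g z) \<longrightarrow>
      (\<exists>f\<in>chom D.M N. \<forall>g\<in>topspace \<Gamma>. \<forall>z\<in>topspace Z. f (gen g z) = \<phi> g z))"

text \<open>The module is free in two stages, and so is the extension. By compactness of
  \<open>\<Gamma>\<close> the entire slice of \<open>\<phi>\<close> at \<open>z\<close> is locally
  constant in \<open>z\<close>, so finitely many slices occur; each of them extends to the
  coefficient module by \<open>Zpi_free_extend\<close>, and \<open>extend_partition\<close> puts the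
  extensions together.\<close>

lemma extensible_discrete:
  assumes N: "comm_group N" "topo N = discrete_topology (carrier N)" and tor: "pi_torsion \<pi> N"
  shows "extensible N"
  unfolding extensible_def
proof (intro conjI allI impI)
  show hN: "hausdorff_abelian N" by (rule hausdorff_abelian_discrete[OF N])
  fix \<phi> assume \<phi>: "continuous_map (prod_topology \<Gamma> Z) (topo N) (\<lambda>(g, z). \<phi> g z)"
  \<comment> \<open>Restriction to the space makes equality of slices mean equality on
    \<open>\<Gamma>\<close>.\<close>
  define F where "F z = restrict (\<lambda>g. \<phi> g z) (topspace \<Gamma>)" for z
  define P where "P = (\<lambda>y. {z \<in> topspace Z. F z = F y}) ` topspace Z"
  have slice: "continuous_map \<Gamma> (topo N) (\<lambda>g. \<phi> g z)" if "z \<in> topspace Z" for z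
    using continuous_map_compose[OF continuous_map_pairedI[of \<Gamma> \<Gamma> "\<lambda>g. g" Z "\<lambda>_. z"] \<phi>] that
    by (simp add: comp_def)
  have P: "P \<in> D.cp"
    unfolding P_def
  proof (rule clopen_partition_fibres[OF Z])
    fix z assume z: "z \<in> topspace Z"
    have "continuous_map (prod_topology Z \<Gamma>) (prod_topology \<Gamma> Z) (\<lambda>x. (snd x, fst x))"
      by (intro continuous_map_pairedI continuous_map_fst continuous_map_snd)
    from continuous_map_compose[OF this \<phi>]
    have 1: "continuous_map (prod_topology Z \<Gamma>) (discrete_topology (carrier N)) (\<lambda>x. \<phi> (snd x) (fst x))"
      by (simp add: comp_def N)
    have 2: "continuous_map (prod_topology Z \<Gamma>) (discrete_topology (carrier N)) (\<lambda>x. \<phi> (snd x) z)"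
      using continuous_map_compose[OF continuous_map_snd slice[OF z]] by (simp add: comp_def N)
    have "openin Z {z' \<in> topspace Z. \<forall>g\<in>topspace \<Gamma>. (z', g) \<in>
        {x \<in> topspace (prod_topology Z \<Gamma>). \<phi> (snd x) (fst x) = \<phi> (snd x) z}}"
      by (rule openin_all[OF \<Gamma> openin_discrete_eq[OF 1 2]])
    also have "{z' \<in> topspace Z. \<forall>g\<in>topspace \<Gamma>. (z', g) \<in>
        {x \<in> topspace (prod_topology Z \<Gamma>). \<phi> (snd x) (fst x) = \<phi> (snd x) z}} = {z' \<in> topspace Z. F z' = F z}"
      by (auto simp: F_def restrict_def fun_eq_iff)
    finally show "openin Z {z' \<in> topspace Z. F z' = F z}" .
  qed
  have some: "(SOME y. y \<in> U) \<in> U" if "U \<in> P" for U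
    using clopen_partitionsD(5)[OF P that] by (meson someI_ex ex_in_conv)
  have top: "(SOME y. y \<in> U) \<in> topspace Z" if "U \<in> P" for U
    using some[OF that] clopen_partitionsD(6)[OF P] that by blast
  have "\<exists>k\<in>chom L.M N. \<forall>g\<in>topspace \<Gamma>. k (unit g) = \<phi> g (SOME y. y \<in> U)" if "U \<in> P" for U
    using Zpi_free_extend[OF \<pi> \<Gamma> N tor slice[OF top[OF that]]] unfolding unit_def by metis
  then obtain k where k: "\<And>U. U \<in> P \<Longrightarrow> k U \<in> chom L.M N"
    "\<And>U g. U \<in> P \<Longrightarrow> g \<in> topspace \<Gamma> \<Longrightarrow> k U (unit g) = \<phi> g (SOME y. y \<in> U)"
    by metis
  obtain f where f: "f \<in> chom D.M N"
    "\<And>r y U. r \<in> carrier L.M \<Longrightarrow> U \<in> P \<Longrightarrow> y \<in> U \<Longrightarrow> f (dirac L.M Z r y) = k U r"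
    using D.extend_partition[OF hausdorff_abelianD(3)[OF hN] N(1) P, of k] k(1) by blast
  have "f (gen g z) = \<phi> g z" if g: "g \<in> topspace \<Gamma>" and z: "z \<in> topspace Z" for g z
  proof -
    let ?U = "{z' \<in> topspace Z. F z' = F z}"
    have U: "?U \<in> P" "z \<in> ?U" using z by (auto simp: P_def)
    have "F (SOME y. y \<in> ?U) = F z" using some[OF U(1)] by simp
    then have "F (SOME y. y \<in> ?U) g = F z g" by simp
    then have "\<phi> g (SOME y. y \<in> ?U) = \<phi> g z" using g by (simp add: F_def)
    then show ?thesis using f(2)[OF unit_closed[OF g] U] k(2)[OF U(1) g] by (simp add: gen_def)
  qed
  then show "\<exists>f\<in>chom D.M N. \<forall>g\<in>topspace \<Gamma>. \<forall>z\<in>topspace Z. f (gen g z) = \<phi> g z" using f(1) by blast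
qed

lemma extensible_tprod:
  assumes N: "\<And>i. i \<in> I \<Longrightarrow> extensible (N i)"
  shows "extensible (tprod I N)"
  unfolding extensible_def
proof (intro conjI allI impI)
  show hN: "hausdorff_abelian (tprod I N)"
    using N by (intro hausdorff_abelian_tprod) (simp add: extensible_def)
  fix \<phi> assume \<phi>: "continuous_map (prod_topology \<Gamma> Z) (topo (tprod I N)) (\<lambda>(g, z). \<phi> g z)"
  have "\<exists>f\<in>chom D.M (N i). \<forall>g\<in>topspace \<Gamma>. \<forall>z\<in>topspace Z. f (gen g z) = \<phi> g z i" if "i \<in> I" for i
  proof -
    have "continuous_map (prod_topology \<Gamma> Z) (topo (N i)) (\<lambda>(g, z). \<phi> g z i)"
      using \<phi> that by (simp add: continuous_map_componentwise case_prod_unfold)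
    then show ?thesis using N[OF that] unfolding extensible_def by blast
  qed
  then obtain f where f: "\<And>i. i \<in> I \<Longrightarrow> f i \<in> chom D.M (N i)"
    "\<And>i g z. i \<in> I \<Longrightarrow> g \<in> topspace \<Gamma> \<Longrightarrow> z \<in> topspace Z \<Longrightarrow> f i (gen g z) = \<phi> g z i"
    by metis
  let ?f = "restrict (\<lambda>m. \<lambda>i\<in>I. f i m) (carrier D.M)"
  have "?f \<in> chom D.M (tprod I N)"
  proof (rule chom_restrictI[OF D.topspace_M D.M.is_group])
    show "(\<lambda>i\<in>I. f i m) \<in> carrier (tprod I N)" if "m \<in> carrier D.M" for m
      using chomD(4)[OF f(1) that] by auto
    show "(\<lambda>i\<in>I. f i (m \<otimes>\<^bsub>D.M\<^esub> n)) = (\<lambda>i\<in>I. f i m) \<otimes>\<^bsub>tprod I N\<^esub> (\<lambda>i\<in>I. f i n)"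
      if "m \<in> carrier D.M" "n \<in> carrier D.M" for m n
      using chomD(5)[OF f(1) that] by (auto simp: restrict_def)
    show "continuous_map (topo D.M) (topo (tprod I N)) (\<lambda>m. \<lambda>i\<in>I. f i m)"
      using chomD(3)[OF f(1)] by (auto simp: continuous_map_componentwise)
  qed
  moreover have "?f (gen g z) = \<phi> g z" if g: "g \<in> topspace \<Gamma>" and z: "z \<in> topspace Z" for g z
  proof -
    have "\<phi> g z \<in> carrier (tprod I N)"
      using continuous_map_image_subset_topspace[OF \<phi>] g z hausdorff_abelianD(5)[OF hN] by fastforce
    then have ext: "\<phi> g z \<in> extensional I" by (simp add: PiE_iff)
    have "?f (gen g z) = (\<lambda>i\<in>I. \<phi> g z i)" using f(2)[OF _ g z] gen_closed[OF g z] by (auto simp: restrict_def)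
    also have "\<dots> = \<phi> g z" using ext by (rule extensional_restrict)
    finally show ?thesis .
  qed
  ultimately show "\<exists>f\<in>chom D.M (tprod I N). \<forall>g\<in>topspace \<Gamma>. \<forall>z\<in>topspace Z. f (gen g z) = \<phi> g z"
    by blast
qed

text \<open>The extension into the ambient group sends generators into the closed subgroup, hence
  everything.\<close>

lemma extensible_tsub:
  assumes N: "extensible N" and H: "subgroup (carrier N \<inter> H) N" "closedin (topo N) (carrier N \<inter> H)"
  shows "extensible (tsub N H)"
  unfolding extensible_def
proof (intro conjI allI impI)
  have hN: "hausdorff_abelian N" using N by (simp add: extensible_def)
  show hT: "hausdorff_abelian (tsub N H)" by (rule hausdorff_abelian_tsub[OF hN H(1)])
  fix \<phi> assume \<phi>: "continuous_map (prod_topology \<Gamma> Z) (topo (tsub N H)) (\<lambda>(g, z). \<phi> g z)"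
  then have "continuous_map (prod_topology \<Gamma> Z) (topo N) (\<lambda>(g, z). \<phi> g z)"
    by (simp add: continuous_map_in_subtopology)
  then obtain f where f: "f \<in> chom D.M N" "\<And>g z. g \<in> topspace \<Gamma> \<Longrightarrow> z \<in> topspace Z \<Longrightarrow> f (gen g z) = \<phi> g z"
    using N unfolding extensible_def by blast
  have fH: "f m \<in> carrier N \<inter> H" if m: "m \<in> carrier D.M" for m
  proof (rule topgen_image_subset[OF topgen_gen D.M.is_group hausdorff_abelianD(2)[OF hN] chomD(1,3)[OF f(1)] D.topspace_M H])
    fix b assume "b \<in> {gen g z | g z. g \<in> topspace \<Gamma> \<and> z \<in> topspace Z}"
    then obtain g z where b: "b = gen g z" "g \<in> topspace \<Gamma>" "z \<in> topspace Z" by blast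
    have "\<phi> g z \<in> topspace (topo (tsub N H))"
      using continuous_map_image_subset_topspace[OF \<phi>] b by fastforce
    then have "\<phi> g z \<in> carrier N \<inter> H" unfolding hausdorff_abelianD(5)[OF hT] by simp
    then show "f b \<in> carrier N \<inter> H" using f(2) b by simp
  qed (rule m)
  have "f \<in> chom D.M (tsub N H)"
    unfolding chom_def
  proof (intro CollectI conjI IntI)
    show "f \<in> hom D.M (tsub N H)" using fH chomD(5)[OF f(1)] by (auto simp: hom_def)
    show "f \<in> extensional (carrier D.M)" by (rule chomD(2)[OF f(1)])
    show "continuous_map (topo D.M) (topo (tsub N H)) f"
      unfolding tsub_sel using chomD(3)[OF f(1)] fH D.topspace_M
      by (intro continuous_map_into_subtopology) auto
  qed
  then show "\<exists>f\<in>chom D.M (tsub N H). \<forall>g\<in>topspace \<Gamma>. \<forall>z\<in>topspace Z. f (gen g z) = \<phi> g z"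
    using f(2) by blast
qed

lemma pi_torsion_mod_group:
  assumes "p \<in> \<pi>"
  shows "pi_torsion \<pi> (discrete_group (integer_mod_group (p ^ k)))"
  unfolding pi_torsion_def
proof (intro exI[of _ "p ^ k"] conjI allI impI ballI)
  have p: "prime p" using \<pi> assms by blast
  then show "p ^ k > 0" by (simp add: prime_gt_0_nat)
  show "q \<in> \<pi>" if "prime q \<and> q dvd p ^ k" for q
    using that p assms by (metis prime_dvd_power primes_dvd_imp_eq)
  fix a assume a: "a \<in> carrier (discrete_group (integer_mod_group (p ^ k)))"
  have "a [^]\<^bsub>discrete_group (integer_mod_group (p ^ k))\<^esub> n = (int n * a) mod int (p ^ k)" for n :: nat
    by (induction n) (auto simp: mod_simps algebra_simps)
  then show "a [^]\<^bsub>discrete_group (integer_mod_group (p ^ k))\<^esub> (p ^ k) = \<one>\<^bsub>discrete_group (integer_mod_group (p ^ k))\<^esub>"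
    by simp
qed

lemma extensible_Zp:
  assumes "p \<in> \<pi>"
  shows "extensible (Zp p)"
  unfolding Zp_alt
proof (rule extensible_tsub)
  let ?N = "\<lambda>k. discrete_group (integer_mod_group (p ^ k))"
  let ?P = "tprod UNIV ?N"
  have p: "p > 0" using \<pi> assms prime_gt_0_nat by blast
  show "extensible ?P"
    by (intro extensible_tprod extensible_discrete pi_torsion_mod_group assms comm_group_discrete_group
        abelian_integer_mod_group) simp
  show "subgroup (carrier ?P \<inter> Zp_coherent p) ?P" by (rule Zp_subgroup[OF p])
  have hP: "hausdorff_abelian ?P" by (intro hausdorff_abelian_tprod hausdorff_abelian_mod_group)
  define E where "E k = {a \<in> topspace (topo ?P). a (Suc k) mod int p ^ k = a k}" for k
  have "closedin (topo ?P) (E k)" for k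
  proof -
    have c: "continuous_map (topo ?P) (discrete_topology (carrier (integer_mod_group (p ^ j)))) (\<lambda>a. a j)" for j
      using continuous_map_product_projection[of j UNIV "\<lambda>k. topo (?N k)"] by simp
    have "continuous_map (discrete_topology (carrier (integer_mod_group (p ^ Suc k))))
        (discrete_topology (carrier (integer_mod_group (p ^ k)))) (\<lambda>x. x mod int p ^ k)"
      using p by (auto simp: carrier_integer_mod_group)
    from continuous_map_compose[OF c this]
    have "continuous_map (topo ?P) (discrete_topology (carrier (integer_mod_group (p ^ k)))) (\<lambda>a. a (Suc k) mod int p ^ k)"
      by (simp add: comp_def)
    from closedin_continuous_maps_eq[OF _ this c] show ?thesis unfolding E_def by simp
  qed
  then have "closedin (topo ?P) (\<Inter>(range E))" by (intro closedin_Inter) auto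
  moreover have "\<Inter>(range E) = carrier ?P \<inter> Zp_coherent p"
    unfolding E_def Zp_coherent_def hausdorff_abelianD(5)[OF hP] by auto
  ultimately show "closedin (topo ?P) (carrier ?P \<inter> Zp_coherent p)" by simp
qed

lemma extensible_Zpi: "extensible (Zpi \<pi>)"
  unfolding Zpi_def by (intro extensible_tprod extensible_Zp)

text \<open>\<open>full\<close> is an iterated product of copies of \<open>R\<close>, and
  \<open>pf_free\<close> is a closed subgroup of it. Applied twice to \<open>Zpi\<close>, this makes
  \<open>std_res\<close> an admissible target for the boundary maps.\<close>

lemma extensible_pf_free:
  assumes R: "extensible R"
  shows "extensible (pf_free R Y)"
proof -
  interpret F: free_module R Y using R by unfold_locales (simp add: extensible_def)
  have "extensible F.full" unfolding F.full_def by (intro extensible_tprod R)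
  then show ?thesis
    unfolding F.M_alt by (intro extensible_tsub F.subgroup_coherent F.closedin_coherent)
qed

end

section \<open>The standard resolution\<close>

lemma topspace_power_top: "topological_group G \<Longrightarrow> topspace (power_top G n) = {..<n} \<rightarrow>\<^sub>E carrier G"
  by (simp add: power_top_def topspace_topological_group)

lemma tuple_mem: "topological_group G \<Longrightarrow> gs \<in> lists (carrier G) \<Longrightarrow> tuple gs \<in> topspace (power_top G (length gs))"
  by (auto simp: topspace_power_top tuple_def in_lists_conv_set)

lemma tuple_map:
  assumes "topological_group G" "z \<in> topspace (power_top G n)"
  shows "tuple (map z [0..<n]) = z" "map z [0..<n] \<in> lists (carrier G)"
  using assms by (auto simp: topspace_power_top tuple_def restrict_def fun_eq_iff PiE_iff extensional_def)

lemma homeomorphic_map_translation: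
  assumes "topological_group G" "g \<in> carrier G"
  shows "homeomorphic_map (topo G) (topo G) (\<lambda>k. g \<otimes>\<^bsub>G\<^esub> k)"
proof -
  interpret group G using assms by (simp add: topological_group_def)
  note ts = topspace_topological_group[OF assms(1)]
  have c: "continuous_map (topo G) (topo G) (\<lambda>k. h \<otimes>\<^bsub>G\<^esub> k)" if "h \<in> carrier G" for h
    using that ts by (intro continuous_map_group_mult assms) auto
  have "homeomorphic_maps (topo G) (topo G) (\<lambda>k. g \<otimes>\<^bsub>G\<^esub> k) (\<lambda>k. inv\<^bsub>G\<^esub> g \<otimes>\<^bsub>G\<^esub> k)"
    unfolding homeomorphic_maps_def using c assms(2) ts by (auto simp flip: m_assoc)
  then show ?thesis by (auto simp: homeomorphic_map_maps)
qed

text \<open>Each \<open>act g\<close> is continuous separately. This is the form established for the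
  profinite modules \<open>std_res\<close>, \<open>Zcosets\<close> and \<open>Delta\<close>, whereas
  \<open>gmodule\<close> is established for the discrete modules of homomorphisms.\<close>

definition continuous_action :: "'g tgroup \<Rightarrow> 'n tgroup \<Rightarrow> ('g \<Rightarrow> 'n \<Rightarrow> 'n) \<Rightarrow> bool" where
  "continuous_action G N act \<longleftrightarrow>
     (\<forall>g\<in>carrier G. act g \<in> hom N N \<and> continuous_map (topo N) (topo N) (act g)) \<and>
     (\<forall>a\<in>carrier N. act \<one>\<^bsub>G\<^esub> a = a) \<and>
     (\<forall>g\<in>carrier G. \<forall>h\<in>carrier G. \<forall>a\<in>carrier N. act (g \<otimes>\<^bsub>G\<^esub> h) a = act g (act h a))"

lemma gmodule_continuous_action:
  assumes "gmodule G N act" "topological_group G"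
  shows "continuous_action G N act"
proof -
  have "continuous_map (topo N) (topo N) (act g)" if g: "g \<in> carrier G" for g
  proof -
    have "continuous_map (topo N) (prod_topology (topo G) (topo N)) (\<lambda>a. (g, a))"
      using g topspace_topological_group[OF assms(2)] by (intro continuous_map_pairedI) auto
    moreover have "continuous_map (prod_topology (topo G) (topo N)) (topo N) (\<lambda>(g, a). act g a)"
      using assms(1) by (simp add: gmodule_def)
    ultimately show ?thesis using continuous_map_compose by (fastforce simp: comp_def)
  qed
  then show ?thesis using assms(1) by (simp add: gmodule_def continuous_action_def)
qed

locale profinite_group_pi =
  fixes G :: "'g tgroup" and \<pi> :: "nat set"
  assumes G: "profinite_group G" and \<pi>: "\<forall>p\<in>\<pi>. prime p"
begin

lemma tg: "topological_group G" using G by (simp add: profinite_group_def)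

sublocale group G using tg by (simp add: topological_group_def)

lemma ts: "topspace (topo G) = carrier G" by (rule topspace_topological_group[OF tg])

lemma compact_G: "compact_space (topo G)"
  using G by (simp add: profinite_group_def profinite_space_def)

lemma compact_power: "compact_space (power_top G n)"
  unfolding power_top_def using compact_G by (simp add: compact_space_product_topology)

lemma double_free: "double_free \<pi> (topo G) (power_top G n)"
  by unfold_locales (rule \<pi> compact_G compact_power)+

abbreviation C where "C n \<equiv> std_res \<pi> G n"
abbreviation pow where "pow n \<equiv> power_top G n"

definition cgen :: "nat \<Rightarrow> 'g \<Rightarrow> (nat \<Rightarrow> 'g) \<Rightarrow> 'g cplx" where
  "cgen n g z = double_free.gen \<pi> (topo G) (pow n) g z"

lemma hausdorff_abelian_C: "hausdorff_abelian (C n)"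
proof -
  interpret double_free \<pi> "topo G" "pow n" by (rule double_free)
  show ?thesis using D.hausdorff_abelian_M by (simp add: std_res_def)
qed

lemma comm_group_C: "comm_group (C n)"
  using hausdorff_abelianD[OF hausdorff_abelian_C] by simp

lemma topspace_C: "topspace (topo (C n)) = carrier (C n)"
  using hausdorff_abelianD[OF hausdorff_abelian_C] by simp

lemma topgen_C: "topgen (C n) {cgen n g z | g z. g \<in> carrier G \<and> z \<in> topspace (pow n)}"
proof -
  interpret double_free \<pi> "topo G" "pow n" by (rule double_free)
  show ?thesis using topgen_gen by (simp add: std_res_def cgen_def ts)
qed

lemma cgen_closed: "g \<in> carrier G \<Longrightarrow> z \<in> topspace (pow n) \<Longrightarrow> cgen n g z \<in> carrier (C n)"
proof -
  interpret double_free \<pi> "topo G" "pow n" by (rule double_free)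
  show "g \<in> carrier G \<Longrightarrow> z \<in> topspace (pow n) \<Longrightarrow> cgen n g z \<in> carrier (C n)"
    using gen_closed by (simp add: std_res_def cgen_def ts)
qed

lemma continuous_map_cgen:
  "continuous_map T (topo G) f \<Longrightarrow> continuous_map T (pow n) h \<Longrightarrow>
    continuous_map T (topo (C n)) (\<lambda>x. cgen n (f x) (h x))"
proof -
  interpret double_free \<pi> "topo G" "pow n" by (rule double_free)
  show "continuous_map T (topo G) f \<Longrightarrow> continuous_map T (pow n) h \<Longrightarrow>
      continuous_map T (topo (C n)) (\<lambda>x. cgen n (f x) (h x))"
    using continuous_map_gen[of T f h] by (simp add: std_res_def cgen_def)
qed

lemma symb_eq: "symb \<pi> G gs = cgen (length gs) \<one>\<^bsub>G\<^esub> (tuple gs)"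
proof -
  interpret double_free \<pi> "topo G" "pow (length gs)" by (rule double_free)
  show ?thesis by (simp add: symb_def cgen_def gen_def unit_def)
qed

lemma symb_closed: "gs \<in> lists (carrier G) \<Longrightarrow> length gs = n \<Longrightarrow> symb \<pi> G gs \<in> carrier (C n)"
  using cgen_closed[OF one_closed tuple_mem[OF tg]] by (auto simp: symb_eq)

lemma std_act:
  assumes g: "g \<in> carrier G"
  shows "\<And>m. m \<in> carrier (C n) \<Longrightarrow> std_act G n g m \<in> carrier (C n)"
    and "std_act G n g \<in> hom (C n) (C n)"
    and "continuous_map (topo (C n)) (topo (C n)) (std_act G n g)"
    and "\<And>h z. h \<in> carrier G \<Longrightarrow> z \<in> topspace (pow n) \<Longrightarrow> std_act G n g (cgen n h z) = cgen n (g \<otimes>\<^bsub>G\<^esub> h) z"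
proof -
  interpret double_free \<pi> "topo G" "pow n" by (rule double_free)
  have hm: "homeomorphic_map (topo G) (topo G) (\<lambda>k. inv\<^bsub>G\<^esub> g \<otimes>\<^bsub>G\<^esub> k)"
    by (rule homeomorphic_map_translation[OF tg inv_closed[OF g]])
  let ?k = "pf_free_act G (topo G) (\<lambda>h k. h \<otimes>\<^bsub>G\<^esub> k) g"
  have k: "?k = (\<lambda>m. \<lambda>P\<in>L.cp. \<lambda>U\<in>P. m ((`) (\<lambda>k. inv\<^bsub>G\<^esub> g \<otimes>\<^bsub>G\<^esub> k) ` P) ((\<lambda>k. inv\<^bsub>G\<^esub> g \<otimes>\<^bsub>G\<^esub> k) ` U))"
    by (simp add: pf_free_act_def[abs_def])
  have kh: "?k \<in> hom L.M L.M" and kc: "continuous_map (topo L.M) (topo L.M) ?k"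
    using L.relabel(2,3)[OF hm] unfolding k by blast+
  have ku: "?k (unit h) = unit (g \<otimes>\<^bsub>G\<^esub> h)" if h: "h \<in> carrier G" for h
  proof -
    have "?k (dirac (Zpi \<pi>) (topo G) (Zpi_unit \<pi>) (inv\<^bsub>G\<^esub> g \<otimes>\<^bsub>G\<^esub> (g \<otimes>\<^bsub>G\<^esub> h))) = dirac (Zpi \<pi>) (topo G) (Zpi_unit \<pi>) (g \<otimes>\<^bsub>G\<^esub> h)"
      unfolding k by (rule L.relabel(4)[OF hm Zpi_unit_closed[OF \<pi>]]) (use g h ts in auto)
    then show ?thesis using g h by (simp add: unit_def flip: m_assoc)
  qed
  have eq: "std_act G n g = (\<lambda>m. \<lambda>P\<in>D.cp. \<lambda>U\<in>P. ?k (m P U))" by (simp add: std_act_def[abs_def])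
  show "\<And>m. m \<in> carrier (C n) \<Longrightarrow> std_act G n g m \<in> carrier (C n)"
    "std_act G n g \<in> hom (C n) (C n)"
    "continuous_map (topo (C n)) (topo (C n)) (std_act G n g)"
    unfolding eq std_res_def using D.map_coeff(1-3)[OF kh kc] by blast+
  show "std_act G n g (cgen n h z) = cgen n (g \<otimes>\<^bsub>G\<^esub> h) z" if h: "h \<in> carrier G" and z: "z \<in> topspace (pow n)" for h z
    unfolding eq cgen_def gen_def using D.map_coeff(4)[OF kh kc unit_closed z, of h] h ts by (simp add: ku)
qed

lemma std_act_symb:
  assumes "g \<in> carrier G" "z \<in> topspace (pow n)"
  shows "cgen n g z = std_act G n g (symb \<pi> G (map z [0..<n]))"
  using std_act(4)[OF assms(1) one_closed assms(2)] assms tuple_map[OF tg assms(2)] by (simp add: symb_eq)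

lemma homGD:
  assumes "f \<in> homG G (C n) (std_act G n) N act"
  shows "f \<in> chom (C n) N" "g \<in> carrier G \<Longrightarrow> m \<in> carrier (C n) \<Longrightarrow> f (std_act G n g m) = act g (f m)"
  using assms by (auto simp: homG_def)

text \<open>The topological generators \<open>cgen n g z\<close> are the translates of the symbols,
  so equivariance reduces a comparison to the symbols.\<close>

lemma homG_eqI:
  assumes N: "hausdorff_abelian N"
    and f: "f \<in> homG G (C n) (std_act G n) N act" and h: "h \<in> homG G (C n) (std_act G n) N act"
    and eq: "\<And>gs. gs \<in> lists (carrier G) \<Longrightarrow> length gs = n \<Longrightarrow> f (symb \<pi> G gs) = h (symb \<pi> G gs)"
  shows "f = h"
proof (rule chom_eqI[OF topgen_C hausdorff_abelian_C N homGD(1)[OF f] homGD(1)[OF h]])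
  fix b assume "b \<in> {cgen n g z | g z. g \<in> carrier G \<and> z \<in> topspace (pow n)}"
  then obtain g z where b: "b = cgen n g z" "g \<in> carrier G" "z \<in> topspace (pow n)" by blast
  let ?gs = "map z [0..<n]"
  have gs: "?gs \<in> lists (carrier G)" "length ?gs = n" using tuple_map(2)[OF tg b(3)] by auto
  have "b = std_act G n g (symb \<pi> G ?gs)" using std_act_symb[OF b(2,3)] b(1) by simp
  then show "f b = h b"
    using homGD(2)[OF f b(2) symb_closed[OF gs]] homGD(2)[OF h b(2) symb_closed[OF gs]] eq[OF gs] by simp
qed

text \<open>Equivariance forces the value \<open>act g (u z)\<close> at the generator
  \<open>cgen n g z\<close>; that the resulting homomorphism is equivariant is then checked on the
  same generators. Joint continuity in \<open>(g, z)\<close> is a separate assumption, because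
  \<open>continuous_action\<close> only controls one \<open>g\<close> at a time.\<close>

lemma homG_exists:
  assumes N: "double_free.extensible \<pi> (topo G) (pow n) N" and act: "continuous_action G N act"
    and u: "\<And>z. z \<in> topspace (pow n) \<Longrightarrow> u z \<in> carrier N"
    and cont: "continuous_map (prod_topology (topo G) (pow n)) (topo N) (\<lambda>(g, z). act g (u z))"
  obtains f where "f \<in> homG G (C n) (std_act G n) N act"
    "\<And>gs. gs \<in> lists (carrier G) \<Longrightarrow> length gs = n \<Longrightarrow> f (symb \<pi> G gs) = u (tuple gs)"
proof -
  interpret double_free \<pi> "topo G" "pow n" by (rule double_free)
  have hN: "hausdorff_abelian N" using N by (simp add: extensible_def)
  obtain f where f: "f \<in> chom (C n) N"
    "\<And>g z. g \<in> carrier G \<Longrightarrow> z \<in> topspace (pow n) \<Longrightarrow> f (cgen n g z) = act g (u z)"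
    using N cont unfolding extensible_def std_res_def cgen_def ts by blast
  have acth: "act g \<in> hom N N" "continuous_map (topo N) (topo N) (act g)" if "g \<in> carrier G" for g
    using act that by (auto simp: continuous_action_def)
  have eq: "f (std_act G n g m) = act g (f m)" if g: "g \<in> carrier G" and m: "m \<in> carrier (C n)" for g m
  proof (rule hom_eq_on_topgen[OF topgen_C hausdorff_abelian_C hN _ _ _ _ _ m])
    show "(\<lambda>m. f (std_act G n g m)) \<in> hom (C n) N"
      using Group.hom_compose[OF std_act(2)[OF g] chomD(1)[OF f(1)]] by (simp add: comp_def)
    show "continuous_map (topo (C n)) (topo N) (\<lambda>m. f (std_act G n g m))"
      using continuous_map_compose[OF std_act(3)[OF g] chomD(3)[OF f(1)]] by (simp add: comp_def)
    show "(\<lambda>m. act g (f m)) \<in> hom (C n) N"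
      using Group.hom_compose[OF chomD(1)[OF f(1)] acth(1)[OF g]] by (simp add: comp_def)
    show "continuous_map (topo (C n)) (topo N) (\<lambda>m. act g (f m))"
      using continuous_map_compose[OF chomD(3)[OF f(1)] acth(2)[OF g]] by (simp add: comp_def)
    fix b assume "b \<in> {cgen n g z | g z. g \<in> carrier G \<and> z \<in> topspace (pow n)}"
    then obtain h z where b: "b = cgen n h z" "h \<in> carrier G" "z \<in> topspace (pow n)" by blast
    then have "f (std_act G n g b) = act (g \<otimes>\<^bsub>G\<^esub> h) (u z)" using std_act(4)[OF g b(2,3)] f(2) g by simp
    also have "\<dots> = act g (act h (u z))" using act g b(2) u[OF b(3)] by (simp add: continuous_action_def)
    also have "\<dots> = act g (f b)" using f(2)[OF b(2,3)] b(1) by simp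
    finally show "f (std_act G n g b) = act g (f b)" .
  qed
  have "f (symb \<pi> G gs) = u (tuple gs)" if gs: "gs \<in> lists (carrier G)" "length gs = n" for gs
  proof -
    have t: "tuple gs \<in> topspace (pow n)" using tuple_mem[OF tg gs(1)] gs(2) by simp
    show ?thesis using f(2)[OF one_closed t] act u[OF t] gs(2) by (simp add: symb_eq continuous_action_def)
  qed
  moreover have "f \<in> homG G (C n) (std_act G n) N act" using f(1) eq by (simp add: homG_def)
  ultimately show ?thesis using that by blast
qed

text \<open>The inhomogeneous description of cochains: over a discrete torsion module any continuous
  function of \<open>n\<close> group elements occurs. All cochains below are produced in this
  way.\<close>

lemma cochain_exists:
  assumes N: "gmodule G N act" "topo N = discrete_topology (carrier N)" and tor: "pi_torsion \<pi> N"
    and u: "continuous_map (pow n) (topo N) u"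
  obtains f where "f \<in> homG G (C n) (std_act G n) N act"
    "\<And>gs. gs \<in> lists (carrier G) \<Longrightarrow> length gs = n \<Longrightarrow> f (symb \<pi> G gs) = u (tuple gs)"
proof (rule homG_exists)
  interpret double_free \<pi> "topo G" "pow n" by (rule double_free)
  show "extensible N" using N tor by (intro extensible_discrete) (auto simp: gmodule_def)
  show "continuous_action G N act" by (rule gmodule_continuous_action[OF N(1) tg])
  show "u z \<in> carrier N" if "z \<in> topspace (pow n)" for z
    using continuous_map_image_subset_topspace[OF u] that N(2) by auto
  have "continuous_map (prod_topology (topo G) (pow n)) (prod_topology (topo G) (topo N)) (\<lambda>x. (fst x, u (snd x)))"
    by (intro continuous_map_pairedI continuous_map_fst continuous_map_compose[OF continuous_map_snd u, unfolded comp_def])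
  moreover have "continuous_map (prod_topology (topo G) (topo N)) (topo N) (\<lambda>(g, a). act g a)"
    using N(1) by (simp add: gmodule_def)
  ultimately have "continuous_map (prod_topology (topo G) (pow n)) (topo N) ((\<lambda>(g, a). act g a) \<circ> (\<lambda>x. (fst x, u (snd x))))"
    by (rule continuous_map_compose)
  then show "continuous_map (prod_topology (topo G) (pow n)) (topo N) (\<lambda>(g, z). act g (u z))"
    by (simp add: comp_def case_prod_unfold)
qed (use that in blast)

lemma extensible_C: "double_free.extensible \<pi> (topo G) (pow n) (C k)"
proof -
  interpret double_free \<pi> "topo G" "pow n" by (rule double_free)
  show ?thesis unfolding std_res_def by (intro extensible_pf_free extensible_Zpi)
qed

lemma continuous_action_C: "continuous_action G (C n) (std_act G n)"
  unfolding continuous_action_def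
proof (intro conjI ballI)
  fix g assume g: "g \<in> carrier G"
  show "std_act G n g \<in> hom (C n) (C n)" "continuous_map (topo (C n)) (topo (C n)) (std_act G n g)"
    by (rule std_act[OF g])+
next
  have id: "(\<lambda>x. x) \<in> hom (C n) (C n)" by (simp add: hom_def)
  fix m assume m: "m \<in> carrier (C n)"
  show "std_act G n \<one>\<^bsub>G\<^esub> m = m"
    by (rule hom_eq_on_topgen[OF topgen_C hausdorff_abelian_C hausdorff_abelian_C
          std_act(2,3)[OF one_closed] id _ _ m]) (auto simp: std_act)
  fix g h assume g: "g \<in> carrier G" and h: "h \<in> carrier G"
  show "std_act G n (g \<otimes>\<^bsub>G\<^esub> h) m = std_act G n g (std_act G n h m)"
  proof (rule hom_eq_on_topgen[OF topgen_C hausdorff_abelian_C hausdorff_abelian_C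
          std_act(2,3)[OF m_closed[OF g h]] _ _ _ m])
    show "(\<lambda>m. std_act G n g (std_act G n h m)) \<in> hom (C n) (C n)"
      using Group.hom_compose[OF std_act(2)[OF h] std_act(2)[OF g]] by (simp add: comp_def)
    show "continuous_map (topo (C n)) (topo (C n)) (\<lambda>m. std_act G n g (std_act G n h m))"
      using continuous_map_compose[OF std_act(3)[OF h] std_act(3)[OF g]] by (simp add: comp_def)
  qed (auto simp: std_act g h m_assoc)
qed

section \<open>The boundary maps\<close>

definition merge_tuple :: "nat \<Rightarrow> nat \<Rightarrow> (nat \<Rightarrow> 'g) \<Rightarrow> nat \<Rightarrow> 'g" where
  "merge_tuple n i z = (\<lambda>j\<in>{..<n}. if j < i then z j else if j = i then z i \<otimes>\<^bsub>G\<^esub> z (Suc i) else z (Suc j))"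

text \<open>The boundary formula with a general coefficient \<open>g\<close> in front of every term.
  Keeping \<open>g\<close> makes joint continuity in \<open>(g, z)\<close> visible, which
  \<open>homG_exists\<close> demands; \<open>std_act_bdry\<close> identifies it with the translate
  of the value at the unit.\<close>

definition bdry :: "nat \<Rightarrow> 'g \<Rightarrow> (nat \<Rightarrow> 'g) \<Rightarrow> 'g cplx" where
  "bdry n g z = cgen n (g \<otimes>\<^bsub>G\<^esub> z 0) (\<lambda>j\<in>{..<n}. z (Suc j))
     \<otimes>\<^bsub>C n\<^esub> (\<Otimes>\<^bsub>C n\<^esub>i\<in>{..<n}. cgen n g (merge_tuple n i z) [^]\<^bsub>C n\<^esub> ((- 1) ^ Suc i :: int))
     \<otimes>\<^bsub>C n\<^esub> cgen n g (\<lambda>j\<in>{..<n}. z j) [^]\<^bsub>C n\<^esub> ((- 1) ^ Suc n :: int)"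

lemma faces_closed:
  assumes "z \<in> topspace (pow (Suc n))"
  shows "z 0 \<in> carrier G" "(\<lambda>j\<in>{..<n}. z (Suc j)) \<in> topspace (pow n)" "(\<lambda>j\<in>{..<n}. z j) \<in> topspace (pow n)"
    "i < n \<Longrightarrow> merge_tuple n i z \<in> topspace (pow n)"
  using assms by (auto simp: topspace_power_top[OF tg] merge_tuple_def PiE_iff)

lemma continuous_map_entry:
  "j < n \<Longrightarrow> continuous_map (pow n) (topo G) (\<lambda>z. z j)"
  using continuous_map_product_projection[of j "{..<n}" "\<lambda>_. topo G"] by (simp add: power_top_def)

lemma continuous_map_into_pow:
  assumes "\<And>j. j < n \<Longrightarrow> continuous_map T (topo G) (\<lambda>x. f x j)" "\<And>x. f x \<in> extensional {..<n}"
  shows "continuous_map T (pow n) f"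
  unfolding power_top_def continuous_map_componentwise using assms by auto

lemma continuous_map_bdry:
  "continuous_map (prod_topology (topo G) (pow (Suc n))) (topo (C n)) (\<lambda>(g, z). bdry n g z)"
proof -
  let ?T = "prod_topology (topo G) (pow (Suc n))"
  note tgC = hausdorff_abelianD(3)[OF hausdorff_abelian_C]
  have e: "continuous_map ?T (topo G) (\<lambda>x. snd x j)" if "j < Suc n" for j
    using continuous_map_compose[OF continuous_map_snd continuous_map_entry[OF that]] by (simp add: comp_def)
  have f: "continuous_map ?T (topo G) fst" by (rule continuous_map_fst)
  have 1: "continuous_map ?T (pow n) (\<lambda>x. \<lambda>j\<in>{..<n}. snd x (Suc j))"
    "continuous_map ?T (pow n) (\<lambda>x. \<lambda>j\<in>{..<n}. snd x j)"
    by (intro continuous_map_into_pow; simp add: e)+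
  have 2: "continuous_map ?T (pow n) (\<lambda>x. merge_tuple n i (snd x))" if "i < n" for i
  proof (rule continuous_map_into_pow)
    fix j assume j: "j < n"
    show "continuous_map ?T (topo G) (\<lambda>x. merge_tuple n i (snd x) j)"
      using j that e continuous_map_group_mult[OF tg e e, of i "Suc i"]
      by (cases "j < i"; cases "j = i") (simp_all add: merge_tuple_def)
  qed (simp add: merge_tuple_def)
  have "continuous_map ?T (topo (C n)) (\<lambda>x. bdry n (fst x) (snd x))"
    unfolding bdry_def
    by (intro continuous_map_group_mult continuous_map_finprod continuous_map_group_int_pow tgC
        comm_group_C continuous_map_cgen tg f e 1 2) auto
  then show ?thesis by (simp add: case_prod_unfold)
qed

lemma std_act_bdry:
  assumes g: "g \<in> carrier G" and z: "z \<in> topspace (pow (Suc n))"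
  shows "std_act G n g (bdry n \<one>\<^bsub>G\<^esub> z) = bdry n g z" "bdry n \<one>\<^bsub>G\<^esub> z \<in> carrier (C n)"
proof -
  interpret Cn: comm_group "C n" by (rule comm_group_C)
  interpret h: group_hom "C n" "C n" "std_act G n g"
    using std_act(2)[OF g] Cn.is_group by (simp add: group_hom_def group_hom_axioms_def)
  note fc = faces_closed[OF z]
  have hfin: "std_act G n g (\<Otimes>\<^bsub>C n\<^esub>i\<in>I. c i) = (\<Otimes>\<^bsub>C n\<^esub>i\<in>I. std_act G n g (c i))"
    if "finite I" "\<And>i. i \<in> I \<Longrightarrow> c i \<in> carrier (C n)" for I and c :: "nat \<Rightarrow> _"
    using that by (induction I) (auto simp: Pi_def)
  have cl: "cgen n k (merge_tuple n i z) [^]\<^bsub>C n\<^esub> (e::int) \<in> carrier (C n)" if "i < n" "k \<in> carrier G" for k i e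
    using cgen_closed[OF that(2) fc(4)[OF that(1)]] by simp
  have fincl: "(\<Otimes>\<^bsub>C n\<^esub>i\<in>{..<n}. cgen n k (merge_tuple n i z) [^]\<^bsub>C n\<^esub> ((- 1) ^ Suc i :: int)) \<in> carrier (C n)"
    if "k \<in> carrier G" for k
    using cl that by (intro Cn.finprod_closed) auto
  show "bdry n \<one>\<^bsub>G\<^esub> z \<in> carrier (C n)"
    unfolding bdry_def using fc cgen_closed fincl by simp
  have "std_act G n g (\<Otimes>\<^bsub>C n\<^esub>i\<in>{..<n}. cgen n \<one>\<^bsub>G\<^esub> (merge_tuple n i z) [^]\<^bsub>C n\<^esub> ((- 1) ^ Suc i :: int))
      = (\<Otimes>\<^bsub>C n\<^esub>i\<in>{..<n}. std_act G n g (cgen n \<one>\<^bsub>G\<^esub> (merge_tuple n i z) [^]\<^bsub>C n\<^esub> ((- 1) ^ Suc i :: int)))"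
    using cl by (intro hfin) auto
  also have "\<dots> = (\<Otimes>\<^bsub>C n\<^esub>i\<in>{..<n}. cgen n g (merge_tuple n i z) [^]\<^bsub>C n\<^esub> ((- 1) ^ Suc i :: int))"
  proof (rule Cn.finprod_cong')
    fix i assume i: "i \<in> {..<n}"
    then show "std_act G n g (cgen n \<one>\<^bsub>G\<^esub> (merge_tuple n i z) [^]\<^bsub>C n\<^esub> ((- 1) ^ Suc i :: int))
        = cgen n g (merge_tuple n i z) [^]\<^bsub>C n\<^esub> ((- 1) ^ Suc i :: int)"
      using h.hom_int_pow[OF cgen_closed[OF one_closed fc(4)]] std_act(4)[OF g one_closed fc(4)] g by simp
  qed (use cl g in auto)
  finally have fin: "std_act G n g (\<Otimes>\<^bsub>C n\<^esub>i\<in>{..<n}. cgen n \<one>\<^bsub>G\<^esub> (merge_tuple n i z) [^]\<^bsub>C n\<^esub> ((- 1) ^ Suc i :: int))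
      = (\<Otimes>\<^bsub>C n\<^esub>i\<in>{..<n}. cgen n g (merge_tuple n i z) [^]\<^bsub>C n\<^esub> ((- 1) ^ Suc i :: int))" .
  have last: "std_act G n g (cgen n \<one>\<^bsub>G\<^esub> (\<lambda>j\<in>{..<n}. z j) [^]\<^bsub>C n\<^esub> ((- 1) ^ Suc n :: int))
      = cgen n g (\<lambda>j\<in>{..<n}. z j) [^]\<^bsub>C n\<^esub> ((- 1) ^ Suc n :: int)"
    using h.hom_int_pow[OF cgen_closed[OF one_closed fc(3)]] std_act(4)[OF g one_closed fc(3)] g by simp
  have first: "std_act G n g (cgen n (\<one>\<^bsub>G\<^esub> \<otimes>\<^bsub>G\<^esub> z 0) (\<lambda>j\<in>{..<n}. z (Suc j))) = cgen n (g \<otimes>\<^bsub>G\<^esub> z 0) (\<lambda>j\<in>{..<n}. z (Suc j))"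
    using std_act(4)[OF g fc(1,2)] fc(1) by simp
  have c1: "cgen n (\<one>\<^bsub>G\<^esub> \<otimes>\<^bsub>G\<^esub> z 0) (\<lambda>j\<in>{..<n}. z (Suc j)) \<in> carrier (C n)"
    using cgen_closed fc by simp
  have c3: "cgen n \<one>\<^bsub>G\<^esub> (\<lambda>j\<in>{..<n}. z j) [^]\<^bsub>C n\<^esub> ((- 1) ^ Suc n :: int) \<in> carrier (C n)"
    using cgen_closed[OF one_closed fc(3)] by simp
  show "std_act G n g (bdry n \<one>\<^bsub>G\<^esub> z) = bdry n g z"
    unfolding bdry_def h.hom_mult[OF Cn.m_closed[OF c1 fincl[OF one_closed]] c3]
      h.hom_mult[OF c1 fincl[OF one_closed]] fin last first ..
qed

lemma bdry_tuple:
  assumes gs: "gs \<in> lists (carrier G)" "length gs = Suc n"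
  shows "bdry n \<one>\<^bsub>G\<^esub> (tuple gs) =
     std_act G n (hd gs) (symb \<pi> G (tl gs))
         \<otimes>\<^bsub>C n\<^esub> (\<Otimes>\<^bsub>C n\<^esub>i\<in>{..<n}. symb \<pi> G (merge G i gs) [^]\<^bsub>C n\<^esub> ((- 1) ^ Suc i :: int))
         \<otimes>\<^bsub>C n\<^esub> symb \<pi> G (butlast gs) [^]\<^bsub>C n\<^esub> ((- 1) ^ Suc n :: int)"
proof -
  interpret Cn: comm_group "C n" by (rule comm_group_C)
  obtain g hs where gh: "gs = g # hs" "g \<in> carrier G" "hs \<in> lists (carrier G)" "length hs = n"
    using gs by (cases gs) auto
  have z: "tuple gs \<in> topspace (pow (Suc n))" using tuple_mem[OF tg gs(1)] gs(2) by simp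
  note fc = faces_closed[OF z]
  have t1: "(\<lambda>j\<in>{..<n}. tuple gs (Suc j)) = tuple (tl gs)" "tuple gs 0 = hd gs"
    using gh by (auto simp: tuple_def fun_eq_iff)
  have t3: "(\<lambda>j\<in>{..<n}. tuple gs j) = tuple (butlast gs)"
    using gs(2) by (auto simp: tuple_def fun_eq_iff nth_butlast)
  have t2: "merge_tuple n i (tuple gs) = tuple (merge G i gs)" "length (merge G i gs) = n" if "i < n" for i
  proof -
    show len: "length (merge G i gs) = n" using that gs(2) by (simp add: merge_def)
    have "merge G i gs ! j = (if j < i then gs ! j else if j = i then gs ! i \<otimes>\<^bsub>G\<^esub> gs ! Suc i else gs ! Suc j)" if "j < n" for j
      using that \<open>i < n\<close> gs(2) by (auto simp: merge_def nth_append nth_Cons' min_def)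
    then show "merge_tuple n i (tuple gs) = tuple (merge G i gs)"
      using that gs(2) len by (auto simp: merge_tuple_def tuple_def fun_eq_iff)
  qed
  have 1: "std_act G n (hd gs) (symb \<pi> G (tl gs)) = cgen n (\<one>\<^bsub>G\<^esub> \<otimes>\<^bsub>G\<^esub> tuple gs 0) (\<lambda>j\<in>{..<n}. tuple gs (Suc j))"
    using std_act(4)[OF gh(2) one_closed fc(2)] gh t1 by (simp add: symb_eq)
  have 2: "(\<Otimes>\<^bsub>C n\<^esub>i\<in>{..<n}. symb \<pi> G (merge G i gs) [^]\<^bsub>C n\<^esub> ((- 1) ^ Suc i :: int))
      = (\<Otimes>\<^bsub>C n\<^esub>i\<in>{..<n}. cgen n \<one>\<^bsub>G\<^esub> (merge_tuple n i (tuple gs)) [^]\<^bsub>C n\<^esub> ((- 1) ^ Suc i :: int))"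
    using t2 cgen_closed[OF one_closed fc(4)] by (intro Cn.finprod_cong') (auto simp: symb_eq)
  have 3: "symb \<pi> G (butlast gs) = cgen n \<one>\<^bsub>G\<^esub> (\<lambda>j\<in>{..<n}. tuple gs j)"
    using t3 gs(2) by (simp add: symb_eq)
  show ?thesis unfolding bdry_def 1 2 3 ..
qed

text \<open>Justifies the definite description: existence by extending \<open>bdry\<close>,
  uniqueness because equivariant maps are determined on symbols.\<close>

lemma boundary:
  shows "boundary \<pi> G n \<in> homG G (C (Suc n)) (std_act G (Suc n)) (C n) (std_act G n)" (is ?in)
    and "gs \<in> lists (carrier G) \<Longrightarrow> length gs = Suc n \<Longrightarrow> boundary \<pi> G n (symb \<pi> G gs) =
      std_act G n (hd gs) (symb \<pi> G (tl gs))
         \<otimes>\<^bsub>C n\<^esub> (\<Otimes>\<^bsub>C n\<^esub>i\<in>{..<n}. symb \<pi> G (merge G i gs) [^]\<^bsub>C n\<^esub> ((- 1) ^ Suc i :: int))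
         \<otimes>\<^bsub>C n\<^esub> symb \<pi> G (butlast gs) [^]\<^bsub>C n\<^esub> ((- 1) ^ Suc n :: int)"
proof -
  let ?r = "\<lambda>gs. std_act G n (hd gs) (symb \<pi> G (tl gs))
         \<otimes>\<^bsub>C n\<^esub> (\<Otimes>\<^bsub>C n\<^esub>i\<in>{..<n}. symb \<pi> G (merge G i gs) [^]\<^bsub>C n\<^esub> ((- 1) ^ Suc i :: int))
         \<otimes>\<^bsub>C n\<^esub> symb \<pi> G (butlast gs) [^]\<^bsub>C n\<^esub> ((- 1) ^ Suc n :: int)"
  let ?P = "\<lambda>f. f \<in> homG G (C (Suc n)) (std_act G (Suc n)) (C n) (std_act G n) \<and>
     (\<forall>gs\<in>lists (carrier G). length gs = Suc n \<longrightarrow> f (symb \<pi> G gs) = ?r gs)"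
  have cont: "continuous_map (prod_topology (topo G) (pow (Suc n))) (topo (C n)) (\<lambda>(g, z). std_act G n g (bdry n \<one>\<^bsub>G\<^esub> z))"
    by (rule continuous_map_eq[OF continuous_map_bdry]) (auto simp: std_act_bdry ts)
  obtain f where f: "f \<in> homG G (C (Suc n)) (std_act G (Suc n)) (C n) (std_act G n)"
    "\<And>gs. gs \<in> lists (carrier G) \<Longrightarrow> length gs = Suc n \<Longrightarrow> f (symb \<pi> G gs) = bdry n \<one>\<^bsub>G\<^esub> (tuple gs)"
    using homG_exists[OF extensible_C continuous_action_C std_act_bdry(2)[OF one_closed] cont] by blast
  have "\<exists>!f. ?P f"
  proof (rule ex1I[of _ f])
    show "?P f" using f bdry_tuple by simp
    fix h assume h: "?P h"
    show "h = f"
    proof (rule homG_eqI[OF hausdorff_abelian_C _ f(1)])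
      fix gs assume gs: "gs \<in> lists (carrier G)" "length gs = Suc n"
      have "h (symb \<pi> G gs) = ?r gs" using h gs by blast
      then show "h (symb \<pi> G gs) = f (symb \<pi> G gs)" using f(2)[OF gs] bdry_tuple[OF gs] by (simp only:)
    qed (use h in blast)
  qed
  from theI'[OF this] have P: "?P (boundary \<pi> G n)" unfolding boundary_def .
  then show ?in by blast
  show "gs \<in> lists (carrier G) \<Longrightarrow> length gs = Suc n \<Longrightarrow> boundary \<pi> G n (symb \<pi> G gs) = ?r gs"
    using P by blast
qed

lemma cobdry_homG:
  assumes "f \<in> homG G (C n) (std_act G n) N act"
  shows "cobdry \<pi> G n f \<in> homG G (C (Suc n)) (std_act G (Suc n)) N act"
proof -
  note b = homGD[OF boundary(1)[of n]] and f = homGD[OF assms]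
  have "cobdry \<pi> G n f \<in> chom (C (Suc n)) N"
    unfolding cobdry_def by (rule chom_compose[OF _ topspace_C b(1) f(1)]) (rule comm_group_C[unfolded comm_group_def, THEN conjunct2])
  moreover have "cobdry \<pi> G n f (std_act G (Suc n) g m) = act g (cobdry \<pi> G n f m)"
    if g: "g \<in> carrier G" and m: "m \<in> carrier (C (Suc n))" for g m
    using f(2)[OF g chomD(4)[OF b(1) m]] b(2)[OF g m] std_act(1)[OF g m] m by (simp add: cobdry_def compose_def)
  ultimately show ?thesis by (simp add: homG_def)
qed

lemma cobdry_0_symb:
  assumes N: "hausdorff_abelian N" and f: "f \<in> homG G (C 0) (std_act G 0) N act" and g: "g \<in> carrier G"
  shows "cobdry \<pi> G 0 f (symb \<pi> G [g]) = act g (f (symb \<pi> G [])) \<otimes>\<^bsub>N\<^esub> inv\<^bsub>N\<^esub> f (symb \<pi> G [])"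
proof -
  interpret C0: comm_group "C 0" by (rule comm_group_C)
  interpret h: group_hom "C 0" N f
    using homGD(1)[OF f] C0.is_group hausdorff_abelianD[OF N] by (intro chom_group_hom)
  have e: "symb \<pi> G [] \<in> carrier (C 0)" by (rule symb_closed) auto
  have "boundary \<pi> G 0 (symb \<pi> G [g]) = std_act G 0 g (symb \<pi> G []) \<otimes>\<^bsub>C 0\<^esub> inv\<^bsub>C 0\<^esub> symb \<pi> G []"
    using boundary(2)[of "[g]" 0] g e std_act(1)[OF g e] by (simp add: C0.int_pow_neg)
  then show ?thesis
    using symb_closed[of "[g]" 1] g homGD(2)[OF f g e] e std_act(1)[OF g e] by (simp add: cobdry_def compose_def)
qed

lemma cobdry_Suc_0_symb:
  assumes N: "hausdorff_abelian N" and f: "f \<in> homG G (C (Suc 0)) (std_act G (Suc 0)) N act"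
    and g: "g \<in> carrier G" and h: "h \<in> carrier G"
  shows "cobdry \<pi> G (Suc 0) f (symb \<pi> G [g, h]) =
    act g (f (symb \<pi> G [h])) \<otimes>\<^bsub>N\<^esub> inv\<^bsub>N\<^esub> f (symb \<pi> G [g \<otimes>\<^bsub>G\<^esub> h]) \<otimes>\<^bsub>N\<^esub> f (symb \<pi> G [g])"
proof -
  interpret C1: comm_group "C (Suc 0)" by (rule comm_group_C)
  interpret h: group_hom "C (Suc 0)" N f
    using homGD(1)[OF f] C1.is_group hausdorff_abelianD[OF N] by (intro chom_group_hom)
  have e: "symb \<pi> G [k] \<in> carrier (C (Suc 0))" if "k \<in> carrier G" for k by (rule symb_closed) (use that in auto)
  have fin: "(\<Otimes>\<^bsub>C (Suc 0)\<^esub>i\<in>{..<Suc 0}. symb \<pi> G (merge G i [g, h]) [^]\<^bsub>C (Suc 0)\<^esub> ((- 1) ^ Suc i :: int))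
      = inv\<^bsub>C (Suc 0)\<^esub> symb \<pi> G [g \<otimes>\<^bsub>G\<^esub> h]"
    using e[OF m_closed[OF g h]] by (simp add: lessThan_Suc merge_def C1.int_pow_neg)
  have "boundary \<pi> G (Suc 0) (symb \<pi> G [g, h]) = std_act G (Suc 0) g (symb \<pi> G [h]) \<otimes>\<^bsub>C (Suc 0)\<^esub> inv\<^bsub>C (Suc 0)\<^esub> symb \<pi> G [g \<otimes>\<^bsub>G\<^esub> h]
      \<otimes>\<^bsub>C (Suc 0)\<^esub> symb \<pi> G [g]"
    using boundary(2)[of "[g, h]" "Suc 0"] g h e[OF g] unfolding fin by simp
  then show ?thesis
    using symb_closed[of "[g, h]" 2] g h homGD(2)[OF f g e[OF h]] e std_act(1)[OF g e[OF h]]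
    by (simp add: cobdry_def compose_def numeral_2_eq_2)
qed

lemmas cobdry_1_symb = cobdry_Suc_0_symb[folded One_nat_def]

end

section \<open>Modules of homomorphisms\<close>

lemma hom_module_sel [simp]:
  "carrier (hom_module M A) = chom M A"
  "f \<otimes>\<^bsub>hom_module M A\<^esub> h = (\<lambda>m\<in>carrier M. f m \<otimes>\<^bsub>A\<^esub> h m)"
  "\<one>\<^bsub>hom_module M A\<^esub> = (\<lambda>m\<in>carrier M. \<one>\<^bsub>A\<^esub>)"
  "topo (hom_module M A) = discrete_topology (chom M A)"
  by (simp_all add: hom_module_def)

locale hom_group =
  fixes M :: "'m tgroup" and A :: "'a tgroup"
  assumes M: "hausdorff_abelian M" and A: "hausdorff_abelian A"
begin

sublocale M: comm_group M using hausdorff_abelianD[OF M] by simp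
sublocale A: comm_group A using hausdorff_abelianD[OF A] by simp

abbreviation H where "H \<equiv> hom_module M A"

lemma val [simp]: "f \<in> chom M A \<Longrightarrow> m \<in> carrier M \<Longrightarrow> f m \<in> carrier A"
  by (rule chomD(4))

lemma mult_closed:
  assumes "f \<in> chom M A" "h \<in> chom M A"
  shows "(\<lambda>m\<in>carrier M. f m \<otimes>\<^bsub>A\<^esub> h m) \<in> chom M A"
  using hausdorff_abelianD[OF M] hausdorff_abelianD(3)[OF A] chomD[OF assms(1)] chomD[OF assms(2)]
  by (intro chom_restrictI continuous_map_group_mult) (simp_all add: A.m_ac)

lemma one_closed: "(\<lambda>m\<in>carrier M. \<one>\<^bsub>A\<^esub>) \<in> chom M A"
  using hausdorff_abelianD[OF M] hausdorff_abelianD(5)[OF A] by (intro chom_restrictI) simp_all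

lemma inv_closed:
  assumes "f \<in> chom M A"
  shows "(\<lambda>m\<in>carrier M. inv\<^bsub>A\<^esub> f m) \<in> chom M A"
  using hausdorff_abelianD[OF M] hausdorff_abelianD(3)[OF A] chomD[OF assms]
  by (intro chom_restrictI continuous_map_group_inv) (simp_all add: A.inv_mult)

lemma ext: "f \<in> chom M A \<Longrightarrow> h \<in> chom M A \<Longrightarrow> (\<And>m. m \<in> carrier M \<Longrightarrow> f m = h m) \<Longrightarrow> f = h"
  by (rule extensionalityI[OF chomD(2) chomD(2)])

lemma comm_group_H: "comm_group H"
proof -
  have "group H"
  proof (rule groupI)
    fix f assume f: "f \<in> carrier H"
    have "\<one>\<^bsub>H\<^esub> \<otimes>\<^bsub>H\<^esub> f \<in> chom M A" using mult_closed[OF one_closed, of f] f by simp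
    then show "\<one>\<^bsub>H\<^esub> \<otimes>\<^bsub>H\<^esub> f = f" using f by (intro ext) simp_all
    let ?h = "\<lambda>m\<in>carrier M. inv\<^bsub>A\<^esub> f m"
    have "?h \<otimes>\<^bsub>H\<^esub> f = \<one>\<^bsub>H\<^esub>" using f by (auto simp: restrict_def fun_eq_iff)
    then show "\<exists>h\<in>carrier H. h \<otimes>\<^bsub>H\<^esub> f = \<one>\<^bsub>H\<^esub>" using f inv_closed[of f] by (intro bexI[of _ ?h]) simp_all
  next
    fix f g h assume "f \<in> carrier H" "g \<in> carrier H" "h \<in> carrier H"
    then show "f \<otimes>\<^bsub>H\<^esub> g \<otimes>\<^bsub>H\<^esub> h = f \<otimes>\<^bsub>H\<^esub> (g \<otimes>\<^bsub>H\<^esub> h)"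
      by (auto simp: restrict_def fun_eq_iff A.m_assoc)
  qed (auto simp: mult_closed one_closed)
  then show ?thesis
    by (rule group.group_comm_groupI) (auto simp: restrict_def fun_eq_iff A.m_comm)
qed

sublocale H: comm_group H by (rule comm_group_H)

lemma hausdorff_abelian_H: "hausdorff_abelian H"
  by (rule hausdorff_abelian_discrete[OF comm_group_H]) simp

text \<open>Used to read inverses and powers in the group of homomorphisms pointwise.\<close>

lemma eval_hom: "m \<in> carrier M \<Longrightarrow> group_hom H A (\<lambda>f. f m)"
  using H.is_group A.is_group by (auto simp: group_hom_def group_hom_axioms_def hom_def chomD(4))

lemma eval_inv: "f \<in> chom M A \<Longrightarrow> m \<in> carrier M \<Longrightarrow> (inv\<^bsub>H\<^esub> f) m = inv\<^bsub>A\<^esub> f m"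
  using group_hom.hom_inv[OF eval_hom] by simp

lemma pi_torsion_H:
  assumes "pi_torsion \<pi> A"
  shows "pi_torsion \<pi> H"
proof -
  obtain e :: nat where e: "e > 0" "\<forall>p. prime p \<and> p dvd e \<longrightarrow> p \<in> \<pi>" "\<forall>a\<in>carrier A. a [^]\<^bsub>A\<^esub> e = \<one>\<^bsub>A\<^esub>"
    using assms by (auto simp: pi_torsion_def)
  have "f [^]\<^bsub>H\<^esub> e = \<one>\<^bsub>H\<^esub>" if f: "f \<in> carrier H" for f
  proof (rule ext)
    fix m assume m: "m \<in> carrier M"
    have "(f [^]\<^bsub>H\<^esub> e) m = f m [^]\<^bsub>A\<^esub> e"
      using group_hom.hom_nat_pow[OF eval_hom[OF m], of f e] f by simp
    then show "(f [^]\<^bsub>H\<^esub> e) m = \<one>\<^bsub>H\<^esub> m" using e(3) f m by (simp add: chomD(4))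
  qed (use f H.nat_pow_closed[of f e] one_closed in auto)
  then show ?thesis using e(1,2) unfolding pi_torsion_def by blast
qed

text \<open>As the module is discrete, joint continuity of the action means that every orbit map is
  locally constant. This is the hypothesis \<open>open_orbit\<close>, which is verified later by
  compactness.\<close>

lemma gmodule_H:
  fixes actM :: "'g \<Rightarrow> 'm \<Rightarrow> 'm"
  assumes G: "topological_group G" and actM: "continuous_action G M actM" and act: "continuous_action G A act"
    and open_orbit: "\<And>f g. f \<in> chom M A \<Longrightarrow> g \<in> carrier G \<Longrightarrow>
      openin (topo G) {h \<in> carrier G. hom_act G M actM act h f = hom_act G M actM act g f}"
  shows "gmodule G H (hom_act G M actM act)"
proof -
  interpret G: group G using G by (simp add: topological_group_def)
  have Mact: "actM g \<in> hom M M" "continuous_map (topo M) (topo M) (actM g)" "m \<in> carrier M \<Longrightarrow> actM g m \<in> carrier M"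
    if "g \<in> carrier G" for g m
    using actM that by (auto simp: continuous_action_def hom_def)
  have Aact: "act g \<in> hom A A" "continuous_map (topo A) (topo A) (act g)" "a \<in> carrier A \<Longrightarrow> act g a \<in> carrier A"
    if "g \<in> carrier G" for g a
    using act that by (auto simp: continuous_action_def hom_def)
  let ?act = "hom_act G M actM act"
  have closed: "?act g f \<in> chom M A" if g: "g \<in> carrier G" and f: "f \<in> chom M A" for g f
    unfolding hom_act_def
  proof (rule chom_restrictI[OF hausdorff_abelianD(5,2)[OF M]])
    let ?i = "inv\<^bsub>G\<^esub> g"
    have i: "?i \<in> carrier G" using g by simp
    show "act g (f (actM ?i m)) \<in> carrier A" if "m \<in> carrier M" for m
      using Aact(3)[OF g] chomD(4)[OF f] Mact(3)[OF i that] by blast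
    show "act g (f (actM ?i (m \<otimes>\<^bsub>M\<^esub> n))) = act g (f (actM ?i m)) \<otimes>\<^bsub>A\<^esub> act g (f (actM ?i n))"
      if "m \<in> carrier M" "n \<in> carrier M" for m n
      using hom_mult[OF Aact(1)[OF g]] chomD(4,5)[OF f] Mact(3)[OF i] hom_mult[OF Mact(1)[OF i]] that by simp
    show "continuous_map (topo M) (topo A) (\<lambda>m. act g (f (actM ?i m)))"
      using continuous_map_compose[OF continuous_map_compose[OF Mact(2)[OF i] chomD(3)[OF f]] Aact(2)[OF g]]
      by (simp add: comp_def)
  qed
  have hom: "?act g \<in> hom H H" if g: "g \<in> carrier G" for g
  proof (rule homI)
    fix f h assume f: "f \<in> carrier H" and h: "h \<in> carrier H"
    show "?act g (f \<otimes>\<^bsub>H\<^esub> h) = ?act g f \<otimes>\<^bsub>H\<^esub> ?act g h"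
      using f h hom_mult[OF Aact(1)[OF g]] Mact(3)[of "inv\<^bsub>G\<^esub> g"] g
      by (auto simp: hom_act_def restrict_def chomD(4))
  qed (use closed g in simp)
  have one: "?act \<one>\<^bsub>G\<^esub> f = f" if f: "f \<in> chom M A" for f
    by (rule ext[OF closed[OF G.one_closed f] f])
      (use act actM chomD(4)[OF f] in \<open>simp add: hom_act_def continuous_action_def\<close>)
  have mult: "?act (g \<otimes>\<^bsub>G\<^esub> h) f = ?act g (?act h f)" if g: "g \<in> carrier G" and h: "h \<in> carrier G" and f: "f \<in> chom M A" for g h f
  proof (rule ext[OF closed[OF G.m_closed[OF g h] f] closed[OF g closed[OF h f]]])
    fix m assume m: "m \<in> carrier M"
    have "actM (inv\<^bsub>G\<^esub> (g \<otimes>\<^bsub>G\<^esub> h)) m = actM (inv\<^bsub>G\<^esub> h) (actM (inv\<^bsub>G\<^esub> g) m)"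
      using actM g h m by (simp add: continuous_action_def G.inv_mult_group)
    moreover have "actM (inv\<^bsub>G\<^esub> h) (actM (inv\<^bsub>G\<^esub> g) m) \<in> carrier M" "actM (inv\<^bsub>G\<^esub> g) m \<in> carrier M"
      using Mact(3) g h m by simp_all
    ultimately show "?act (g \<otimes>\<^bsub>G\<^esub> h) f m = ?act g (?act h f) m"
      using m act g h chomD(4)[OF f] by (simp add: hom_act_def continuous_action_def)
  qed
  have cont: "continuous_map (prod_topology (topo G) (topo H)) (topo H) (\<lambda>(g, f). ?act g f)"
    unfolding hom_module_sel
  proof (rule continuous_map_discreteI)
    note ts = topspace_topological_group[OF G]
    let ?T = "prod_topology (topo G) (discrete_topology (chom M A))"
    fix x assume x: "x \<in> topspace ?T"
    then obtain g f where gf: "x = (g, f)" "g \<in> carrier G" "f \<in> chom M A" by (auto simp: ts)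
    show "(case x of (g, f) \<Rightarrow> ?act g f) \<in> chom M A" using closed gf by simp
    let ?V = "{h \<in> carrier G. ?act h f = ?act g f} \<times> {f}"
    have "openin ?T ?V" using open_orbit[OF gf(3,2)] gf(3) by (simp add: openin_prod_Times_iff)
    then show "\<exists>V. openin ?T V \<and> x \<in> V \<and> (\<forall>x'\<in>V. (case x' of (g, f) \<Rightarrow> ?act g f) = (case x of (g, f) \<Rightarrow> ?act g f))"
      using gf by (intro exI[of _ ?V]) auto
  qed
  show ?thesis
    unfolding gmodule_def
    using comm_group_H hausdorff_abelianD(3)[OF hausdorff_abelian_H] hom one mult cont by simp
qed

end

section \<open>The coset space and its free module\<close>

text \<open>Nonemptiness of \<open>X\<close> provides a point of the coset space; it splits the
  augmentation and is the place where constants are read off.\<close>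

locale relative_pair = profinite_group_pi G \<pi>
  for G :: "'g tgroup" and \<pi> :: "nat set" +
  fixes X :: "'x topology" and S :: "'x \<Rightarrow> 'g set" and A :: "'a tgroup" and act :: "'g \<Rightarrow> 'a \<Rightarrow> 'a"
  assumes X: "profinite_space X" and X_nonempty: "topspace X \<noteq> {}"
    and S: "continuously_indexed G X S"
    and Amod: "finite_primary_gmodule \<pi> G A act"
begin

lemma compact_X: "compact_space X" using X by (simp add: profinite_space_def)

lemma S_subgroup: "x \<in> topspace X \<Longrightarrow> subgroup (S x) G"
  using S by (simp add: continuously_indexed_def)

lemma S_sub: "x \<in> topspace X \<Longrightarrow> s \<in> S x \<Longrightarrow> s \<in> carrier G"
  using subgroup.subset[OF S_subgroup] by blast

lemma S_one: "x \<in> topspace X \<Longrightarrow> \<one>\<^bsub>G\<^esub> \<in> S x"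
  using subgroup.one_closed[OF S_subgroup] .

lemma gmod: "gmodule G A act" and A_discrete: "topo A = discrete_topology (carrier A)"
  and A_finite: "finite (carrier A)"
  using Amod by (auto simp: finite_primary_gmodule_def)

sublocale A: comm_group A using gmod by (simp add: gmodule_def)

lemma hausdorff_abelian_A: "hausdorff_abelian A"
  by (rule hausdorff_abelian_discrete[OF A.comm_group_axioms A_discrete])

lemma tgA: "topological_group A" by (rule hausdorff_abelianD(3)[OF hausdorff_abelian_A])

lemma tsA: "topspace (topo A) = carrier A" by (simp add: A_discrete)

lemma pi_torsion_A: "pi_torsion \<pi> A"
  unfolding pi_torsion_def
proof (intro exI[of _ "order A"] conjI)
  show "order A > 0" using A_finite A.one_closed by (auto simp: order_def card_gt_0_iff)
  show "\<forall>p. prime p \<and> p dvd order A \<longrightarrow> p \<in> \<pi>" using Amod by (simp add: finite_primary_gmodule_def)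
  show "\<forall>a\<in>carrier A. a [^]\<^bsub>A\<^esub> order A = \<one>\<^bsub>A\<^esub>"
    using A.power_order_eq_one[OF A_finite] by (simp add: order_def)
qed

lemma act_action: "continuous_action G A act" by (rule gmodule_continuous_action[OF gmod tg])

lemma act_hom: "g \<in> carrier G \<Longrightarrow> group_hom A A (act g)"
  using act_action A.is_group by (simp add: continuous_action_def group_hom_def group_hom_axioms_def)

lemma act_closed [simp]: "g \<in> carrier G \<Longrightarrow> a \<in> carrier A \<Longrightarrow> act g a \<in> carrier A"
  using group_hom.hom_closed[OF act_hom] .

lemma act_distrib [simp]: "g \<in> carrier G \<Longrightarrow> a \<in> carrier A \<Longrightarrow> b \<in> carrier A \<Longrightarrow>
    act g (a \<otimes>\<^bsub>A\<^esub> b) = act g a \<otimes>\<^bsub>A\<^esub> act g b"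
  using group_hom.hom_mult[OF act_hom] .

lemma act_inv [simp]: "g \<in> carrier G \<Longrightarrow> a \<in> carrier A \<Longrightarrow> act g (inv\<^bsub>A\<^esub> a) = inv\<^bsub>A\<^esub> act g a"
  using group_hom.hom_inv[OF act_hom] .

lemma act_one [simp]: "a \<in> carrier A \<Longrightarrow> act \<one>\<^bsub>G\<^esub> a = a"
  using act_action by (simp add: continuous_action_def)

lemma act_of_one [simp]: "g \<in> carrier G \<Longrightarrow> act g \<one>\<^bsub>A\<^esub> = \<one>\<^bsub>A\<^esub>"
  using group_hom.hom_one[OF act_hom] .

lemma act_act: "g \<in> carrier G \<Longrightarrow> h \<in> carrier G \<Longrightarrow> a \<in> carrier A \<Longrightarrow> act g (act h a) = act (g \<otimes>\<^bsub>G\<^esub> h) a"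
  using act_action by (simp add: continuous_action_def)

lemma continuous_map_act:
  assumes "continuous_map T (topo G) f" "continuous_map T (topo A) h"
  shows "continuous_map T (topo A) (\<lambda>x. act (f x) (h x))"
proof -
  have "continuous_map (prod_topology (topo G) (topo A)) (topo A) (\<lambda>(g, a). act g a)"
    using gmod by (simp add: gmodule_def)
  from continuous_map_compose[OF continuous_map_pairedI[OF assms] this]
  show ?thesis by (simp add: comp_def)
qed

section \<open>The coset space\<close>

abbreviation Y where "Y \<equiv> coset_space G X S"
abbreviation GX where "GX \<equiv> prod_topology (topo G) X"

definition cs :: "'g \<Rightarrow> 'x \<Rightarrow> 'g set \<times> 'x" where
  "cs g x = (g <#\<^bsub>G\<^esub> S x, x)"

lemma quotient_cs: "quotient_map GX Y (\<lambda>z. cs (fst z) (snd z))"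
  unfolding coset_space_def cs_def case_prod_unfold by (rule quotient_map_quot_topology)

lemma topspace_Y: "topspace Y = {cs g x | g x. g \<in> carrier G \<and> x \<in> topspace X}"
  unfolding coset_space_def topspace_quot_topology by (auto simp: cs_def ts)

lemma cs_mem [simp]: "g \<in> carrier G \<Longrightarrow> x \<in> topspace X \<Longrightarrow> cs g x \<in> topspace Y"
  by (auto simp: topspace_Y)

lemma compact_Y: "compact_space Y"
proof -
  have "compact_space GX" using compact_G compact_X by (simp add: compact_space_prod_topology)
  then have "compactin Y ((\<lambda>z. cs (fst z) (snd z)) ` topspace GX)"
    unfolding compact_space_def by (rule image_compactin[OF _ quotient_imp_continuous_map[OF quotient_cs]])
  then show ?thesis using quotient_imp_surjective_map[OF quotient_cs] by (simp add: compact_space_def)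
qed

text \<open>Functions on the coset space are handled through their pullbacks to \<open>GX\<close>,
  where continuity can be computed.\<close>

lemma continuous_map_from_Y:
  "continuous_map Y T h \<longleftrightarrow> continuous_map GX T (\<lambda>z. h (cs (fst z) (snd z)))"
  using continuous_compose_quotient_map[OF quotient_cs, of T h]
    continuous_map_compose[OF quotient_imp_continuous_map[OF quotient_cs], of T h]
  by (auto simp: comp_def)

lemma cs_mult: "g \<in> carrier G \<Longrightarrow> x \<in> topspace X \<Longrightarrow> s \<in> S x \<Longrightarrow> cs (g \<otimes>\<^bsub>G\<^esub> s) x = cs g x"
  using lcos_m_assoc[of "S x" g s] subgroup.subset[OF S_subgroup] coset_join3[of s "S x"] S_subgroup S_sub
  by (simp add: cs_def)

lemma cs_eqD:
  assumes "cs g x = cs h x'" "g \<in> carrier G" "h \<in> carrier G" "x \<in> topspace X"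
  shows "x' = x" "inv\<^bsub>G\<^esub> g \<otimes>\<^bsub>G\<^esub> h \<in> S x"
proof -
  show x: "x' = x" using assms by (simp add: cs_def)
  have "h <#\<^bsub>G\<^esub> S x = g <#\<^bsub>G\<^esub> S x" using assms by (simp add: cs_def x)
  moreover have "h \<in> h <#\<^bsub>G\<^esub> S x" using S_one[OF assms(4)] assms(3) by (auto simp: l_coset_def intro!: exI[of _ "\<one>\<^bsub>G\<^esub>"] bexI[of _ "\<one>\<^bsub>G\<^esub>"])
  ultimately obtain s where "s \<in> S x" "h = g \<otimes>\<^bsub>G\<^esub> s" by (auto simp: l_coset_def)
  then show "inv\<^bsub>G\<^esub> g \<otimes>\<^bsub>G\<^esub> h \<in> S x" using assms S_sub by (simp flip: m_assoc)
qed

lemma coset_space_act_cs: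
  "g \<in> carrier G \<Longrightarrow> h \<in> carrier G \<Longrightarrow> x \<in> topspace X \<Longrightarrow> coset_space_act G g (cs h x) = cs (g \<otimes>\<^bsub>G\<^esub> h) x"
  using lcos_m_assoc[of "S x" g h] subgroup.subset[OF S_subgroup] by (simp add: coset_space_act_def cs_def)

lemma homeomorphic_coset_space_act:
  assumes "g \<in> carrier G"
  shows "homeomorphic_map Y Y (coset_space_act G g)"
proof -
  have c: "continuous_map Y Y (coset_space_act G h)" if h: "h \<in> carrier G" for h
  proof -
    have "continuous_map GX GX (\<lambda>z. (h \<otimes>\<^bsub>G\<^esub> fst z, snd z))"
      using h ts by (intro continuous_map_pairedI continuous_map_group_mult tg continuous_map_fst continuous_map_snd) auto
    from continuous_map_compose[OF this quotient_imp_continuous_map[OF quotient_cs]]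
    have "continuous_map GX Y (\<lambda>z. cs (h \<otimes>\<^bsub>G\<^esub> fst z) (snd z))" by (simp add: comp_def)
    then have "continuous_map GX Y (\<lambda>z. coset_space_act G h (cs (fst z) (snd z)))"
      by (rule continuous_map_eq) (use h ts in \<open>auto simp: coset_space_act_cs\<close>)
    then show ?thesis by (simp add: continuous_map_from_Y)
  qed
  have "homeomorphic_maps Y Y (coset_space_act G g) (coset_space_act G (inv\<^bsub>G\<^esub> g))"
    unfolding homeomorphic_maps_def using c assms
    by (auto simp: topspace_Y coset_space_act_cs simp flip: m_assoc)
  then show ?thesis by (auto simp: homeomorphic_map_maps)
qed

section \<open>The free module on the coset space\<close>

abbreviation Z where "Z \<equiv> Zcosets \<pi> G X S"

sublocale Z: free_module "Zpi \<pi>" Y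
  rewrites "pf_free (Zpi \<pi>) Y = Z"
  by (unfold_locales, rule hausdorff_abelian_Zpi[OF \<pi>]) (simp add: Zcosets_def)

definition pt :: "'g set \<times> 'x \<Rightarrow> ('g, 'x) zcosets" where
  "pt y = dirac (Zpi \<pi>) Y (Zpi_unit \<pi>) y"

abbreviation eps where "eps \<equiv> augm Y"

lemma Y_nonempty: "topspace Y \<noteq> {}" using X_nonempty cs_mem[OF one_closed] by blast

lemma pt_closed [simp]: "y \<in> topspace Y \<Longrightarrow> pt y \<in> carrier Z"
  unfolding pt_def using Z.dirac_closed[OF Zpi_unit_closed[OF \<pi>]] .

lemma continuous_map_pt: "continuous_map Y (topo Z) pt"
proof -
  have "Zpi_unit \<pi> \<in> topspace (topo (Zpi \<pi>))"
    using Zpi_unit_closed[OF \<pi>] hausdorff_abelianD(5)[OF hausdorff_abelian_Zpi[OF \<pi>]] by simp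
  then have "continuous_map Y (topo Z) (\<lambda>y. dirac (Zpi \<pi>) Y (Zpi_unit \<pi>) y)"
    by (intro Z.continuous_map_diracI) auto
  then show ?thesis by (simp add: pt_def[abs_def])
qed

lemma topgen_Z: "topgen Z {pt y | y. y \<in> topspace Y}"
proof -
  have "{dirac (Zpi \<pi>) Y b y | b y. b \<in> {Zpi_unit \<pi>} \<and> y \<in> topspace Y} = {pt y | y. y \<in> topspace Y}"
    by (auto simp: pt_def)
  then show ?thesis using Z.topgen_dirac[OF compact_Y topgen_Zpi[OF \<pi>]] by simp
qed

lemma chom_Z_eqI:
  assumes "f \<in> chom Z A" "h \<in> chom Z A" "\<And>g x. g \<in> carrier G \<Longrightarrow> x \<in> topspace X \<Longrightarrow> f (pt (cs g x)) = h (pt (cs g x))"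
  shows "f = h"
  by (rule chom_eqI[OF topgen_Z Z.hausdorff_abelian_M hausdorff_abelian_A assms(1,2)])
    (use assms(3) in \<open>auto simp: topspace_Y\<close>)

lemma chom_Z_exists:
  assumes "continuous_map GX (topo A) (\<lambda>z. w (cs (fst z) (snd z)))"
  obtains f where "f \<in> chom Z A" "\<And>y. y \<in> topspace Y \<Longrightarrow> f (pt y) = w y"
proof (rule Zpi_free_extend[OF \<pi> compact_Y A.comm_group_axioms A_discrete pi_torsion_A])
  show "continuous_map Y (topo A) w" using assms by (simp add: continuous_map_from_Y)
qed (use that in \<open>simp add: pt_def Zcosets_def\<close>)

lemma Zact:
  assumes g: "g \<in> carrier G"
  shows "\<And>m. m \<in> carrier Z \<Longrightarrow> Zcosets_act G X S g m \<in> carrier Z"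
    and "Zcosets_act G X S g \<in> hom Z Z"
    and "continuous_map (topo Z) (topo Z) (Zcosets_act G X S g)"
    and "\<And>h x. h \<in> carrier G \<Longrightarrow> x \<in> topspace X \<Longrightarrow> Zcosets_act G X S g (pt (cs h x)) = pt (cs (g \<otimes>\<^bsub>G\<^esub> h) x)"
proof -
  have hm: "homeomorphic_map Y Y (coset_space_act G (inv\<^bsub>G\<^esub> g))"
    by (rule homeomorphic_coset_space_act[OF inv_closed[OF g]])
  have eq: "Zcosets_act G X S g = (\<lambda>m. \<lambda>P\<in>Z.cp. \<lambda>U\<in>P. m ((`) (coset_space_act G (inv\<^bsub>G\<^esub> g)) ` P) (coset_space_act G (inv\<^bsub>G\<^esub> g) ` U))"
    by (simp add: Zcosets_act_def pf_free_act_def[abs_def])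
  show "\<And>m. m \<in> carrier Z \<Longrightarrow> Zcosets_act G X S g m \<in> carrier Z"
    "Zcosets_act G X S g \<in> hom Z Z"
    "continuous_map (topo Z) (topo Z) (Zcosets_act G X S g)"
    unfolding eq using Z.relabel(1-3)[OF hm] by blast+
  show "Zcosets_act G X S g (pt (cs h x)) = pt (cs (g \<otimes>\<^bsub>G\<^esub> h) x)" if h: "h \<in> carrier G" and x: "x \<in> topspace X" for h x
  proof -
    have "Zcosets_act G X S g (pt (coset_space_act G (inv\<^bsub>G\<^esub> g) (cs (g \<otimes>\<^bsub>G\<^esub> h) x))) = pt (cs (g \<otimes>\<^bsub>G\<^esub> h) x)"
      unfolding eq pt_def using Z.relabel(4)[OF hm Zpi_unit_closed[OF \<pi>]] g h x by simp
    then show ?thesis using g h x by (simp add: coset_space_act_cs flip: m_assoc)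
  qed
qed

lemma continuous_action_Z: "continuous_action G Z (Zcosets_act G X S)"
  unfolding continuous_action_def
proof (intro conjI ballI)
  fix g assume g: "g \<in> carrier G"
  show "Zcosets_act G X S g \<in> hom Z Z" "continuous_map (topo Z) (topo Z) (Zcosets_act G X S g)"
    by (rule Zact[OF g])+
next
  have id: "(\<lambda>x. x) \<in> hom Z Z" by (simp add: hom_def)
  fix m assume m: "m \<in> carrier Z"
  show "Zcosets_act G X S \<one>\<^bsub>G\<^esub> m = m"
    by (rule hom_eq_on_topgen[OF topgen_Z Z.hausdorff_abelian_M Z.hausdorff_abelian_M
          Zact(2,3)[OF one_closed] id _ _ m]) (auto simp: Zact topspace_Y)
  fix g h assume g: "g \<in> carrier G" and h: "h \<in> carrier G"
  show "Zcosets_act G X S (g \<otimes>\<^bsub>G\<^esub> h) m = Zcosets_act G X S g (Zcosets_act G X S h m)"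
  proof (rule hom_eq_on_topgen[OF topgen_Z Z.hausdorff_abelian_M Z.hausdorff_abelian_M
          Zact(2,3)[OF m_closed[OF g h]] _ _ _ m])
    show "(\<lambda>m. Zcosets_act G X S g (Zcosets_act G X S h m)) \<in> hom Z Z"
      using Group.hom_compose[OF Zact(2)[OF h] Zact(2)[OF g]] by (simp add: comp_def)
    show "continuous_map (topo Z) (topo Z) (\<lambda>m. Zcosets_act G X S g (Zcosets_act G X S h m))"
      using continuous_map_compose[OF Zact(3)[OF h] Zact(3)[OF g]] by (simp add: comp_def)
  qed (auto simp: Zact topspace_Y g h m_assoc)
qed

lemma eps_hom: "eps \<in> hom Z (Zpi \<pi>)" "continuous_map (topo Z) (topo (Zpi \<pi>)) eps"
  and eps_pt: "y \<in> topspace Y \<Longrightarrow> eps (pt y) = Zpi_unit \<pi>"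
  using Z.augm[OF Y_nonempty] by (simp_all add: pt_def)

lemma eps_group_hom: "group_hom Z (Zpi \<pi>) eps"
  using eps_hom(1) Z.M.is_group Z.R.is_group by (simp add: group_hom_def group_hom_axioms_def)

lemma eps_closed: "m \<in> carrier Z \<Longrightarrow> eps m \<in> carrier (Zpi \<pi>)"
  using group_hom.hom_closed[OF eps_group_hom] .

text \<open>The action permutes the points, and all points have augmentation
  \<open>Zpi_unit\<close>.\<close>

lemma eps_Zact:
  assumes g: "g \<in> carrier G" and m: "m \<in> carrier Z"
  shows "eps (Zcosets_act G X S g m) = eps m"
proof (rule hom_eq_on_topgen[OF topgen_Z Z.hausdorff_abelian_M hausdorff_abelian_Zpi[OF \<pi>] _ _ eps_hom _ m])
  show "(\<lambda>m. eps (Zcosets_act G X S g m)) \<in> hom Z (Zpi \<pi>)"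
    using Group.hom_compose[OF Zact(2)[OF g] eps_hom(1)] by (simp add: comp_def)
  show "continuous_map (topo Z) (topo (Zpi \<pi>)) (\<lambda>m. eps (Zcosets_act G X S g m))"
    using continuous_map_compose[OF Zact(3)[OF g] eps_hom(2)] by (simp add: comp_def)
  fix b assume "b \<in> {pt y | y. y \<in> topspace Y}"
  then obtain h x where "b = pt (cs h x)" "h \<in> carrier G" "x \<in> topspace X" unfolding topspace_Y by blast
  then show "eps (Zcosets_act G X S g b) = eps b" using g by (simp add: Zact(4) eps_pt)
qed

section \<open>The augmentation kernel\<close>

abbreviation D where "D \<equiv> Delta \<pi> G X S"

lemma carrier_D: "m \<in> carrier D \<longleftrightarrow> m \<in> carrier Z \<and> eps m = \<one>\<^bsub>Zpi \<pi>\<^esub>"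
  by (auto simp: Delta_def kernel_def)

lemma mult_D [simp]: "m \<otimes>\<^bsub>D\<^esub> n = m \<otimes>\<^bsub>Z\<^esub> n" by (simp add: Delta_def)

lemma topo_D: "topo D = subtopology (topo Z) (carrier D)"
  by (simp add: Delta_def subtopology_restrict topspace_topological_group
      flip: hausdorff_abelianD(5)[OF Z.hausdorff_abelian_M])

lemma hausdorff_abelian_D: "hausdorff_abelian D"
  unfolding Delta_def
proof (rule hausdorff_abelian_tsub[OF Z.hausdorff_abelian_M])
  have "carrier Z \<inter> kernel Z (Zpi \<pi>) eps = kernel Z (Zpi \<pi>) eps" by (auto simp: kernel_def)
  then show "subgroup (carrier Z \<inter> kernel Z (Zpi \<pi>) eps) Z"
    using group_hom.subgroup_kernel[OF eps_group_hom] by simp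
qed

lemma continuous_action_D: "continuous_action G D (Zcosets_act G X S)"
proof -
  have cl: "Zcosets_act G X S g m \<in> carrier D" if "g \<in> carrier G" "m \<in> carrier D" for g m
    using that by (simp add: carrier_D Zact(1) eps_Zact)
  have "Zcosets_act G X S g \<in> hom D D" if g: "g \<in> carrier G" for g
    using cl[OF g] hom_mult[OF Zact(2)[OF g]] by (auto simp: hom_def carrier_D)
  moreover have "continuous_map (topo D) (topo D) (Zcosets_act G X S g)" if g: "g \<in> carrier G" for g
    using continuous_map_from_subtopology[OF Zact(3)[OF g]] cl[OF g]
      hausdorff_abelianD(5)[OF hausdorff_abelian_D]
    unfolding topo_D by (intro continuous_map_into_subtopology) auto
  ultimately show ?thesis using continuous_action_Z by (simp add: continuous_action_def carrier_D)
qed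

section \<open>The coefficient modules of homomorphisms into \<open>A\<close>\<close>

sublocale HZ: hom_group Z A by unfold_locales (rule Z.hausdorff_abelian_M hausdorff_abelian_A)+
sublocale HD: hom_group D A by unfold_locales (rule hausdorff_abelian_D hausdorff_abelian_A)+

abbreviation Zaction where "Zaction \<equiv> HomZ_act \<pi> G X S act"
abbreviation Daction where "Daction \<equiv> HomDelta_act \<pi> G X S act"

lemma Zaction_pt:
  assumes "g \<in> carrier G" "k \<in> carrier G" "x \<in> topspace X"
  shows "Zaction g f (pt (cs k x)) = act g (f (pt (cs (inv\<^bsub>G\<^esub> g \<otimes>\<^bsub>G\<^esub> k) x)))"
  using assms by (simp add: hom_act_def Zact(4))

lemma continuous_map_eval:
  assumes f: "f \<in> chom Z A" and "continuous_map T (topo G) k" "continuous_map T X x"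
  shows "continuous_map T (topo A) (\<lambda>t. f (pt (cs (k t) (x t))))"
  using continuous_map_compose[OF continuous_map_compose[OF continuous_map_compose[OF
      continuous_map_pairedI[OF assms(2,3)] quotient_imp_continuous_map[OF quotient_cs]] continuous_map_pt] chomD(3)[OF f]]
  by (simp add: comp_def)

lemma Zaction_closed:
  assumes g: "g \<in> carrier G" and f: "f \<in> chom Z A"
  shows "Zaction g f \<in> chom Z A"
  unfolding hom_act_def
proof (rule chom_restrictI[OF Z.topspace_M Z.M.is_group])
  let ?i = "inv\<^bsub>G\<^esub> g"
  have i: "?i \<in> carrier G" using g by simp
  show "act g (f (Zcosets_act G X S ?i m)) \<in> carrier A" if "m \<in> carrier Z" for m
    using chomD(4)[OF f Zact(1)[OF i that]] g by simp
  show "act g (f (Zcosets_act G X S ?i (m \<otimes>\<^bsub>Z\<^esub> n))) = act g (f (Zcosets_act G X S ?i m)) \<otimes>\<^bsub>A\<^esub> act g (f (Zcosets_act G X S ?i n))"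
    if "m \<in> carrier Z" "n \<in> carrier Z" for m n
    using hom_mult[OF Zact(2)[OF i] that] chomD(4,5)[OF f] Zact(1)[OF i] that g by simp
  show "continuous_map (topo Z) (topo A) (\<lambda>m. act g (f (Zcosets_act G X S ?i m)))"
    using continuous_map_compose[OF Zact(3)[OF i] chomD(3)[OF f]] ts g
    by (intro continuous_map_act) (simp_all add: comp_def)
qed

text \<open>Homomorphisms on \<open>Z\<close> are compared at the points of the coset space, that
  is, over the compact space \<open>GX\<close>; agreeing at all of them is an open condition on the
  group element.\<close>

lemma Zaction_open_orbit:
  assumes f: "f \<in> chom Z A" and g: "g \<in> carrier G"
  shows "openin (topo G) {h \<in> carrier G. Zaction h f = Zaction g f}"
proof -
  let ?T = "prod_topology (topo G) GX"
  have 1: "continuous_map ?T (topo A) (\<lambda>t. act (fst t) (f (pt (cs (inv\<^bsub>G\<^esub> (fst t) \<otimes>\<^bsub>G\<^esub> fst (snd t)) (snd (snd t))))))"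
    by (intro continuous_map_act continuous_map_eval[OF f] continuous_map_group_mult tg continuous_map_group_inv
        continuous_map_fst continuous_map_compose[OF continuous_map_snd continuous_map_fst, unfolded comp_def]
        continuous_map_compose[OF continuous_map_snd continuous_map_snd, unfolded comp_def])
  have 2: "continuous_map ?T (topo A) (\<lambda>t. Zaction g f (pt (cs (fst (snd t)) (snd (snd t)))))"
    by (intro continuous_map_eval[OF Zaction_closed[OF g f]]
        continuous_map_compose[OF continuous_map_snd continuous_map_fst, unfolded comp_def]
        continuous_map_compose[OF continuous_map_snd continuous_map_snd, unfolded comp_def])
  have "compact_space GX" using compact_G compact_X by (simp add: compact_space_prod_topology)
  from openin_all[OF this openin_discrete_eq[OF 1[unfolded A_discrete] 2[unfolded A_discrete]]]
  have "openin (topo G) {h \<in> carrier G. \<forall>z\<in>topspace GX. act h (f (pt (cs (inv\<^bsub>G\<^esub> h \<otimes>\<^bsub>G\<^esub> fst z) (snd z)))) = Zaction g f (pt (cs (fst z) (snd z)))}"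
    (is "openin _ ?V")
    by (rule back_subst[of "openin (topo G)"]) (auto simp: ts)
  moreover have "?V = {h \<in> carrier G. Zaction h f = Zaction g f}"
  proof (intro Collect_cong conj_cong refl iffI)
    fix h assume h: "h \<in> carrier G"
    show "Zaction h f = Zaction g f"
      if "\<forall>z\<in>topspace GX. act h (f (pt (cs (inv\<^bsub>G\<^esub> h \<otimes>\<^bsub>G\<^esub> fst z) (snd z)))) = Zaction g f (pt (cs (fst z) (snd z)))"
      using that h by (intro chom_Z_eqI Zaction_closed f g) (auto simp: Zaction_pt ts)
    show "\<forall>z\<in>topspace GX. act h (f (pt (cs (inv\<^bsub>G\<^esub> h \<otimes>\<^bsub>G\<^esub> fst z) (snd z)))) = Zaction g f (pt (cs (fst z) (snd z)))"
      if "Zaction h f = Zaction g f"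
      using that h by (auto simp: ts simp flip: Zaction_pt)
  qed
  ultimately show ?thesis by simp
qed

lemma gmodule_HZ: "gmodule G HZ.H Zaction"
  by (rule HZ.gmodule_H[OF tg continuous_action_Z act_action Zaction_open_orbit])

lemma chom_restrict_D:
  assumes "f \<in> chom Z A"
  shows "restrict f (carrier D) \<in> chom D A"
proof (rule chom_restrictI[OF hausdorff_abelianD(5,2)[OF hausdorff_abelian_D]])
  show "continuous_map (topo D) (topo A) f"
    unfolding topo_D by (rule continuous_map_from_subtopology[OF chomD(3)[OF assms]])
qed (use chomD[OF assms] in \<open>auto simp: carrier_D\<close>)

definition y0 where "y0 = (SOME y. y \<in> topspace Y)"

lemma y0 [simp]: "y0 \<in> topspace Y" unfolding y0_def using Y_nonempty by (meson ex_in_conv someI_ex)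

text \<open>Subtracting from \<open>m\<close> its augmentation placed at \<open>y0\<close> is a
  continuous retraction \<open>r\<close> of \<open>Z\<close> onto \<open>Delta\<close>;
  precomposition with \<open>r\<close> extends homomorphisms.\<close>

lemma chom_D_extends:
  assumes f: "f \<in> chom D A"
  obtains f' where "f' \<in> chom Z A" "restrict f' (carrier D) = f"
proof -
  define r where "r m = m \<otimes>\<^bsub>Z\<^esub> inv\<^bsub>Z\<^esub> dirac (Zpi \<pi>) Y (eps m) y0" for m
  interpret e: group_hom Z "Zpi \<pi>" eps by (rule eps_group_hom)
  interpret d: group_hom "Zpi \<pi>" Z "\<lambda>r. dirac (Zpi \<pi>) Y r y0"
    using Z.dirac_chom[OF y0] Z.M.is_group Z.R.is_group by (simp add: group_hom_def group_hom_axioms_def)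
  have ed: "eps (dirac (Zpi \<pi>) Y r y0) = r" for r using Z.augm(3)[OF Y_nonempty y0] .
  have rD: "r m \<in> carrier D" if "m \<in> carrier Z" for m
    using that by (simp add: r_def carrier_D ed)
  have rmult: "r (m \<otimes>\<^bsub>Z\<^esub> n) = r m \<otimes>\<^bsub>Z\<^esub> r n" if "m \<in> carrier Z" "n \<in> carrier Z" for m n
    using that by (simp add: r_def Z.M.inv_mult Z.M.m_ac)
  have rid: "r m = m" if "m \<in> carrier D" for m
    using that by (simp add: r_def carrier_D)
  have "continuous_map (topo Z) (topo Z) r"
    unfolding r_def
    by (intro continuous_map_group_mult continuous_map_group_inv hausdorff_abelianD(3)[OF Z.hausdorff_abelian_M]
        Z.continuous_map_diracI eps_hom(2)) auto
  then have "continuous_map (topo Z) (topo D) r"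
    unfolding topo_D using rD Z.topspace_M by (intro continuous_map_into_subtopology) auto
  from continuous_map_compose[OF this chomD(3)[OF f]]
  have c: "continuous_map (topo Z) (topo A) (\<lambda>m. f (r m))" by (simp add: comp_def)
  have "restrict (\<lambda>m. f (r m)) (carrier Z) \<in> chom Z A"
    using chomD(4)[OF f rD] chomD(5)[OF f rD rD]
    by (intro chom_restrictI[OF Z.topspace_M Z.M.is_group _ _ c]) (simp_all add: rmult)
  moreover have "restrict (restrict (\<lambda>m. f (r m)) (carrier Z)) (carrier D) = f"
  proof (rule extensionalityI[OF restrict_extensional chomD(2)[OF f]])
    fix m assume "m \<in> carrier D"
    then show "restrict (restrict (\<lambda>m. f (r m)) (carrier Z)) (carrier D) m = f m"
      by (simp add: rid) (simp add: carrier_D)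
  qed
  ultimately show ?thesis using that by blast
qed

lemma Daction_restrict:
  assumes "g \<in> carrier G"
  shows "Daction g (restrict f (carrier D)) = restrict (Zaction g f) (carrier D)"
proof -
  have "Zcosets_act G X S (inv\<^bsub>G\<^esub> g) m \<in> carrier D" if "m \<in> carrier D" for m
    using that assms by (simp add: carrier_D Zact(1) eps_Zact)
  then show ?thesis by (auto simp: hom_act_def restrict_def fun_eq_iff carrier_D)
qed

text \<open>Inherited from an extension \<open>f'\<close> of \<open>f\<close> to \<open>Z\<close>:
  wherever the translates of \<open>f'\<close> agree, so do those of \<open>f\<close>.\<close>

lemma gmodule_HD: "gmodule G HD.H Daction"
proof (rule HD.gmodule_H[OF tg continuous_action_D act_action])
  fix f g assume f: "f \<in> chom D A" and g: "g \<in> carrier G"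
  obtain f' where f': "f' \<in> chom Z A" "restrict f' (carrier D) = f" using chom_D_extends[OF f] .
  show "openin (topo G) {h \<in> carrier G. Daction h f = Daction g f}"
  proof (rule openin_locally)
    fix h assume h: "h \<in> {h \<in> carrier G. Daction h f = Daction g f}"
    let ?V = "{k \<in> carrier G. Zaction k f' = Zaction h f'}"
    have "?V \<subseteq> {h \<in> carrier G. Daction h f = Daction g f}"
      using h Daction_restrict[of _ f'] f'(2) by auto
    then show "\<exists>V. openin (topo G) V \<and> h \<in> V \<and> V \<subseteq> {h \<in> carrier G. Daction h f = Daction g f}"
      using Zaction_open_orbit[OF f'(1), of h] h by (intro exI[of _ ?V]) auto
  qed
qed

text \<open>Exactness of the augmentation sequence after applying \<open>Hom(-, A)\<close>. The
  difference of two points lies in \<open>Delta\<close>, so a homomorphism that kills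
  \<open>Delta\<close> does not distinguish points. Conversely, one that is constant on points
  factors through the augmentation, by comparison on generators.\<close>

lemma constant_iff_trivial_on_D:
  assumes f: "f \<in> chom Z A"
  shows "(\<forall>y\<in>topspace Y. f (pt y) = f (pt y0)) \<longleftrightarrow> (\<forall>m\<in>carrier D. f m = \<one>\<^bsub>A\<^esub>)"
proof
  interpret f: group_hom Z A f using f by (intro chom_group_hom) auto
  interpret e: group_hom Z "Zpi \<pi>" eps by (rule eps_group_hom)
  assume triv: "\<forall>m\<in>carrier D. f m = \<one>\<^bsub>A\<^esub>"
  show "\<forall>y\<in>topspace Y. f (pt y) = f (pt y0)"
  proof
    fix y assume y: "y \<in> topspace Y"
    have "pt y \<otimes>\<^bsub>Z\<^esub> inv\<^bsub>Z\<^esub> pt y0 \<in> carrier D"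
      using y Zpi_unit_closed[OF \<pi>] by (simp add: carrier_D eps_pt)
    then have "f (pt y \<otimes>\<^bsub>Z\<^esub> inv\<^bsub>Z\<^esub> pt y0) = \<one>\<^bsub>A\<^esub>" using triv by blast
    then have "f (pt y) \<otimes>\<^bsub>A\<^esub> inv\<^bsub>A\<^esub> f (pt y0) = \<one>\<^bsub>A\<^esub>" using y by simp
    then show "f (pt y) = f (pt y0)" using y by (simp add: A.inv_solve_right')
  qed
next
  assume const: "\<forall>y\<in>topspace Y. f (pt y) = f (pt y0)"
  let ?a = "f (pt y0)"
  have a: "?a \<in> carrier A" using chomD(4)[OF f pt_closed[OF y0]] .
  note sc = Zpi_scale[OF \<pi> A.comm_group_axioms A_discrete pi_torsion_A a]
  interpret s: group_hom "Zpi \<pi>" A "Zpi_scale \<pi> A ?a" by (intro chom_group_hom sc(1)) auto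
  have eq: "f m = Zpi_scale \<pi> A ?a (eps m)" if m: "m \<in> carrier Z" for m
  proof (rule hom_eq_on_topgen[OF topgen_Z Z.hausdorff_abelian_M hausdorff_abelian_A chomD(1,3)[OF f] _ _ _ m])
    show "(\<lambda>m. Zpi_scale \<pi> A ?a (eps m)) \<in> hom Z A"
      using Group.hom_compose[OF eps_hom(1) chomD(1)[OF sc(1)]] by (simp add: comp_def)
    show "continuous_map (topo Z) (topo A) (\<lambda>m. Zpi_scale \<pi> A ?a (eps m))"
      using continuous_map_compose[OF eps_hom(2) chomD(3)[OF sc(1)]] by (simp add: comp_def)
    fix b assume "b \<in> {pt y | y. y \<in> topspace Y}"
    then obtain y where y: "b = pt y" "y \<in> topspace Y" by blast
    have "f b = ?a" using const y by blast
    then show "f b = Zpi_scale \<pi> A ?a (eps b)" using sc(2) by (simp only: y(1) eps_pt[OF y(2)])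
  qed
  show "\<forall>m\<in>carrier D. f m = \<one>\<^bsub>A\<^esub>"
  proof
    fix m assume "m \<in> carrier D"
    then have m: "m \<in> carrier Z" "eps m = \<one>\<^bsub>Zpi \<pi>\<^esub>" using carrier_D by blast+
    have "f m = Zpi_scale \<pi> A ?a \<one>\<^bsub>Zpi \<pi>\<^esub>" using eq[OF m(1)] by (simp only: m(2))
    then show "f m = \<one>\<^bsub>A\<^esub>" by (simp only: s.hom_one)
  qed
qed

end

section \<open>Relative cochains as functions\<close>

lemma discrete_locally_constant:
  assumes "continuous_map T (discrete_topology U) f" "t \<in> topspace T"
  shows "openin T {s \<in> topspace T. f s = f t}" "t \<in> {s \<in> topspace T. f s = f t}"
  using openin_discrete_fibre[OF assms(1)] assms(2) by auto

context relative_pair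
begin

abbreviation Fam where "Fam n \<equiv> homG G (C n) (std_act G n) HZ.H Zaction"
abbreviation Rel where "Rel n \<equiv> homG G (C n) (std_act G n) HD.H Daction"
abbreviation Coch where "Coch n \<equiv> homG G (C n) (std_act G n) A act"

lemma family_cochains_carrier: "carrier (family_cochains \<pi> G X S A act n) = Fam n"
  by (simp add: family_cochains_def cochains_def)

lemma cochains_carrier: "carrier (cochains \<pi> G n A act) = Coch n"
  by (simp add: cochains_def)

lemma group_C: "group (C n)" by (rule hausdorff_abelianD(2)[OF hausdorff_abelian_C])

lemma continuous_map_symb:
  assumes "\<eta> \<in> homG G (C n) (std_act G n) N actN"
  shows "continuous_map (pow n) (topo N) (\<lambda>z. \<eta> (cgen n \<one>\<^bsub>G\<^esub> z))"
proof -
  have "continuous_map (pow n) (topo (C n)) (\<lambda>z. cgen n \<one>\<^bsub>G\<^esub> z)"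
    by (intro continuous_map_cgen) (auto simp: ts)
  from continuous_map_compose[OF this chomD(3)[OF homGD(1)[OF assms]]] show ?thesis by (simp add: comp_def)
qed

lemma continuous_map_tuple_singleton: "continuous_map (topo G) (pow 1) (\<lambda>g. tuple [g])"
  by (rule continuous_map_into_pow) (auto simp: tuple_def)

lemma continuous_map_symb_1:
  assumes "\<eta> \<in> homG G (C 1) (std_act G 1) N actN"
  shows "continuous_map (topo G) (topo N) (\<lambda>g. \<eta> (symb \<pi> G [g]))"
  using continuous_map_compose[OF continuous_map_tuple_singleton continuous_map_symb[OF assms]]
  by (simp add: symb_eq comp_def)

text \<open>The module of homomorphisms is discrete, so near \<open>t\<close> the homomorphism
  \<open>F t\<close> can be frozen, and only the continuity of a single homomorphism
  remains.\<close>

lemma continuous_map_HZ_eval: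
  assumes F: "continuous_map T (topo HZ.H) F" and k: "continuous_map T (topo G) k" and x: "continuous_map T X x"
  shows "continuous_map T (topo A) (\<lambda>t. F t (pt (cs (k t) (x t))))"
  unfolding A_discrete
proof (rule continuous_map_discreteI)
  fix t assume t: "t \<in> topspace T"
  have Ft: "F t \<in> chom Z A" using continuous_map_image_subset_topspace[OF F] t by auto
  have c: "continuous_map T (discrete_topology (carrier A)) (\<lambda>s. F t (pt (cs (k s) (x s))))"
    using continuous_map_eval[OF Ft k x] by (simp add: A_discrete)
  show "F t (pt (cs (k t) (x t))) \<in> carrier A"
    using continuous_map_image_subset_topspace[OF c] t by auto
  let ?V = "{s \<in> topspace T. F s = F t} \<inter> {s \<in> topspace T. F t (pt (cs (k s) (x s))) = F t (pt (cs (k t) (x t)))}"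
  have "openin T ?V"
    using discrete_locally_constant(1)[OF F[unfolded hom_module_sel] t] discrete_locally_constant(1)[OF c t]
    by (rule openin_Int)
  then show "\<exists>V. openin T V \<and> t \<in> V \<and> (\<forall>s\<in>V. F s (pt (cs (k s) (x s))) = F t (pt (cs (k t) (x t))))"
    using t by (intro exI[of _ ?V]) auto
qed

text \<open>The functions that occur as values of cochains in degree 1. Continuity is asked on
  \<open>GX\<close> instead of the coset space; this avoids the question whether the product of the
  quotient map with \<open>G\<close> is again a quotient map.\<close>

definition fam :: "('g \<Rightarrow> 'g set \<times> 'x \<Rightarrow> 'a) \<Rightarrow> bool" where
  "fam u \<longleftrightarrow> continuous_map (prod_topology (topo G) GX) (topo A) (\<lambda>t. u (fst t) (cs (fst (snd t)) (snd (snd t))))"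

lemma fam_continuous:
  assumes "fam u" "continuous_map T (topo G) g" "continuous_map T (topo G) k" "continuous_map T X x"
  shows "continuous_map T (topo A) (\<lambda>t. u (g t) (cs (k t) (x t)))"
  using continuous_map_compose[OF continuous_map_pairedI[OF assms(2) continuous_map_pairedI[OF assms(3,4)]] assms(1)[unfolded fam_def]]
  by (simp add: comp_def)

lemma fam_closed:
  assumes "fam u" "g \<in> carrier G" "k \<in> carrier G" "x \<in> topspace X"
  shows "u g (cs k x) \<in> carrier A"
  using continuous_map_image_subset_topspace[OF assms(1)[unfolded fam_def]] assms(2-4) tsA ts
  by (auto simp: image_subset_iff)

definition fn :: "('g cplx \<Rightarrow> ('g, 'x) zcosets \<Rightarrow> 'a) \<Rightarrow> 'g \<Rightarrow> 'g set \<times> 'x \<Rightarrow> 'a" where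
  "fn \<eta> g y = \<eta> (symb \<pi> G [g]) (pt y)"

lemma fam_fn:
  assumes "\<eta> \<in> Fam 1"
  shows "fam (fn \<eta>)"
  unfolding fam_def fn_def
  by (intro continuous_map_HZ_eval continuous_map_compose[OF continuous_map_fst continuous_map_symb_1[OF assms], unfolded comp_def]
        continuous_map_compose[OF continuous_map_snd continuous_map_fst, unfolded comp_def]
        continuous_map_compose[OF continuous_map_snd continuous_map_snd, unfolded comp_def])

text \<open>For each \<open>g\<close> the slice of \<open>u\<close> extends to a homomorphism
  \<open>F g\<close>. By compactness of \<open>GX\<close>, agreeing with a given slice everywhere is
  an open condition on \<open>g\<close>, so \<open>F\<close> is locally constant and may be
  prescribed as the value on the symbols.\<close>

lemma fam_exists:
  assumes u: "fam u"
  obtains \<eta> where "\<eta> \<in> Fam 1" "\<And>g y. g \<in> carrier G \<Longrightarrow> y \<in> topspace Y \<Longrightarrow> fn \<eta> g y = u g y"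
proof -
  have cu: "continuous_map GX (topo A) (\<lambda>z. u g (cs (fst z) (snd z)))" if "g \<in> carrier G" for g
    by (rule fam_continuous[OF u _ continuous_map_fst continuous_map_snd]) (use that ts in simp)
  define F where "F g = (SOME f. f \<in> chom Z A \<and> (\<forall>y\<in>topspace Y. f (pt y) = u g y))" for g
  have F: "F g \<in> chom Z A \<and> (\<forall>y\<in>topspace Y. F g (pt y) = u g y)" if "g \<in> carrier G" for g
  proof -
    have "\<exists>f. f \<in> chom Z A \<and> (\<forall>y\<in>topspace Y. f (pt y) = u g y)" using chom_Z_exists[OF cu[OF that]] by metis
    then show ?thesis unfolding F_def by (rule someI_ex)
  qed
  have cF: "continuous_map (topo G) (topo HZ.H) F"
    unfolding hom_module_sel
  proof (rule continuous_map_discreteI)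
    fix g assume "g \<in> topspace (topo G)"
    then have g: "g \<in> carrier G" by (simp add: ts)
    then show "F g \<in> chom Z A" using F by blast
    let ?T = "prod_topology (topo G) GX"
    let ?V = "{h \<in> topspace (topo G). \<forall>z\<in>topspace GX. (h, z) \<in>
        {t \<in> topspace ?T. u (fst t) (cs (fst (snd t)) (snd (snd t))) = u g (cs (fst (snd t)) (snd (snd t)))}}"
    have cGX: "compact_space GX" using compact_G compact_X by (simp add: compact_space_prod_topology)
    have 1: "continuous_map ?T (discrete_topology (carrier A)) (\<lambda>t. u (fst t) (cs (fst (snd t)) (snd (snd t))))"
      using u by (simp add: fam_def A_discrete)
    have 2: "continuous_map ?T (discrete_topology (carrier A)) (\<lambda>t. u g (cs (fst (snd t)) (snd (snd t))))"
      using continuous_map_compose[OF continuous_map_snd cu[OF g]] by (simp add: comp_def A_discrete)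
    have "openin (topo G) ?V" by (rule openin_all[OF cGX openin_discrete_eq[OF 1 2]])
    moreover have "g \<in> ?V" using g by (auto simp: ts)
    moreover have "F h = F g" if h: "h \<in> ?V" for h
    proof -
      have hG: "h \<in> carrier G" using h ts by blast
      have "u h (cs k x) = u g (cs k x)" if "k \<in> carrier G" "x \<in> topspace X" for k x
        using h that ts by auto
      then show ?thesis using F[OF hG] F[OF g] by (intro chom_Z_eqI) simp_all
    qed
    ultimately show "\<exists>V. openin (topo G) V \<and> g \<in> V \<and> (\<forall>h\<in>V. F h = F g)" by blast
  qed
  have "continuous_map (pow 1) (topo HZ.H) (\<lambda>z. F (z 0))"
    using continuous_map_compose[OF continuous_map_entry[of 0 1] cF] by (simp add: comp_def)
  from cochain_exists[OF gmodule_HZ _ HZ.pi_torsion_H[OF pi_torsion_A] this]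
  obtain \<eta> where \<eta>: "\<eta> \<in> Fam 1" "\<And>gs. gs \<in> lists (carrier G) \<Longrightarrow> length gs = 1 \<Longrightarrow> \<eta> (symb \<pi> G gs) = F (tuple gs 0)"
    by auto
  have "fn \<eta> g y = u g y" if "g \<in> carrier G" "y \<in> topspace Y" for g y
    using \<eta>(2)[of "[g]"] that F[OF that(1)] by (simp add: fn_def tuple_def)
  then show ?thesis using that \<eta>(1) by blast
qed

text \<open>The coboundary of a degree 1 cochain at the symbol \<open>[g, h]\<close> and the coset
  of \<open>k\<close>; the translation by the inverse of \<open>g\<close> comes from the diagonal
  action.\<close>

definition cob :: "('g \<Rightarrow> 'g set \<times> 'x \<Rightarrow> 'a) \<Rightarrow> 'g \<Rightarrow> 'g \<Rightarrow> 'g \<Rightarrow> 'x \<Rightarrow> 'a" where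
  "cob u g h k x = act g (u h (cs (inv\<^bsub>G\<^esub> g \<otimes>\<^bsub>G\<^esub> k) x)) \<otimes>\<^bsub>A\<^esub> inv\<^bsub>A\<^esub> u (g \<otimes>\<^bsub>G\<^esub> h) (cs k x) \<otimes>\<^bsub>A\<^esub> u g (cs k x)"

lemma Fam_val: "\<eta> \<in> Fam n \<Longrightarrow> c \<in> carrier (C n) \<Longrightarrow> \<eta> c \<in> chom Z A"
  using chomD(4)[OF homGD(1)] by fastforce

lemma Rel_val: "\<xi> \<in> Rel n \<Longrightarrow> c \<in> carrier (C n) \<Longrightarrow> \<xi> c \<in> chom D A"
  using chomD(4)[OF homGD(1)] by fastforce

lemma symb_1: "g \<in> carrier G \<Longrightarrow> symb \<pi> G [g] \<in> carrier (C 1)"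
  and symb_2: "g \<in> carrier G \<Longrightarrow> h \<in> carrier G \<Longrightarrow> symb \<pi> G [g, h] \<in> carrier (C 2)"
  and symb_0: "symb \<pi> G [] \<in> carrier (C 0)"
  by (rule symb_closed; simp)+

lemma cobdry_fn:
  assumes \<eta>: "\<eta> \<in> Fam 1" and g: "g \<in> carrier G" and h: "h \<in> carrier G" and k: "k \<in> carrier G" and x: "x \<in> topspace X"
  shows "cobdry \<pi> G 1 \<eta> (symb \<pi> G [g, h]) (pt (cs k x)) = cob (fn \<eta>) g h k x"
proof -
  note v = Fam_val[OF \<eta> symb_1]
  have Zc: "Zaction g (\<eta> (symb \<pi> G [h])) \<in> chom Z A" using Zaction_closed[OF g v[OF h]] .
  have ic: "inv\<^bsub>HZ.H\<^esub> (\<eta> (symb \<pi> G [g \<otimes>\<^bsub>G\<^esub> h])) \<in> chom Z A" using HZ.H.inv_closed[of "\<eta> (symb \<pi> G [g \<otimes>\<^bsub>G\<^esub> h])"] v g h by simp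
  show ?thesis
    unfolding cobdry_1_symb[OF HZ.hausdorff_abelian_H \<eta> g h] cob_def fn_def
    using k x g h v by (simp add: HZ.eval_inv Zaction_pt)
qed

section \<open>Restriction of cochains to the augmentation kernel\<close>

lemma in_star_apply: "c \<in> carrier (C n) \<Longrightarrow> in_star \<pi> G X S n \<eta> c = restrict (\<eta> c) (carrier D)"
  by (simp add: in_star_def)

lemma D_sub: "m \<in> carrier D \<Longrightarrow> m \<in> carrier Z" by (simp add: carrier_D)

lemma in_star_closed:
  assumes \<eta>: "\<eta> \<in> Fam n"
  shows "in_star \<pi> G X S n \<eta> \<in> Rel n"
proof -
  have "in_star \<pi> G X S n \<eta> \<in> chom (C n) HD.H"
    unfolding in_star_def
  proof (rule chom_restrictI[OF topspace_C group_C])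
    show "restrict (\<eta> c) (carrier D) \<in> carrier HD.H" if "c \<in> carrier (C n)" for c
      using chom_restrict_D[OF Fam_val[OF \<eta> that]] by simp
    show "restrict (\<eta> (c \<otimes>\<^bsub>C n\<^esub> d)) (carrier D) = restrict (\<eta> c) (carrier D) \<otimes>\<^bsub>HD.H\<^esub> restrict (\<eta> d) (carrier D)"
      if "c \<in> carrier (C n)" "d \<in> carrier (C n)" for c d
      using chomD(5)[OF homGD(1)[OF \<eta>] that] by (auto simp: restrict_def fun_eq_iff D_sub)
    have "continuous_map (topo HZ.H) (topo HD.H) (\<lambda>f. restrict f (carrier D))"
      using chom_restrict_D by auto
    from continuous_map_compose[OF chomD(3)[OF homGD(1)[OF \<eta>]] this]
    show "continuous_map (topo (C n)) (topo HD.H) (\<lambda>c. restrict (\<eta> c) (carrier D))" by (simp add: comp_def)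
  qed
  moreover have "in_star \<pi> G X S n \<eta> (std_act G n g c) = Daction g (in_star \<pi> G X S n \<eta> c)"
    if "g \<in> carrier G" "c \<in> carrier (C n)" for g c
    using that homGD(2)[OF \<eta> that] by (simp add: in_star_apply std_act(1) Daction_restrict)
  ultimately show ?thesis by (simp add: homG_def)
qed

text \<open>Extensions to \<open>Z\<close> are chosen by an arbitrary function
  \<open>\<sigma>\<close>, which is continuous because its domain is discrete. Additivity and
  equivariance are recovered afterwards, since the cochain is rebuilt from its values on
  symbols.\<close>

lemma in_star_surj:
  assumes \<xi>: "\<xi> \<in> Rel n"
  obtains \<eta> where "\<eta> \<in> Fam n" "in_star \<pi> G X S n \<eta> = \<xi>"
proof -
  define \<sigma> where "\<sigma> f = (SOME f'. f' \<in> chom Z A \<and> restrict f' (carrier D) = f)" for f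
  have \<sigma>: "\<sigma> f \<in> chom Z A \<and> restrict (\<sigma> f) (carrier D) = f" if "f \<in> chom D A" for f
  proof -
    have "\<exists>f'. f' \<in> chom Z A \<and> restrict f' (carrier D) = f" using chom_D_extends[OF that] by metis
    then show ?thesis unfolding \<sigma>_def by (rule someI_ex)
  qed
  have "continuous_map (topo HD.H) (topo HZ.H) \<sigma>" using \<sigma> by auto
  from continuous_map_compose[OF continuous_map_symb[OF \<xi>] this]
  have "continuous_map (pow n) (topo HZ.H) (\<lambda>z. \<sigma> (\<xi> (cgen n \<one>\<^bsub>G\<^esub> z)))" by (simp add: comp_def)
  from cochain_exists[OF gmodule_HZ _ HZ.pi_torsion_H[OF pi_torsion_A] this]
  obtain \<eta> where \<eta>: "\<eta> \<in> Fam n" "\<And>gs. gs \<in> lists (carrier G) \<Longrightarrow> length gs = n \<Longrightarrow> \<eta> (symb \<pi> G gs) = \<sigma> (\<xi> (cgen n \<one>\<^bsub>G\<^esub> (tuple gs)))"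
    by auto
  have "in_star \<pi> G X S n \<eta> = \<xi>"
  proof (rule homG_eqI[OF HD.hausdorff_abelian_H in_star_closed[OF \<eta>(1)] \<xi>])
    fix gs assume gs: "gs \<in> lists (carrier G)" "length gs = n"
    have "\<eta> (symb \<pi> G gs) = \<sigma> (\<xi> (symb \<pi> G gs))" using \<eta>(2)[OF gs] gs by (simp add: symb_eq)
    then show "in_star \<pi> G X S n \<eta> (symb \<pi> G gs) = \<xi> (symb \<pi> G gs)"
      using \<sigma>[OF Rel_val[OF \<xi> symb_closed[OF gs]]] by (simp add: in_star_apply symb_closed[OF gs])
  qed
  then show ?thesis using that \<eta>(1) by blast
qed

lemma cobdry_in_star:
  "cobdry \<pi> G n (in_star \<pi> G X S n \<eta>) = in_star \<pi> G X S (Suc n) (cobdry \<pi> G n \<eta>)"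
  using chomD(4)[OF homGD(1)[OF boundary(1)]]
  by (auto simp: cobdry_def compose_def in_star_def restrict_def fun_eq_iff)

text \<open>The homomorphism with the constant value \<open>a\<close> at all points of the coset
  space.\<close>

definition cst :: "'a \<Rightarrow> ('g, 'x) zcosets \<Rightarrow> 'a" where
  "cst a = compose (carrier Z) (Zpi_scale \<pi> A a) eps"

lemma cst:
  assumes a: "a \<in> carrier A"
  shows "cst a \<in> chom Z A" "y \<in> topspace Y \<Longrightarrow> cst a (pt y) = a"
proof -
  note sc = Zpi_scale[OF \<pi> A.comm_group_axioms A_discrete pi_torsion_A a]
  have "restrict eps (carrier Z) \<in> chom Z (Zpi \<pi>)"
    using eps_hom group_hom.hom_mult[OF eps_group_hom] eps_closed
    by (intro chom_restrictI[OF Z.topspace_M Z.M.is_group]) auto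
  from chom_compose[OF Z.M.is_group Z.topspace_M this sc(1)]
  have "compose (carrier Z) (Zpi_scale \<pi> A a) (restrict eps (carrier Z)) \<in> chom Z A" .
  moreover have "compose (carrier Z) (Zpi_scale \<pi> A a) (restrict eps (carrier Z)) = cst a"
    by (auto simp: cst_def compose_def restrict_def fun_eq_iff)
  ultimately show "cst a \<in> chom Z A" by simp
  show "y \<in> topspace Y \<Longrightarrow> cst a (pt y) = a" using sc(2) by (simp add: cst_def compose_def eps_pt)
qed

section \<open>Cochains that are constant along the coset space\<close>

lemma ev_star_apply: "c \<in> carrier (C n) \<Longrightarrow> ev_star \<pi> G X S A n \<zeta> c = cst (\<zeta> c)"
  by (simp add: ev_star_def cst_def)

lemma ev_star_closed:
  assumes \<zeta>: "\<zeta> \<in> Coch n"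
  shows "ev_star \<pi> G X S A n \<zeta> \<in> Fam n"
proof -
  have val: "\<zeta> c \<in> carrier A" if "c \<in> carrier (C n)" for c using chomD(4)[OF homGD(1)[OF \<zeta>] that] .
  have eq: "ev_star \<pi> G X S A n \<zeta> = restrict (\<lambda>c. cst (\<zeta> c)) (carrier (C n))"
    by (simp add: ev_star_def cst_def)
  have "ev_star \<pi> G X S A n \<zeta> \<in> chom (C n) HZ.H"
    unfolding eq
  proof (rule chom_restrictI[OF topspace_C group_C])
    show "cst (\<zeta> c) \<in> carrier HZ.H" if "c \<in> carrier (C n)" for c using cst(1)[OF val[OF that]] by simp
    show "cst (\<zeta> (c \<otimes>\<^bsub>C n\<^esub> d)) = cst (\<zeta> c) \<otimes>\<^bsub>HZ.H\<^esub> cst (\<zeta> d)"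
      if c: "c \<in> carrier (C n)" and d: "d \<in> carrier (C n)" for c d
    proof (rule chom_Z_eqI)
      show "cst (\<zeta> (c \<otimes>\<^bsub>C n\<^esub> d)) \<in> chom Z A"
        using cst(1) val c d chomD(5)[OF homGD(1)[OF \<zeta>] c d] by simp
      show "cst (\<zeta> c) \<otimes>\<^bsub>HZ.H\<^esub> cst (\<zeta> d) \<in> chom Z A"
        using HZ.mult_closed cst(1) val c d by simp
    qed (use cst val c d chomD(5)[OF homGD(1)[OF \<zeta>] c d] in simp)
    have "continuous_map (topo A) (topo HZ.H) cst" unfolding A_discrete using cst(1) by auto
    from continuous_map_compose[OF chomD(3)[OF homGD(1)[OF \<zeta>]] this]
    show "continuous_map (topo (C n)) (topo HZ.H) (\<lambda>c. cst (\<zeta> c))" by (simp add: comp_def)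
  qed
  moreover have "ev_star \<pi> G X S A n \<zeta> (std_act G n g c) = Zaction g (ev_star \<pi> G X S A n \<zeta> c)"
    if g: "g \<in> carrier G" and c: "c \<in> carrier (C n)" for g c
  proof -
    have "cst (act g (\<zeta> c)) = Zaction g (cst (\<zeta> c))"
      using val[OF c] g cst by (intro chom_Z_eqI Zaction_closed) (simp_all add: Zaction_pt)
    then show ?thesis using homGD(2)[OF \<zeta> g c] std_act(1)[OF g c] c by (simp add: ev_star_apply)
  qed
  ultimately show ?thesis by (simp add: homG_def)
qed

lemma list2_cases: "gs \<in> lists (carrier G) \<Longrightarrow> length gs = 2 \<Longrightarrow> (\<And>g h. gs = [g, h] \<Longrightarrow> g \<in> carrier G \<Longrightarrow> h \<in> carrier G \<Longrightarrow> thesis) \<Longrightarrow> thesis"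
  by (cases gs; cases "tl gs") auto

lemma list1_cases: "gs \<in> lists (carrier G) \<Longrightarrow> length gs = 1 \<Longrightarrow> (\<And>g. gs = [g] \<Longrightarrow> g \<in> carrier G \<Longrightarrow> thesis) \<Longrightarrow> thesis"
  by (cases gs) auto

text \<open>Both cochains are determined by their values on symbols and points; there
  \<open>ev_star\<close> is constant in the point and the coboundary is given by
  \<open>cob\<close>.\<close>

lemma ev_star_eq_iff:
  assumes \<eta>: "\<eta> \<in> Fam 1" and \<zeta>: "\<zeta> \<in> Coch 2"
  shows "ev_star \<pi> G X S A 2 \<zeta> = cobdry \<pi> G 1 \<eta> \<longleftrightarrow>
    (\<forall>g\<in>carrier G. \<forall>h\<in>carrier G. \<forall>k\<in>carrier G. \<forall>x\<in>topspace X. \<zeta> (symb \<pi> G [g, h]) = cob (fn \<eta>) g h k x)"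
    (is "?L \<longleftrightarrow> ?R")
proof
  have val: "\<zeta> (symb \<pi> G [g, h]) \<in> carrier A" if "g \<in> carrier G" "h \<in> carrier G" for g h
    using chomD(4)[OF homGD(1)[OF \<zeta>] symb_2[OF that]] .
  have dF: "cobdry \<pi> G 1 \<eta> \<in> Fam 2" using cobdry_homG[OF \<eta>] by (simp add: numeral_2_eq_2)
  show ?R if L: ?L
  proof (intro ballI)
    fix g h k x assume gh: "g \<in> carrier G" "h \<in> carrier G" and kx: "k \<in> carrier G" "x \<in> topspace X"
    have "cob (fn \<eta>) g h k x = ev_star \<pi> G X S A 2 \<zeta> (symb \<pi> G [g, h]) (pt (cs k x))"
      using cobdry_fn[OF \<eta> gh kx] L by simp
    also have "\<dots> = \<zeta> (symb \<pi> G [g, h])" using gh kx cst(2)[OF val[OF gh]] by (simp add: ev_star_apply symb_2)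
    finally show "\<zeta> (symb \<pi> G [g, h]) = cob (fn \<eta>) g h k x" by simp
  qed
  show ?L if R: ?R
  proof (rule homG_eqI[OF HZ.hausdorff_abelian_H ev_star_closed[OF \<zeta>] dF])
    fix gs assume gs: "gs \<in> lists (carrier G)" "length gs = 2"
    then obtain g h where gh: "gs = [g, h]" "g \<in> carrier G" "h \<in> carrier G" by (rule list2_cases)
    note v = symb_2[OF gh(2,3)]
    show "ev_star \<pi> G X S A 2 \<zeta> (symb \<pi> G gs) = cobdry \<pi> G 1 \<eta> (symb \<pi> G gs)"
      unfolding gh(1)
    proof (rule chom_Z_eqI[OF Fam_val[OF ev_star_closed[OF \<zeta>] v] Fam_val[OF dF v]])
      fix k x assume kx: "k \<in> carrier G" "x \<in> topspace X"
      show "ev_star \<pi> G X S A 2 \<zeta> (symb \<pi> G [g, h]) (pt (cs k x)) = cobdry \<pi> G 1 \<eta> (symb \<pi> G [g, h]) (pt (cs k x))"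
        using R[rule_format, OF gh(2,3) kx] cst(2)[OF val[OF gh(2,3)] cs_mem[OF kx]]
        by (simp only: ev_star_apply[OF v] cobdry_fn[OF \<eta> gh(2,3) kx])
    qed
  qed
qed

lemma ev_star_inject:
  assumes "\<zeta> \<in> Coch n" "\<zeta>' \<in> Coch n" "ev_star \<pi> G X S A n \<zeta> = ev_star \<pi> G X S A n \<zeta>'"
  shows "\<zeta> = \<zeta>'"
proof (rule extensionalityI[OF chomD(2)[OF homGD(1)[OF assms(1)]] chomD(2)[OF homGD(1)[OF assms(2)]]])
  fix c assume c: "c \<in> carrier (C n)"
  have "cst (\<zeta> c) (pt y0) = cst (\<zeta>' c) (pt y0)" using assms(3) ev_star_apply[OF c] by metis
  then show "\<zeta> c = \<zeta>' c"
    using cst(2)[OF chomD(4)[OF homGD(1)[OF assms(1)] c] y0] cst(2)[OF chomD(4)[OF homGD(1)[OF assms(2)] c] y0] by simp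
qed

lemma rel_cocycles_carrier:
  "carrier (rel_cocycles \<pi> G X S A act 2) = {\<xi> \<in> Rel 1. cobdry \<pi> G 1 \<xi> = (\<lambda>c\<in>carrier (C 2). \<one>\<^bsub>HD.H\<^esub>)}"
  by (simp add: rel_cocycles_def cocycles_def kernel_def cochains_def numeral_2_eq_2 del: hom_module_sel)

lemma ball_Y: "(\<forall>y\<in>topspace Y. P y) \<longleftrightarrow> (\<forall>k\<in>carrier G. \<forall>x\<in>topspace X. P (cs k x))"
  unfolding topspace_Y by blast

text \<open>The restriction of the coboundary to \<open>Delta\<close> vanishes exactly when the
  coboundary is constant in the coset, by \<open>constant_iff_trivial_on_D\<close>; the constant is
  named by its value at \<open>y0\<close>.\<close>

lemma cocycle_iff:
  assumes \<eta>: "\<eta> \<in> Fam 1"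
  shows "in_star \<pi> G X S 1 \<eta> \<in> carrier (rel_cocycles \<pi> G X S A act 2) \<longleftrightarrow>
    (\<forall>g\<in>carrier G. \<forall>h\<in>carrier G. \<forall>k\<in>carrier G. \<forall>x\<in>topspace X.
      cobdry \<pi> G 1 \<eta> (symb \<pi> G [g, h]) (pt y0) = cob (fn \<eta>) g h k x)"
    (is "?L \<longleftrightarrow> ?R")
proof -
  have dF: "cobdry \<pi> G 1 \<eta> \<in> Fam 2" using cobdry_homG[OF \<eta>] by (simp add: numeral_2_eq_2)
  have one: "(\<lambda>c\<in>carrier (C 2). \<one>\<^bsub>HD.H\<^esub>) \<in> Rel 2"
  proof -
    interpret HC: hom_group "C 2" "HD.H" by unfold_locales (rule hausdorff_abelian_C HD.hausdorff_abelian_H)+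
    show ?thesis using HC.one_closed std_act(1)
      by (auto simp: homG_def hom_act_def restrict_def fun_eq_iff carrier_D Zact(1) eps_Zact)
  qed
  have "cobdry \<pi> G 1 (in_star \<pi> G X S 1 \<eta>) = in_star \<pi> G X S 2 (cobdry \<pi> G 1 \<eta>)"
    using cobdry_in_star[of 1 \<eta>] by (simp only: Suc_1)
  then have "?L \<longleftrightarrow> in_star \<pi> G X S 2 (cobdry \<pi> G 1 \<eta>) = (\<lambda>c\<in>carrier (C 2). \<one>\<^bsub>HD.H\<^esub>)"
    unfolding rel_cocycles_carrier using in_star_closed[OF \<eta>] by (simp only: mem_Collect_eq simp_thms)
  also have "\<dots> \<longleftrightarrow> (\<forall>g\<in>carrier G. \<forall>h\<in>carrier G. restrict (cobdry \<pi> G 1 \<eta> (symb \<pi> G [g, h])) (carrier D) = \<one>\<^bsub>HD.H\<^esub>)"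
    (is "?A \<longleftrightarrow> ?B")
  proof
    show ?B if ?A
    proof (intro ballI)
      fix g h assume gh: "g \<in> carrier G" "h \<in> carrier G"
      show "restrict (cobdry \<pi> G 1 \<eta> (symb \<pi> G [g, h])) (carrier D) = \<one>\<^bsub>HD.H\<^esub>"
        using fun_cong[OF \<open>?A\<close>, of "symb \<pi> G [g, h]"] symb_2[OF gh] by (simp only: in_star_apply restrict_apply' if_True)
    qed
    show ?A if B: ?B
    proof (rule homG_eqI[OF HD.hausdorff_abelian_H in_star_closed[OF dF] one])
      fix gs assume "gs \<in> lists (carrier G)" "length gs = 2"
      then obtain g h where gh: "gs = [g, h]" "g \<in> carrier G" "h \<in> carrier G" by (rule list2_cases)
      show "in_star \<pi> G X S 2 (cobdry \<pi> G 1 \<eta>) (symb \<pi> G gs) = (\<lambda>c\<in>carrier (C 2). \<one>\<^bsub>HD.H\<^esub>) (symb \<pi> G gs)"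
        using B gh symb_2[OF gh(2,3)] by (simp only: in_star_apply restrict_apply' if_True)
    qed
  qed
  also have "\<dots> \<longleftrightarrow> (\<forall>g\<in>carrier G. \<forall>h\<in>carrier G. \<forall>m\<in>carrier D. cobdry \<pi> G 1 \<eta> (symb \<pi> G [g, h]) m = \<one>\<^bsub>A\<^esub>)"
    by (auto simp: restrict_def fun_eq_iff)
  also have "\<dots> \<longleftrightarrow> (\<forall>g\<in>carrier G. \<forall>h\<in>carrier G. \<forall>y\<in>topspace Y.
      cobdry \<pi> G 1 \<eta> (symb \<pi> G [g, h]) (pt y) = cobdry \<pi> G 1 \<eta> (symb \<pi> G [g, h]) (pt y0))"
    using constant_iff_trivial_on_D[OF Fam_val[OF dF symb_2]] by blast
  also have "\<dots> \<longleftrightarrow> ?R"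
    unfolding ball_Y by (intro ball_cong refl) (metis cobdry_fn[OF \<eta>])
  finally show ?thesis .
qed

text \<open>The candidate is the coboundary evaluated at the single coset \<open>y0\<close>.
  Evaluation there is not equivariant, so the cochain is built from its values on symbols; constancy
  in the coset then gives the equation.\<close>

lemma zeta_exists:
  assumes \<eta>: "\<eta> \<in> Fam 1" and \<xi>: "in_star \<pi> G X S 1 \<eta> \<in> carrier (rel_cocycles \<pi> G X S A act 2)"
  obtains \<zeta> where "\<zeta> \<in> Coch 2" "ev_star \<pi> G X S A 2 \<zeta> = cobdry \<pi> G 1 \<eta>"
proof -
  have dF: "cobdry \<pi> G 1 \<eta> \<in> Fam 2" using cobdry_homG[OF \<eta>] by (simp add: numeral_2_eq_2)
  have "continuous_map (topo HZ.H) (topo A) (\<lambda>f. f (pt y0))" using chomD(4) by (auto simp: A_discrete)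
  from continuous_map_compose[OF continuous_map_symb[OF dF] this]
  have "continuous_map (pow 2) (topo A) (\<lambda>z. cobdry \<pi> G 1 \<eta> (cgen 2 \<one>\<^bsub>G\<^esub> z) (pt y0))" by (simp add: comp_def)
  from cochain_exists[OF gmod A_discrete pi_torsion_A this]
  obtain \<zeta> where \<zeta>: "\<zeta> \<in> Coch 2" "\<And>gs. gs \<in> lists (carrier G) \<Longrightarrow> length gs = 2 \<Longrightarrow>
      \<zeta> (symb \<pi> G gs) = cobdry \<pi> G 1 \<eta> (cgen 2 \<one>\<^bsub>G\<^esub> (tuple gs)) (pt y0)"
    by auto
  have "\<zeta> (symb \<pi> G [g, h]) = cobdry \<pi> G 1 \<eta> (symb \<pi> G [g, h]) (pt y0)" if "g \<in> carrier G" "h \<in> carrier G" for g h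
    using \<zeta>(2)[of "[g, h]"] that by (simp add: symb_eq numeral_2_eq_2)
  then have "ev_star \<pi> G X S A 2 \<zeta> = cobdry \<pi> G 1 \<eta>"
    using \<xi> unfolding ev_star_eq_iff[OF \<eta> \<zeta>(1)] cocycle_iff[OF \<eta>] by metis
  then show ?thesis using that \<zeta>(1) by blast
qed

section \<open>Cohomologous relative cocycles\<close>

lemma HCD: "hom_group (C n) HD.H"
  by unfold_locales (rule hausdorff_abelian_C HD.hausdorff_abelian_H)+

lemma Daction_group_hom: "g \<in> carrier G \<Longrightarrow> group_hom HD.H HD.H (Daction g)"
  using gmodule_HD HD.H.is_group by (simp add: gmodule_def group_hom_def group_hom_axioms_def)

lemma Rel_subgroup: "subgroup (Rel n) (hom_module (C n) HD.H)"
proof -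
  interpret HC: hom_group "C n" "HD.H" by (rule HCD)
  show ?thesis
  proof (rule HC.H.subgroupI)
    show "Rel n \<subseteq> carrier HC.H" using homGD(1) by auto
    have "(\<lambda>c\<in>carrier (C n). \<one>\<^bsub>HD.H\<^esub>) \<in> Rel n"
      using HC.one_closed std_act(1) group_hom.hom_one[OF Daction_group_hom] by (simp add: homG_def del: hom_module_sel)
    then show "Rel n \<noteq> {}" by blast
  next
    fix f assume f: "f \<in> Rel n"
    have "inv\<^bsub>HC.H\<^esub> f \<in> chom (C n) HD.H" using HC.H.inv_closed[of f] homGD(1)[OF f] by simp
    then show "inv\<^bsub>HC.H\<^esub> f \<in> Rel n"
      using HC.eval_inv[OF homGD(1)[OF f]] homGD(2)[OF f] std_act(1) group_hom.hom_inv[OF Daction_group_hom]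
        chomD(4)[OF homGD(1)[OF f]] by (simp add: homG_def del: hom_module_sel)
  next
    fix f h assume f: "f \<in> Rel n" and h: "h \<in> Rel n"
    have "f \<otimes>\<^bsub>HC.H\<^esub> h \<in> carrier HC.H" by (rule HC.H.m_closed) (use homGD(1) f h in auto)
    then have "f \<otimes>\<^bsub>HC.H\<^esub> h \<in> chom (C n) HD.H" by (simp only: hom_module_sel(1))
    then show "f \<otimes>\<^bsub>HC.H\<^esub> h \<in> Rel n"
      using homGD(2)[OF f] homGD(2)[OF h] std_act(1) group_hom.hom_mult[OF Daction_group_hom]
        chomD(4)[OF homGD(1)[OF f]] chomD(4)[OF homGD(1)[OF h]]
      by (simp add: homG_def hom_module_sel(2)[of "C n"] del: hom_module_sel)
  qed
qed

lemma cobdry_group_hom: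
  "group_hom (hom_module (C n) HD.H) (hom_module (C (Suc n)) HD.H) (cobdry \<pi> G n)"
proof -
  interpret H1: hom_group "C n" "HD.H" by (rule HCD)
  interpret H2: hom_group "C (Suc n)" "HD.H" by (rule HCD)
  note b = homGD(1)[OF boundary(1)[of n]]
  show ?thesis
    unfolding group_hom_def group_hom_axioms_def
  proof (intro conjI H1.H.is_group H2.H.is_group homI)
    show "cobdry \<pi> G n f \<in> carrier H2.H" if "f \<in> carrier H1.H" for f
      using chom_compose[OF group_C topspace_C b, of f] that by (simp add: cobdry_def)
    show "cobdry \<pi> G n (f \<otimes>\<^bsub>H1.H\<^esub> h) = cobdry \<pi> G n f \<otimes>\<^bsub>H2.H\<^esub> cobdry \<pi> G n h" if "f \<in> carrier H1.H" "h \<in> carrier H1.H" for f h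
      unfolding hom_module_sel(2)[of "C n"] hom_module_sel(2)[of "C (Suc n)"] cobdry_def compose_def
      using chomD(4)[OF b] by (intro restrict_ext) simp
  qed
qed

text \<open>Classes are cosets of the coboundaries, and these cosets may be formed in the larger
  group of all continuous homomorphisms, where the group laws are already available.\<close>

lemma rel_class_eq_iff:
  assumes \<xi>: "\<xi> \<in> Rel 1" and \<xi>': "\<xi>' \<in> Rel 1"
  shows "rel_class \<pi> G X S A act 2 \<xi> = rel_class \<pi> G X S A act 2 \<xi>' \<longleftrightarrow>
    (\<exists>w\<in>Rel 0. \<xi>' = cobdry \<pi> G 0 w \<otimes>\<^bsub>hom_module (C 1) HD.H\<^esub> \<xi>)"
proof -
  interpret H0: hom_group "C 0" "HD.H" by (rule HCD)
  interpret H1: hom_group "C 1" "HD.H" by (rule HCD)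
  interpret d: group_hom H0.H H1.H "cobdry \<pi> G 0" using cobdry_group_hom[of 0] by simp
  define B where "B = cobdry \<pi> G 0 ` Rel 0"
  have B: "subgroup B H1.H" unfolding B_def by (rule d.subgroup_img_is_subgroup[OF Rel_subgroup])
  have cl: "rel_class \<pi> G X S A act 2 \<theta> = B #>\<^bsub>H1.H\<^esub> \<theta>" for \<theta>
    by (simp add: rel_class_def cohomology_class_def coboundaries_def cocycles_def cochains_def r_coset_def B_def del: hom_module_sel)
      (simp add: hom_module_sel(2)[of "C (Suc 0)"] del: hom_module_sel)
  have car: "\<xi> \<in> carrier H1.H" "\<xi>' \<in> carrier H1.H" using homGD(1) \<xi> \<xi>' by auto
  have "B #>\<^bsub>H1.H\<^esub> \<xi> = B #>\<^bsub>H1.H\<^esub> \<xi>' \<longleftrightarrow> \<xi>' \<in> B #>\<^bsub>H1.H\<^esub> \<xi>"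
    using H1.H.repr_independence[OF _ car(1) B] H1.H.rcos_self[OF car(2) B] by auto
  then show ?thesis unfolding cl by (simp add: r_coset_def B_def)
qed

text \<open>\<open>w\<close> is a lift to \<open>Z\<close> of a degree 0 cochain on
  \<open>Delta\<close>, and \<open>b\<close> is the constant by which two homomorphisms with the
  same restriction to \<open>Delta\<close> may differ.\<close>

definition cohomologous :: "('g \<Rightarrow> 'g set \<times> 'x \<Rightarrow> 'a) \<Rightarrow> ('g \<Rightarrow> 'g set \<times> 'x \<Rightarrow> 'a) \<Rightarrow> bool" where
  "cohomologous u u' \<longleftrightarrow> (\<exists>b w. continuous_map (topo G) (topo A) b \<and>
     continuous_map GX (topo A) (\<lambda>z. w (cs (fst z) (snd z))) \<and>
     (\<forall>g\<in>carrier G. \<forall>k\<in>carrier G. \<forall>x\<in>topspace X.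
        u' g (cs k x) = b g \<otimes>\<^bsub>A\<^esub> (act g (w (cs (inv\<^bsub>G\<^esub> g \<otimes>\<^bsub>G\<^esub> k) x)) \<otimes>\<^bsub>A\<^esub> inv\<^bsub>A\<^esub> w (cs k x) \<otimes>\<^bsub>A\<^esub> u g (cs k x))))"

text \<open>\<open>L f g\<close> is \<open>\<eta>\<close> changed by the coboundary of
  \<open>f\<close>, computed on all of \<open>Z\<close>, and \<open>K f g\<close> is its discrepancy
  from \<open>\<eta>'\<close>. Equality of classes says that \<open>K\<close> is trivial on
  \<open>Delta\<close> for some \<open>f\<close>; being cohomologous says that it is constant on
  points. The two agree by \<open>constant_iff_trivial_on_D\<close>.\<close>

lemma rel_class_eq_cohomologous:
  assumes \<eta>: "\<eta> \<in> Fam 1" and \<eta>': "\<eta>' \<in> Fam 1"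
  shows "rel_class \<pi> G X S A act 2 (in_star \<pi> G X S 1 \<eta>) = rel_class \<pi> G X S A act 2 (in_star \<pi> G X S 1 \<eta>') \<longleftrightarrow>
    cohomologous (fn \<eta>) (fn \<eta>')"
proof -
  interpret H1: hom_group "C 1" "HD.H" by (rule HCD)
  let ?\<xi> = "in_star \<pi> G X S 1 \<eta>" and ?\<xi>' = "in_star \<pi> G X S 1 \<eta>'"
  note \<xi> = in_star_closed[OF \<eta>] and \<xi>' = in_star_closed[OF \<eta>']
  define L where "L f g = Zaction g f \<otimes>\<^bsub>HZ.H\<^esub> inv\<^bsub>HZ.H\<^esub> f \<otimes>\<^bsub>HZ.H\<^esub> \<eta> (symb \<pi> G [g])" for f g
  have Lc: "L f g \<in> carrier HZ.H" if "f \<in> chom Z A" "g \<in> carrier G" for f g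
    unfolding L_def using that Zaction_closed Fam_val[OF \<eta> symb_1]
    by (intro HZ.H.m_closed HZ.H.inv_closed) simp_all
  have Lval: "L f g m = Zaction g f m \<otimes>\<^bsub>A\<^esub> inv\<^bsub>A\<^esub> f m \<otimes>\<^bsub>A\<^esub> \<eta> (symb \<pi> G [g]) m"
    if "f \<in> chom Z A" "m \<in> carrier Z" for f g m
    using that by (simp add: L_def HZ.eval_inv)
  have key: "cobdry \<pi> G 0 w (symb \<pi> G [g]) \<otimes>\<^bsub>HD.H\<^esub> ?\<xi> (symb \<pi> G [g]) = restrict (L f g) (carrier D)"
    if w: "w \<in> Rel 0" and f: "f \<in> chom Z A" "w (symb \<pi> G []) = restrict f (carrier D)" and g: "g \<in> carrier G" for w f g
  proof (rule HD.ext)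
    note rf = chom_restrict_D[OF f(1)]
    have inv_c: "inv\<^bsub>HD.H\<^esub> (restrict f (carrier D)) \<in> carrier HD.H" using rf by (intro HD.H.inv_closed) simp
    have x_c: "?\<xi> (symb \<pi> G [g]) \<in> carrier HD.H" using Rel_val[OF \<xi> symb_1[OF g]] by simp
    have D_c: "Daction g (restrict f (carrier D)) \<in> carrier HD.H"
      using Daction_restrict[OF g] chom_restrict_D[OF Zaction_closed[OF g f(1)]] by simp
    have eq: "cobdry \<pi> G 0 w (symb \<pi> G [g]) = Daction g (restrict f (carrier D)) \<otimes>\<^bsub>HD.H\<^esub> inv\<^bsub>HD.H\<^esub> (restrict f (carrier D))"
      using cobdry_0_symb[OF HD.hausdorff_abelian_H w g] f(2) by simp
    have c1: "cobdry \<pi> G 0 w (symb \<pi> G [g]) \<in> carrier HD.H"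
      unfolding eq by (rule HD.H.m_closed[OF D_c inv_c])
    show "cobdry \<pi> G 0 w (symb \<pi> G [g]) \<otimes>\<^bsub>HD.H\<^esub> ?\<xi> (symb \<pi> G [g]) \<in> chom D A"
      using HD.H.m_closed[OF c1 x_c] by (simp only: hom_module_sel(1))
    show "restrict (L f g) (carrier D) \<in> chom D A" using chom_restrict_D Lc[OF f(1) g] by simp
    fix m assume m: "m \<in> carrier D"
    have e1: "(inv\<^bsub>HD.H\<^esub> (restrict f (carrier D))) m = inv\<^bsub>A\<^esub> f m" using HD.eval_inv[OF rf m] m by simp
    have e2: "Daction g (restrict f (carrier D)) m = Zaction g f m" using Daction_restrict[OF g] m by simp
    have e3: "?\<xi> (symb \<pi> G [g]) m = \<eta> (symb \<pi> G [g]) m"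
      unfolding in_star_apply[OF symb_1[OF g]] using m by simp
    show "(cobdry \<pi> G 0 w (symb \<pi> G [g]) \<otimes>\<^bsub>HD.H\<^esub> ?\<xi> (symb \<pi> G [g])) m = restrict (L f g) (carrier D) m"
      unfolding eq using m by (simp add: e1 e2 e3[simplified] Lval[OF f(1) D_sub[OF m]])
  qed
  have Lpt: "L f g (pt (cs k x)) = act g (f (pt (cs (inv\<^bsub>G\<^esub> g \<otimes>\<^bsub>G\<^esub> k) x))) \<otimes>\<^bsub>A\<^esub> inv\<^bsub>A\<^esub> f (pt (cs k x)) \<otimes>\<^bsub>A\<^esub> fn \<eta> g (cs k x)"
    if "f \<in> chom Z A" "g \<in> carrier G" "k \<in> carrier G" "x \<in> topspace X" for f g k x
    using that by (simp add: Lval Zaction_pt fn_def)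
  define K where "K f g = \<eta>' (symb \<pi> G [g]) \<otimes>\<^bsub>HZ.H\<^esub> inv\<^bsub>HZ.H\<^esub> L f g" for f g
  have Kc: "K f g \<in> chom Z A" if "f \<in> chom Z A" "g \<in> carrier G" for f g
  proof -
    have "K f g \<in> carrier HZ.H"
      unfolding K_def using Lc[OF that] Fam_val[OF \<eta>' symb_1[OF that(2)]]
      by (intro HZ.H.m_closed HZ.H.inv_closed) simp_all
    then show ?thesis by simp
  qed
  have Kval: "K f g m = \<eta>' (symb \<pi> G [g]) m \<otimes>\<^bsub>A\<^esub> inv\<^bsub>A\<^esub> L f g m"
    if "f \<in> chom Z A" "g \<in> carrier G" "m \<in> carrier Z" for f g m
    using that HZ.eval_inv[of "L f g" m] Lc[OF that(1,2)] by (simp add: K_def)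
  have eqK: "\<eta>' (symb \<pi> G [g]) m = K f g m \<otimes>\<^bsub>A\<^esub> L f g m" if "f \<in> chom Z A" "g \<in> carrier G" "m \<in> carrier Z" for f g m
    using that Kval[OF that] Lc[OF that(1,2)] Fam_val[OF \<eta>' symb_1[OF that(2)]] by (simp add: A.m_assoc)
  have K1: "K f g m = \<one>\<^bsub>A\<^esub> \<longleftrightarrow> \<eta>' (symb \<pi> G [g]) m = L f g m" if "f \<in> chom Z A" "g \<in> carrier G" "m \<in> carrier Z" for f g m
    using eqK[OF that] Kc[OF that(1,2)] that Lc[OF that(1,2)] by (auto simp: A.l_cancel_one)
  show ?thesis
    unfolding rel_class_eq_iff[OF \<xi> \<xi>']
  proof
    assume "\<exists>w\<in>Rel 0. ?\<xi>' = cobdry \<pi> G 0 w \<otimes>\<^bsub>H1.H\<^esub> ?\<xi>"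
    then obtain w where w: "w \<in> Rel 0" "?\<xi>' = cobdry \<pi> G 0 w \<otimes>\<^bsub>H1.H\<^esub> ?\<xi>" by blast
    obtain f where f: "f \<in> chom Z A" "restrict f (carrier D) = w (symb \<pi> G [])"
      using chom_D_extends[OF Rel_val[OF w(1) symb_0]] .
    have KD: "K f g m = \<one>\<^bsub>A\<^esub>" if g: "g \<in> carrier G" and m: "m \<in> carrier D" for g m
    proof -
      have "?\<xi>' (symb \<pi> G [g]) = restrict (L f g) (carrier D)"
        using key[OF w(1) f(1) f(2)[symmetric] g] w(2) symb_1[OF g] by (simp add: hom_module_sel(2)[of "C (Suc 0)"] del: hom_module_sel)
      then have "restrict (\<eta>' (symb \<pi> G [g])) (carrier D) m = restrict (L f g) (carrier D) m"
        using in_star_apply[OF symb_1[OF g]] by metis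
      then show ?thesis using K1[OF f(1) g D_sub[OF m]] m by simp
    qed
    have Kconst: "K f g (pt y) = K f g (pt y0)" if "g \<in> carrier G" "y \<in> topspace Y" for g y
      using constant_iff_trivial_on_D[OF Kc[OF f(1) that(1)]] KD[OF that(1)] that(2) by blast
    obtain k0 x0 where kx0: "y0 = cs k0 x0" "k0 \<in> carrier G" "x0 \<in> topspace X" using y0 unfolding topspace_Y by blast
    \<comment> \<open>The discrepancy is constant in the coset; reading it off at \<open>y0\<close>
      gives an explicit formula that shows continuity in \<open>g\<close>.\<close>
    let ?b = "\<lambda>g. K f g (pt y0)"
    have "continuous_map (topo G) (topo A) (\<lambda>g. fn \<eta>' g (cs k0 x0) \<otimes>\<^bsub>A\<^esub>
        inv\<^bsub>A\<^esub> (act g (f (pt (cs (inv\<^bsub>G\<^esub> g \<otimes>\<^bsub>G\<^esub> k0) x0))) \<otimes>\<^bsub>A\<^esub> inv\<^bsub>A\<^esub> f (pt (cs k0 x0)) \<otimes>\<^bsub>A\<^esub> fn \<eta> g (cs k0 x0)))"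
      using kx0 ts tsA HZ.val[OF f(1) pt_closed[OF cs_mem[OF kx0(2,3)]]]
      by (intro continuous_map_group_mult continuous_map_group_inv tgA tg continuous_map_act continuous_map_eval[OF f(1)]
          fam_continuous[OF fam_fn[OF \<eta>']] fam_continuous[OF fam_fn[OF \<eta>]]) auto
    then have bc: "continuous_map (topo G) (topo A) ?b"
      by (rule continuous_map_eq) (use kx0 f(1) ts in \<open>simp add: Kval Lpt fn_def\<close>)
    have wc: "continuous_map GX (topo A) (\<lambda>z. f (pt (cs (fst z) (snd z))))"
      by (rule continuous_map_eval[OF f(1) continuous_map_fst continuous_map_snd])
    show "cohomologous (fn \<eta>) (fn \<eta>')"
      unfolding cohomologous_def
    proof (intro exI[of _ ?b] exI[of _ "\<lambda>y. f (pt y)"] conjI ballI bc wc)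
      fix g k x assume g: "g \<in> carrier G" and kx: "k \<in> carrier G" "x \<in> topspace X"
      show "fn \<eta>' g (cs k x) = ?b g \<otimes>\<^bsub>A\<^esub> (act g (f (pt (cs (inv\<^bsub>G\<^esub> g \<otimes>\<^bsub>G\<^esub> k) x))) \<otimes>\<^bsub>A\<^esub> inv\<^bsub>A\<^esub> f (pt (cs k x)) \<otimes>\<^bsub>A\<^esub> fn \<eta> g (cs k x))"
        using eqK[OF f(1) g pt_closed[OF cs_mem[OF kx]]] Kconst[OF g cs_mem[OF kx]] Lpt[OF f(1) g kx]
        by (simp only: fn_def)
    qed
  next
    assume "cohomologous (fn \<eta>) (fn \<eta>')"
    then obtain b w where b: "continuous_map (topo G) (topo A) b"
      and w: "continuous_map GX (topo A) (\<lambda>z. w (cs (fst z) (snd z)))"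
      and eq: "\<And>g k x. g \<in> carrier G \<Longrightarrow> k \<in> carrier G \<Longrightarrow> x \<in> topspace X \<Longrightarrow> fn \<eta>' g (cs k x) =
         b g \<otimes>\<^bsub>A\<^esub> (act g (w (cs (inv\<^bsub>G\<^esub> g \<otimes>\<^bsub>G\<^esub> k) x)) \<otimes>\<^bsub>A\<^esub> inv\<^bsub>A\<^esub> w (cs k x) \<otimes>\<^bsub>A\<^esub> fn \<eta> g (cs k x))"
      unfolding cohomologous_def by blast
    obtain f where f: "f \<in> chom Z A" "\<And>y. y \<in> topspace Y \<Longrightarrow> f (pt y) = w y" using chom_Z_exists[OF w] by blast
    \<comment> \<open>There is one empty symbol, and a degree 0 cochain may take any value on
      it.\<close>
    have "continuous_map (pow 0) (topo HD.H) (\<lambda>z. restrict f (carrier D))" using chom_restrict_D[OF f(1)] by simp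
    from cochain_exists[OF gmodule_HD _ HD.pi_torsion_H[OF pi_torsion_A] this]
    obtain w0 where w0: "w0 \<in> Rel 0" "w0 (symb \<pi> G []) = restrict f (carrier D)"
      by (metis hom_module_sel(1,4) lists.Nil list.size(3))
    have KD: "K f g m = \<one>\<^bsub>A\<^esub>" if g: "g \<in> carrier G" and m: "m \<in> carrier D" for g m
    proof -
      have bg: "b g \<in> carrier A" using continuous_map_image_subset_topspace[OF b] g ts tsA by auto
      have "K f g (pt y) = b g" if "y \<in> topspace Y" for y
      proof -
        obtain k x where kx: "y = cs k x" "k \<in> carrier G" "x \<in> topspace X" using \<open>y \<in> topspace Y\<close> unfolding topspace_Y by blast
        have p: "pt (cs k x) \<in> carrier Z" using kx by simp
        have Lv: "L f g (pt (cs k x)) \<in> carrier A" using HZ.val[OF _ p] Lc[OF f(1) g] by simp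
        have "fn \<eta>' g (cs k x) = b g \<otimes>\<^bsub>A\<^esub> L f g (pt (cs k x))"
          using eq[OF g kx(2,3)] Lpt[OF f(1) g kx(2,3)] f(2) kx g by simp
        then show ?thesis using Kval[OF f(1) g p] bg Lv by (simp add: kx fn_def A.m_assoc)
      qed
      then have "\<forall>y\<in>topspace Y. K f g (pt y) = K f g (pt y0)" using y0 by metis
      then show ?thesis using constant_iff_trivial_on_D[OF Kc[OF f(1) g]] m by blast
    qed
    have d0: "cobdry \<pi> G 0 w0 \<in> Rel 1" using cobdry_homG[OF w0(1)] by simp
    have "?\<xi>' = cobdry \<pi> G 0 w0 \<otimes>\<^bsub>H1.H\<^esub> ?\<xi>"
    proof (rule homG_eqI[OF HD.hausdorff_abelian_H \<xi>'])
      show "cobdry \<pi> G 0 w0 \<otimes>\<^bsub>H1.H\<^esub> ?\<xi> \<in> Rel 1" by (rule subgroup.m_closed[OF Rel_subgroup d0 \<xi>])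
      fix gs assume "gs \<in> lists (carrier G)" "length gs = 1"
      then obtain g where g: "gs = [g]" "g \<in> carrier G" by (rule list1_cases)
      have "restrict (\<eta>' (symb \<pi> G [g])) (carrier D) = restrict (L f g) (carrier D)"
        using K1[OF f(1) g(2) D_sub] KD[OF g(2)] by (intro restrict_ext) blast
      then show "?\<xi>' (symb \<pi> G gs) = (cobdry \<pi> G 0 w0 \<otimes>\<^bsub>H1.H\<^esub> ?\<xi>) (symb \<pi> G gs)"
        unfolding g(1) hom_module_sel(2)[of "C 1"] restrict_apply'[OF symb_1[OF g(2)]] key[OF w0(1) f(1) w0(2) g(2)]
        by (simp only: in_star_apply[OF symb_1[OF g(2)]])
    qed
    then show "\<exists>w\<in>Rel 0. ?\<xi>' = cobdry \<pi> G 0 w \<otimes>\<^bsub>H1.H\<^esub> ?\<xi>" using w0(1) by blast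
  qed
qed

end

section \<open>The relative extension of a cocycle\<close>

text \<open>Connected sets project to connected sets, so they have at most one point in each
  coordinate.\<close>

lemma profinite_space_prod:
  assumes "profinite_space S" "profinite_space T"
  shows "profinite_space (prod_topology S T)"
  unfolding profinite_space_def
proof (intro conjI allI impI)
  show "compact_space (prod_topology S T)" "Hausdorff_space (prod_topology S T)"
    using assms by (simp_all add: profinite_space_def compact_space_prod_topology Hausdorff_space_prod_topology)
  fix K assume K: "connectedin (prod_topology S T) K"
  obtain a where a: "fst ` K \<subseteq> {a}"
    using assms(1) connectedin_continuous_map_image[OF continuous_map_fst K] by (auto simp: profinite_space_def)
  obtain b where b: "snd ` K \<subseteq> {b}"
    using assms(2) connectedin_continuous_map_image[OF continuous_map_snd K] by (auto simp: profinite_space_def)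
  have "K \<subseteq> {(a, b)}" using a b by force
  then show "\<exists>c. K \<subseteq> {c}" by blast
qed

lemma profinite_space_finite_discrete: "finite U \<Longrightarrow> profinite_space (discrete_topology U)"
  unfolding profinite_space_def by (auto simp: compact_space_discrete_topology connectedin_discrete_topology)

text \<open>
  Here \<open>u g (k S\<^sub>x)\<close> stands for \<open>\<eta>([g])(k S\<^sub>x)\<close> and \<open>v g h\<close> for \<open>\<zeta>([g, h])\<close>, so that \<open>v_cob\<close> is
  the equation \<open>ev\<^sup>* \<zeta> = d\<eta>\<close>.
\<close>

locale cocycle_data = relative_pair G \<pi> X S A act
  for G :: "'g tgroup" and \<pi> :: "nat set" and X :: "'x topology" and S :: "'x \<Rightarrow> 'g set"
    and A :: "'a tgroup" and act :: "'g \<Rightarrow> 'a \<Rightarrow> 'a" +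
  fixes u :: "'g \<Rightarrow> 'g set \<times> 'x \<Rightarrow> 'a" and v :: "'g \<Rightarrow> 'g \<Rightarrow> 'a"
  assumes u: "fam u"
    and v_cob: "\<And>g h k x. g \<in> carrier G \<Longrightarrow> h \<in> carrier G \<Longrightarrow> k \<in> carrier G \<Longrightarrow> x \<in> topspace X \<Longrightarrow> v g h = cob u g h k x"
begin

lemma u_closed [simp]: "g \<in> carrier G \<Longrightarrow> k \<in> carrier G \<Longrightarrow> x \<in> topspace X \<Longrightarrow> u g (cs k x) \<in> carrier A"
  by (rule fam_closed[OF u])

lemma v_closed [simp]: "g \<in> carrier G \<Longrightarrow> h \<in> carrier G \<Longrightarrow> v g h \<in> carrier A"
proof -
  assume gh: "g \<in> carrier G" "h \<in> carrier G"
  obtain x where x: "x \<in> topspace X" using X_nonempty by blast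
  show "v g h \<in> carrier A" unfolding v_cob[OF gh one_closed x] cob_def using gh x by simp
qed

text \<open>The equation \<open>v_cob\<close> cleared of inverses; the later computations multiply
  several such equations and cancel.\<close>

lemma v_u:
  assumes "g \<in> carrier G" "h \<in> carrier G" "k \<in> carrier G" "x \<in> topspace X"
  shows "v g h \<otimes>\<^bsub>A\<^esub> u (g \<otimes>\<^bsub>G\<^esub> h) (cs k x) = act g (u h (cs (inv\<^bsub>G\<^esub> g \<otimes>\<^bsub>G\<^esub> k) x)) \<otimes>\<^bsub>A\<^esub> u g (cs k x)"
proof -
  let ?p = "act g (u h (cs (inv\<^bsub>G\<^esub> g \<otimes>\<^bsub>G\<^esub> k) x))" and ?q = "u (g \<otimes>\<^bsub>G\<^esub> h) (cs k x)" and ?r = "u g (cs k x)"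
  have c: "?p \<in> carrier A" "?q \<in> carrier A" "?r \<in> carrier A" using assms by simp_all
  have "v g h \<otimes>\<^bsub>A\<^esub> ?q = (?p \<otimes>\<^bsub>A\<^esub> ?r) \<otimes>\<^bsub>A\<^esub> (?q \<otimes>\<^bsub>A\<^esub> inv\<^bsub>A\<^esub> ?q)"
    unfolding v_cob[OF assms] cob_def using c by (simp add: A.m_ac del: A.r_inv A.l_inv A.Units_r_inv A.Units_l_inv)
  then show ?thesis using c by simp
qed

text \<open>\<open>v\<close> inherits the cocycle identity from the vanishing of the double
  coboundary of \<open>u\<close>, as a constant function is determined by its value. Concretely,
  four instances of \<open>v_u\<close>, at the cosets of \<open>1\<close> and of the inverse of
  \<open>g\<close>, multiply to the identity once the values of \<open>u\<close> cancel.\<close>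

lemma cocycle:
  assumes g: "g \<in> carrier G" and h: "h \<in> carrier G" and k: "k \<in> carrier G"
  shows "act g (v h k) \<otimes>\<^bsub>A\<^esub> v g (h \<otimes>\<^bsub>G\<^esub> k) = v g h \<otimes>\<^bsub>A\<^esub> v (g \<otimes>\<^bsub>G\<^esub> h) k"
proof -
  obtain x where x: "x \<in> topspace X" using X_nonempty by blast
  let ?gi = "inv\<^bsub>G\<^esub> g"
  have gi: "?gi \<in> carrier G" using g by simp
  let ?y = "cs \<one>\<^bsub>G\<^esub> x" and ?y' = "cs ?gi x"
  let ?a = "act (g \<otimes>\<^bsub>G\<^esub> h) (u k (cs (inv\<^bsub>G\<^esub> (g \<otimes>\<^bsub>G\<^esub> h)) x))"
  let ?b = "act g (u (h \<otimes>\<^bsub>G\<^esub> k) ?y')" and ?c = "act g (u h ?y')"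
  let ?d = "u (g \<otimes>\<^bsub>G\<^esub> h \<otimes>\<^bsub>G\<^esub> k) ?y" and ?e = "u g ?y" and ?f = "u (g \<otimes>\<^bsub>G\<^esub> h) ?y"
  have car: "?a \<in> carrier A" "?b \<in> carrier A" "?c \<in> carrier A" "?d \<in> carrier A" "?e \<in> carrier A" "?f \<in> carrier A"
    "v h k \<in> carrier A" "act g (v h k) \<in> carrier A" "v g (h \<otimes>\<^bsub>G\<^esub> k) \<in> carrier A" "v g h \<in> carrier A" "v (g \<otimes>\<^bsub>G\<^esub> h) k \<in> carrier A"
    using g h k x by simp_all
  have "act g (v h k \<otimes>\<^bsub>A\<^esub> u (h \<otimes>\<^bsub>G\<^esub> k) ?y') = act g (act h (u k (cs (inv\<^bsub>G\<^esub> h \<otimes>\<^bsub>G\<^esub> ?gi) x)) \<otimes>\<^bsub>A\<^esub> u h ?y')"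
    using v_u[OF h k gi x] by simp
  then have 1: "act g (v h k) \<otimes>\<^bsub>A\<^esub> ?b = ?a \<otimes>\<^bsub>A\<^esub> ?c"
    using g h k x by (simp add: act_act inv_mult_group)
  have 2: "v g (h \<otimes>\<^bsub>G\<^esub> k) \<otimes>\<^bsub>A\<^esub> ?d = ?b \<otimes>\<^bsub>A\<^esub> ?e"
    using v_u[OF g m_closed[OF h k] one_closed x] g h k by (simp add: m_assoc)
  have 3: "v g h \<otimes>\<^bsub>A\<^esub> ?f = ?c \<otimes>\<^bsub>A\<^esub> ?e"
    using v_u[OF g h one_closed x] g by simp
  have 4: "v (g \<otimes>\<^bsub>G\<^esub> h) k \<otimes>\<^bsub>A\<^esub> ?d = ?a \<otimes>\<^bsub>A\<^esub> ?f"
    using v_u[OF m_closed[OF g h] k one_closed x] g h by simp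
  \<comment> \<open>The factors \<open>?b\<close>, \<open>?d\<close> and \<open>?f\<close> complete
    the values of \<open>v\<close> to left-hand sides of \<open>1\<close> to \<open>4\<close>; both
    products then reduce to the same five values of \<open>u\<close>.\<close>
  have l: "act g (v h k) \<otimes>\<^bsub>A\<^esub> v g (h \<otimes>\<^bsub>G\<^esub> k) \<otimes>\<^bsub>A\<^esub> (?b \<otimes>\<^bsub>A\<^esub> ?d \<otimes>\<^bsub>A\<^esub> ?f)
      = (act g (v h k) \<otimes>\<^bsub>A\<^esub> ?b) \<otimes>\<^bsub>A\<^esub> (v g (h \<otimes>\<^bsub>G\<^esub> k) \<otimes>\<^bsub>A\<^esub> ?d) \<otimes>\<^bsub>A\<^esub> ?f"
    using car by (simp only: A.m_ac A.m_closed)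
  have r: "v g h \<otimes>\<^bsub>A\<^esub> v (g \<otimes>\<^bsub>G\<^esub> h) k \<otimes>\<^bsub>A\<^esub> (?b \<otimes>\<^bsub>A\<^esub> ?d \<otimes>\<^bsub>A\<^esub> ?f)
      = (v g h \<otimes>\<^bsub>A\<^esub> ?f) \<otimes>\<^bsub>A\<^esub> (v (g \<otimes>\<^bsub>G\<^esub> h) k \<otimes>\<^bsub>A\<^esub> ?d) \<otimes>\<^bsub>A\<^esub> ?b"
    using car by (simp only: A.m_ac A.m_closed)
  have "act g (v h k) \<otimes>\<^bsub>A\<^esub> v g (h \<otimes>\<^bsub>G\<^esub> k) \<otimes>\<^bsub>A\<^esub> (?b \<otimes>\<^bsub>A\<^esub> ?d \<otimes>\<^bsub>A\<^esub> ?f)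
      = v g h \<otimes>\<^bsub>A\<^esub> v (g \<otimes>\<^bsub>G\<^esub> h) k \<otimes>\<^bsub>A\<^esub> (?b \<otimes>\<^bsub>A\<^esub> ?d \<otimes>\<^bsub>A\<^esub> ?f)"
    unfolding l r 1 2 3 4 using car by (simp only: A.m_ac A.m_closed)
  then show ?thesis using car by (simp del: A.m_assoc)
qed

text \<open>The cocycle is not normalised. This formula and \<open>v_one_right\<close> are what make
  the shift by \<open>v1\<close> in the unit of \<open>E\<close> and in \<open>i\<close> come out
  right.\<close>

lemma v_one_left:
  assumes g: "g \<in> carrier G"
  shows "v \<one>\<^bsub>G\<^esub> g = v \<one>\<^bsub>G\<^esub> \<one>\<^bsub>G\<^esub>"
proof -
  have "v \<one>\<^bsub>G\<^esub> g \<otimes>\<^bsub>A\<^esub> v \<one>\<^bsub>G\<^esub> g = v \<one>\<^bsub>G\<^esub> \<one>\<^bsub>G\<^esub> \<otimes>\<^bsub>A\<^esub> v \<one>\<^bsub>G\<^esub> g"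
    using cocycle[OF one_closed one_closed g] g by simp
  then show ?thesis using g by simp
qed

lemma v_one_right:
  assumes g: "g \<in> carrier G"
  shows "v g \<one>\<^bsub>G\<^esub> = act g (v \<one>\<^bsub>G\<^esub> \<one>\<^bsub>G\<^esub>)"
proof -
  have "act g (v \<one>\<^bsub>G\<^esub> \<one>\<^bsub>G\<^esub>) \<otimes>\<^bsub>A\<^esub> v g \<one>\<^bsub>G\<^esub> = v g \<one>\<^bsub>G\<^esub> \<otimes>\<^bsub>A\<^esub> v g \<one>\<^bsub>G\<^esub>"
    using cocycle[OF g one_closed one_closed] g by simp
  then show ?thesis using g by simp
qed

text \<open>Continuity of \<open>v\<close> is read off from \<open>v_cob\<close> at one fixed
  coset.\<close>

lemma continuous_map_v:
  assumes "continuous_map T (topo G) g" "continuous_map T (topo G) h"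
  shows "continuous_map T (topo A) (\<lambda>t. v (g t) (h t))"
proof -
  obtain x where x: "x \<in> topspace X" using X_nonempty by blast
  have m: "g t \<in> carrier G" "h t \<in> carrier G" if "t \<in> topspace T" for t
    using continuous_map_image_subset_topspace[OF assms(1)] continuous_map_image_subset_topspace[OF assms(2)] that ts by auto
  have "continuous_map T (topo A) (\<lambda>t. cob u (g t) (h t) \<one>\<^bsub>G\<^esub> x)"
    unfolding cob_def
    by (intro continuous_map_group_mult continuous_map_group_inv tgA tg continuous_map_act fam_continuous[OF u] assms)
      (auto simp: x ts)
  then show ?thesis by (rule continuous_map_eq) (metis m x v_cob one_closed)
qed

abbreviation v1 where "v1 \<equiv> v \<one>\<^bsub>G\<^esub> \<one>\<^bsub>G\<^esub>"

definition E :: "('a \<times> 'g) tgroup" where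
  "E = \<lparr>carrier = carrier A \<times> carrier G,
      monoid.mult = (\<lambda>(a\<^sub>1, g\<^sub>1) (a\<^sub>2, g\<^sub>2). (a\<^sub>1 \<otimes>\<^bsub>A\<^esub> act g\<^sub>1 a\<^sub>2 \<otimes>\<^bsub>A\<^esub> v g\<^sub>1 g\<^sub>2, g\<^sub>1 \<otimes>\<^bsub>G\<^esub> g\<^sub>2)),
      one = (inv\<^bsub>A\<^esub> v1, \<one>\<^bsub>G\<^esub>),
      topo = prod_topology (topo A) (topo G)\<rparr>"

definition i :: "'a \<Rightarrow> 'a \<times> 'g" where "i a = (a \<otimes>\<^bsub>A\<^esub> inv\<^bsub>A\<^esub> v1, \<one>\<^bsub>G\<^esub>)"

definition q :: "'x \<Rightarrow> 'g \<Rightarrow> 'a \<times> 'g" where "q x s = (inv\<^bsub>A\<^esub> u s (cs \<one>\<^bsub>G\<^esub> x), s)"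

definition R :: "('a, 'g, 'x, 'a \<times> 'g) rel_ext" where
  "R = \<lparr>ext_group = E, ext_incl = i, ext_proj = snd, ext_sec = q\<rparr>"

lemma carrier_E: "carrier E = carrier A \<times> carrier G" by (simp add: E_def)

lemma mem_E [simp]: "(a, g) \<in> carrier E \<longleftrightarrow> a \<in> carrier A \<and> g \<in> carrier G" by (simp add: carrier_E)

lemma one_E: "\<one>\<^bsub>E\<^esub> = (inv\<^bsub>A\<^esub> v1, \<one>\<^bsub>G\<^esub>)" by (simp add: E_def)

lemma topo_E [simp]: "topo E = prod_topology (topo A) (topo G)" by (simp add: E_def)

lemma mult_E: "(a, g) \<otimes>\<^bsub>E\<^esub> (b, h) = (a \<otimes>\<^bsub>A\<^esub> act g b \<otimes>\<^bsub>A\<^esub> v g h, g \<otimes>\<^bsub>G\<^esub> h)"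
  by (simp add: E_def)

lemma R_sel [simp]: "ext_group R = E" "ext_incl R = i" "ext_proj R = snd" "ext_sec R = q"
  by (simp_all add: R_def)

text \<open>The first component solves, in additive notation, the equation that the sum of it, the
  translate of \<open>a\<close> by the inverse of \<open>g\<close>, and \<open>v\<close> at that
  inverse and \<open>g\<close> be \<open>- v1\<close>.\<close>

lemma E_inv_left:
  assumes a: "a \<in> carrier A" and g: "g \<in> carrier G"
  shows "(inv\<^bsub>A\<^esub> (v1 \<otimes>\<^bsub>A\<^esub> act (inv\<^bsub>G\<^esub> g) a \<otimes>\<^bsub>A\<^esub> v (inv\<^bsub>G\<^esub> g) g), inv\<^bsub>G\<^esub> g) \<otimes>\<^bsub>E\<^esub> (a, g) = \<one>\<^bsub>E\<^esub>"
proof -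
  let ?p = "act (inv\<^bsub>G\<^esub> g) a" and ?r = "v (inv\<^bsub>G\<^esub> g) g"
  have c: "?p \<in> carrier A" "?r \<in> carrier A" "v1 \<in> carrier A" using a g by simp_all
  have "inv\<^bsub>A\<^esub> (v1 \<otimes>\<^bsub>A\<^esub> ?p \<otimes>\<^bsub>A\<^esub> ?r) \<otimes>\<^bsub>A\<^esub> ?p \<otimes>\<^bsub>A\<^esub> ?r = inv\<^bsub>A\<^esub> v1 \<otimes>\<^bsub>A\<^esub> (?p \<otimes>\<^bsub>A\<^esub> inv\<^bsub>A\<^esub> ?p) \<otimes>\<^bsub>A\<^esub> (?r \<otimes>\<^bsub>A\<^esub> inv\<^bsub>A\<^esub> ?r)"
    using c by (simp add: A.inv_mult A.m_ac del: A.r_inv A.l_inv A.Units_r_inv A.Units_l_inv)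
  then show ?thesis using c g by (simp add: mult_E one_E)
qed

lemma group_E: "group E"
proof (rule groupI)
  fix x assume "x \<in> carrier E"
  then obtain a g where x: "x = (a, g)" "a \<in> carrier A" "g \<in> carrier G" by (auto simp: carrier_E)
  have "inv\<^bsub>A\<^esub> v1 \<otimes>\<^bsub>A\<^esub> a \<otimes>\<^bsub>A\<^esub> v1 = a \<otimes>\<^bsub>A\<^esub> (v1 \<otimes>\<^bsub>A\<^esub> inv\<^bsub>A\<^esub> v1)"
    using x by (simp add: A.m_ac del: A.r_inv A.l_inv A.Units_r_inv A.Units_l_inv)
  then show "\<one>\<^bsub>E\<^esub> \<otimes>\<^bsub>E\<^esub> x = x" using x by (simp add: v_one_left[OF x(3)] mult_E one_E)
  show "\<exists>y\<in>carrier E. y \<otimes>\<^bsub>E\<^esub> x = \<one>\<^bsub>E\<^esub>"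
    using E_inv_left[OF x(2,3)] x by (intro bexI[of _ "(inv\<^bsub>A\<^esub> (v1 \<otimes>\<^bsub>A\<^esub> act (inv\<^bsub>G\<^esub> g) a \<otimes>\<^bsub>A\<^esub> v (inv\<^bsub>G\<^esub> g) g), inv\<^bsub>G\<^esub> g)"]) auto
next
  fix x y z assume "x \<in> carrier E" "y \<in> carrier E" "z \<in> carrier E"
  then obtain a g b h c k where x: "x = (a, g)" "y = (b, h)" "z = (c, k)"
    and m: "a \<in> carrier A" "g \<in> carrier G" "b \<in> carrier A" "h \<in> carrier G" "c \<in> carrier A" "k \<in> carrier G" by (auto simp: carrier_E)
  have "a \<otimes>\<^bsub>A\<^esub> act g b \<otimes>\<^bsub>A\<^esub> v g h \<otimes>\<^bsub>A\<^esub> act (g \<otimes>\<^bsub>G\<^esub> h) c \<otimes>\<^bsub>A\<^esub> v (g \<otimes>\<^bsub>G\<^esub> h) k =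
      a \<otimes>\<^bsub>A\<^esub> act g b \<otimes>\<^bsub>A\<^esub> act (g \<otimes>\<^bsub>G\<^esub> h) c \<otimes>\<^bsub>A\<^esub> (v g h \<otimes>\<^bsub>A\<^esub> v (g \<otimes>\<^bsub>G\<^esub> h) k)"
    using m by (simp add: A.m_ac)
  also have "\<dots> = a \<otimes>\<^bsub>A\<^esub> (act g b \<otimes>\<^bsub>A\<^esub> act (g \<otimes>\<^bsub>G\<^esub> h) c \<otimes>\<^bsub>A\<^esub> act g (v h k)) \<otimes>\<^bsub>A\<^esub> v g (h \<otimes>\<^bsub>G\<^esub> k)"
    unfolding cocycle[OF m(2,4,6), symmetric] using m by (simp add: A.m_ac)
  finally show "x \<otimes>\<^bsub>E\<^esub> y \<otimes>\<^bsub>E\<^esub> z = x \<otimes>\<^bsub>E\<^esub> (y \<otimes>\<^bsub>E\<^esub> z)" using m by (simp add: x m_assoc act_act mult_E)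
qed (auto simp: carrier_E mult_E one_E)

sublocale E: group E by (rule group_E)

lemma inv_E: "a \<in> carrier A \<Longrightarrow> g \<in> carrier G \<Longrightarrow>
    inv\<^bsub>E\<^esub> (a, g) = (inv\<^bsub>A\<^esub> (v1 \<otimes>\<^bsub>A\<^esub> act (inv\<^bsub>G\<^esub> g) a \<otimes>\<^bsub>A\<^esub> v (inv\<^bsub>G\<^esub> g) g), inv\<^bsub>G\<^esub> g)"
  by (rule E.inv_equality[OF E_inv_left]) simp_all

lemma profinite_E: "profinite_group E"
proof -
  let ?T = "prod_topology (topo A) (topo G)"
  let ?TT = "prod_topology ?T ?T"
  have proj: "continuous_map ?TT (topo A) (\<lambda>z. fst (fst z))" "continuous_map ?TT (topo G) (\<lambda>z. snd (fst z))"
    "continuous_map ?TT (topo A) (\<lambda>z. fst (snd z))" "continuous_map ?TT (topo G) (\<lambda>z. snd (snd z))"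
    by (intro continuous_map_compose[OF continuous_map_fst continuous_map_fst, unfolded comp_def]
        continuous_map_compose[OF continuous_map_fst continuous_map_snd, unfolded comp_def]
        continuous_map_compose[OF continuous_map_snd continuous_map_fst, unfolded comp_def]
        continuous_map_compose[OF continuous_map_snd continuous_map_snd, unfolded comp_def])+
  have "continuous_map ?TT ?T (\<lambda>z. (fst (fst z) \<otimes>\<^bsub>A\<^esub> act (snd (fst z)) (fst (snd z)) \<otimes>\<^bsub>A\<^esub> v (snd (fst z)) (snd (snd z)),
      snd (fst z) \<otimes>\<^bsub>G\<^esub> snd (snd z)))"
    by (intro continuous_map_pairedI continuous_map_group_mult tgA tg continuous_map_act continuous_map_v proj)
  then have mult: "continuous_map ?TT ?T (\<lambda>(x, y). x \<otimes>\<^bsub>E\<^esub> y)" by (simp add: case_prod_unfold E_def)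
  have "continuous_map ?T ?T (\<lambda>z. (inv\<^bsub>A\<^esub> (v1 \<otimes>\<^bsub>A\<^esub> act (inv\<^bsub>G\<^esub> (snd z)) (fst z) \<otimes>\<^bsub>A\<^esub> v (inv\<^bsub>G\<^esub> (snd z)) (snd z)), inv\<^bsub>G\<^esub> (snd z)))"
    by (intro continuous_map_pairedI continuous_map_group_mult continuous_map_group_inv tgA tg continuous_map_act
        continuous_map_v continuous_map_fst continuous_map_snd) (simp_all add: tsA ts)
  then have inv: "continuous_map ?T ?T (\<lambda>x. inv\<^bsub>E\<^esub> x)"
    by (rule continuous_map_eq) (auto simp: tsA ts inv_E)
  have "profinite_space ?T"
    using G profinite_space_finite_discrete[OF A_finite]
    by (intro profinite_space_prod) (simp_all add: A_discrete profinite_group_def)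
  then show ?thesis using mult inv group_E by (simp add: profinite_group_def topological_group_def tsA ts carrier_E)
qed

lemma i_closed [simp]: "a \<in> carrier A \<Longrightarrow> i a \<in> carrier E" by (simp add: i_def)

lemma mult_i:
  assumes "a \<in> carrier A" "c \<in> carrier A" "g \<in> carrier G"
  shows "(c, g) \<otimes>\<^bsub>E\<^esub> i a = (c \<otimes>\<^bsub>A\<^esub> act g a, g)"
  using assms by (simp add: i_def v_one_right[OF assms(3)] A.m_assoc mult_E)

lemma i_mult:
  assumes "a \<in> carrier A" "c \<in> carrier A" "g \<in> carrier G"
  shows "i a \<otimes>\<^bsub>E\<^esub> (c, g) = (a \<otimes>\<^bsub>A\<^esub> c, g)"
proof -
  have "a \<otimes>\<^bsub>A\<^esub> inv\<^bsub>A\<^esub> v1 \<otimes>\<^bsub>A\<^esub> c \<otimes>\<^bsub>A\<^esub> v1 = a \<otimes>\<^bsub>A\<^esub> c \<otimes>\<^bsub>A\<^esub> (v1 \<otimes>\<^bsub>A\<^esub> inv\<^bsub>A\<^esub> v1)"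
    using assms by (simp add: A.m_ac del: A.r_inv A.l_inv A.Units_r_inv A.Units_l_inv)
  then show ?thesis using assms by (simp add: i_def v_one_left[OF assms(3)] mult_E)
qed

lemma q_closed: "x \<in> topspace X \<Longrightarrow> s \<in> S x \<Longrightarrow> q x s \<in> carrier E"
  using S_sub by (simp add: q_def)

lemma cs_S: "x \<in> topspace X \<Longrightarrow> s \<in> S x \<Longrightarrow> cs (inv\<^bsub>G\<^esub> s) x = cs \<one>\<^bsub>G\<^esub> x"
  using cs_mult[OF one_closed, of x "inv\<^bsub>G\<^esub> s"] subgroup.m_inv_closed[OF S_subgroup, of x s] S_sub by simp

lemma conj_i: "e \<in> carrier E \<Longrightarrow> a \<in> carrier A \<Longrightarrow> e \<otimes>\<^bsub>E\<^esub> i a \<otimes>\<^bsub>E\<^esub> inv\<^bsub>E\<^esub> e = i (act (snd e) a)"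
proof -
  assume e: "e \<in> carrier E" and a: "a \<in> carrier A"
  obtain c g where cg: "e = (c, g)" "c \<in> carrier A" "g \<in> carrier G" using e by (auto simp: carrier_E)
  have "e \<otimes>\<^bsub>E\<^esub> i a = i (act (snd e) a) \<otimes>\<^bsub>E\<^esub> e" using cg a by (simp add: mult_i i_mult A.m_comm)
  then show ?thesis using e a cg(2,3) by (simp add: E.m_assoc cg(1))
qed

text \<open>Elements of \<open>S x\<close> fix the coset \<open>1 S_x\<close>, so at this coset
  \<open>v_cob\<close> involves \<open>u\<close> only there and says that \<open>u\<close> splits
  \<open>v\<close> over \<open>S x\<close>: \<open>v(s, t) = s u(t) - u(s t) + u(s)\<close>.
  Negating \<open>u\<close> therefore gives a homomorphism.\<close>

lemma q_hom: "x \<in> topspace X \<Longrightarrow> q x \<in> hom (G\<lparr>carrier := S x\<rparr>) E"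
proof (rule homI)
  assume x: "x \<in> topspace X"
  show "q x s \<in> carrier E" if "s \<in> carrier (G\<lparr>carrier := S x\<rparr>)" for s using q_closed[OF x] that by simp
  fix s t assume st: "s \<in> carrier (G\<lparr>carrier := S x\<rparr>)" "t \<in> carrier (G\<lparr>carrier := S x\<rparr>)"
  then have s: "s \<in> S x" "t \<in> S x" "s \<in> carrier G" "t \<in> carrier G" using S_sub[OF x] by auto
  let ?a = "u s (cs \<one>\<^bsub>G\<^esub> x)" and ?b = "act s (u t (cs \<one>\<^bsub>G\<^esub> x))" and ?c = "u (s \<otimes>\<^bsub>G\<^esub> t) (cs \<one>\<^bsub>G\<^esub> x)"
  have c: "?a \<in> carrier A" "?b \<in> carrier A" "?c \<in> carrier A" using s x by simp_all
  have "v s t \<otimes>\<^bsub>A\<^esub> ?c = ?b \<otimes>\<^bsub>A\<^esub> ?a" using v_u[OF s(3,4) one_closed x] s x by (simp add: cs_S)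
  then have "v s t = ?b \<otimes>\<^bsub>A\<^esub> ?a \<otimes>\<^bsub>A\<^esub> inv\<^bsub>A\<^esub> ?c" using c s by (simp add: A.inv_solve_right)
  then have "inv\<^bsub>A\<^esub> ?a \<otimes>\<^bsub>A\<^esub> inv\<^bsub>A\<^esub> ?b \<otimes>\<^bsub>A\<^esub> v s t = (?a \<otimes>\<^bsub>A\<^esub> inv\<^bsub>A\<^esub> ?a) \<otimes>\<^bsub>A\<^esub> (?b \<otimes>\<^bsub>A\<^esub> inv\<^bsub>A\<^esub> ?b) \<otimes>\<^bsub>A\<^esub> inv\<^bsub>A\<^esub> ?c"
    using c by (simp add: A.m_ac del: A.r_inv A.l_inv A.Units_r_inv A.Units_l_inv)
  then have "inv\<^bsub>A\<^esub> ?c = inv\<^bsub>A\<^esub> ?a \<otimes>\<^bsub>A\<^esub> inv\<^bsub>A\<^esub> ?b \<otimes>\<^bsub>A\<^esub> v s t" using c by simp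
  then show "q x (s \<otimes>\<^bsub>G\<lparr>carrier := S x\<rparr>\<^esub> t) = q x s \<otimes>\<^bsub>E\<^esub> q x t" using s x by (simp add: q_def mult_E)
qed

lemma relative_extension: "relative_extension G X S A act R"
  unfolding relative_extension_def R_sel
proof (intro conjI ballI profinite_E)
  have inj: "inj_on i (carrier A)" by (rule inj_onI) (simp add: i_def)
  have "i (a \<otimes>\<^bsub>A\<^esub> b) = i a \<otimes>\<^bsub>E\<^esub> i b" if "a \<in> carrier A" "b \<in> carrier A" for a b
    using i_mult[of a "b \<otimes>\<^bsub>A\<^esub> inv\<^bsub>A\<^esub> v1" "\<one>\<^bsub>G\<^esub>"] that by (simp add: i_def A.m_assoc)
  then show "i \<in> mon A E" using inj by (auto simp: mon_def hom_def)
  show "continuous_map (topo A) (topo E) i" unfolding A_discrete by (auto simp: i_def tsA ts)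
  show "snd \<in> epi E G" by (auto simp: epi_def hom_def image_iff carrier_E mult_E intro!: bexI[of _ "\<one>\<^bsub>A\<^esub>"])
  show "continuous_map (topo E) (topo G) snd" by (simp add: continuous_map_snd)
  show "i ` carrier A = kernel E G snd"
  proof
    show "i ` carrier A \<subseteq> kernel E G snd" by (auto simp: kernel_def i_def carrier_E)
    show "kernel E G snd \<subseteq> i ` carrier A"
    proof
      fix z assume "z \<in> kernel E G snd"
      then obtain c where "z = (c, \<one>\<^bsub>G\<^esub>)" "c \<in> carrier A" by (auto simp: kernel_def carrier_E)
      then show "z \<in> i ` carrier A" by (intro image_eqI[of _ _ "c \<otimes>\<^bsub>A\<^esub> v1"]) (simp_all add: i_def A.m_assoc)
    qed
  qed
  show "e \<otimes>\<^bsub>E\<^esub> i a \<otimes>\<^bsub>E\<^esub> inv\<^bsub>E\<^esub> e = i (act (snd e) a)" if "e \<in> carrier E" "a \<in> carrier A" for e a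
    using conj_i that .
  have "continuous_map (subtopology GX (total_family X S)) (prod_topology (topo A) (topo G)) (\<lambda>z. (inv\<^bsub>A\<^esub> u (fst z) (cs \<one>\<^bsub>G\<^esub> (snd z)), fst z))"
    by (intro continuous_map_from_subtopology continuous_map_pairedI continuous_map_group_inv tgA fam_continuous[OF u]
        continuous_map_fst continuous_map_snd) (simp add: ts)
  then show "continuous_map (subtopology GX (total_family X S)) (topo E) (\<lambda>(s, x). q x s)"
    by (simp add: q_def case_prod_unfold)
  show "q x \<in> hom (G\<lparr>carrier := S x\<rparr>) E" if "x \<in> topspace X" for x using q_hom that .
  show "snd (q x s) = s" for x s by (simp add: q_def)
qed

end

subsection \<open>Equivalent extensions and cohomologous cocycles\<close>

locale two_cocycle_data = relative_pair G \<pi> X S A act +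
  P: cocycle_data G \<pi> X S A act u v + P': cocycle_data G \<pi> X S A act u' v'
  for G :: "'g tgroup" and \<pi> :: "nat set" and X :: "'x topology" and S :: "'x \<Rightarrow> 'g set"
    and A :: "'a tgroup" and act :: "'g \<Rightarrow> 'a \<Rightarrow> 'a"
    and u :: "'g \<Rightarrow> 'g set \<times> 'x \<Rightarrow> 'a" and v :: "'g \<Rightarrow> 'g \<Rightarrow> 'a" and u' v'
begin

text \<open>The terms in \<open>w\<close> form a coboundary, so they cancel in the comparison of
  \<open>v\<close> with \<open>v'\<close>, which differ by the coboundary of \<open>b\<close> alone.
  \<open>w\<close> survives only at the cosets \<open>1 S_x\<close>, where it conjugates one section
  into the other.\<close>

lemma equivalent_if_cohomologous:
  assumes "cohomologous u u'"
  shows "rel_ext_equivalent X S A P.R P'.R"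
proof -
  obtain b w where b: "continuous_map (topo G) (topo A) b"
    and w: "continuous_map GX (topo A) (\<lambda>z. w (cs (fst z) (snd z)))"
    and eq: "\<And>g k x. g \<in> carrier G \<Longrightarrow> k \<in> carrier G \<Longrightarrow> x \<in> topspace X \<Longrightarrow> u' g (cs k x) =
       b g \<otimes>\<^bsub>A\<^esub> (act g (w (cs (inv\<^bsub>G\<^esub> g \<otimes>\<^bsub>G\<^esub> k) x)) \<otimes>\<^bsub>A\<^esub> inv\<^bsub>A\<^esub> w (cs k x) \<otimes>\<^bsub>A\<^esub> u g (cs k x))"
    using assms unfolding cohomologous_def by blast
  have bA [simp]: "b g \<in> carrier A" if "g \<in> carrier G" for g
    using continuous_map_image_subset_topspace[OF b] that ts tsA by auto
  have wA [simp]: "w (cs k x) \<in> carrier A" if "k \<in> carrier G" "x \<in> topspace X" for k x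
    using continuous_map_image_subset_topspace[OF w] that ts tsA by (auto simp: image_subset_iff)
  have u'w: "u' g (cs k x) \<otimes>\<^bsub>A\<^esub> w (cs k x) = b g \<otimes>\<^bsub>A\<^esub> act g (w (cs (inv\<^bsub>G\<^esub> g \<otimes>\<^bsub>G\<^esub> k) x)) \<otimes>\<^bsub>A\<^esub> u g (cs k x)"
    if "g \<in> carrier G" "k \<in> carrier G" "x \<in> topspace X" for g k x
  proof -
    let ?p = "act g (w (cs (inv\<^bsub>G\<^esub> g \<otimes>\<^bsub>G\<^esub> k) x))" and ?w = "w (cs k x)"
    have "u' g (cs k x) \<otimes>\<^bsub>A\<^esub> ?w = (b g \<otimes>\<^bsub>A\<^esub> ?p \<otimes>\<^bsub>A\<^esub> u g (cs k x)) \<otimes>\<^bsub>A\<^esub> (?w \<otimes>\<^bsub>A\<^esub> inv\<^bsub>A\<^esub> ?w)"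
      unfolding eq[OF that] using that by (simp add: A.m_ac del: A.r_inv A.l_inv A.Units_r_inv A.Units_l_inv)
    then show ?thesis using that by simp
  qed
  have v': "v' g h \<otimes>\<^bsub>A\<^esub> b (g \<otimes>\<^bsub>G\<^esub> h) = v g h \<otimes>\<^bsub>A\<^esub> act g (b h) \<otimes>\<^bsub>A\<^esub> b g" if g: "g \<in> carrier G" and h: "h \<in> carrier G" for g h
  proof -
    obtain x where x: "x \<in> topspace X" using X_nonempty by blast
    let ?gi = "inv\<^bsub>G\<^esub> g"
    have gi: "?gi \<in> carrier G" using g by simp
    let ?y = "cs \<one>\<^bsub>G\<^esub> x" and ?y' = "cs ?gi x"
    let ?w = "w ?y" and ?gw = "act g (w ?y')" and ?ghw = "act (g \<otimes>\<^bsub>G\<^esub> h) (w (cs (inv\<^bsub>G\<^esub> (g \<otimes>\<^bsub>G\<^esub> h)) x))"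
    let ?u1 = "act g (u h ?y')" and ?u2 = "u (g \<otimes>\<^bsub>G\<^esub> h) ?y" and ?u3 = "u g ?y"
    let ?u1' = "act g (u' h ?y')" and ?u2' = "u' (g \<otimes>\<^bsub>G\<^esub> h) ?y" and ?u3' = "u' g ?y"
    have car: "?w \<in> carrier A" "?gw \<in> carrier A" "?ghw \<in> carrier A" "?u1 \<in> carrier A" "?u2 \<in> carrier A" "?u3 \<in> carrier A"
      "?u1' \<in> carrier A" "?u2' \<in> carrier A" "?u3' \<in> carrier A" "v g h \<in> carrier A" "v' g h \<in> carrier A" "b g \<in> carrier A"
      "act g (b h) \<in> carrier A" "b (g \<otimes>\<^bsub>G\<^esub> h) \<in> carrier A"
      using g h x by simp_all
    have e1: "v g h \<otimes>\<^bsub>A\<^esub> ?u2 = ?u1 \<otimes>\<^bsub>A\<^esub> ?u3" using P.v_u[OF g h one_closed x] g by simp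
    have e2: "v' g h \<otimes>\<^bsub>A\<^esub> ?u2' = ?u1' \<otimes>\<^bsub>A\<^esub> ?u3'" using P'.v_u[OF g h one_closed x] g by simp
    have e3: "?u2' \<otimes>\<^bsub>A\<^esub> ?w = b (g \<otimes>\<^bsub>G\<^esub> h) \<otimes>\<^bsub>A\<^esub> ?ghw \<otimes>\<^bsub>A\<^esub> ?u2" using u'w[OF m_closed[OF g h] one_closed x] g h by simp
    have e4: "?u3' \<otimes>\<^bsub>A\<^esub> ?w = b g \<otimes>\<^bsub>A\<^esub> ?gw \<otimes>\<^bsub>A\<^esub> ?u3" using u'w[OF g one_closed x] g by simp
    have "act g (u' h ?y' \<otimes>\<^bsub>A\<^esub> w ?y') = act g (b h \<otimes>\<^bsub>A\<^esub> act h (w (cs (inv\<^bsub>G\<^esub> h \<otimes>\<^bsub>G\<^esub> ?gi) x)) \<otimes>\<^bsub>A\<^esub> u h ?y')"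
      using u'w[OF h gi x] by simp
    then have e5: "?u1' \<otimes>\<^bsub>A\<^esub> ?gw = act g (b h) \<otimes>\<^bsub>A\<^esub> ?ghw \<otimes>\<^bsub>A\<^esub> ?u1"
      using g h x by (simp add: act_act inv_mult_group)
    \<comment> \<open>Multiplication by \<open>?z\<close> completes all factors to sides of
      \<open>e1\<close> to \<open>e5\<close>; after rewriting with these the factor cancels.\<close>
    let ?z = "?u2' \<otimes>\<^bsub>A\<^esub> ?ghw \<otimes>\<^bsub>A\<^esub> ?u2 \<otimes>\<^bsub>A\<^esub> ?gw \<otimes>\<^bsub>A\<^esub> ?w"
    have zc: "?z \<in> carrier A" using car by simp
    have "v' g h \<otimes>\<^bsub>A\<^esub> b (g \<otimes>\<^bsub>G\<^esub> h) \<otimes>\<^bsub>A\<^esub> ?z = (v' g h \<otimes>\<^bsub>A\<^esub> ?u2') \<otimes>\<^bsub>A\<^esub> (b (g \<otimes>\<^bsub>G\<^esub> h) \<otimes>\<^bsub>A\<^esub> ?ghw \<otimes>\<^bsub>A\<^esub> ?u2) \<otimes>\<^bsub>A\<^esub> ?gw \<otimes>\<^bsub>A\<^esub> ?w"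
      using car by (simp only: A.m_ac A.m_closed)
    also have "\<dots> = (?u1' \<otimes>\<^bsub>A\<^esub> ?gw) \<otimes>\<^bsub>A\<^esub> (?u3' \<otimes>\<^bsub>A\<^esub> ?w) \<otimes>\<^bsub>A\<^esub> (?u2' \<otimes>\<^bsub>A\<^esub> ?w)"
      unfolding e2 e3[symmetric] using car by (simp only: A.m_ac A.m_closed)
    also have "\<dots> = act g (b h) \<otimes>\<^bsub>A\<^esub> ?ghw \<otimes>\<^bsub>A\<^esub> (?u1 \<otimes>\<^bsub>A\<^esub> ?u3) \<otimes>\<^bsub>A\<^esub> b g \<otimes>\<^bsub>A\<^esub> ?gw \<otimes>\<^bsub>A\<^esub> (?u2' \<otimes>\<^bsub>A\<^esub> ?w)"
      unfolding e5 e4 using car by (simp only: A.m_ac A.m_closed)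
    also have "\<dots> = v g h \<otimes>\<^bsub>A\<^esub> act g (b h) \<otimes>\<^bsub>A\<^esub> b g \<otimes>\<^bsub>A\<^esub> ?z"
      unfolding e1[symmetric] using car by (simp only: A.m_ac A.m_closed)
    finally show ?thesis using car zc by (simp only: A.right_cancel A.m_closed)
  qed
  define f where "f = (\<lambda>(a, g). (a \<otimes>\<^bsub>A\<^esub> inv\<^bsub>A\<^esub> b g, g))"
  define t where "t x = w (cs \<one>\<^bsub>G\<^esub> x)" for x
  have bij: "bij_betw f (carrier P.E) (carrier P'.E)"
  proof (rule bij_betwI[of _ _ _ "\<lambda>(a, g). (a \<otimes>\<^bsub>A\<^esub> b g, g)"])
  qed (auto simp: f_def A.m_assoc P.carrier_E P'.carrier_E)
  have hom: "f (x \<otimes>\<^bsub>P.E\<^esub> y) = f x \<otimes>\<^bsub>P'.E\<^esub> f y" if "x \<in> carrier P.E" "y \<in> carrier P.E" for x y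
  proof -
    obtain a g c h where xy: "x = (a, g)" "y = (c, h)" and m: "a \<in> carrier A" "g \<in> carrier G" "c \<in> carrier A" "h \<in> carrier G"
      using \<open>x \<in> carrier P.E\<close> \<open>y \<in> carrier P.E\<close> by (auto simp: P.carrier_E)
    have e: "v' g h = v g h \<otimes>\<^bsub>A\<^esub> act g (b h) \<otimes>\<^bsub>A\<^esub> b g \<otimes>\<^bsub>A\<^esub> inv\<^bsub>A\<^esub> b (g \<otimes>\<^bsub>G\<^esub> h)"
      using v'[OF m(2,4)] m by (simp add: A.inv_solve_right)
    have "a \<otimes>\<^bsub>A\<^esub> inv\<^bsub>A\<^esub> b g \<otimes>\<^bsub>A\<^esub> (act g c \<otimes>\<^bsub>A\<^esub> inv\<^bsub>A\<^esub> act g (b h)) \<otimes>\<^bsub>A\<^esub> v' g h =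
       a \<otimes>\<^bsub>A\<^esub> act g c \<otimes>\<^bsub>A\<^esub> v g h \<otimes>\<^bsub>A\<^esub> inv\<^bsub>A\<^esub> b (g \<otimes>\<^bsub>G\<^esub> h) \<otimes>\<^bsub>A\<^esub> (b g \<otimes>\<^bsub>A\<^esub> inv\<^bsub>A\<^esub> b g) \<otimes>\<^bsub>A\<^esub> (act g (b h) \<otimes>\<^bsub>A\<^esub> inv\<^bsub>A\<^esub> act g (b h))"
      unfolding e using m by (simp add: A.m_ac del: A.r_inv A.l_inv A.Units_r_inv A.Units_l_inv)
    then show ?thesis using m by (simp add: xy f_def P.mult_E P'.mult_E)
  qed
  have cont: "continuous_map (topo P.E) (topo P'.E) f"
    unfolding P.topo_E P'.topo_E f_def case_prod_unfold
    by (intro continuous_map_pairedI continuous_map_group_mult continuous_map_group_inv tgA continuous_map_fst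
        continuous_map_compose[OF continuous_map_snd b, unfolded comp_def] continuous_map_snd)
  have homeo: "homeomorphic_map (topo P.E) (topo P'.E) f"
  proof (rule continuous_imp_homeomorphic_map[OF cont])
    show "compact_space (topo P.E)" "Hausdorff_space (topo P'.E)"
      using P.profinite_E P'.profinite_E by (simp_all add: profinite_group_def profinite_space_def)
  qed (use bij in \<open>simp_all add: bij_betw_def tsA ts P.carrier_E P'.carrier_E\<close>)
  have incl: "f (P.i a) = P'.i a" if a: "a \<in> carrier A" for a
  proof -
    have "v' \<one>\<^bsub>G\<^esub> \<one>\<^bsub>G\<^esub> \<otimes>\<^bsub>A\<^esub> b \<one>\<^bsub>G\<^esub> = v \<one>\<^bsub>G\<^esub> \<one>\<^bsub>G\<^esub> \<otimes>\<^bsub>A\<^esub> b \<one>\<^bsub>G\<^esub> \<otimes>\<^bsub>A\<^esub> b \<one>\<^bsub>G\<^esub>"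
      using v'[OF one_closed one_closed] by simp
    then have "v' \<one>\<^bsub>G\<^esub> \<one>\<^bsub>G\<^esub> = v \<one>\<^bsub>G\<^esub> \<one>\<^bsub>G\<^esub> \<otimes>\<^bsub>A\<^esub> b \<one>\<^bsub>G\<^esub>" by simp
    then show ?thesis using a by (simp add: f_def P.i_def P'.i_def A.inv_mult A.m_assoc)
  qed
  have tc: "continuous_map X (topo A) t"
    unfolding t_def using continuous_map_compose[OF continuous_map_pairedI[of X "topo G" "\<lambda>_. \<one>\<^bsub>G\<^esub>" X "\<lambda>x. x"] w] ts
    by (simp add: comp_def)
  have sec: "P'.q x s = P'.i (t x) \<otimes>\<^bsub>P'.E\<^esub> f (P.q x s) \<otimes>\<^bsub>P'.E\<^esub> inv\<^bsub>P'.E\<^esub> (P'.i (t x))"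
    if x: "x \<in> topspace X" and s: "s \<in> S x" for x s
  proof -
    have sG: "s \<in> carrier G" using S_sub[OF x s] .
    have tA: "t x \<in> carrier A" using x by (simp add: t_def)
    have fq: "f (P.q x s) \<in> carrier P'.E" using bij P.q_closed[OF x s] by (metis bij_betwE)
    let ?a = "u s (cs \<one>\<^bsub>G\<^esub> x)" and ?b = "u' s (cs \<one>\<^bsub>G\<^esub> x)"
    have c: "?a \<in> carrier A" "?b \<in> carrier A" "act s (t x) \<in> carrier A" "b s \<in> carrier A" using x sG tA by simp_all
    have "?b \<otimes>\<^bsub>A\<^esub> t x = b s \<otimes>\<^bsub>A\<^esub> act s (t x) \<otimes>\<^bsub>A\<^esub> ?a"
      using u'w[OF sG one_closed x] x s sG by (simp add: t_def P.cs_S)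
    then have eb: "t x = b s \<otimes>\<^bsub>A\<^esub> act s (t x) \<otimes>\<^bsub>A\<^esub> ?a \<otimes>\<^bsub>A\<^esub> inv\<^bsub>A\<^esub> ?b"
      using A.inv_solve_right[of "t x" "b s \<otimes>\<^bsub>A\<^esub> act s (t x) \<otimes>\<^bsub>A\<^esub> ?a" ?b] A.m_comm[of ?b "t x"] c tA
      by simp
    have "t x \<otimes>\<^bsub>A\<^esub> (inv\<^bsub>A\<^esub> ?a \<otimes>\<^bsub>A\<^esub> inv\<^bsub>A\<^esub> b s) = (b s \<otimes>\<^bsub>A\<^esub> inv\<^bsub>A\<^esub> b s) \<otimes>\<^bsub>A\<^esub> (?a \<otimes>\<^bsub>A\<^esub> inv\<^bsub>A\<^esub> ?a) \<otimes>\<^bsub>A\<^esub> (inv\<^bsub>A\<^esub> ?b \<otimes>\<^bsub>A\<^esub> act s (t x))"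
      by (subst eb) (use c tA in \<open>simp add: A.m_ac del: A.r_inv A.l_inv A.Units_r_inv A.Units_l_inv\<close>)
    then have "P'.q x s \<otimes>\<^bsub>P'.E\<^esub> P'.i (t x) = P'.i (t x) \<otimes>\<^bsub>P'.E\<^esub> f (P.q x s)"
      using c tA sG x by (simp add: P'.q_def P.q_def f_def P'.mult_i P'.i_mult)
    then show ?thesis using P'.E.inv_solve_right[of "P'.q x s" "P'.i (t x) \<otimes>\<^bsub>P'.E\<^esub> f (P.q x s)" "P'.i (t x)"]
        fq P'.q_closed[OF x s] P'.i_closed[OF tA] by (metis P'.E.m_closed)
  qed
  show ?thesis
    unfolding rel_ext_equivalent_def P.R_sel P'.R_sel
  proof (intro exI[of _ f] exI[of _ t] conjI ballI homeo tc incl sec)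
    show "f \<in> iso P.E P'.E" using bij hom by (auto simp: iso_def hom_def bij_betw_def)
    show "snd (f e) = snd e" for e by (simp add: f_def case_prod_unfold)
  qed
qed

text \<open>An isomorphism over \<open>G\<close> that fixes \<open>A\<close> has the form
  \<open>(a, g) \<mapsto> (a + c(g), g)\<close>, so \<open>b = - c\<close>. The difference
  \<open>e\<close> of \<open>u' + c\<close> and \<open>u\<close> is a cocycle of \<open>G\<close>
  with values in functions on the coset space, and over the stabilizer \<open>S x\<close> of
  \<open>1 S_x\<close> it is the coboundary of \<open>t x\<close>. As in Shapiro's lemma, the
  cocycle is then a coboundary: \<open>t x\<close> is transported along the orbit to a function
  \<open>w\<close>.\<close>

lemma cohomologous_if_equivalent:
  assumes "rel_ext_equivalent X S A P.R P'.R"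
  shows "cohomologous u u'"
proof -
  obtain f t where iso: "f \<in> iso P.E P'.E" and homeo: "homeomorphic_map (topo P.E) (topo P'.E) f"
    and incl: "\<And>a. a \<in> carrier A \<Longrightarrow> f (P.i a) = P'.i a"
    and proj: "\<And>e. e \<in> carrier P.E \<Longrightarrow> snd (f e) = snd e"
    and t: "continuous_map X (topo A) t"
    and sec: "\<And>x s. x \<in> topspace X \<Longrightarrow> s \<in> S x \<Longrightarrow>
       P'.q x s = P'.i (t x) \<otimes>\<^bsub>P'.E\<^esub> f (P.q x s) \<otimes>\<^bsub>P'.E\<^esub> inv\<^bsub>P'.E\<^esub> (P'.i (t x))"
    using assms unfolding rel_ext_equivalent_def P.R_sel P'.R_sel by blast
  have tA [simp]: "t x \<in> carrier A" if "x \<in> topspace X" for x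
    using continuous_map_image_subset_topspace[OF t] that tsA by auto
  have fE: "f e \<in> carrier P'.E" if "e \<in> carrier P.E" for e using iso that by (simp only: iso_def hom_def) blast
  have fmult: "f (e \<otimes>\<^bsub>P.E\<^esub> e') = f e \<otimes>\<^bsub>P'.E\<^esub> f e'" if "e \<in> carrier P.E" "e' \<in> carrier P.E" for e e'
    using iso that by (simp only: iso_def hom_def) blast
  define c where "c g = fst (f (\<one>\<^bsub>A\<^esub>, g))" for g
  have f1: "f (\<one>\<^bsub>A\<^esub>, g) = (c g, g)" and cA [simp]: "c g \<in> carrier A" if "g \<in> carrier G" for g
  proof -
    have m: "(\<one>\<^bsub>A\<^esub>, g) \<in> carrier P.E" using that by simp
    show "f (\<one>\<^bsub>A\<^esub>, g) = (c g, g)" using proj[OF m] by (simp add: c_def prod_eq_iff)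
    then show "c g \<in> carrier A" using fE[OF m] by simp
  qed
  have fag: "f (a, g) = (a \<otimes>\<^bsub>A\<^esub> c g, g)" if "a \<in> carrier A" "g \<in> carrier G" for a g
  proof -
    have "f (P.i a \<otimes>\<^bsub>P.E\<^esub> (\<one>\<^bsub>A\<^esub>, g)) = P'.i a \<otimes>\<^bsub>P'.E\<^esub> (c g, g)"
      using fmult[OF P.i_closed[OF that(1)], of "(\<one>\<^bsub>A\<^esub>, g)"] incl that f1 by simp
    then show ?thesis using that by (simp add: P.i_mult P'.i_mult)
  qed
  have E1: "v g h \<otimes>\<^bsub>A\<^esub> c (g \<otimes>\<^bsub>G\<^esub> h) = c g \<otimes>\<^bsub>A\<^esub> act g (c h) \<otimes>\<^bsub>A\<^esub> v' g h" if "g \<in> carrier G" "h \<in> carrier G" for g h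
    using fmult[of "(\<one>\<^bsub>A\<^esub>, g)" "(\<one>\<^bsub>A\<^esub>, h)"] that by (simp add: fag P.mult_E P'.mult_E)
  have E2: "u' s (cs \<one>\<^bsub>G\<^esub> x) \<otimes>\<^bsub>A\<^esub> c s \<otimes>\<^bsub>A\<^esub> t x = act s (t x) \<otimes>\<^bsub>A\<^esub> u s (cs \<one>\<^bsub>G\<^esub> x)"
    if x: "x \<in> topspace X" and s: "s \<in> S x" for x s
  proof -
    have sG: "s \<in> carrier G" using S_sub[OF x s] .
    let ?a = "u s (cs \<one>\<^bsub>G\<^esub> x)" and ?b = "u' s (cs \<one>\<^bsub>G\<^esub> x)"
    have cc: "?a \<in> carrier A" "?b \<in> carrier A" "act s (t x) \<in> carrier A" "c s \<in> carrier A" using x sG by simp_all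
    have "P'.q x s \<otimes>\<^bsub>P'.E\<^esub> P'.i (t x) = P'.i (t x) \<otimes>\<^bsub>P'.E\<^esub> f (P.q x s)"
      using sec[OF x s] P'.E.inv_solve_right[of "P'.q x s" "P'.i (t x) \<otimes>\<^bsub>P'.E\<^esub> f (P.q x s)" "P'.i (t x)"]
        fE[OF P.q_closed[OF x s]] P'.q_closed[OF x s] P'.i_closed[OF tA[OF x]] by (metis P'.E.m_closed)
    then have e: "inv\<^bsub>A\<^esub> ?b \<otimes>\<^bsub>A\<^esub> act s (t x) = t x \<otimes>\<^bsub>A\<^esub> (inv\<^bsub>A\<^esub> ?a \<otimes>\<^bsub>A\<^esub> c s)"
      using x sG by (simp add: P'.q_def P.q_def fag P'.mult_i P'.i_mult)
    have "?b \<otimes>\<^bsub>A\<^esub> c s \<otimes>\<^bsub>A\<^esub> t x = (?b \<otimes>\<^bsub>A\<^esub> c s \<otimes>\<^bsub>A\<^esub> t x) \<otimes>\<^bsub>A\<^esub> (?a \<otimes>\<^bsub>A\<^esub> inv\<^bsub>A\<^esub> ?a)" using cc x by simp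
    also have "\<dots> = (t x \<otimes>\<^bsub>A\<^esub> (inv\<^bsub>A\<^esub> ?a \<otimes>\<^bsub>A\<^esub> c s)) \<otimes>\<^bsub>A\<^esub> (?b \<otimes>\<^bsub>A\<^esub> ?a)"
      using cc x by (simp add: A.m_ac del: A.r_inv A.l_inv A.Units_r_inv A.Units_l_inv)
    also have "\<dots> = (act s (t x) \<otimes>\<^bsub>A\<^esub> ?a) \<otimes>\<^bsub>A\<^esub> (?b \<otimes>\<^bsub>A\<^esub> inv\<^bsub>A\<^esub> ?b)"
      unfolding e[symmetric] using cc x by (simp add: A.m_ac del: A.r_inv A.l_inv A.Units_r_inv A.Units_l_inv)
    finally show ?thesis using cc by simp
  qed
  have cc: "continuous_map (topo G) (topo A) c"
  proof -
    have "continuous_map (topo G) (topo P.E) (\<lambda>g. (\<one>\<^bsub>A\<^esub>, g))"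
      unfolding P.topo_E by (intro continuous_map_pairedI) (auto simp: tsA)
    from continuous_map_compose[OF this homeomorphic_imp_continuous_map[OF homeo]]
    have "continuous_map (topo G) (prod_topology (topo A) (topo G)) (\<lambda>g. f (\<one>\<^bsub>A\<^esub>, g))" by (simp add: comp_def)
    from continuous_map_compose[OF this continuous_map_fst]
    show ?thesis by (simp add: comp_def c_def[abs_def])
  qed
  define e where "e g y = u' g y \<otimes>\<^bsub>A\<^esub> c g \<otimes>\<^bsub>A\<^esub> inv\<^bsub>A\<^esub> u g y" for g y
  have eA [simp]: "e g (cs k x) \<in> carrier A" if "g \<in> carrier G" "k \<in> carrier G" "x \<in> topspace X" for g k x
    using that by (simp add: e_def)
  have eu: "e g (cs k x) \<otimes>\<^bsub>A\<^esub> u g (cs k x) = u' g (cs k x) \<otimes>\<^bsub>A\<^esub> c g" if "g \<in> carrier G" "k \<in> carrier G" "x \<in> topspace X" for g k x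
    using that by (simp add: e_def A.m_assoc)
  \<comment> \<open>The coboundaries of \<open>u\<close> and \<open>u'\<close> are \<open>v\<close>
    and \<open>v'\<close>, and that of \<open>c\<close> is \<open>v - v'\<close> by
    \<open>E1\<close>; those of \<open>u' + c\<close> and \<open>u\<close> thus agree.\<close>
  have E3: "e (g \<otimes>\<^bsub>G\<^esub> h) (cs k x) = e g (cs k x) \<otimes>\<^bsub>A\<^esub> act g (e h (cs (inv\<^bsub>G\<^esub> g \<otimes>\<^bsub>G\<^esub> k) x))"
    if g: "g \<in> carrier G" and h: "h \<in> carrier G" and k: "k \<in> carrier G" and x: "x \<in> topspace X" for g h k x
  proof -
    have gik: "inv\<^bsub>G\<^esub> g \<otimes>\<^bsub>G\<^esub> k \<in> carrier G" using g k by simp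
    let ?y = "cs k x" and ?y' = "cs (inv\<^bsub>G\<^esub> g \<otimes>\<^bsub>G\<^esub> k) x"
    let ?e0 = "e (g \<otimes>\<^bsub>G\<^esub> h) ?y" and ?e1 = "e g ?y" and ?e2 = "act g (e h ?y')"
    let ?u1 = "act g (u h ?y')" and ?u2 = "u (g \<otimes>\<^bsub>G\<^esub> h) ?y" and ?u3 = "u g ?y"
    let ?u1' = "act g (u' h ?y')" and ?u2' = "u' (g \<otimes>\<^bsub>G\<^esub> h) ?y" and ?u3' = "u' g ?y"
    let ?c0 = "c (g \<otimes>\<^bsub>G\<^esub> h)" and ?c1 = "c g" and ?c2 = "act g (c h)"
    have car: "?e0 \<in> carrier A" "?e1 \<in> carrier A" "?e2 \<in> carrier A" "?u1 \<in> carrier A" "?u2 \<in> carrier A" "?u3 \<in> carrier A"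
      "?u1' \<in> carrier A" "?u2' \<in> carrier A" "?u3' \<in> carrier A" "?c0 \<in> carrier A" "?c1 \<in> carrier A" "?c2 \<in> carrier A"
      "v g h \<in> carrier A" "v' g h \<in> carrier A"
      using g h k x by simp_all
    have a0: "?e0 \<otimes>\<^bsub>A\<^esub> ?u2 = ?u2' \<otimes>\<^bsub>A\<^esub> ?c0" using eu[OF m_closed[OF g h] k x] .
    have a1: "?e1 \<otimes>\<^bsub>A\<^esub> ?u3 = ?u3' \<otimes>\<^bsub>A\<^esub> ?c1" using eu[OF g k x] .
    have "act g (e h ?y' \<otimes>\<^bsub>A\<^esub> u h ?y') = act g (u' h ?y' \<otimes>\<^bsub>A\<^esub> c h)" using eu[OF h gik x] by simp
    then have a2: "?e2 \<otimes>\<^bsub>A\<^esub> ?u1 = ?u1' \<otimes>\<^bsub>A\<^esub> ?c2" using g h gik x by simp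
    have b1: "v g h \<otimes>\<^bsub>A\<^esub> ?u2 = ?u1 \<otimes>\<^bsub>A\<^esub> ?u3" by (rule P.v_u[OF g h k x])
    have b2: "v' g h \<otimes>\<^bsub>A\<^esub> ?u2' = ?u1' \<otimes>\<^bsub>A\<^esub> ?u3'" by (rule P'.v_u[OF g h k x])
    have b3: "v g h \<otimes>\<^bsub>A\<^esub> ?c0 = ?c1 \<otimes>\<^bsub>A\<^esub> ?c2 \<otimes>\<^bsub>A\<^esub> v' g h" by (rule E1[OF g h])
    let ?z = "?u2 \<otimes>\<^bsub>A\<^esub> v g h"
    have zc: "?z \<in> carrier A" using car by simp
    have "?e1 \<otimes>\<^bsub>A\<^esub> ?e2 \<otimes>\<^bsub>A\<^esub> ?z = (?e1 \<otimes>\<^bsub>A\<^esub> ?u3) \<otimes>\<^bsub>A\<^esub> (?e2 \<otimes>\<^bsub>A\<^esub> ?u1)"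
    proof -
      have "?e1 \<otimes>\<^bsub>A\<^esub> ?e2 \<otimes>\<^bsub>A\<^esub> ?z = ?e1 \<otimes>\<^bsub>A\<^esub> ?e2 \<otimes>\<^bsub>A\<^esub> (v g h \<otimes>\<^bsub>A\<^esub> ?u2)" using car by (simp only: A.m_comm)
      then show ?thesis unfolding b1 using car by (simp only: A.m_ac A.m_closed)
    qed
    also have "\<dots> = (?u1' \<otimes>\<^bsub>A\<^esub> ?u3') \<otimes>\<^bsub>A\<^esub> ?c1 \<otimes>\<^bsub>A\<^esub> ?c2"
      unfolding a1 a2 using car by (simp only: A.m_ac A.m_closed)
    also have "\<dots> = ?u2' \<otimes>\<^bsub>A\<^esub> (?c1 \<otimes>\<^bsub>A\<^esub> ?c2 \<otimes>\<^bsub>A\<^esub> v' g h)"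
      unfolding b2[symmetric] using car by (simp only: A.m_ac A.m_closed)
    also have "\<dots> = (?u2' \<otimes>\<^bsub>A\<^esub> ?c0) \<otimes>\<^bsub>A\<^esub> v g h"
      unfolding b3[symmetric] using car by (simp only: A.m_ac A.m_closed)
    also have "\<dots> = ?e0 \<otimes>\<^bsub>A\<^esub> ?z"
      unfolding a0[symmetric] using car by (simp only: A.m_ac A.m_closed)
    finally show ?thesis using car zc by (simp only: A.right_cancel A.m_closed)
  qed
  \<comment> \<open>Compatibility of the sections turns the cocycle, restricted to the stabilizer
    and evaluated at its fixed coset, into the coboundary of \<open>t x\<close>.\<close>
  have E4: "e s (cs \<one>\<^bsub>G\<^esub> x) \<otimes>\<^bsub>A\<^esub> t x = act s (t x)" if x: "x \<in> topspace X" and s: "s \<in> S x" for x s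
  proof -
    have sG: "s \<in> carrier G" using S_sub[OF x s] .
    let ?a = "u s (cs \<one>\<^bsub>G\<^esub> x)"
    have ca: "?a \<in> carrier A" "e s (cs \<one>\<^bsub>G\<^esub> x) \<in> carrier A" "t x \<in> carrier A" "act s (t x) \<in> carrier A" using x sG by simp_all
    have "e s (cs \<one>\<^bsub>G\<^esub> x) \<otimes>\<^bsub>A\<^esub> t x \<otimes>\<^bsub>A\<^esub> ?a = (e s (cs \<one>\<^bsub>G\<^esub> x) \<otimes>\<^bsub>A\<^esub> ?a) \<otimes>\<^bsub>A\<^esub> t x"
      using ca by (simp only: A.m_ac A.m_closed)
    also have "\<dots> = act s (t x) \<otimes>\<^bsub>A\<^esub> ?a" unfolding eu[OF sG one_closed x] by (rule E2[OF x s])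
    finally show ?thesis using ca by (simp only: A.right_cancel A.m_closed)
  qed
  \<comment> \<open>Forced by the two requirements \<open>w(1 S_x) = t x\<close> and
    \<open>g w(g^-1 y) - w(y) = e(g, y)\<close>, taken at \<open>g = h\<close> and
    \<open>y = h S_x\<close>.\<close>
  define W where "W h x = act h (t x) \<otimes>\<^bsub>A\<^esub> inv\<^bsub>A\<^esub> e h (cs h x)" for h x
  have WA [simp]: "W h x \<in> carrier A" if "h \<in> carrier G" "x \<in> topspace X" for h x using that by (simp add: W_def)
  have We: "W h x \<otimes>\<^bsub>A\<^esub> e h (cs h x) = act h (t x)" if "h \<in> carrier G" "x \<in> topspace X" for h x
    using that by (simp add: W_def A.m_assoc)
  have W_coset: "W (h \<otimes>\<^bsub>G\<^esub> s) x = W h x" if h: "h \<in> carrier G" and x: "x \<in> topspace X" and s: "s \<in> S x" for h s x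
  proof -
    have sG: "s \<in> carrier G" using S_sub[OF x s] .
    have hs: "h \<otimes>\<^bsub>G\<^esub> s \<in> carrier G" using h sG by simp
    let ?e1 = "e h (cs h x)" and ?e2 = "act h (e s (cs \<one>\<^bsub>G\<^esub> x))"
    have e0: "e (h \<otimes>\<^bsub>G\<^esub> s) (cs (h \<otimes>\<^bsub>G\<^esub> s) x) = ?e1 \<otimes>\<^bsub>A\<^esub> ?e2"
      using E3[OF h sG h x] h by (simp add: cs_mult[OF h x s])
    have car: "?e1 \<in> carrier A" "?e2 \<in> carrier A" "act h (t x) \<in> carrier A" "W h x \<in> carrier A" "W (h \<otimes>\<^bsub>G\<^esub> s) x \<in> carrier A"
      using h sG x by simp_all
    have "act h (e s (cs \<one>\<^bsub>G\<^esub> x) \<otimes>\<^bsub>A\<^esub> t x) = act h (act s (t x))" using E4[OF x s] by simp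
    then have e2: "?e2 \<otimes>\<^bsub>A\<^esub> act h (t x) = act (h \<otimes>\<^bsub>G\<^esub> s) (t x)" using h sG x by (simp add: act_act)
    have "W (h \<otimes>\<^bsub>G\<^esub> s) x \<otimes>\<^bsub>A\<^esub> (?e1 \<otimes>\<^bsub>A\<^esub> ?e2) = ?e2 \<otimes>\<^bsub>A\<^esub> act h (t x)"
      using We[OF hs x] unfolding e0 e2 .
    also have "\<dots> = W h x \<otimes>\<^bsub>A\<^esub> (?e1 \<otimes>\<^bsub>A\<^esub> ?e2)"
      unfolding We[OF h x, symmetric] using car by (simp only: A.m_ac A.m_closed)
    finally show ?thesis using car by (simp only: A.right_cancel A.m_closed)
  qed
  \<comment> \<open>Any representative of the coset will do, by \<open>W_coset\<close>.\<close>
  define w where "w y = W (SOME h. h \<in> carrier G \<and> cs h (snd y) = y) (snd y)" for y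
  have w: "w (cs h x) = W h x" if h: "h \<in> carrier G" and x: "x \<in> topspace X" for h x
  proof -
    have sx: "snd (cs h x) = x" by (simp add: cs_def)
    let ?h = "SOME h'. h' \<in> carrier G \<and> cs h' (snd (cs h x)) = cs h x"
    have h': "?h \<in> carrier G \<and> cs ?h (snd (cs h x)) = cs h x"
      by (rule someI[of _ h]) (simp add: h sx)
    have "inv\<^bsub>G\<^esub> h \<otimes>\<^bsub>G\<^esub> ?h \<in> S x"
      by (rule cs_eqD(2)[of h x ?h x]) (use h h' x in \<open>simp_all add: sx\<close>)
    from W_coset[OF h x this] h h' show ?thesis by (simp add: w_def sx flip: m_assoc)
  qed
  have dW: "act g (W (inv\<^bsub>G\<^esub> g \<otimes>\<^bsub>G\<^esub> k) x) \<otimes>\<^bsub>A\<^esub> inv\<^bsub>A\<^esub> W k x = e g (cs k x)" if g: "g \<in> carrier G" and k: "k \<in> carrier G" and x: "x \<in> topspace X" for g k x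
  proof -
    let ?gk = "inv\<^bsub>G\<^esub> g \<otimes>\<^bsub>G\<^esub> k"
    have gk: "?gk \<in> carrier G" "g \<otimes>\<^bsub>G\<^esub> ?gk = k" using g k by (simp_all flip: m_assoc)
    let ?e1 = "e g (cs k x)" and ?e2 = "act g (e ?gk (cs ?gk x))" and ?w = "act g (W ?gk x)"
    have car: "?e1 \<in> carrier A" "?e2 \<in> carrier A" "?w \<in> carrier A" "W k x \<in> carrier A"
      using g k x by simp_all
    have e0: "e k (cs k x) = ?e1 \<otimes>\<^bsub>A\<^esub> ?e2" using E3[OF g gk(1) k x] gk(2) by simp
    have "act g (W ?gk x \<otimes>\<^bsub>A\<^esub> e ?gk (cs ?gk x)) = act g (act ?gk (t x))" using We[OF gk(1) x] by simp
    then have 1: "?w \<otimes>\<^bsub>A\<^esub> ?e2 = act k (t x)" using g gk x by (simp add: act_act)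
    have "?e1 \<otimes>\<^bsub>A\<^esub> W k x \<otimes>\<^bsub>A\<^esub> ?e2 = W k x \<otimes>\<^bsub>A\<^esub> (?e1 \<otimes>\<^bsub>A\<^esub> ?e2)" using car by (simp only: A.m_ac A.m_closed)
    also have "\<dots> = ?w \<otimes>\<^bsub>A\<^esub> ?e2" using We[OF k x] unfolding e0 1 .
    finally have "?e1 \<otimes>\<^bsub>A\<^esub> W k x = ?w" using car by (simp only: A.right_cancel A.m_closed)
    then have "?w \<otimes>\<^bsub>A\<^esub> inv\<^bsub>A\<^esub> W k x = ?e1 \<otimes>\<^bsub>A\<^esub> W k x \<otimes>\<^bsub>A\<^esub> inv\<^bsub>A\<^esub> W k x" by simp
    then show ?thesis using car by (simp add: A.m_assoc)
  qed
  have wc: "continuous_map GX (topo A) (\<lambda>z. w (cs (fst z) (snd z)))"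
  proof -
    have "continuous_map GX (topo A) (\<lambda>z. act (fst z) (t (snd z)) \<otimes>\<^bsub>A\<^esub> inv\<^bsub>A\<^esub>
        (u' (fst z) (cs (fst z) (snd z)) \<otimes>\<^bsub>A\<^esub> c (fst z) \<otimes>\<^bsub>A\<^esub> inv\<^bsub>A\<^esub> u (fst z) (cs (fst z) (snd z))))"
      by (intro continuous_map_group_mult continuous_map_group_inv tgA continuous_map_act fam_continuous[OF P.u]
          fam_continuous[OF P'.u] continuous_map_fst continuous_map_snd
          continuous_map_compose[OF continuous_map_snd t, unfolded comp_def]
          continuous_map_compose[OF continuous_map_fst cc, unfolded comp_def])
    then show ?thesis by (rule continuous_map_eq) (use ts in \<open>auto simp: w W_def e_def\<close>)
  qed
  show ?thesis
    unfolding cohomologous_def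
  proof (intro exI[of _ "\<lambda>g. inv\<^bsub>A\<^esub> c g"] exI[of _ w] conjI ballI wc continuous_map_group_inv tgA cc)
    fix g k x assume g: "g \<in> carrier G" and k: "k \<in> carrier G" and x: "x \<in> topspace X"
    have gk: "inv\<^bsub>G\<^esub> g \<otimes>\<^bsub>G\<^esub> k \<in> carrier G" using g k by simp
    have "e g (cs k x) \<otimes>\<^bsub>A\<^esub> u g (cs k x) = u' g (cs k x) \<otimes>\<^bsub>A\<^esub> c g" by (rule eu[OF g k x])
    moreover have "inv\<^bsub>A\<^esub> c g \<otimes>\<^bsub>A\<^esub> (u' g (cs k x) \<otimes>\<^bsub>A\<^esub> c g) = u' g (cs k x) \<otimes>\<^bsub>A\<^esub> (c g \<otimes>\<^bsub>A\<^esub> inv\<^bsub>A\<^esub> c g)"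
      using g k x by (simp add: A.m_ac del: A.r_inv A.l_inv A.Units_r_inv A.Units_l_inv)
    ultimately show "u' g (cs k x) = inv\<^bsub>A\<^esub> c g \<otimes>\<^bsub>A\<^esub> (act g (w (cs (inv\<^bsub>G\<^esub> g \<otimes>\<^bsub>G\<^esub> k) x)) \<otimes>\<^bsub>A\<^esub> inv\<^bsub>A\<^esub> w (cs k x) \<otimes>\<^bsub>A\<^esub> u g (cs k x))"
      using g k x by (simp add: w[OF gk x] w[OF k x] dW[OF g k x])
  qed
qed

end

section \<open>Trivialising a finite covering of a profinite space\<close>

lemma openin_continuous_preimage:
  "continuous_map X Y f \<Longrightarrow> openin Y U \<Longrightarrow> openin X {x \<in> topspace X. f x \<in> U}"
  by (simp add: continuous_map_def)

lemma openin_iff_clopen: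
  assumes "openin X U" "closedin X U" "openin X V" "closedin X V"
  shows "openin X {x \<in> topspace X. x \<in> U \<longleftrightarrow> x \<in> V}"
proof -
  have "{x \<in> topspace X. x \<in> U \<longleftrightarrow> x \<in> V} = (U \<inter> V) \<union> ((topspace X - U) \<inter> (topspace X - V))"
    using openin_subset[OF assms(1)] openin_subset[OF assms(3)] by auto
  then show ?thesis using assms by (simp add: openin_Int openin_Un openin_diff)
qed

text \<open>The complement is a union of left cosets of \<open>H\<close>, which are open.\<close>

lemma open_subgroup_closedin:
  assumes E: "topological_group E" and H: "subgroup H E" "openin (topo E) H"
  shows "closedin (topo E) H"
proof -
  interpret E: group E using E by (simp add: topological_group_def)
  interpret H: subgroup H E by fact
  note ts = topspace_topological_group[OF E]
  have "openin (topo E) (carrier E - H)"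
  proof (rule openin_locally)
    fix g assume g: "g \<in> carrier E - H"
    let ?V = "{h \<in> topspace (topo E). inv\<^bsub>E\<^esub> g \<otimes>\<^bsub>E\<^esub> h \<in> H}"
    have "continuous_map (topo E) (topo E) (\<lambda>h. inv\<^bsub>E\<^esub> g \<otimes>\<^bsub>E\<^esub> h)"
      using g ts by (intro continuous_map_group_mult E) auto
    then have "openin (topo E) ?V" using H(2) by (rule openin_continuous_preimage)
    moreover have "?V \<subseteq> carrier E - H"
    proof
      fix h assume h: "h \<in> ?V"
      show "h \<in> carrier E - H"
      proof (rule ccontr)
        assume "h \<notin> carrier E - H"
        then have hH: "h \<in> H" "h \<in> carrier E" using h ts by auto
        have "h \<otimes>\<^bsub>E\<^esub> inv\<^bsub>E\<^esub> (inv\<^bsub>E\<^esub> g \<otimes>\<^bsub>E\<^esub> h) \<in> H" using h hH by auto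
        moreover have "h \<otimes>\<^bsub>E\<^esub> inv\<^bsub>E\<^esub> (inv\<^bsub>E\<^esub> g \<otimes>\<^bsub>E\<^esub> h) = g"
          using g hH by (simp add: E.inv_mult_group flip: E.m_assoc)
        ultimately show False using g by simp
      qed
    qed
    ultimately show "\<exists>V. openin (topo E) V \<and> g \<in> V \<and> V \<subseteq> carrier E - H"
      using g ts by (intro exI[of _ ?V]) auto
  qed
  then show ?thesis using H.subset ts by (simp add: closedin_def)
qed

text \<open>
  The subgroup is the stabilizer of a clopen set that contains \<open>T\<close>, avoids \<open>F\<close> and is invariant
  under left translation by \<open>T\<close>.
\<close>

lemma open_subgroup_separation:
  assumes E: "profinite_group E" and T: "subgroup T E" "closedin (topo E) T"
    and F: "closedin (topo E) F" and TF: "T \<inter> F = {}"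
  obtains H where "subgroup H E" "openin (topo E) H" "closedin (topo E) H" "T \<subseteq> H" "H \<inter> F = {}"
proof -
  have tg: "topological_group E" and prof: "profinite_space (topo E)" and comp: "compact_space (topo E)"
    using E by (auto simp: profinite_group_def profinite_space_def)
  interpret E: group E using tg by (simp add: topological_group_def)
  interpret T: subgroup T E by fact
  note ts = topspace_topological_group[OF tg]
  obtain C where C: "openin (topo E) C" "closedin (topo E) C" "T \<subseteq> C" "C \<inter> F = {}"
    using profinite_clopen_separation[OF prof T(2) F TF] .
  \<comment> \<open>The largest part of \<open>C\<close> that is stable under left translation by
    \<open>T\<close>. It is closed as an intersection, and open because \<open>T\<close> is
    compact.\<close>
  define C' where "C' = {c \<in> carrier E. \<forall>t\<in>T. t \<otimes>\<^bsub>E\<^esub> c \<in> C}"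
  have tT: "topspace (subtopology (topo E) T) = T" using T.subset ts by auto
  have C'_open: "openin (topo E) C'"
  proof -
    let ?P = "prod_topology (topo E) (subtopology (topo E) T)"
    have cT: "compact_space (subtopology (topo E) T)"
      using closedin_compact_space[OF comp T(2)] by (simp add: compact_space_subtopology)
    have "continuous_map ?P (topo E) (\<lambda>z. snd z \<otimes>\<^bsub>E\<^esub> fst z)"
      by (intro continuous_map_group_mult tg continuous_map_fst continuous_map_into_fulltopology[OF continuous_map_snd])
    from openin_all[OF cT openin_continuous_preimage[OF this C(1)]] show ?thesis
      by (rule back_subst[of "openin (topo E)"]) (use T.subset in \<open>auto simp: C'_def ts tT\<close>)
  qed
  have C'_closed: "closedin (topo E) C'"
  proof -
    have "closedin (topo E) (\<Inter>t\<in>T. {c \<in> topspace (topo E). t \<otimes>\<^bsub>E\<^esub> c \<in> C})"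
    proof (rule closedin_INT)
      fix t assume "t \<in> T"
      then have "continuous_map (topo E) (topo E) (\<lambda>c. t \<otimes>\<^bsub>E\<^esub> c)"
        using ts by (intro continuous_map_group_mult tg) auto
      then show "closedin (topo E) {c \<in> topspace (topo E). t \<otimes>\<^bsub>E\<^esub> c \<in> C}"
        using C(2) by (rule closedin_continuous_map_preimage)
    qed (use T.one_closed in blast)
    moreover have "(\<Inter>t\<in>T. {c \<in> topspace (topo E). t \<otimes>\<^bsub>E\<^esub> c \<in> C}) = C'"
      unfolding C'_def ts using T.one_closed by blast
    ultimately show ?thesis by simp
  qed
  have TC': "T \<subseteq> C'" using C(3) by (auto simp: C'_def)
  have C'C: "C' \<subseteq> C"
  proof
    fix c assume c: "c \<in> C'"
    then have "\<one>\<^bsub>E\<^esub> \<otimes>\<^bsub>E\<^esub> c \<in> C" using T.one_closed unfolding C'_def by blast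
    then show "c \<in> C" using c by (simp add: C'_def)
  qed
  \<comment> \<open>For clopen \<open>C'\<close> the pairs \<open>(g, c)\<close> with
    \<open>g c\<close> and \<open>c\<close> both inside or both outside form an open set, so
    compactness of \<open>E\<close> makes \<open>H\<close> open.\<close>
  define H where "H = {g \<in> carrier E. \<forall>c\<in>carrier E. g \<otimes>\<^bsub>E\<^esub> c \<in> C' \<longleftrightarrow> c \<in> C'}"
  have H_open: "openin (topo E) H"
  proof -
    let ?P = "prod_topology (topo E) (topo E)"
    have m: "continuous_map ?P (topo E) (\<lambda>z. fst z \<otimes>\<^bsub>E\<^esub> snd z)"
      by (intro continuous_map_group_mult tg continuous_map_fst continuous_map_snd)
    have s: "continuous_map ?P (topo E) snd" by (rule continuous_map_snd)
    from openin_all[OF comp openin_iff_clopen[OF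
        openin_continuous_preimage[OF m C'_open] closedin_continuous_map_preimage[OF m C'_closed]
        openin_continuous_preimage[OF s C'_open] closedin_continuous_map_preimage[OF s C'_closed]]]
    show ?thesis by (rule back_subst[of "openin (topo E)"]) (auto simp: H_def ts)
  qed
  have H: "subgroup H E"
  proof (rule E.subgroupI)
    show "H \<noteq> {}" by (auto simp: H_def intro!: exI[of _ "\<one>\<^bsub>E\<^esub>"])
    show "inv\<^bsub>E\<^esub> g \<in> H" if g: "g \<in> H" for g
    proof -
      have gE: "g \<in> carrier E" and gc: "\<And>c. c \<in> carrier E \<Longrightarrow> g \<otimes>\<^bsub>E\<^esub> c \<in> C' \<longleftrightarrow> c \<in> C'" using g by (auto simp: H_def)
      have "inv\<^bsub>E\<^esub> g \<otimes>\<^bsub>E\<^esub> c \<in> C' \<longleftrightarrow> c \<in> C'" if c: "c \<in> carrier E" for c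
        using gc[of "inv\<^bsub>E\<^esub> g \<otimes>\<^bsub>E\<^esub> c"] gE c by (simp flip: E.m_assoc)
      then show ?thesis using gE by (simp add: H_def)
    qed
    show "g \<otimes>\<^bsub>E\<^esub> h \<in> H" if "g \<in> H" "h \<in> H" for g h
      using that by (simp add: H_def E.m_assoc)
  qed (auto simp: H_def)
  have TH: "T \<subseteq> H"
  proof
    fix t assume t: "t \<in> T"
    have "t \<otimes>\<^bsub>E\<^esub> c \<in> C' \<longleftrightarrow> c \<in> C'" if c: "c \<in> carrier E" for c
    proof
      assume "c \<in> C'"
      then show "t \<otimes>\<^bsub>E\<^esub> c \<in> C'" using t c by (auto simp: C'_def simp flip: E.m_assoc)
    next
      assume tc: "t \<otimes>\<^bsub>E\<^esub> c \<in> C'"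
      have "s \<otimes>\<^bsub>E\<^esub> c \<in> C" if s: "s \<in> T" for s
      proof -
        have "(s \<otimes>\<^bsub>E\<^esub> inv\<^bsub>E\<^esub> t) \<otimes>\<^bsub>E\<^esub> (t \<otimes>\<^bsub>E\<^esub> c) \<in> C"
          using tc s t by (simp add: C'_def)
        moreover have "(s \<otimes>\<^bsub>E\<^esub> inv\<^bsub>E\<^esub> t) \<otimes>\<^bsub>E\<^esub> (t \<otimes>\<^bsub>E\<^esub> c) = s \<otimes>\<^bsub>E\<^esub> c"
        proof -
          have "inv\<^bsub>E\<^esub> t \<otimes>\<^bsub>E\<^esub> (t \<otimes>\<^bsub>E\<^esub> c) = c" using t c by (simp flip: E.m_assoc)
          then show ?thesis using s t c by (simp add: E.m_assoc)
        qed
        ultimately show ?thesis by simp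
      qed
      then show "c \<in> C'" using c by (simp add: C'_def)
    qed
    then show "t \<in> H" using t by (simp add: H_def)
  qed
  have "H \<subseteq> C'"
  proof
    fix h assume h: "h \<in> H"
    have "\<one>\<^bsub>E\<^esub> \<in> C'" using TC' T.one_closed by blast
    moreover have "h \<otimes>\<^bsub>E\<^esub> \<one>\<^bsub>E\<^esub> \<in> C' \<longleftrightarrow> \<one>\<^bsub>E\<^esub> \<in> C'" using h E.one_closed unfolding H_def by blast
    ultimately show "h \<in> C'" using h by (simp add: H_def)
  qed
  then have "H \<inter> F = {}" using C'C C(4) by blast
  then show ?thesis using that[OF H H_open open_subgroup_closedin[OF tg H H_open] TH] by blast
qed

text \<open>\<open>A\<close> acts on \<open>E\<close> from the left, and \<open>T x\<close> acts on
  the fibre over \<open>x\<close> from the right. By \<open>normal\<close> and \<open>T_i\<close>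
  the action of \<open>A\<close> on \<open>E / T x\<close> is free: if \<open>i a\<close> fixes the
  coset of \<open>e\<close>, its conjugate by the inverse of \<open>e\<close> lies in the image of
  \<open>i\<close> and in \<open>T x\<close>.\<close>

locale finite_covering =
  fixes E :: "'e tgroup" and X :: "'x topology" and A :: "'a tgroup" and i :: "'a \<Rightarrow> 'e" and T :: "'x \<Rightarrow> 'e set"
  assumes E: "profinite_group E" and X: "profinite_space X"
    and A: "comm_group A" "finite (carrier A)"
    and i: "i \<in> mon A E"
    and normal: "\<And>e a. e \<in> carrier E \<Longrightarrow> a \<in> carrier A \<Longrightarrow> e \<otimes>\<^bsub>E\<^esub> i a \<otimes>\<^bsub>E\<^esub> inv\<^bsub>E\<^esub> e \<in> i ` carrier A"
    and T: "\<And>x. x \<in> topspace X \<Longrightarrow> subgroup (T x) E"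
    and T_closed: "closedin (prod_topology (topo E) X) {(e, x). x \<in> topspace X \<and> e \<in> T x}"
    and T_i: "\<And>x a. x \<in> topspace X \<Longrightarrow> a \<in> carrier A \<Longrightarrow> i a \<in> T x \<Longrightarrow> a = \<one>\<^bsub>A\<^esub>"
begin

lemma tg: "topological_group E" using E by (simp add: profinite_group_def)

sublocale E: group E using tg by (simp add: topological_group_def)
sublocale A: comm_group A by (rule A)

sublocale i: group_hom A E i
  using i A.is_group E.is_group by (simp add: group_hom_def group_hom_axioms_def mon_def)

lemma i_inj: "inj_on i (carrier A)" using i by (simp add: mon_def)

lemma ts: "topspace (topo E) = carrier E" by (rule topspace_topological_group[OF tg])

abbreviation EtX where "EtX \<equiv> prod_topology (topo E) X"

lemma compact: "compact_space (topo E)" "compact_space X" "compact_space EtX"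
  using E X by (simp_all add: profinite_group_def profinite_space_def compact_space_prod_topology)

lemma hausdorff_E: "Hausdorff_space (topo E)"
  using E by (simp add: profinite_group_def profinite_space_def)

lemma T_fibre_closed: "x \<in> topspace X \<Longrightarrow> closedin (topo E) (T x)"
proof -
  assume x: "x \<in> topspace X"
  have "continuous_map (topo E) EtX (\<lambda>e. (e, x))" using x by (intro continuous_map_pairedI) auto
  from closedin_continuous_map_preimage[OF this T_closed]
  have "closedin (topo E) {e \<in> topspace (topo E). e \<in> T x}" using x by simp
  moreover have "{e \<in> topspace (topo E). e \<in> T x} = T x" using subgroup.subset[OF T[OF x]] ts by auto
  ultimately show ?thesis by simp
qed

text \<open>A clopen partial transversal for the action of \<open>A\<close>, taken stable under the
  right translations so that it descends to the fibrewise quotients \<open>E / T x\<close>.\<close>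

definition transversal_piece :: "('e \<times> 'x) set \<Rightarrow> bool" where
  "transversal_piece V \<longleftrightarrow> openin EtX V \<and> closedin EtX V \<and>
     (\<forall>e x t. (e, x) \<in> V \<longrightarrow> t \<in> T x \<longrightarrow> (e \<otimes>\<^bsub>E\<^esub> t, x) \<in> V) \<and>
     (\<forall>e x a. (e, x) \<in> V \<longrightarrow> a \<in> carrier A \<longrightarrow> (i a \<otimes>\<^bsub>E\<^esub> e, x) \<in> V \<longrightarrow> a = \<one>\<^bsub>A\<^esub>)"

lemma transversal_piece_sub: "transversal_piece V \<Longrightarrow> (e, x) \<in> V \<Longrightarrow> e \<in> carrier E \<and> x \<in> topspace X"
proof -
  assume "transversal_piece V" "(e, x) \<in> V"
  then have "(e, x) \<in> topspace EtX" using openin_subset unfolding transversal_piece_def by blast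
  then show ?thesis by (simp add: ts)
qed

text \<open>The piece is \<open>e H \<times> K\<close>, where \<open>H\<close> is an open subgroup
  that contains \<open>T x\<close> and misses all nontrivial \<open>i a\<close>, and
  \<open>K\<close> is a clopen neighbourhood of \<open>x\<close> over which the subgroups stay
  inside \<open>H\<close>. If \<open>f\<close> and \<open>i a f\<close> both lie in
  \<open>e H\<close>, then the conjugate of \<open>i a\<close> by the inverse of \<open>e\<close>
  lies in \<open>H\<close>; by normality it is some \<open>i c\<close>, so it is trivial.\<close>

lemma transversal_piece_neighbourhood:
  assumes e: "e \<in> carrier E" and x: "x \<in> topspace X"
  obtains V where "transversal_piece V" "(e, x) \<in> V"
proof -
  interpret Tx: subgroup "T x" E by (rule T[OF x])
  let ?F = "i ` (carrier A - {\<one>\<^bsub>A\<^esub>})"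
  have "compactin (topo E) ?F" using A(2) by (intro finite_imp_compactin) (auto simp: ts)
  then have "closedin (topo E) ?F" using hausdorff_E by (rule compactin_imp_closedin[rotated])
  moreover have "T x \<inter> ?F = {}" using T_i[OF x] by blast
  ultimately obtain H where H: "subgroup H E" "openin (topo E) H" "closedin (topo E) H" "T x \<subseteq> H" "H \<inter> ?F = {}"
    using open_subgroup_separation[OF E T[OF x] T_fibre_closed[OF x]] by metis
  interpret H: subgroup H E by (rule H(1))
  \<comment> \<open>The inclusion in \<open>H\<close> persists near \<open>x\<close>: the graph of
    \<open>T\<close> is closed and \<open>E\<close> is compact, so \<open>openin_all\<close> applies
    to the condition that an element avoids \<open>T y\<close> or lies in \<open>H\<close>.\<close>
  define O' where "O' = {y \<in> topspace X. T y \<subseteq> H}"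
  have "openin X O'"
  proof -
    let ?N = "topspace EtX - {(e, y). y \<in> topspace X \<and> e \<in> T y}"
    let ?W = "{z \<in> topspace (prod_topology X (topo E)). (snd z, fst z) \<in> ?N \<union> H \<times> topspace X}"
    have "openin EtX (?N \<union> H \<times> topspace X)"
      using T_closed H(2) by (intro openin_Un) (simp_all add: closedin_def openin_prod_Times_iff)
    moreover have "continuous_map (prod_topology X (topo E)) EtX (\<lambda>z. (snd z, fst z))"
      by (intro continuous_map_pairedI continuous_map_fst continuous_map_snd)
    ultimately have "openin (prod_topology X (topo E)) ?W" by (rule openin_continuous_preimage[rotated])
    from openin_all[OF compact(1) this] show ?thesis
      by (rule back_subst[of "openin X"]) (use subgroup.subset[OF T] in \<open>auto simp: O'_def ts\<close>)
  qed
  then have "closedin X (topspace X - O')" by blast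
  moreover have "closedin X {x}"
    using X x by (simp add: profinite_space_def closedin_Hausdorff_sing_eq)
  moreover have "{x} \<inter> (topspace X - O') = {}" using H(4) x by (simp add: O'_def)
  ultimately obtain K where K: "openin X K" "closedin X K" "{x} \<subseteq> K" "K \<inter> (topspace X - O') = {}"
    using profinite_clopen_separation[OF X] by metis
  have KH: "T y \<subseteq> H" "y \<in> topspace X" if "y \<in> K" for y
    using K(4) that openin_subset[OF K(1)] by (auto simp: O'_def)
  let ?U = "{h \<in> topspace (topo E). inv\<^bsub>E\<^esub> e \<otimes>\<^bsub>E\<^esub> h \<in> H}"
  have c: "continuous_map (topo E) (topo E) (\<lambda>h. inv\<^bsub>E\<^esub> e \<otimes>\<^bsub>E\<^esub> h)"
    using e ts by (intro continuous_map_group_mult tg) auto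
  have U: "openin (topo E) ?U" "closedin (topo E) ?U"
    using openin_continuous_preimage[OF c H(2)] closedin_continuous_map_preimage[OF c H(3)] by auto
  have "transversal_piece (?U \<times> K)"
    unfolding transversal_piece_def
  proof (intro conjI allI impI)
    show "openin EtX (?U \<times> K)" "closedin EtX (?U \<times> K)"
      using U K by (simp_all add: openin_prod_Times_iff closedin_prod_Times_iff)
    fix f y assume fy: "(f, y) \<in> ?U \<times> K"
    then have f: "f \<in> carrier E" "inv\<^bsub>E\<^esub> e \<otimes>\<^bsub>E\<^esub> f \<in> H" and y: "y \<in> K" by (auto simp: ts)
    show "(f \<otimes>\<^bsub>E\<^esub> t, y) \<in> ?U \<times> K" if t: "t \<in> T y" for t
    proof -
      have tH: "t \<in> H" using t KH(1)[OF y] by blast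
      have "inv\<^bsub>E\<^esub> e \<otimes>\<^bsub>E\<^esub> (f \<otimes>\<^bsub>E\<^esub> t) = (inv\<^bsub>E\<^esub> e \<otimes>\<^bsub>E\<^esub> f) \<otimes>\<^bsub>E\<^esub> t" using e f tH by (simp add: E.m_assoc)
      then show ?thesis using f y tH e by (simp add: ts)
    qed
    fix a assume a: "a \<in> carrier A" and "(i a \<otimes>\<^bsub>E\<^esub> f, y) \<in> ?U \<times> K"
    then have g: "inv\<^bsub>E\<^esub> e \<otimes>\<^bsub>E\<^esub> (i a \<otimes>\<^bsub>E\<^esub> f) \<in> H" by simp
    have "(inv\<^bsub>E\<^esub> e \<otimes>\<^bsub>E\<^esub> (i a \<otimes>\<^bsub>E\<^esub> f)) \<otimes>\<^bsub>E\<^esub> inv\<^bsub>E\<^esub> (inv\<^bsub>E\<^esub> e \<otimes>\<^bsub>E\<^esub> f) = inv\<^bsub>E\<^esub> e \<otimes>\<^bsub>E\<^esub> i a \<otimes>\<^bsub>E\<^esub> inv\<^bsub>E\<^esub> (inv\<^bsub>E\<^esub> e)"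
    proof -
      have "f \<otimes>\<^bsub>E\<^esub> (inv\<^bsub>E\<^esub> f \<otimes>\<^bsub>E\<^esub> e) = e" using e f by (simp flip: E.m_assoc)
      then show ?thesis using e f a by (simp add: E.inv_mult_group E.m_assoc)
    qed
    then have cH: "inv\<^bsub>E\<^esub> e \<otimes>\<^bsub>E\<^esub> i a \<otimes>\<^bsub>E\<^esub> inv\<^bsub>E\<^esub> (inv\<^bsub>E\<^esub> e) \<in> H" using H.m_closed[OF g H.m_inv_closed[OF f(2)]] by simp
    obtain c where c: "c \<in> carrier A" "inv\<^bsub>E\<^esub> e \<otimes>\<^bsub>E\<^esub> i a \<otimes>\<^bsub>E\<^esub> inv\<^bsub>E\<^esub> (inv\<^bsub>E\<^esub> e) = i c"
      using normal[OF E.inv_closed[OF e] a] by auto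
    have "c = \<one>\<^bsub>A\<^esub>" using cH H(5) c by auto
    then have "inv\<^bsub>E\<^esub> e \<otimes>\<^bsub>E\<^esub> i a \<otimes>\<^bsub>E\<^esub> e = \<one>\<^bsub>E\<^esub>" using c e by simp
    then have "i a = e \<otimes>\<^bsub>E\<^esub> \<one>\<^bsub>E\<^esub> \<otimes>\<^bsub>E\<^esub> inv\<^bsub>E\<^esub> e" using e a by (metis E.inv_closed E.inv_solve_left E.inv_solve_right E.m_closed E.one_closed E.r_one i.hom_closed E.r_inv)
    then have "i a = i \<one>\<^bsub>A\<^esub>" using e by simp
    then show "a = \<one>\<^bsub>A\<^esub>" by (rule inj_onD[OF i_inj _ a A.one_closed])
  qed
  moreover have "(e, x) \<in> ?U \<times> K" using e K(3) H.one_closed by (simp add: ts)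
  ultimately show ?thesis using that by blast
qed

definition saturation :: "('e \<times> 'x) set \<Rightarrow> ('e \<times> 'x) set" where
  "saturation V = {z \<in> topspace EtX. \<exists>a\<in>carrier A. (i a \<otimes>\<^bsub>E\<^esub> fst z, snd z) \<in> V}"

lemma continuous_map_translate: "a \<in> carrier A \<Longrightarrow> continuous_map EtX EtX (\<lambda>z. (i a \<otimes>\<^bsub>E\<^esub> fst z, snd z))"
  using ts by (intro continuous_map_pairedI continuous_map_group_mult tg continuous_map_fst continuous_map_snd) auto

text \<open>Finiteness of \<open>A\<close> keeps the union of the translates closed.\<close>

lemma saturation_clopen:
  assumes "openin EtX V" "closedin EtX V"
  shows "openin EtX (saturation V)" "closedin EtX (saturation V)"
proof -
  have eq: "saturation V = (\<Union>a\<in>carrier A. {z \<in> topspace EtX. (i a \<otimes>\<^bsub>E\<^esub> fst z, snd z) \<in> V})" by (auto simp: saturation_def)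
  show "openin EtX (saturation V)"
    unfolding eq using openin_continuous_preimage[OF continuous_map_translate assms(1)] by blast
  show "closedin EtX (saturation V)"
    unfolding eq using closedin_continuous_map_preimage[OF continuous_map_translate assms(2)] A(2)
    by (intro closedin_Union) auto
qed

text \<open>A piece \<open>V\<close> is added to \<open>D\<close> after removing the points whose \<open>A\<close>-orbit already meets \<open>D\<close>.\<close>

lemma fundamental_domain:
  assumes "finite \<V>" "\<And>V. V \<in> \<V> \<Longrightarrow> transversal_piece V"
  shows "\<exists>D. transversal_piece D \<and> \<Union>\<V> \<subseteq> saturation D"
  using assms
proof (induction \<V>)
  case empty
  show ?case by (intro exI[of _ "{}"]) (simp add: transversal_piece_def)
next
  case (insert V \<V>)
  have "\<exists>D. transversal_piece D \<and> \<Union>\<V> \<subseteq> saturation D" by (rule insert.IH) (rule insert.prems, simp)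
  then obtain D where "transversal_piece D \<and> \<Union>\<V> \<subseteq> saturation D" by (rule exE)
  then have D: "transversal_piece D" "\<Union>\<V> \<subseteq> saturation D" by simp_all
  have V: "transversal_piece V" by (rule insert.prems) simp
  let ?D = "D \<union> (V - saturation D)"
  have cl: "openin EtX D" "closedin EtX D" "openin EtX V" "closedin EtX V" using D(1) V by (auto simp: transversal_piece_def)
  note sD = saturation_clopen[OF cl(1,2)]
  have satD: "(e, x) \<in> saturation D \<longleftrightarrow> e \<in> carrier E \<and> x \<in> topspace X \<and> (\<exists>a\<in>carrier A. (i a \<otimes>\<^bsub>E\<^esub> e, x) \<in> D)" for e x
    by (auto simp: saturation_def ts)
  have Dsep: "a = \<one>\<^bsub>A\<^esub>" if "(e, x) \<in> D" "a \<in> carrier A" "(i a \<otimes>\<^bsub>E\<^esub> e, x) \<in> D" for a e x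
    using D(1) that unfolding transversal_piece_def by blast
  have Vsep: "a = \<one>\<^bsub>A\<^esub>" if "(e, x) \<in> V" "a \<in> carrier A" "(i a \<otimes>\<^bsub>E\<^esub> e, x) \<in> V" for a e x
    using V that unfolding transversal_piece_def by blast
  have Dt: "(e \<otimes>\<^bsub>E\<^esub> t, x) \<in> D" if "(e, x) \<in> D" "t \<in> T x" for e x t using D(1) that unfolding transversal_piece_def by blast
  have Vt: "(e \<otimes>\<^bsub>E\<^esub> t, x) \<in> V" if "(e, x) \<in> V" "t \<in> T x" for e x t using V that unfolding transversal_piece_def by blast
  have "transversal_piece ?D"
    unfolding transversal_piece_def
  proof (intro conjI allI impI)
    show "openin EtX ?D" "closedin EtX ?D" using cl sD by (auto simp: closedin_diff openin_diff)
    fix e x assume ex: "(e, x) \<in> ?D"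
    have eE: "e \<in> carrier E" "x \<in> topspace X" using ex transversal_piece_sub[OF D(1)] transversal_piece_sub[OF V] by auto
    interpret Tx: subgroup "T x" E by (rule T[OF eE(2)])
    show "(e \<otimes>\<^bsub>E\<^esub> t, x) \<in> ?D" if t: "t \<in> T x" for t
    proof (cases "(e, x) \<in> D")
      case True
      then show ?thesis using Dt t by blast
    next
      case False
      then have V': "(e, x) \<in> V" "(e, x) \<notin> saturation D" using ex by auto
      have "(e \<otimes>\<^bsub>E\<^esub> t, x) \<notin> saturation D"
      proof
        assume "(e \<otimes>\<^bsub>E\<^esub> t, x) \<in> saturation D"
        then obtain a where a: "a \<in> carrier A" "(i a \<otimes>\<^bsub>E\<^esub> (e \<otimes>\<^bsub>E\<^esub> t), x) \<in> D" using satD by blast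
        have "(i a \<otimes>\<^bsub>E\<^esub> (e \<otimes>\<^bsub>E\<^esub> t) \<otimes>\<^bsub>E\<^esub> inv\<^bsub>E\<^esub> t, x) \<in> D" using Dt[OF a(2)] t by simp
        then have "(i a \<otimes>\<^bsub>E\<^esub> e, x) \<in> D" using a eE t by (simp add: E.m_assoc)
        then show False using V'(2) satD a(1) eE by blast
      qed
      then show ?thesis using Vt[OF V'(1) t] by blast
    qed
    fix a assume a: "a \<in> carrier A" and aex: "(i a \<otimes>\<^bsub>E\<^esub> e, x) \<in> ?D"
    have n1: False if "(e, x) \<in> D" "(i a \<otimes>\<^bsub>E\<^esub> e, x) \<notin> saturation D"
    proof -
      have "i (inv\<^bsub>A\<^esub> a) \<otimes>\<^bsub>E\<^esub> (i a \<otimes>\<^bsub>E\<^esub> e) = e" using a eE by (simp flip: E.m_assoc)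
      then show False using that satD a eE A.inv_closed[OF a] by (metis E.m_closed i.hom_closed)
    qed
    have n2: False if "(i a \<otimes>\<^bsub>E\<^esub> e, x) \<in> D" "(e, x) \<notin> saturation D" using that satD a eE by blast
    show "a = \<one>\<^bsub>A\<^esub>" using ex aex n1 n2 Dsep Vsep a by blast
  qed
  moreover have "\<Union>(insert V \<V>) \<subseteq> saturation ?D"
  proof
    fix z assume z: "z \<in> \<Union>(insert V \<V>)"
    have mono: "saturation D \<subseteq> saturation ?D" by (auto simp: saturation_def)
    show "z \<in> saturation ?D"
    proof (cases "z \<in> saturation D")
      case False
      then have zV: "z \<in> V" using z D(2) by blast
      obtain e x where ex: "z = (e, x)" "e \<in> carrier E" "x \<in> topspace X"
        using zV transversal_piece_sub[OF V] by (metis surj_pair)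
      have "i \<one>\<^bsub>A\<^esub> \<otimes>\<^bsub>E\<^esub> e = e" using ex by simp
      then have "(i \<one>\<^bsub>A\<^esub> \<otimes>\<^bsub>E\<^esub> fst z, snd z) \<in> ?D" using zV False ex by simp
      then show ?thesis using ex A.one_closed unfolding saturation_def by (auto simp: ts simp del: i.hom_one)
    qed (use mono in blast)
  qed
  ultimately show ?case by blast
qed

text \<open>Finitely many pieces cover by compactness, and \<open>fundamental_domain\<close> merges
  them into a transversal \<open>D\<close> that meets every orbit. \<open>\<kappa> e x\<close> is
  the unique element of \<open>A\<close> that carries a point of \<open>D\<close> over
  \<open>x\<close> to \<open>e\<close>; it is locally constant because \<open>D\<close> is open, and
  uniqueness gives the two transformation rules.\<close>

lemma trivialisation:
  obtains \<kappa> where "continuous_map EtX (discrete_topology (carrier A)) (\<lambda>z. \<kappa> (fst z) (snd z))"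
    and "\<And>a e x. a \<in> carrier A \<Longrightarrow> e \<in> carrier E \<Longrightarrow> x \<in> topspace X \<Longrightarrow> \<kappa> (i a \<otimes>\<^bsub>E\<^esub> e) x = a \<otimes>\<^bsub>A\<^esub> \<kappa> e x"
    and "\<And>t e x. e \<in> carrier E \<Longrightarrow> x \<in> topspace X \<Longrightarrow> t \<in> T x \<Longrightarrow> \<kappa> (e \<otimes>\<^bsub>E\<^esub> t) x = \<kappa> e x"
proof -
  have "topspace EtX \<subseteq> \<Union>{V. transversal_piece V}"
  proof
    fix z assume "z \<in> topspace EtX"
    then obtain e x where "z = (e, x)" "e \<in> carrier E" "x \<in> topspace X" by (auto simp: ts)
    then show "z \<in> \<Union>{V. transversal_piece V}" using transversal_piece_neighbourhood by blast
  qed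
  moreover have "\<forall>V\<in>{V. transversal_piece V}. openin EtX V" by (simp add: transversal_piece_def)
  ultimately obtain \<V> where \<V>: "finite \<V>" "\<V> \<subseteq> {V. transversal_piece V}" "topspace EtX \<subseteq> \<Union>\<V>"
    using compact(3) unfolding compact_space_alt by meson
  have "\<exists>D. transversal_piece D \<and> \<Union>\<V> \<subseteq> saturation D" by (rule fundamental_domain[OF \<V>(1)]) (use \<V>(2) in auto)
  then obtain D where "transversal_piece D \<and> \<Union>\<V> \<subseteq> saturation D" by (rule exE)
  then have D: "transversal_piece D" "\<Union>\<V> \<subseteq> saturation D" by simp_all
  have sep: "a = \<one>\<^bsub>A\<^esub>" if "(e, x) \<in> D" "a \<in> carrier A" "(i a \<otimes>\<^bsub>E\<^esub> e, x) \<in> D" for a e x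
    using D(1) that unfolding transversal_piece_def by blast
  have Dt: "(e \<otimes>\<^bsub>E\<^esub> t, x) \<in> D" if "(e, x) \<in> D" "t \<in> T x" for e x t using D(1) that unfolding transversal_piece_def by blast
  define \<kappa> where "\<kappa> e x = (THE a. a \<in> carrier A \<and> (i (inv\<^bsub>A\<^esub> a) \<otimes>\<^bsub>E\<^esub> e, x) \<in> D)" for e x
  have uniq: "a = b" if e: "e \<in> carrier E" and a: "a \<in> carrier A" "(i (inv\<^bsub>A\<^esub> a) \<otimes>\<^bsub>E\<^esub> e, x) \<in> D"
    and b: "b \<in> carrier A" "(i (inv\<^bsub>A\<^esub> b) \<otimes>\<^bsub>E\<^esub> e, x) \<in> D" for a b e x
  proof -
    have "i (a \<otimes>\<^bsub>A\<^esub> inv\<^bsub>A\<^esub> b) \<otimes>\<^bsub>E\<^esub> (i (inv\<^bsub>A\<^esub> a) \<otimes>\<^bsub>E\<^esub> e) = i (a \<otimes>\<^bsub>A\<^esub> inv\<^bsub>A\<^esub> b \<otimes>\<^bsub>A\<^esub> inv\<^bsub>A\<^esub> a) \<otimes>\<^bsub>E\<^esub> e"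
      using e a b by (simp add: E.m_assoc)
    also have "a \<otimes>\<^bsub>A\<^esub> inv\<^bsub>A\<^esub> b \<otimes>\<^bsub>A\<^esub> inv\<^bsub>A\<^esub> a = inv\<^bsub>A\<^esub> b" using a b by (simp add: A.m_comm[of a "inv\<^bsub>A\<^esub> b"] A.m_assoc)
    finally have "a \<otimes>\<^bsub>A\<^esub> inv\<^bsub>A\<^esub> b = \<one>\<^bsub>A\<^esub>" using sep[OF a(2), of "a \<otimes>\<^bsub>A\<^esub> inv\<^bsub>A\<^esub> b"] a b by simp
    then show "a = b" using a b A.inv_solve_right[of "\<one>\<^bsub>A\<^esub>" a b] by simp
  qed
  have \<kappa>: "\<kappa> e x \<in> carrier A" "(i (inv\<^bsub>A\<^esub> \<kappa> e x) \<otimes>\<^bsub>E\<^esub> e, x) \<in> D" if e: "e \<in> carrier E" and x: "x \<in> topspace X" for e x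
  proof -
    have "(e, x) \<in> saturation D" using e x \<V>(3) D(2) by (auto simp: ts)
    then obtain a where a: "a \<in> carrier A" "(i a \<otimes>\<^bsub>E\<^esub> e, x) \<in> D" by (auto simp: saturation_def)
    have "\<exists>!a. a \<in> carrier A \<and> (i (inv\<^bsub>A\<^esub> a) \<otimes>\<^bsub>E\<^esub> e, x) \<in> D"
    proof (rule ex1I[of _ "inv\<^bsub>A\<^esub> a"])
      show "inv\<^bsub>A\<^esub> a \<in> carrier A \<and> (i (inv\<^bsub>A\<^esub> (inv\<^bsub>A\<^esub> a)) \<otimes>\<^bsub>E\<^esub> e, x) \<in> D"
        using a A.inv_closed[OF a(1)] A.inv_inv[OF a(1)] by (simp only: simp_thms)
      then show "b = inv\<^bsub>A\<^esub> a" if "b \<in> carrier A \<and> (i (inv\<^bsub>A\<^esub> b) \<otimes>\<^bsub>E\<^esub> e, x) \<in> D" for b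
        using uniq[OF e] that by blast
    qed
    from theI'[OF this] show "\<kappa> e x \<in> carrier A" "(i (inv\<^bsub>A\<^esub> \<kappa> e x) \<otimes>\<^bsub>E\<^esub> e, x) \<in> D"
      unfolding \<kappa>_def by blast+
  qed
  have \<kappa>_eq: "\<kappa> e x = a" if "e \<in> carrier E" "x \<in> topspace X" "a \<in> carrier A" "(i (inv\<^bsub>A\<^esub> a) \<otimes>\<^bsub>E\<^esub> e, x) \<in> D" for a e x
    using uniq[OF that(1) \<kappa>[OF that(1,2)] that(3,4)] .
  have 1: "continuous_map EtX (discrete_topology (carrier A)) (\<lambda>z. \<kappa> (fst z) (snd z))"
  proof (rule continuous_map_discreteI)
    fix z assume z: "z \<in> topspace EtX"
    then obtain e x where ex: "z = (e, x)" "e \<in> carrier E" "x \<in> topspace X" by (auto simp: ts)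
    show "\<kappa> (fst z) (snd z) \<in> carrier A" using \<kappa>(1) ex by simp
    let ?V = "{y \<in> topspace EtX. (i (inv\<^bsub>A\<^esub> \<kappa> e x) \<otimes>\<^bsub>E\<^esub> fst y, snd y) \<in> D}"
    have "openin EtX ?V"
      using openin_continuous_preimage[OF continuous_map_translate[of "inv\<^bsub>A\<^esub> \<kappa> e x"]] \<kappa>(1)[OF ex(2,3)] D(1) by (simp add: transversal_piece_def)
    moreover have "z \<in> ?V" using z \<kappa>(2)[OF ex(2,3)] ex by simp
    moreover have "\<kappa> (fst y) (snd y) = \<kappa> (fst z) (snd z)" if "y \<in> ?V" for y
      using that \<kappa>_eq[of "fst y" "snd y" "\<kappa> e x"] \<kappa>(1)[OF ex(2,3)] ex by (auto simp: ts)
    ultimately show "\<exists>V. openin EtX V \<and> z \<in> V \<and> (\<forall>y\<in>V. \<kappa> (fst y) (snd y) = \<kappa> (fst z) (snd z))" by blast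
  qed
  have 2: "\<kappa> (i a \<otimes>\<^bsub>E\<^esub> e) x = a \<otimes>\<^bsub>A\<^esub> \<kappa> e x" if a: "a \<in> carrier A" and e: "e \<in> carrier E" and x: "x \<in> topspace X" for a e x
  proof (rule \<kappa>_eq)
    have "i (inv\<^bsub>A\<^esub> (a \<otimes>\<^bsub>A\<^esub> \<kappa> e x)) \<otimes>\<^bsub>E\<^esub> (i a \<otimes>\<^bsub>E\<^esub> e) = i (inv\<^bsub>A\<^esub> (a \<otimes>\<^bsub>A\<^esub> \<kappa> e x) \<otimes>\<^bsub>A\<^esub> a) \<otimes>\<^bsub>E\<^esub> e"
      using a e \<kappa>(1)[OF e x] by (simp add: E.m_assoc)
    also have "inv\<^bsub>A\<^esub> (a \<otimes>\<^bsub>A\<^esub> \<kappa> e x) \<otimes>\<^bsub>A\<^esub> a = inv\<^bsub>A\<^esub> \<kappa> e x"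
      using a \<kappa>(1)[OF e x] by (simp add: A.inv_mult A.m_comm[of "inv\<^bsub>A\<^esub> a" "inv\<^bsub>A\<^esub> \<kappa> e x"] A.m_assoc)
    finally show "(i (inv\<^bsub>A\<^esub> (a \<otimes>\<^bsub>A\<^esub> \<kappa> e x)) \<otimes>\<^bsub>E\<^esub> (i a \<otimes>\<^bsub>E\<^esub> e), x) \<in> D" using \<kappa>(2)[OF e x] by simp
  qed (use a e x \<kappa>(1)[OF e x] in auto)
  have 3: "\<kappa> (e \<otimes>\<^bsub>E\<^esub> t) x = \<kappa> e x" if e: "e \<in> carrier E" and x: "x \<in> topspace X" and t: "t \<in> T x" for t e x
  proof (rule \<kappa>_eq)
    have tE: "t \<in> carrier E" using subgroup.subset[OF T[OF x]] t by blast
    show "e \<otimes>\<^bsub>E\<^esub> t \<in> carrier E" using e tE by simp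
    show "(i (inv\<^bsub>A\<^esub> \<kappa> e x) \<otimes>\<^bsub>E\<^esub> (e \<otimes>\<^bsub>E\<^esub> t), x) \<in> D"
      using Dt[OF \<kappa>(2)[OF e x] t] e tE \<kappa>(1)[OF e x] by (simp add: E.m_assoc)
  qed (use x \<kappa>(1)[OF e x] in auto)
  show ?thesis by (rule that[OF 1 2 3])
qed

end

section \<open>Every relative extension comes from a cocycle\<close>

context relative_pair
begin

text \<open>A point \<open>g\<close> outside \<open>S x\<close> is separated from \<open>S x\<close>
  by a clopen \<open>K\<close>, and the inclusion of \<open>S y\<close> in \<open>K\<close> is an
  open condition on \<open>y\<close>.\<close>

lemma closedin_total_family: "closedin GX (total_family X S)"
proof -
  have "openin GX (topspace GX - total_family X S)"
  proof (rule openin_locally)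
    fix z assume z: "z \<in> topspace GX - total_family X S"
    then obtain g x where gx: "z = (g, x)" "g \<in> carrier G" "x \<in> topspace X" "g \<notin> S x"
      by (auto simp: total_family_def ts)
    have Sx: "closedin (topo G) (S x)" using S gx(3) by (simp add: continuously_indexed_def)
    have "closedin (topo G) {g}"
      using G gx(2) by (simp add: profinite_group_def profinite_space_def closedin_Hausdorff_sing_eq ts)
    moreover have "profinite_space (topo G)" using G by (simp add: profinite_group_def)
    ultimately obtain K where K: "openin (topo G) K" "closedin (topo G) K" "S x \<subseteq> K" "K \<inter> {g} = {}"
      using profinite_clopen_separation[OF _ Sx, of "{g}"] gx(4) by auto
    let ?V = "(topspace (topo G) - K) \<times> {y \<in> topspace X. S y \<subseteq> K}"
    have "openin X {y \<in> topspace X. S y \<subseteq> K}" using S K(1) by (simp add: continuously_indexed_def)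
    then have "openin GX ?V" using K(2) by (simp add: openin_prod_Times_iff closedin_def)
    moreover have "z \<in> ?V" using gx K by (auto simp: ts)
    moreover have "?V \<subseteq> topspace GX - total_family X S" by (auto simp: total_family_def)
    ultimately show "\<exists>V. openin GX V \<and> z \<in> V \<and> V \<subseteq> topspace GX - total_family X S" by blast
  qed
  moreover have "total_family X S \<subseteq> topspace GX" using S_sub by (auto simp: total_family_def ts)
  ultimately show ?thesis by (simp add: closedin_def)
qed

end

locale extension_data = relative_pair G \<pi> X S A act
  for G :: "'g tgroup" and \<pi> :: "nat set" and X :: "'x topology" and S :: "'x \<Rightarrow> 'g set"
    and A :: "'a tgroup" and act :: "'g \<Rightarrow> 'a \<Rightarrow> 'a" +
  fixes R :: "('a, 'g, 'x, 'e) rel_ext"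
  assumes R: "relative_extension G X S A act R"
begin

abbreviation E where "E \<equiv> ext_group R"
abbreviation i where "i \<equiv> ext_incl R"
abbreviation p where "p \<equiv> ext_proj R"
abbreviation q where "q \<equiv> ext_sec R"

lemma profinite_E: "profinite_group E"
  and i_mon: "i \<in> mon A E"
  and continuous_i: "continuous_map (topo A) (topo E) i"
  and p_epi: "p \<in> epi E G"
  and continuous_p: "continuous_map (topo E) (topo G) p"
  and exact: "i ` carrier A = kernel E G p"
  and conj: "\<And>e a. e \<in> carrier E \<Longrightarrow> a \<in> carrier A \<Longrightarrow> e \<otimes>\<^bsub>E\<^esub> i a \<otimes>\<^bsub>E\<^esub> inv\<^bsub>E\<^esub> e = i (act (p e) a)"
  and continuous_q: "continuous_map (subtopology GX (total_family X S)) (topo E) (\<lambda>(s, x). q x s)"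
  and q_hom: "\<And>x. x \<in> topspace X \<Longrightarrow> q x \<in> hom (G\<lparr>carrier := S x\<rparr>) E"
  and p_q: "\<And>x s. x \<in> topspace X \<Longrightarrow> s \<in> S x \<Longrightarrow> p (q x s) = s"
  using R by (auto simp: relative_extension_def)

lemma tgE: "topological_group E" using profinite_E by (simp add: profinite_group_def)

sublocale E: group E using tgE by (simp add: topological_group_def)

lemma tsE: "topspace (topo E) = carrier E" by (rule topspace_topological_group[OF tgE])

sublocale i: group_hom A E i
  using i_mon A.is_group E.is_group by (simp add: group_hom_def group_hom_axioms_def mon_def)

sublocale p: group_hom E G p
  using p_epi E.is_group is_group by (simp add: group_hom_def group_hom_axioms_def epi_def)

lemma p_i [simp]: "a \<in> carrier A \<Longrightarrow> p (i a) = \<one>\<^bsub>G\<^esub>"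
  using exact by (auto simp: kernel_def)

lemma q_closed: "x \<in> topspace X \<Longrightarrow> s \<in> S x \<Longrightarrow> q x s \<in> carrier E"
  using q_hom by (fastforce simp: hom_def)

lemma comm_i: "e \<in> carrier E \<Longrightarrow> a \<in> carrier A \<Longrightarrow> e \<otimes>\<^bsub>E\<^esub> i a = i (act (p e) a) \<otimes>\<^bsub>E\<^esub> e"
  by (simp add: conj[symmetric] E.m_assoc)

lemma fibre:
  assumes "e \<in> carrier E" "e' \<in> carrier E" "p e = p e'"
  obtains a where "a \<in> carrier A" "e' = i a \<otimes>\<^bsub>E\<^esub> e"
proof -
  have "e' \<otimes>\<^bsub>E\<^esub> inv\<^bsub>E\<^esub> e \<in> kernel E G p" using assms by (simp add: kernel_def)
  then obtain a where a: "a \<in> carrier A" "e' \<otimes>\<^bsub>E\<^esub> inv\<^bsub>E\<^esub> e = i a" using exact by auto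
  have "e' = e' \<otimes>\<^bsub>E\<^esub> inv\<^bsub>E\<^esub> e \<otimes>\<^bsub>E\<^esub> e" using assms by (simp add: E.m_assoc)
  then have "e' = i a \<otimes>\<^bsub>E\<^esub> e" unfolding a(2) .
  then show ?thesis using that a(1) by blast
qed

definition T where "T x = q x ` S x"

text \<open>The graph of \<open>T\<close> is closed as the image of the compact total family under
  \<open>(s, x) \<mapsto> (q_x(s), x)\<close>. The subgroups meet the image of \<open>i\<close>
  trivially because \<open>p\<close> kills that image but is inverse to \<open>q_x\<close> on
  \<open>T x\<close>.\<close>

lemma covering: "finite_covering E X A i T"
proof (rule finite_covering.intro)
  show "profinite_group E" "profinite_space X" "i \<in> mon A E" "finite (carrier A)"
    by (rule profinite_E X i_mon A_finite)+
  show "comm_group A" by (rule A.comm_group_axioms)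
  show "e \<otimes>\<^bsub>E\<^esub> i a \<otimes>\<^bsub>E\<^esub> inv\<^bsub>E\<^esub> e \<in> i ` carrier A" if "e \<in> carrier E" "a \<in> carrier A" for e a
    using that by (simp add: conj)
  show "subgroup (T x) E" if x: "x \<in> topspace X" for x
  proof -
    have "group (G\<lparr>carrier := S x\<rparr>)" by (rule subgroup.subgroup_is_group[OF S_subgroup[OF x] is_group])
    then interpret qx: group_hom "G\<lparr>carrier := S x\<rparr>" E "q x"
      using q_hom[OF x] E.is_group by (simp add: group_hom_def group_hom_axioms_def)
    show ?thesis using qx.img_is_subgroup by (simp add: T_def)
  qed
  show "a = \<one>\<^bsub>A\<^esub>" if x: "x \<in> topspace X" and a: "a \<in> carrier A" "i a \<in> T x" for x a
  proof -
    obtain s where s: "s \<in> S x" "i a = q x s" using a(2) by (auto simp: T_def)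
    then have "s = \<one>\<^bsub>G\<^esub>" using p_q[OF x s(1)] p_i[OF a(1)] by simp
    moreover have "group (G\<lparr>carrier := S x\<rparr>)" by (rule subgroup.subgroup_is_group[OF S_subgroup[OF x] is_group])
    ultimately have "i a = \<one>\<^bsub>E\<^esub>" using hom_one[OF q_hom[OF x] _ E.is_group] s(2) by simp
    then have "i a = i \<one>\<^bsub>A\<^esub>" by simp
    then show ?thesis using i_mon a(1) unfolding mon_def by (blast dest: inj_onD)
  qed
  show "closedin (prod_topology (topo E) X) {(e, x). x \<in> topspace X \<and> e \<in> T x}"
  proof -
    let ?S = "subtopology GX (total_family X S)"
    have sub: "total_family X S \<subseteq> topspace GX" by (rule closedin_subset[OF closedin_total_family])
    have "compactin GX (total_family X S)"
      using closedin_compact_space[OF _ closedin_total_family] compact_G compact_X by (simp add: compact_space_prod_topology)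
    then have "compactin ?S (topspace ?S)" using sub by (simp add: compactin_subtopology Int_absorb1)
    moreover have "continuous_map ?S (prod_topology (topo E) X) (\<lambda>z. (q (snd z) (fst z), snd z))"
      using continuous_q by (intro continuous_map_pairedI continuous_map_from_subtopology[OF continuous_map_snd]) (simp add: case_prod_unfold)
    ultimately have "compactin (prod_topology (topo E) X) ((\<lambda>z. (q (snd z) (fst z), snd z)) ` topspace ?S)"
      by (rule image_compactin)
    moreover have "Hausdorff_space (prod_topology (topo E) X)"
      using profinite_E X by (simp add: profinite_group_def profinite_space_def Hausdorff_space_prod_topology)
    ultimately have "closedin (prod_topology (topo E) X) ((\<lambda>z. (q (snd z) (fst z), snd z)) ` topspace ?S)"
      by (rule compactin_imp_closedin[rotated])
    moreover have "(\<lambda>z. (q (snd z) (fst z), snd z)) ` topspace ?S = {(e, x). x \<in> topspace X \<and> e \<in> T x}"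
      using sub by (force simp: Int_absorb1 total_family_def T_def image_iff)
    ultimately show ?thesis by simp
  qed
qed

text \<open>With trivial subgroups, the trivialisation at one index is an equivariant function
  \<open>E \<rightarrow> A\<close>, which amounts to a continuous section of
  \<open>p\<close>.\<close>

lemma trivial_covering: "finite_covering E X A i (\<lambda>x. {\<one>\<^bsub>E\<^esub>})"
proof (rule finite_covering.intro)
  interpret C: finite_covering E X A i T by (rule covering)
  show "profinite_group E" "profinite_space X" "i \<in> mon A E" "finite (carrier A)"
    by (rule profinite_E X i_mon A_finite)+
  show "comm_group A" by (rule A.comm_group_axioms)
  show "e \<otimes>\<^bsub>E\<^esub> i a \<otimes>\<^bsub>E\<^esub> inv\<^bsub>E\<^esub> e \<in> i ` carrier A" if "e \<in> carrier E" "a \<in> carrier A" for e a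
    using that by (simp add: conj)
  show "subgroup {\<one>\<^bsub>E\<^esub>} E" by (rule E.triv_subgroup)
  show "a = \<one>\<^bsub>A\<^esub>" if "a \<in> carrier A" "i a \<in> {\<one>\<^bsub>E\<^esub>}" for a
    using inj_onD[OF C.i_inj, of a "\<one>\<^bsub>A\<^esub>"] that by simp
  have "closedin (topo E) {\<one>\<^bsub>E\<^esub>}" using C.hausdorff_E by (simp add: closedin_Hausdorff_sing_eq tsE)
  then have "closedin (prod_topology (topo E) X) ({\<one>\<^bsub>E\<^esub>} \<times> topspace X)" by (simp add: closedin_prod_Times_iff)
  moreover have "{\<one>\<^bsub>E\<^esub>} \<times> topspace X = {(e, x). x \<in> topspace X \<and> e \<in> {\<one>\<^bsub>E\<^esub>}}" by auto
  ultimately show "closedin (prod_topology (topo E) X) {(e, x). x \<in> topspace X \<and> e \<in> {\<one>\<^bsub>E\<^esub>}}" by simp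
qed

text \<open>Two trivialisations are used. \<open>k0\<close>, from trivial subgroups, yields the
  section \<open>s\<close>, its factor set \<open>v\<close> and the coordinates
  \<open>(k0 e, p e)\<close> on \<open>E\<close>; \<open>\<kappa>\<close>, from the subgroups
  \<open>T x\<close>, yields \<open>u\<close> and the conjugating elements
  \<open>t x\<close>.\<close>

lemma cocycle_exists:
  obtains u v where "cocycle_data G \<pi> X S A act u v" "rel_ext_equivalent X S A R (cocycle_data.R G S A act u v)"
proof -
  obtain x0 where x0: "x0 \<in> topspace X" using X_nonempty by blast
  obtain \<kappa>' where c\<kappa>': "continuous_map (prod_topology (topo E) X) (discrete_topology (carrier A)) (\<lambda>z. \<kappa>' (fst z) (snd z))"
    and \<kappa>'_i: "\<And>a e x. a \<in> carrier A \<Longrightarrow> e \<in> carrier E \<Longrightarrow> x \<in> topspace X \<Longrightarrow> \<kappa>' (i a \<otimes>\<^bsub>E\<^esub> e) x = a \<otimes>\<^bsub>A\<^esub> \<kappa>' e x"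
    by (rule finite_covering.trivialisation[OF trivial_covering]) (rule that, assumption+)
  obtain \<kappa> where c\<kappa>: "continuous_map (prod_topology (topo E) X) (discrete_topology (carrier A)) (\<lambda>z. \<kappa> (fst z) (snd z))"
    and \<kappa>_i: "\<And>a e x. a \<in> carrier A \<Longrightarrow> e \<in> carrier E \<Longrightarrow> x \<in> topspace X \<Longrightarrow> \<kappa> (i a \<otimes>\<^bsub>E\<^esub> e) x = a \<otimes>\<^bsub>A\<^esub> \<kappa> e x"
    and \<kappa>_T: "\<And>t e x. e \<in> carrier E \<Longrightarrow> x \<in> topspace X \<Longrightarrow> t \<in> T x \<Longrightarrow> \<kappa> (e \<otimes>\<^bsub>E\<^esub> t) x = \<kappa> e x"
    by (rule finite_covering.trivialisation[OF covering]) (rule that, assumption+)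
  have \<kappa>_closed [simp]: "\<kappa> e x \<in> carrier A" if "e \<in> carrier E" "x \<in> topspace X" for e x
    using continuous_map_image_subset_topspace[OF c\<kappa>] that by (auto simp: tsE image_subset_iff)
  have \<kappa>_cont: "continuous_map W (topo A) (\<lambda>t. \<kappa> (f t) (y t))" if "continuous_map W (topo E) f" "continuous_map W X y" for W f y
    using continuous_map_compose[OF continuous_map_pairedI[OF that] c\<kappa>] by (simp add: comp_def A_discrete)
  define k0 where "k0 e = \<kappa>' e x0" for e
  have k0_cont: "continuous_map (topo E) (topo A) k0"
    using continuous_map_compose[OF continuous_map_pairedI[of "topo E" "topo E" "\<lambda>e. e" X "\<lambda>_. x0"] c\<kappa>'] x0
    by (simp add: comp_def A_discrete k0_def[abs_def])
  have k0_closed [simp]: "k0 e \<in> carrier A" if "e \<in> carrier E" for e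
    using continuous_map_image_subset_topspace[OF k0_cont] that tsE tsA by auto
  have k0_i: "k0 (i a \<otimes>\<^bsub>E\<^esub> e) = a \<otimes>\<^bsub>A\<^esub> k0 e" if "a \<in> carrier A" "e \<in> carrier E" for a e
    using \<kappa>'_i[OF that x0] by (simp add: k0_def)
  \<comment> \<open>The element \<open>i (- k0 e) e\<close> does not change within a fibre of
    \<open>p\<close>, because \<open>k0\<close> is equivariant; hence any choice of \<open>e\<close>
    over \<open>g\<close> defines the same section.\<close>
  define s where "s g = (let e = (SOME e. e \<in> carrier E \<and> p e = g) in i (inv\<^bsub>A\<^esub> k0 e) \<otimes>\<^bsub>E\<^esub> e)" for g
  have s_p: "s (p e) = i (inv\<^bsub>A\<^esub> k0 e) \<otimes>\<^bsub>E\<^esub> e" if e: "e \<in> carrier E" for e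
  proof -
    let ?e = "SOME e'. e' \<in> carrier E \<and> p e' = p e"
    have e': "?e \<in> carrier E \<and> p ?e = p e" by (rule someI[of _ e]) (simp add: e)
    obtain a where a: "a \<in> carrier A" "?e = i a \<otimes>\<^bsub>E\<^esub> e" using fibre[of e ?e] e e' by auto
    have "s (p e) = i (inv\<^bsub>A\<^esub> (a \<otimes>\<^bsub>A\<^esub> k0 e)) \<otimes>\<^bsub>E\<^esub> (i a \<otimes>\<^bsub>E\<^esub> e)"
      unfolding s_def Let_def a(2) k0_i[OF a(1) e] ..
    also have "\<dots> = i (inv\<^bsub>A\<^esub> (a \<otimes>\<^bsub>A\<^esub> k0 e) \<otimes>\<^bsub>A\<^esub> a) \<otimes>\<^bsub>E\<^esub> e" using a e by (simp add: E.m_assoc)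
    also have "inv\<^bsub>A\<^esub> (a \<otimes>\<^bsub>A\<^esub> k0 e) \<otimes>\<^bsub>A\<^esub> a = inv\<^bsub>A\<^esub> k0 e"
      using a e by (simp add: A.inv_mult A.m_comm[of "inv\<^bsub>A\<^esub> a" "inv\<^bsub>A\<^esub> k0 e"] A.m_assoc)
    finally show ?thesis .
  qed
  have surj: "\<exists>e\<in>carrier E. p e = g" if "g \<in> carrier G" for g using p_epi that unfolding epi_def by (metis (mono_tags, lifting) imageE mem_Collect_eq)
  have s_closed [simp]: "s g \<in> carrier E" and p_s [simp]: "p (s g) = g" if g: "g \<in> carrier G" for g
  proof -
    obtain e where e: "e \<in> carrier E" "p e = g" using surj[OF g] by blast
    show "s g \<in> carrier E" "p (s g) = g" unfolding e(2)[symmetric] s_p[OF e(1)] using e(1) by simp_all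
  qed
  have decomp: "e = i (k0 e) \<otimes>\<^bsub>E\<^esub> s (p e)" if e: "e \<in> carrier E" for e
  proof -
    have "i (k0 e) \<otimes>\<^bsub>E\<^esub> s (p e) = e"
      unfolding s_p[OF e] using e by (simp flip: E.m_assoc)
    then show ?thesis ..
  qed
  have k0_s: "k0 (s g) = \<one>\<^bsub>A\<^esub>" if g: "g \<in> carrier G" for g
  proof -
    obtain e where e: "e \<in> carrier E" "p e = g" using surj[OF g] by blast
    show ?thesis unfolding e(2)[symmetric] s_p[OF e(1)] k0_i[OF A.inv_closed[OF k0_closed[OF e(1)]] e(1)] using e(1) by simp
  qed
  \<comment> \<open>\<open>p\<close> is a quotient map, being a continuous surjection from a compact
    to a Hausdorff space, so continuity is tested after composition with \<open>p\<close>, where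
    \<open>s_p\<close> is explicit.\<close>
  have s_cont: "continuous_map (topo G) (topo E) s"
  proof -
    have "quotient_map (topo E) (topo G) p"
      using profinite_E G continuous_p p_epi
      by (intro continuous_imp_quotient_map) (auto simp: profinite_group_def profinite_space_def epi_def tsE ts)
    moreover have "continuous_map (topo E) (topo E) (s \<circ> p)"
    proof -
      have "continuous_map (topo E) (topo E) (\<lambda>e. i (inv\<^bsub>A\<^esub> k0 e) \<otimes>\<^bsub>E\<^esub> e)"
        using continuous_map_compose[OF continuous_map_group_inv[OF tgA k0_cont] continuous_i]
        by (intro continuous_map_group_mult tgE) (simp_all add: comp_def)
      then show ?thesis by (rule continuous_map_eq) (simp add: s_p tsE)
    qed
    ultimately show ?thesis by (rule continuous_compose_quotient_map)
  qed
  define v where "v g h = k0 (s g \<otimes>\<^bsub>E\<^esub> s h)" for g h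
  have v_closed [simp]: "v g h \<in> carrier A" if "g \<in> carrier G" "h \<in> carrier G" for g h using that by (simp add: v_def)
  have s_mult: "s g \<otimes>\<^bsub>E\<^esub> s h = i (v g h) \<otimes>\<^bsub>E\<^esub> s (g \<otimes>\<^bsub>G\<^esub> h)" if "g \<in> carrier G" "h \<in> carrier G" for g h
    using decomp[of "s g \<otimes>\<^bsub>E\<^esub> s h"] that by (simp add: v_def)
  \<comment> \<open>The failure of \<open>\<kappa>(-, x)\<close> to be equivariant; it is invariant under \<open>A\<close> and \<open>q\<^sub>x(S\<^sub>x)\<close>, hence a function on \<open>G/S\<^sub>x\<close>.\<close>
  define J where "J g e x = \<kappa> (s g \<otimes>\<^bsub>E\<^esub> e) x \<otimes>\<^bsub>A\<^esub> inv\<^bsub>A\<^esub> act g (\<kappa> e x)" for g e x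
  have J_closed [simp]: "J g e x \<in> carrier A" if "g \<in> carrier G" "e \<in> carrier E" "x \<in> topspace X" for g e x
    using that by (simp add: J_def)
  have J_i: "J g (i a \<otimes>\<^bsub>E\<^esub> e) x = J g e x" if g: "g \<in> carrier G" and a: "a \<in> carrier A" and e: "e \<in> carrier E" and x: "x \<in> topspace X" for g a e x
  proof -
    have "s g \<otimes>\<^bsub>E\<^esub> (i a \<otimes>\<^bsub>E\<^esub> e) = i (act g a) \<otimes>\<^bsub>E\<^esub> (s g \<otimes>\<^bsub>E\<^esub> e)"
      using comm_i[of "s g" a] g a e by (simp flip: E.m_assoc)
    then have "J g (i a \<otimes>\<^bsub>E\<^esub> e) x = act g a \<otimes>\<^bsub>A\<^esub> \<kappa> (s g \<otimes>\<^bsub>E\<^esub> e) x \<otimes>\<^bsub>A\<^esub> inv\<^bsub>A\<^esub> (act g a \<otimes>\<^bsub>A\<^esub> act g (\<kappa> e x))"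
      using g a e x by (simp add: J_def \<kappa>_i)
    also have "\<dots> = (act g a \<otimes>\<^bsub>A\<^esub> inv\<^bsub>A\<^esub> act g a) \<otimes>\<^bsub>A\<^esub> J g e x"
      using g a e x by (simp add: J_def A.inv_mult A.m_ac del: A.r_inv A.l_inv A.Units_r_inv A.Units_l_inv)
    finally show ?thesis using g a e x by simp
  qed
  have J_T: "J g (e \<otimes>\<^bsub>E\<^esub> t) x = J g e x" if g: "g \<in> carrier G" and e: "e \<in> carrier E" and x: "x \<in> topspace X" and t: "t \<in> T x" for g e x t
  proof -
    have tE: "t \<in> carrier E" using t q_closed[OF x] by (auto simp: T_def)
    have "\<kappa> (s g \<otimes>\<^bsub>E\<^esub> (e \<otimes>\<^bsub>E\<^esub> t)) x = \<kappa> (s g \<otimes>\<^bsub>E\<^esub> e) x"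
      using \<kappa>_T[of "s g \<otimes>\<^bsub>E\<^esub> e" x t] g e x t tE by (simp add: E.m_assoc)
    then show ?thesis using \<kappa>_T[OF e x t] by (simp add: J_def)
  qed
  have J_cs: "J g e x = J g e' x" if g: "g \<in> carrier G" and e: "e \<in> carrier E" and e': "e' \<in> carrier E" and x: "x \<in> topspace X"
    and eq: "cs (p e) x = cs (p e') x" for g e e' x
  proof -
    obtain \<sigma> where \<sigma>: "\<sigma> \<in> S x" "\<sigma> = inv\<^bsub>G\<^esub> p e \<otimes>\<^bsub>G\<^esub> p e'"
      using cs_eqD(2)[OF eq] e e' x by simp
    have qE: "q x \<sigma> \<in> carrier E" by (rule q_closed[OF x \<sigma>(1)])
    have "p (e \<otimes>\<^bsub>E\<^esub> q x \<sigma>) = p e'"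
      using e e' qE by (simp add: p_q[OF x \<sigma>(1)]) (simp add: \<sigma>(2) flip: m_assoc)
    then obtain a where a: "a \<in> carrier A" "e' = i a \<otimes>\<^bsub>E\<^esub> (e \<otimes>\<^bsub>E\<^esub> q x \<sigma>)"
      using fibre[of "e \<otimes>\<^bsub>E\<^esub> q x \<sigma>" e'] e e' qE by (metis E.m_closed)
    have "J g e' x = J g (e \<otimes>\<^bsub>E\<^esub> q x \<sigma>) x" unfolding a(2) using J_i g a(1) e qE x by simp
    also have "\<dots> = J g e x" using J_T[OF g e x] \<sigma>(1) by (simp add: T_def)
    finally show ?thesis by simp
  qed
  \<comment> \<open>\<open>J g e x\<close> is placed at the coset of \<open>g p(e)\<close>, over
    which \<open>s g e\<close> lies. If \<open>\<kappa>\<close> were a function of cosets,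
    \<open>u(g, y)\<close> would be \<open>\<kappa>(y) - g \<kappa>(g^-1 y)\<close>.\<close>
  define u where "u g y = J g (SOME e. e \<in> carrier E \<and> cs (g \<otimes>\<^bsub>G\<^esub> p e) (snd y) = y) (snd y)" for g y
  have u_J: "u g (cs (g \<otimes>\<^bsub>G\<^esub> p e) x) = J g e x" if g: "g \<in> carrier G" and e: "e \<in> carrier E" and x: "x \<in> topspace X" for g e x
  proof -
    let ?y = "cs (g \<otimes>\<^bsub>G\<^esub> p e) x"
    have sy: "snd ?y = x" by (simp add: cs_def)
    let ?e = "SOME e'. e' \<in> carrier E \<and> cs (g \<otimes>\<^bsub>G\<^esub> p e') (snd ?y) = ?y"
    have e': "?e \<in> carrier E \<and> cs (g \<otimes>\<^bsub>G\<^esub> p ?e) (snd ?y) = ?y" by (rule someI[of _ e]) (simp add: e sy)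
    have "coset_space_act G (inv\<^bsub>G\<^esub> g) (cs (g \<otimes>\<^bsub>G\<^esub> p ?e) x) = coset_space_act G (inv\<^bsub>G\<^esub> g) ?y"
      using e' by (simp only: sy)
    then have "cs (p ?e) x = cs (p e) x"
      using g e e' x by (simp add: coset_space_act_cs flip: m_assoc)
    from J_cs[OF g conjunct1[OF e'] e x this] show ?thesis by (simp only: u_def sy)
  qed
  have u_s: "u g (cs k x) = J g (s (inv\<^bsub>G\<^esub> g \<otimes>\<^bsub>G\<^esub> k)) x" if g: "g \<in> carrier G" and k: "k \<in> carrier G" and x: "x \<in> topspace X" for g k x
    using u_J[OF g s_closed x, of "inv\<^bsub>G\<^esub> g \<otimes>\<^bsub>G\<^esub> k"] g k by (simp flip: m_assoc)
  have fam_u: "fam u"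
  proof -
    let ?W = "prod_topology (topo G) GX"
    have pr: "continuous_map ?W (topo G) fst" "continuous_map ?W (topo G) (\<lambda>t. fst (snd t))" "continuous_map ?W X (\<lambda>t. snd (snd t))"
      by (intro continuous_map_fst continuous_map_compose[OF continuous_map_snd continuous_map_fst, unfolded comp_def]
          continuous_map_compose[OF continuous_map_snd continuous_map_snd, unfolded comp_def])+
    have sg: "continuous_map ?W (topo E) (\<lambda>t. s (fst t))"
      using continuous_map_compose[OF pr(1) s_cont] by (simp add: comp_def)
    have "continuous_map ?W (topo G) (\<lambda>t. inv\<^bsub>G\<^esub> (fst t) \<otimes>\<^bsub>G\<^esub> fst (snd t))"
      by (intro continuous_map_group_mult continuous_map_group_inv tg pr)
    from continuous_map_compose[OF this s_cont]
    have sk: "continuous_map ?W (topo E) (\<lambda>t. s (inv\<^bsub>G\<^esub> (fst t) \<otimes>\<^bsub>G\<^esub> fst (snd t)))" by (simp add: comp_def)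
    have "continuous_map ?W (topo A) (\<lambda>t. J (fst t) (s (inv\<^bsub>G\<^esub> (fst t) \<otimes>\<^bsub>G\<^esub> fst (snd t))) (snd (snd t)))"
      unfolding J_def
      by (intro continuous_map_group_mult continuous_map_group_inv tgA tgE continuous_map_act \<kappa>_cont sg sk pr)
    then show ?thesis unfolding fam_def by (rule continuous_map_eq) (auto simp: ts u_s)
  qed
  \<comment> \<open>In the coboundary of this formal coboundary all values of
    \<open>\<kappa>\<close> cancel, except that \<open>s g s h\<close> stands where
    \<open>s (g h)\<close> is expected; equivariance of \<open>\<kappa>\<close> turns the
    discrepancy into \<open>v g h\<close>.\<close>
  have v_cob: "v g h = cob u g h k x" if g: "g \<in> carrier G" and h: "h \<in> carrier G" and k: "k \<in> carrier G" and x: "x \<in> topspace X" for g h k x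
  proof -
    let ?e = "s (inv\<^bsub>G\<^esub> (g \<otimes>\<^bsub>G\<^esub> h) \<otimes>\<^bsub>G\<^esub> k)"
    have e: "?e \<in> carrier E" "p ?e = inv\<^bsub>G\<^esub> (g \<otimes>\<^bsub>G\<^esub> h) \<otimes>\<^bsub>G\<^esub> k" using g h k by simp_all
    have hpe: "h \<otimes>\<^bsub>G\<^esub> p ?e = inv\<^bsub>G\<^esub> g \<otimes>\<^bsub>G\<^esub> k"
      unfolding e(2) using g h k by (simp add: inv_mult_group) (simp flip: m_assoc)
    have 1: "u h (cs (inv\<^bsub>G\<^esub> g \<otimes>\<^bsub>G\<^esub> k) x) = J h ?e x" using u_J[OF h e(1) x] by (simp only: hpe)
    have 2: "u g (cs k x) = J g (s h \<otimes>\<^bsub>E\<^esub> ?e) x"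
    proof -
      have "g \<otimes>\<^bsub>G\<^esub> p (s h \<otimes>\<^bsub>E\<^esub> ?e) = k" using e(1) h g k hpe by (simp flip: m_assoc del: p_s) (simp add: hpe flip: m_assoc)
      then show ?thesis using u_J[OF g _ x, of "s h \<otimes>\<^bsub>E\<^esub> ?e"] e(1) h by simp
    qed
    have 3: "u (g \<otimes>\<^bsub>G\<^esub> h) (cs k x) = J (g \<otimes>\<^bsub>G\<^esub> h) ?e x" using u_s[OF m_closed[OF g h] k x] .
    let ?a = "\<kappa> (s (g \<otimes>\<^bsub>G\<^esub> h) \<otimes>\<^bsub>E\<^esub> ?e) x" and ?b = "act g (\<kappa> (s h \<otimes>\<^bsub>E\<^esub> ?e) x)" and ?c = "act (g \<otimes>\<^bsub>G\<^esub> h) (\<kappa> ?e x)"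
    have car: "?a \<in> carrier A" "?b \<in> carrier A" "?c \<in> carrier A" "v g h \<in> carrier A" using g h k x e by simp_all
    have "s g \<otimes>\<^bsub>E\<^esub> (s h \<otimes>\<^bsub>E\<^esub> ?e) = i (v g h) \<otimes>\<^bsub>E\<^esub> (s (g \<otimes>\<^bsub>G\<^esub> h) \<otimes>\<^bsub>E\<^esub> ?e)"
      using s_mult[OF g h] g h e by (simp flip: E.m_assoc)
    then have 4: "\<kappa> (s g \<otimes>\<^bsub>E\<^esub> (s h \<otimes>\<^bsub>E\<^esub> ?e)) x = v g h \<otimes>\<^bsub>A\<^esub> ?a" using \<kappa>_i g h e x by simp
    have "cob u g h k x = (?b \<otimes>\<^bsub>A\<^esub> inv\<^bsub>A\<^esub> ?c) \<otimes>\<^bsub>A\<^esub> inv\<^bsub>A\<^esub> (?a \<otimes>\<^bsub>A\<^esub> inv\<^bsub>A\<^esub> ?c) \<otimes>\<^bsub>A\<^esub> (v g h \<otimes>\<^bsub>A\<^esub> ?a \<otimes>\<^bsub>A\<^esub> inv\<^bsub>A\<^esub> ?b)"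
      unfolding cob_def 1 2 3 J_def 4 using g h e x by (simp add: act_act)
    also have "\<dots> = v g h \<otimes>\<^bsub>A\<^esub> (?a \<otimes>\<^bsub>A\<^esub> inv\<^bsub>A\<^esub> ?a) \<otimes>\<^bsub>A\<^esub> (?b \<otimes>\<^bsub>A\<^esub> inv\<^bsub>A\<^esub> ?b) \<otimes>\<^bsub>A\<^esub> (?c \<otimes>\<^bsub>A\<^esub> inv\<^bsub>A\<^esub> ?c)"
      using car by (simp add: A.inv_mult A.m_ac del: A.r_inv A.l_inv A.Units_r_inv A.Units_l_inv)
    finally show ?thesis using car by simp
  qed
  have data: "cocycle_data G \<pi> X S A act u v"
    by unfold_locales (fact fam_u, rule v_cob)
  interpret Q: cocycle_data G \<pi> X S A act u v by (rule data)
  define f where "f e = (k0 e, p e)" for e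
  have f_hom: "f (e \<otimes>\<^bsub>E\<^esub> e') = f e \<otimes>\<^bsub>Q.E\<^esub> f e'" if e: "e \<in> carrier E" and e': "e' \<in> carrier E" for e e'
  proof -
    let ?g = "p e" and ?h = "p e'"
    have gh: "?g \<in> carrier G" "?h \<in> carrier G" using e e' by simp_all
    have sc: "s ?g \<in> carrier E" "s ?h \<in> carrier E" using gh by simp_all
    have ic: "i (k0 e) \<in> carrier E" "i (k0 e') \<in> carrier E" "i (act ?g (k0 e')) \<in> carrier E" using e e' gh by simp_all
    have "e \<otimes>\<^bsub>E\<^esub> e' = (i (k0 e) \<otimes>\<^bsub>E\<^esub> s ?g) \<otimes>\<^bsub>E\<^esub> (i (k0 e') \<otimes>\<^bsub>E\<^esub> s ?h)" using decomp[OF e] decomp[OF e'] by simp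
    also have "\<dots> = i (k0 e) \<otimes>\<^bsub>E\<^esub> (s ?g \<otimes>\<^bsub>E\<^esub> i (k0 e')) \<otimes>\<^bsub>E\<^esub> s ?h" using sc ic by (simp add: E.m_assoc)
    also have "\<dots> = i (k0 e) \<otimes>\<^bsub>E\<^esub> (i (act ?g (k0 e')) \<otimes>\<^bsub>E\<^esub> s ?g) \<otimes>\<^bsub>E\<^esub> s ?h"
      using comm_i[OF sc(1), of "k0 e'"] e' gh by simp
    also have "\<dots> = i (k0 e) \<otimes>\<^bsub>E\<^esub> i (act ?g (k0 e')) \<otimes>\<^bsub>E\<^esub> (s ?g \<otimes>\<^bsub>E\<^esub> s ?h)" using sc ic by (simp add: E.m_assoc)
    also have "\<dots> = i (k0 e \<otimes>\<^bsub>A\<^esub> act ?g (k0 e') \<otimes>\<^bsub>A\<^esub> v ?g ?h) \<otimes>\<^bsub>E\<^esub> s (?g \<otimes>\<^bsub>G\<^esub> ?h)"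
      unfolding s_mult[OF gh] using e e' gh by (simp add: E.m_assoc)
    finally have "k0 (e \<otimes>\<^bsub>E\<^esub> e') = k0 e \<otimes>\<^bsub>A\<^esub> act ?g (k0 e') \<otimes>\<^bsub>A\<^esub> v ?g ?h"
      using k0_i[of "k0 e \<otimes>\<^bsub>A\<^esub> act ?g (k0 e') \<otimes>\<^bsub>A\<^esub> v ?g ?h" "s (?g \<otimes>\<^bsub>G\<^esub> ?h)"] k0_s[OF m_closed[OF gh]] e e' gh by simp
    then show ?thesis using e e' by (simp add: f_def Q.mult_E)
  qed
  have f_bij: "bij_betw f (carrier E) (carrier Q.E)"
  proof (rule bij_betwI[of _ _ _ "\<lambda>(a, g). i a \<otimes>\<^bsub>E\<^esub> s g"])
    show "(\<lambda>(a, g). i a \<otimes>\<^bsub>E\<^esub> s g) (f e) = e" if "e \<in> carrier E" for e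
      using decomp[OF that] by (simp add: f_def)
    show "f ((\<lambda>(a, g). i a \<otimes>\<^bsub>E\<^esub> s g) z) = z" if "z \<in> carrier Q.E" for z
      using that by (auto simp: f_def Q.carrier_E k0_i k0_s)
  qed (auto simp: f_def Q.carrier_E)
  have f_cont: "continuous_map (topo E) (topo Q.E) f"
    unfolding Q.topo_E f_def by (intro continuous_map_pairedI k0_cont continuous_p)
  have homeo: "homeomorphic_map (topo E) (topo Q.E) f"
  proof (rule continuous_imp_homeomorphic_map[OF f_cont])
    show "compact_space (topo E)" "Hausdorff_space (topo Q.E)"
      using profinite_E Q.profinite_E by (simp_all add: profinite_group_def profinite_space_def)
  qed (use f_bij in \<open>simp_all add: bij_betw_def tsE Q.carrier_E tsA ts\<close>)
  \<comment> \<open>Multiplicativity makes the image of the unit idempotent, and this determines its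
    first component.\<close>
  have k0_1: "k0 \<one>\<^bsub>E\<^esub> = inv\<^bsub>A\<^esub> v \<one>\<^bsub>G\<^esub> \<one>\<^bsub>G\<^esub>"
  proof -
    have "f \<one>\<^bsub>E\<^esub> \<otimes>\<^bsub>Q.E\<^esub> f \<one>\<^bsub>E\<^esub> = f \<one>\<^bsub>E\<^esub>" using f_hom[of "\<one>\<^bsub>E\<^esub>" "\<one>\<^bsub>E\<^esub>"] by simp
    then have "k0 \<one>\<^bsub>E\<^esub> \<otimes>\<^bsub>A\<^esub> k0 \<one>\<^bsub>E\<^esub> \<otimes>\<^bsub>A\<^esub> v \<one>\<^bsub>G\<^esub> \<one>\<^bsub>G\<^esub> = k0 \<one>\<^bsub>E\<^esub>" by (simp add: f_def Q.mult_E)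
    then have "k0 \<one>\<^bsub>E\<^esub> \<otimes>\<^bsub>A\<^esub> v \<one>\<^bsub>G\<^esub> \<one>\<^bsub>G\<^esub> = \<one>\<^bsub>A\<^esub>" by (simp add: A.m_assoc)
    then show ?thesis by (simp add: A.inv_equality)
  qed
  have f_i: "f (i a) = Q.i a" if "a \<in> carrier A" for a
    using k0_i[OF that E.one_closed] that by (simp add: f_def Q.i_def k0_1)
  \<comment> \<open>\<open>\<kappa>\<close> agrees at \<open>1\<close> and
    \<open>q x \<sigma>\<close>. Writing \<open>q x \<sigma>\<close> as \<open>i c\<close> times
    \<open>s \<sigma>\<close> gives \<open>c = \<kappa>(1) - \<kappa>(s \<sigma>)\<close>, and
    conjugation by \<open>t x = - \<kappa>(1)\<close> changes \<open>c\<close> into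
    \<open>\<sigma> \<kappa>(1) - \<kappa>(s \<sigma>)\<close>, which is
    \<open>- u(\<sigma>, 1 S_x)\<close>.\<close>
  define t where "t x = inv\<^bsub>A\<^esub> \<kappa> \<one>\<^bsub>E\<^esub> x" for x
  have t_closed [simp]: "t x \<in> carrier A" if "x \<in> topspace X" for x using that by (simp add: t_def)
  have t_cont: "continuous_map X (topo A) t"
    unfolding t_def by (intro continuous_map_group_inv tgA \<kappa>_cont) (simp_all add: tsE)
  have f_q: "Q.q x \<sigma> = Q.i (t x) \<otimes>\<^bsub>Q.E\<^esub> f (q x \<sigma>) \<otimes>\<^bsub>Q.E\<^esub> inv\<^bsub>Q.E\<^esub> (Q.i (t x))" if x: "x \<in> topspace X" and \<sigma>: "\<sigma> \<in> S x" for x \<sigma>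
  proof -
    have \<sigma>G: "\<sigma> \<in> carrier G" using S_sub[OF x \<sigma>] .
    have qE: "q x \<sigma> \<in> carrier E" by (rule q_closed[OF x \<sigma>])
    have fq: "f (q x \<sigma>) = (k0 (q x \<sigma>), \<sigma>)" by (simp add: f_def p_q[OF x \<sigma>])
    have fqE: "f (q x \<sigma>) \<in> carrier Q.E" using fq qE \<sigma>G by simp
    let ?a = "\<kappa> \<one>\<^bsub>E\<^esub> x" and ?b = "\<kappa> (s \<sigma>) x" and ?c = "k0 (q x \<sigma>)"
    have car: "?a \<in> carrier A" "?b \<in> carrier A" "?c \<in> carrier A" "act \<sigma> ?a \<in> carrier A" using x \<sigma>G qE by simp_all
    have "u \<sigma> (cs \<one>\<^bsub>G\<^esub> x) = J \<sigma> \<one>\<^bsub>E\<^esub> x"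
      using u_J[OF \<sigma>G E.one_closed x] cs_mult[OF one_closed x \<sigma>] \<sigma>G by simp
    then have us: "u \<sigma> (cs \<one>\<^bsub>G\<^esub> x) = ?b \<otimes>\<^bsub>A\<^esub> inv\<^bsub>A\<^esub> act \<sigma> ?a" using \<sigma>G by (simp add: J_def)
    have "?a = \<kappa> (\<one>\<^bsub>E\<^esub> \<otimes>\<^bsub>E\<^esub> q x \<sigma>) x" using \<kappa>_T[OF E.one_closed x, of "q x \<sigma>"] \<sigma> by (simp add: T_def)
    also have "\<dots> = \<kappa> (i ?c \<otimes>\<^bsub>E\<^esub> s \<sigma>) x" using decomp[OF qE] qE by (simp add: p_q[OF x \<sigma>])
    finally have a: "?a = ?c \<otimes>\<^bsub>A\<^esub> ?b" using \<kappa>_i \<sigma>G qE x by simp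
    have "inv\<^bsub>A\<^esub> (?b \<otimes>\<^bsub>A\<^esub> inv\<^bsub>A\<^esub> act \<sigma> ?a) \<otimes>\<^bsub>A\<^esub> inv\<^bsub>A\<^esub> act \<sigma> ?a = inv\<^bsub>A\<^esub> ?b \<otimes>\<^bsub>A\<^esub> (act \<sigma> ?a \<otimes>\<^bsub>A\<^esub> inv\<^bsub>A\<^esub> act \<sigma> ?a)"
      using car by (simp add: A.inv_mult A.m_ac del: A.r_inv A.l_inv A.Units_r_inv A.Units_l_inv)
    moreover have "inv\<^bsub>A\<^esub> (?c \<otimes>\<^bsub>A\<^esub> ?b) \<otimes>\<^bsub>A\<^esub> ?c = inv\<^bsub>A\<^esub> ?b \<otimes>\<^bsub>A\<^esub> (?c \<otimes>\<^bsub>A\<^esub> inv\<^bsub>A\<^esub> ?c)"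
      using car by (simp add: A.inv_mult A.m_ac del: A.r_inv A.l_inv A.Units_r_inv A.Units_l_inv)
    ultimately have "inv\<^bsub>A\<^esub> (u \<sigma> (cs \<one>\<^bsub>G\<^esub> x)) \<otimes>\<^bsub>A\<^esub> act \<sigma> (t x) = t x \<otimes>\<^bsub>A\<^esub> ?c"
      using car x \<sigma>G a[symmetric] by (simp add: us t_def)
    then have "Q.q x \<sigma> \<otimes>\<^bsub>Q.E\<^esub> Q.i (t x) = Q.i (t x) \<otimes>\<^bsub>Q.E\<^esub> f (q x \<sigma>)"
      using x \<sigma>G car(3) by (simp add: fq Q.q_def Q.mult_i Q.i_mult)
    then show ?thesis using Q.E.inv_solve_right[of "Q.q x \<sigma>" "Q.i (t x) \<otimes>\<^bsub>Q.E\<^esub> f (q x \<sigma>)" "Q.i (t x)"]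
        fqE Q.q_closed[OF x \<sigma>] Q.i_closed[OF t_closed[OF x]] by (metis Q.E.m_closed)
  qed
  have "rel_ext_equivalent X S A R Q.R"
    unfolding rel_ext_equivalent_def Q.R_sel
  proof (intro exI[of _ f] exI[of _ t] conjI ballI homeo t_cont f_i f_q)
    show "f \<in> iso E Q.E" using f_bij f_hom by (auto simp: iso_def hom_def bij_betw_def)
    show "snd (f e) = p e" for e by (simp add: f_def)
  qed
  then show ?thesis using that data by blast
qed

end

section \<open>The bijection\<close>

context relative_pair
begin

section \<open>Equivalence of relative extensions is an equivalence relation\<close>

lemma extension_data_iff: "extension_data G \<pi> X S A act R \<longleftrightarrow> relative_extension G X S A act R"
  using relative_pair_axioms by (simp add: extension_data_def extension_data_axioms_def)

lemma rel_ext_equivalent_refl: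
  assumes "relative_extension G X S A act R"
  shows "rel_ext_equivalent X S A R R"
proof -
  interpret extension_data G \<pi> X S A act R using assms by (simp add: extension_data_iff)
  show ?thesis
    unfolding rel_ext_equivalent_def
  proof (intro exI[of _ "\<lambda>e. e"] exI[of _ "\<lambda>_. \<one>\<^bsub>A\<^esub>"] conjI ballI)
    show "(\<lambda>e. e) \<in> iso E E" by (simp add: iso_def hom_def bij_betw_def)
    show "homeomorphic_map (topo E) (topo E) (\<lambda>e. e)" by (simp add: homeomorphic_map_id[unfolded id_def])
    show "continuous_map X (topo A) (\<lambda>_. \<one>\<^bsub>A\<^esub>)" by (simp add: tsA)
    show "q x s = i \<one>\<^bsub>A\<^esub> \<otimes>\<^bsub>E\<^esub> q x s \<otimes>\<^bsub>E\<^esub> inv\<^bsub>E\<^esub> i \<one>\<^bsub>A\<^esub>" if "x \<in> topspace X" "s \<in> S x" for x s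
      using q_closed[OF that] by simp
  qed simp_all
qed

lemma rel_ext_equivalent_sym:
  assumes R: "relative_extension G X S A act R" and R': "relative_extension G X S A act R'"
    and eq: "rel_ext_equivalent X S A R R'"
  shows "rel_ext_equivalent X S A R' R"
proof -
  interpret P: extension_data G \<pi> X S A act R using R by (simp add: extension_data_iff)
  interpret Q: extension_data G \<pi> X S A act R' using R' by (simp add: extension_data_iff)
  obtain f t where iso: "f \<in> iso P.E Q.E" and homeo: "homeomorphic_map (topo P.E) (topo Q.E) f"
    and incl: "\<And>a. a \<in> carrier A \<Longrightarrow> f (P.i a) = Q.i a"
    and proj: "\<And>e. e \<in> carrier P.E \<Longrightarrow> Q.p (f e) = P.p e"
    and t: "continuous_map X (topo A) t"
    and sec: "\<And>x s. x \<in> topspace X \<Longrightarrow> s \<in> S x \<Longrightarrow>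
      Q.q x s = Q.i (t x) \<otimes>\<^bsub>Q.E\<^esub> f (P.q x s) \<otimes>\<^bsub>Q.E\<^esub> inv\<^bsub>Q.E\<^esub> (Q.i (t x))"
    using eq unfolding rel_ext_equivalent_def by blast
  have tA: "t x \<in> carrier A" if "x \<in> topspace X" for x
    using continuous_map_image_subset_topspace[OF t] that tsA by auto
  obtain h where h: "homeomorphic_map (topo Q.E) (topo P.E) h"
    and hf: "\<And>e. e \<in> carrier P.E \<Longrightarrow> h (f e) = e" and fh: "\<And>e. e \<in> carrier Q.E \<Longrightarrow> f (h e) = e"
  proof -
    obtain h where "homeomorphic_maps (topo P.E) (topo Q.E) f h" using homeo by (auto simp: homeomorphic_map_maps)
    then show ?thesis using that unfolding homeomorphic_maps_map P.tsE Q.tsE by blast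
  qed
  have hE: "h e \<in> carrier P.E" if "e \<in> carrier Q.E" for e
    using homeomorphic_imp_surjective_map[OF h] that by (auto simp: P.tsE Q.tsE)
  have fE: "f e \<in> carrier Q.E" if "e \<in> carrier P.E" for e
    using homeomorphic_imp_surjective_map[OF homeo] that by (auto simp: P.tsE Q.tsE)
  have fmult: "f (e \<otimes>\<^bsub>P.E\<^esub> e') = f e \<otimes>\<^bsub>Q.E\<^esub> f e'" if "e \<in> carrier P.E" "e' \<in> carrier P.E" for e e'
    using iso that by (simp only: iso_def hom_def) blast
  have hmult: "h (e \<otimes>\<^bsub>Q.E\<^esub> e') = h e \<otimes>\<^bsub>P.E\<^esub> h e'" if e: "e \<in> carrier Q.E" "e' \<in> carrier Q.E" for e e'
  proof -
    have "f (h e \<otimes>\<^bsub>P.E\<^esub> h e') = e \<otimes>\<^bsub>Q.E\<^esub> e'" using fmult[OF hE hE] fh e by simp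
    then have "h (e \<otimes>\<^bsub>Q.E\<^esub> e') = h (f (h e \<otimes>\<^bsub>P.E\<^esub> h e'))" by simp
    then show ?thesis using hf hE e by simp
  qed
  have bij: "bij_betw h (carrier Q.E) (carrier P.E)"
    using hE fE hf fh by (intro bij_betwI[of _ _ _ f]) auto
  have hi: "h (Q.i a) = P.i a" if "a \<in> carrier A" for a
    using hf[of "P.i a"] incl that by simp
  show ?thesis
    unfolding rel_ext_equivalent_def
  proof (intro exI[of _ h] exI[of _ "\<lambda>x. inv\<^bsub>A\<^esub> t x"] conjI ballI h hi continuous_map_group_inv tgA t)
    show "h \<in> iso Q.E P.E" using bij hmult hE by (auto simp: iso_def hom_def)
    show "P.p (h e) = Q.p e" if "e \<in> carrier Q.E" for e
      using proj[OF hE[OF that]] fh[OF that] by simp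
    fix x s assume x: "x \<in> topspace X" and s: "s \<in> S x"
    have q: "P.q x s \<in> carrier P.E" "Q.q x s \<in> carrier Q.E" by (rule P.q_closed[OF x s], rule Q.q_closed[OF x s])
    have a: "P.i (t x) \<in> carrier P.E" "Q.i (t x) \<in> carrier Q.E" using tA[OF x] by auto
    have "Q.q x s \<otimes>\<^bsub>Q.E\<^esub> Q.i (t x) = Q.i (t x) \<otimes>\<^bsub>Q.E\<^esub> f (P.q x s)"
      unfolding sec[OF x s] using a(2) fE[OF q(1)] by (simp add: Q.E.m_assoc)
    then have "h (Q.q x s \<otimes>\<^bsub>Q.E\<^esub> Q.i (t x)) = h (Q.i (t x) \<otimes>\<^bsub>Q.E\<^esub> f (P.q x s))" by simp
    then have "h (Q.q x s) \<otimes>\<^bsub>P.E\<^esub> P.i (t x) = P.i (t x) \<otimes>\<^bsub>P.E\<^esub> P.q x s"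
      using a q fE[OF q(1)] by (simp add: hmult hi tA x hf)
    then have "inv\<^bsub>P.E\<^esub> (P.i (t x)) \<otimes>\<^bsub>P.E\<^esub> (h (Q.q x s) \<otimes>\<^bsub>P.E\<^esub> P.i (t x)) = P.q x s"
      using a(1) q(1) P.E.inv_solve_left' by simp
    then show "P.q x s = P.i (inv\<^bsub>A\<^esub> t x) \<otimes>\<^bsub>P.E\<^esub> h (Q.q x s) \<otimes>\<^bsub>P.E\<^esub> inv\<^bsub>P.E\<^esub> (P.i (inv\<^bsub>A\<^esub> t x))"
      using a(1) hE[OF q(2)] tA[OF x] by (simp add: P.E.m_assoc)
  qed
qed

lemma rel_ext_equivalent_trans:
  assumes R: "relative_extension G X S A act R" and R': "relative_extension G X S A act R'"
    and R'': "relative_extension G X S A act R''"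
    and eq: "rel_ext_equivalent X S A R R'" "rel_ext_equivalent X S A R' R''"
  shows "rel_ext_equivalent X S A R R''"
proof -
  interpret P: extension_data G \<pi> X S A act R using R by (simp add: extension_data_iff)
  interpret Q: extension_data G \<pi> X S A act R' using R' by (simp add: extension_data_iff)
  interpret W: extension_data G \<pi> X S A act R'' using R'' by (simp add: extension_data_iff)
  obtain f t where iso: "f \<in> iso P.E Q.E" and homeo: "homeomorphic_map (topo P.E) (topo Q.E) f"
    and incl: "\<And>a. a \<in> carrier A \<Longrightarrow> f (P.i a) = Q.i a"
    and proj: "\<And>e. e \<in> carrier P.E \<Longrightarrow> Q.p (f e) = P.p e"
    and t: "continuous_map X (topo A) t"
    and sec: "\<And>x s. x \<in> topspace X \<Longrightarrow> s \<in> S x \<Longrightarrow>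
      Q.q x s = Q.i (t x) \<otimes>\<^bsub>Q.E\<^esub> f (P.q x s) \<otimes>\<^bsub>Q.E\<^esub> inv\<^bsub>Q.E\<^esub> (Q.i (t x))"
    using eq(1) unfolding rel_ext_equivalent_def by blast
  obtain f' t' where iso': "f' \<in> iso Q.E W.E" and homeo': "homeomorphic_map (topo Q.E) (topo W.E) f'"
    and incl': "\<And>a. a \<in> carrier A \<Longrightarrow> f' (Q.i a) = W.i a"
    and proj': "\<And>e. e \<in> carrier Q.E \<Longrightarrow> W.p (f' e) = Q.p e"
    and t': "continuous_map X (topo A) t'"
    and sec': "\<And>x s. x \<in> topspace X \<Longrightarrow> s \<in> S x \<Longrightarrow>
      W.q x s = W.i (t' x) \<otimes>\<^bsub>W.E\<^esub> f' (Q.q x s) \<otimes>\<^bsub>W.E\<^esub> inv\<^bsub>W.E\<^esub> (W.i (t' x))"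
    using eq(2) unfolding rel_ext_equivalent_def by blast
  interpret f': group_hom Q.E W.E f'
    using iso' Q.E.is_group W.E.is_group by (simp add: group_hom_def group_hom_axioms_def iso_def)
  have fE: "f e \<in> carrier Q.E" if "e \<in> carrier P.E" for e
    using iso that by (auto simp: iso_def hom_def)
  have tA: "t x \<in> carrier A" "t' x \<in> carrier A" if "x \<in> topspace X" for x
    using continuous_map_image_subset_topspace[OF t] continuous_map_image_subset_topspace[OF t'] that tsA by auto
  show ?thesis
    unfolding rel_ext_equivalent_def
  proof (intro exI[of _ "f' \<circ> f"] exI[of _ "\<lambda>x. t' x \<otimes>\<^bsub>A\<^esub> t x"] conjI ballI continuous_map_group_mult tgA t t')
    show "f' \<circ> f \<in> iso P.E W.E" by (rule iso_set_trans[OF iso iso'])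
    show "homeomorphic_map (topo P.E) (topo W.E) (f' \<circ> f)" by (rule homeomorphic_map_compose[OF homeo homeo'])
    show "(f' \<circ> f) (P.i a) = W.i a" if "a \<in> carrier A" for a using that incl incl' by simp
    show "W.p ((f' \<circ> f) e) = P.p e" if "e \<in> carrier P.E" for e using that proj proj' fE by simp
    fix x s assume x: "x \<in> topspace X" and s: "s \<in> S x"
    note tx = tA[OF x] and fq = fE[OF P.q_closed[OF x s]]
    have "W.q x s = W.i (t' x) \<otimes>\<^bsub>W.E\<^esub> (W.i (t x) \<otimes>\<^bsub>W.E\<^esub> f' (f (P.q x s)) \<otimes>\<^bsub>W.E\<^esub> inv\<^bsub>W.E\<^esub> (W.i (t x)))
        \<otimes>\<^bsub>W.E\<^esub> inv\<^bsub>W.E\<^esub> (W.i (t' x))"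
      unfolding sec'[OF x s] sec[OF x s] using tx fq by (simp add: incl')
    then show "W.q x s = W.i (t' x \<otimes>\<^bsub>A\<^esub> t x) \<otimes>\<^bsub>W.E\<^esub> (f' \<circ> f) (P.q x s) \<otimes>\<^bsub>W.E\<^esub> inv\<^bsub>W.E\<^esub> (W.i (t' x \<otimes>\<^bsub>A\<^esub> t x))"
      using tx fq by (simp add: W.E.m_assoc W.E.inv_mult_group del: W.i.hom_inv)
  qed
qed

lemma equiv_rel_ext_rel: "equiv {R. relative_extension G X S A act R} (rel_ext_rel G X S A act)"
proof (rule equivI)
  show "rel_ext_rel G X S A act \<subseteq> {R. relative_extension G X S A act R} \<times> {R. relative_extension G X S A act R}"
    by (auto simp: rel_ext_rel_def)
  show "refl_on {R. relative_extension G X S A act R} (rel_ext_rel G X S A act)"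
    by (auto simp: refl_on_def rel_ext_rel_def rel_ext_equivalent_refl)
  show "sym (rel_ext_rel G X S A act)"
    by (auto simp: sym_def rel_ext_rel_def intro: rel_ext_equivalent_sym)
  show "trans (rel_ext_rel G X S A act)"
    unfolding trans_def rel_ext_rel_def by (blast intro: rel_ext_equivalent_trans)
qed

text \<open>The choices that enter the construction of the extension. That the restriction of
  \<open>\<eta>\<close> is a cocycle follows from the last condition.\<close>

definition admissible where
  "admissible \<eta> \<zeta> \<longleftrightarrow> \<eta> \<in> Fam 1 \<and> \<zeta> \<in> Coch 2 \<and> ev_star \<pi> G X S A 2 \<zeta> = cobdry \<pi> G 1 \<eta>"

abbreviation ext_of where "ext_of \<eta> \<zeta> \<equiv> cocycle_rel_ext \<pi> G X S A act \<eta> \<zeta>"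

lemma admissible_cocycle_data:
  assumes "admissible \<eta> \<zeta>"
  shows "cocycle_data G \<pi> X S A act (fn \<eta>) (\<lambda>g h. \<zeta> (symb \<pi> G [g, h]))"
  using assms fam_fn ev_star_eq_iff[of \<eta> \<zeta>] relative_pair_axioms
  by (simp add: admissible_def cocycle_data_def cocycle_data_axioms_def)

lemma admissible_ext_of:
  assumes "admissible \<eta> \<zeta>"
  shows "ext_of \<eta> \<zeta> = cocycle_data.R G S A act (fn \<eta>) (\<lambda>g h. \<zeta> (symb \<pi> G [g, h]))"
proof -
  interpret cocycle_data G \<pi> X S A act "fn \<eta>" "\<lambda>g h. \<zeta> (symb \<pi> G [g, h])" by (rule admissible_cocycle_data[OF assms])
  show ?thesis
    unfolding cocycle_rel_ext_def cocycle_group_def R_def E_def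
    by (simp add: i_def[abs_def] q_def[abs_def] fn_def pt_def cs_def)
qed

lemma admissible_relative_extension:
  assumes "admissible \<eta> \<zeta>"
  shows "relative_extension G X S A act (ext_of \<eta> \<zeta>)"
  unfolding admissible_ext_of[OF assms] by (rule cocycle_data.relative_extension[OF admissible_cocycle_data[OF assms]])

text \<open>Both equalities amount to the functions being \<open>cohomologous\<close>. One direction
  makes the correspondence independent of the cocycle and of the choices, the other makes it
  injective.\<close>

lemma admissible_class_eq_iff:
  assumes a: "admissible \<eta> \<zeta>" and a': "admissible \<eta>' \<zeta>'"
  shows "rel_class \<pi> G X S A act 2 (in_star \<pi> G X S 1 \<eta>) = rel_class \<pi> G X S A act 2 (in_star \<pi> G X S 1 \<eta>') \<longleftrightarrow>
    rel_ext_rel G X S A act `` {ext_of \<eta> \<zeta>} = rel_ext_rel G X S A act `` {ext_of \<eta>' \<zeta>'}"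
proof -
  interpret two_cocycle_data G \<pi> X S A act "fn \<eta>" "\<lambda>g h. \<zeta> (symb \<pi> G [g, h])" "fn \<eta>'" "\<lambda>g h. \<zeta>' (symb \<pi> G [g, h])"
    using admissible_cocycle_data[OF a] admissible_cocycle_data[OF a'] relative_pair_axioms by (simp add: two_cocycle_data_def)
  have "rel_ext_rel G X S A act `` {ext_of \<eta> \<zeta>} = rel_ext_rel G X S A act `` {ext_of \<eta>' \<zeta>'} \<longleftrightarrow>
      rel_ext_equivalent X S A (ext_of \<eta> \<zeta>) (ext_of \<eta>' \<zeta>')"
    using eq_equiv_class_iff[OF equiv_rel_ext_rel] admissible_relative_extension[OF a] admissible_relative_extension[OF a']
    by (simp add: rel_ext_rel_def)
  also have "\<dots> \<longleftrightarrow> cohomologous (fn \<eta>) (fn \<eta>')"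
    unfolding admissible_ext_of[OF a] admissible_ext_of[OF a'] using equivalent_if_cohomologous cohomologous_if_equivalent by blast
  finally show ?thesis
    using rel_class_eq_cohomologous[of \<eta> \<eta>'] a a' by (simp add: admissible_def)
qed

text \<open>By \<open>v_cob\<close> the coboundary takes the value \<open>v g h\<close> at every
  coset, so it is constant there.\<close>

lemma in_star_cocycle:
  assumes \<eta>: "\<eta> \<in> Fam 1" and "cocycle_data G \<pi> X S A act (fn \<eta>) v"
  shows "in_star \<pi> G X S 1 \<eta> \<in> carrier (rel_cocycles \<pi> G X S A act 2)"
proof -
  interpret P: cocycle_data G \<pi> X S A act "fn \<eta>" v by fact
  obtain k0 x0 where y0: "y0 = cs k0 x0" "k0 \<in> carrier G" "x0 \<in> topspace X" using y0 unfolding topspace_Y by blast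
  show ?thesis
    unfolding cocycle_iff[OF \<eta>] y0(1)
  proof (intro ballI)
    fix g h k x assume gh: "g \<in> carrier G" "h \<in> carrier G" and kx: "k \<in> carrier G" "x \<in> topspace X"
    show "cobdry \<pi> G 1 \<eta> (symb \<pi> G [g, h]) (pt (cs k0 x0)) = cob (fn \<eta>) g h k x"
      unfolding cobdry_fn[OF \<eta> gh y0(2,3)] P.v_cob[OF gh y0(2,3), symmetric] by (rule P.v_cob[OF gh kx])
  qed
qed

lemma admissible_exists:
  assumes "\<xi> \<in> carrier (rel_cocycles \<pi> G X S A act 2)"
  obtains \<eta> \<zeta> where "admissible \<eta> \<zeta>" "in_star \<pi> G X S 1 \<eta> = \<xi>"
proof -
  have "\<xi> \<in> Rel 1" using assms by (simp add: rel_cocycles_carrier)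
  then obtain \<eta> where \<eta>: "\<eta> \<in> Fam 1" "in_star \<pi> G X S 1 \<eta> = \<xi>" by (rule in_star_surj)
  obtain \<zeta> where "\<zeta> \<in> Coch 2" "ev_star \<pi> G X S A 2 \<zeta> = cobdry \<pi> G 1 \<eta>"
    by (rule zeta_exists[OF \<eta>(1)]) (use assms \<eta>(2) in simp)
  then show ?thesis using that \<eta> by (simp add: admissible_def)
qed

text \<open>The extension yields functions \<open>u\<close> and \<open>v\<close>, and
  \<open>u\<close> comes from a cochain \<open>\<eta>\<close>. As \<open>fn \<eta>\<close> and
  \<open>u\<close> are only known to agree on the carrier, they are compared through
  \<open>cohomologous\<close>, with \<open>b\<close> and \<open>w\<close> trivial.\<close>

lemma admissible_surj:
  assumes R: "relative_extension G X S A act R"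
  obtains \<eta> \<zeta> where "admissible \<eta> \<zeta>" "rel_ext_equivalent X S A R (ext_of \<eta> \<zeta>)"
proof -
  interpret R: extension_data G \<pi> X S A act R using R by (simp add: extension_data_iff)
  obtain u v where data: "cocycle_data G \<pi> X S A act u v"
    and eq: "rel_ext_equivalent X S A R (cocycle_data.R G S A act u v)" by (rule R.cocycle_exists)
  interpret P: cocycle_data G \<pi> X S A act u v by (rule data)
  obtain \<eta> where \<eta>: "\<eta> \<in> Fam 1" and \<eta>u: "\<And>g y. g \<in> carrier G \<Longrightarrow> y \<in> topspace Y \<Longrightarrow> fn \<eta> g y = u g y"
    by (rule fam_exists[OF P.u]) (rule that, assumption+)
  have "cocycle_data G \<pi> X S A act (fn \<eta>) v"
  proof unfold_locales
    show "fam (fn \<eta>)" by (rule fam_fn[OF \<eta>])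
    show "v g h = cob (fn \<eta>) g h k x" if "g \<in> carrier G" "h \<in> carrier G" "k \<in> carrier G" "x \<in> topspace X" for g h k x
      unfolding P.v_cob[OF that] cob_def using that by (simp add: \<eta>u)
  qed
  from in_star_cocycle[OF \<eta> this] obtain \<zeta> where "\<zeta> \<in> Coch 2" "ev_star \<pi> G X S A 2 \<zeta> = cobdry \<pi> G 1 \<eta>" by (rule zeta_exists[OF \<eta>])
  then have a: "admissible \<eta> \<zeta>" using \<eta> by (simp add: admissible_def)
  interpret T: two_cocycle_data G \<pi> X S A act u v "fn \<eta>" "\<lambda>g h. \<zeta> (symb \<pi> G [g, h])"
    using data admissible_cocycle_data[OF a] relative_pair_axioms by (simp add: two_cocycle_data_def)
  have "cohomologous u (fn \<eta>)"
    unfolding cohomologous_def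
    by (intro exI[of _ "\<lambda>_. \<one>\<^bsub>A\<^esub>"]) (simp add: tsA \<eta>u)
  from T.equivalent_if_cohomologous[OF this] have "rel_ext_equivalent X S A P.R (ext_of \<eta> \<zeta>)"
    unfolding admissible_ext_of[OF a] .
  with eq have "rel_ext_equivalent X S A R (ext_of \<eta> \<zeta>)"
    using rel_ext_equivalent_trans[OF R P.relative_extension admissible_relative_extension[OF a]] by blast
  then show ?thesis using that a by blast
qed

lemma carrier_rel_cohomology:
  "carrier (rel_cohomology \<pi> G X S A act 2) = rel_class \<pi> G X S A act 2 ` carrier (rel_cocycles \<pi> G X S A act 2)"
  by (auto simp: rel_cohomology_def cohomology_def FactGroup_def RCOSETS_def rel_class_def cohomology_class_def rel_cocycles_def)

text \<open>\<open>\<Phi>\<close> is chosen among the extension classes of all admissible pairs that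
  represent a given class; \<open>admissible_class_eq_iff\<close> shows that they coincide.\<close>

lemma bijection:
  obtains \<Phi> where "bij_betw \<Phi> (carrier (rel_cohomology \<pi> G X S A act 2)) (rel_ext_classes G X S A act)"
    and "\<And>\<eta> \<zeta>. admissible \<eta> \<zeta> \<Longrightarrow>
      \<Phi> (rel_class \<pi> G X S A act 2 (in_star \<pi> G X S 1 \<eta>)) = rel_ext_rel G X S A act `` {ext_of \<eta> \<zeta>}"
proof -
  let ?cl = "\<lambda>\<eta>. rel_class \<pi> G X S A act 2 (in_star \<pi> G X S 1 \<eta>)"
  let ?ex = "\<lambda>\<eta> \<zeta>. rel_ext_rel G X S A act `` {ext_of \<eta> \<zeta>}"
  define \<Phi> where "\<Phi> c = (SOME e. \<exists>\<eta> \<zeta>. admissible \<eta> \<zeta> \<and> c = ?cl \<eta> \<and> e = ?ex \<eta> \<zeta>)" for c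
  have \<Phi>: "\<Phi> (?cl \<eta>) = ?ex \<eta> \<zeta>" if a: "admissible \<eta> \<zeta>" for \<eta> \<zeta>
  proof -
    have "\<exists>\<eta>' \<zeta>'. admissible \<eta>' \<zeta>' \<and> ?cl \<eta> = ?cl \<eta>' \<and> \<Phi> (?cl \<eta>) = ?ex \<eta>' \<zeta>'"
      unfolding \<Phi>_def by (rule someI_ex[of "\<lambda>e. \<exists>\<eta>' \<zeta>'. admissible \<eta>' \<zeta>' \<and> ?cl \<eta> = ?cl \<eta>' \<and> e = ?ex \<eta>' \<zeta>'"]) (use a in blast)
    then obtain \<eta>' \<zeta>' where "admissible \<eta>' \<zeta>'" "?cl \<eta> = ?cl \<eta>'" "\<Phi> (?cl \<eta>) = ?ex \<eta>' \<zeta>'" by blast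
    then show ?thesis using admissible_class_eq_iff[OF a, of \<eta>' \<zeta>'] by simp
  qed
  have rep: "\<exists>\<eta> \<zeta>. admissible \<eta> \<zeta> \<and> c = ?cl \<eta>" if c: "c \<in> carrier (rel_cohomology \<pi> G X S A act 2)" for c
  proof -
    obtain \<xi> where \<xi>: "\<xi> \<in> carrier (rel_cocycles \<pi> G X S A act 2)" "c = rel_class \<pi> G X S A act 2 \<xi>"
      using c unfolding carrier_rel_cohomology by blast
    obtain \<eta> \<zeta> where "admissible \<eta> \<zeta>" "in_star \<pi> G X S 1 \<eta> = \<xi>" using admissible_exists[OF \<xi>(1)] .
    then show ?thesis using \<xi>(2) by blast
  qed
  have "bij_betw \<Phi> (carrier (rel_cohomology \<pi> G X S A act 2)) (rel_ext_classes G X S A act)"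
  proof (rule bij_betwI')
    fix c c' assume "c \<in> carrier (rel_cohomology \<pi> G X S A act 2)" "c' \<in> carrier (rel_cohomology \<pi> G X S A act 2)"
    then obtain \<eta> \<zeta> \<eta>' \<zeta>' where a: "admissible \<eta> \<zeta>" "c = ?cl \<eta>" "admissible \<eta>' \<zeta>'" "c' = ?cl \<eta>'" using rep by meson
    show "\<Phi> c = \<Phi> c' \<longleftrightarrow> c = c'"
      unfolding a(2,4) \<Phi>[OF a(1)] \<Phi>[OF a(3)] using admissible_class_eq_iff[OF a(1,3)] by simp
  next
    fix c assume "c \<in> carrier (rel_cohomology \<pi> G X S A act 2)"
    then obtain \<eta> \<zeta> where a: "admissible \<eta> \<zeta>" "c = ?cl \<eta>" using rep by meson
    show "\<Phi> c \<in> rel_ext_classes G X S A act"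
      unfolding a(2) \<Phi>[OF a(1)] rel_ext_classes_def by (rule quotientI) (simp add: admissible_relative_extension[OF a(1)])
  next
    fix e assume "e \<in> rel_ext_classes G X S A act"
    then obtain R where R: "relative_extension G X S A act R" "e = rel_ext_rel G X S A act `` {R}"
      by (auto simp: rel_ext_classes_def elim: quotientE)
    obtain \<eta> \<zeta> where a: "admissible \<eta> \<zeta>" "rel_ext_equivalent X S A R (ext_of \<eta> \<zeta>)" using admissible_surj[OF R(1)] .
    have "e = \<Phi> (?cl \<eta>)"
      unfolding R(2) \<Phi>[OF a(1)]
      by (rule equiv_class_eq[OF equiv_rel_ext_rel]) (simp add: rel_ext_rel_def R(1) a(2) admissible_relative_extension[OF a(1)])
    moreover have "?cl \<eta> \<in> carrier (rel_cohomology \<pi> G X S A act 2)"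
      unfolding carrier_rel_cohomology using in_star_cocycle[OF _ admissible_cocycle_data[OF a(1)]] a(1) by (simp only: admissible_def imageI)
    ultimately show "\<exists>c\<in>carrier (rel_cohomology \<pi> G X S A act 2). e = \<Phi> c" by blast
  qed
  then show ?thesis using that \<Phi> by blast
qed

end

text \<open>The first conjunct says that the choices in the construction can always be made and that
  \<open>\<eta>\<close> determines \<open>\<zeta>\<close>; it keeps the condition on
  \<open>\<Phi>\<close> from being vacuous. Naturality is expressed by that condition:
  \<open>\<Phi>\<close> sends each class to the extension built from any of its representatives and
  any choices. \<open>X\<close> is nonempty because otherwise the augmentation would not be
  onto.\<close>

theorem theorem5p5:
  fixes G :: "'g tgroup" and X :: "'x topology" and S :: "'x \<Rightarrow> 'g set"
    and \<pi> :: "nat set" and A :: "'a tgroup" and act :: "'g \<Rightarrow> 'a \<Rightarrow> 'a"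
  assumes "profinite_group G"
    and "profinite_space X" and "topspace X \<noteq> {}"
    and "continuously_indexed G X S"
    and "\<pi> \<noteq> {}" and "\<forall>p\<in>\<pi>. prime p"
    and "finite_primary_gmodule \<pi> G A act"
  shows "(\<forall>\<xi>\<in>carrier (rel_cocycles \<pi> G X S A act 2).
            (\<exists>\<eta>\<in>carrier (family_cochains \<pi> G X S A act 1). in_star \<pi> G X S 1 \<eta> = \<xi>) \<and>
            (\<forall>\<eta>\<in>carrier (family_cochains \<pi> G X S A act 1). in_star \<pi> G X S 1 \<eta> = \<xi> \<longrightarrow>
               (\<exists>!\<zeta>. \<zeta> \<in> carrier (cochains \<pi> G 2 A act) \<and>
                     ev_star \<pi> G X S A 2 \<zeta> = cobdry \<pi> G 1 \<eta>))) \<and>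
         (\<exists>\<Phi>. bij_betw \<Phi> (carrier (rel_cohomology \<pi> G X S A act 2)) (rel_ext_classes G X S A act) \<and>
            (\<forall>\<xi>\<in>carrier (rel_cocycles \<pi> G X S A act 2).
             \<forall>\<eta>\<in>carrier (family_cochains \<pi> G X S A act 1).
             \<forall>\<zeta>\<in>carrier (cochains \<pi> G 2 A act).
               in_star \<pi> G X S 1 \<eta> = \<xi> \<and> ev_star \<pi> G X S A 2 \<zeta> = cobdry \<pi> G 1 \<eta> \<longrightarrow>
               relative_extension G X S A act (cocycle_rel_ext \<pi> G X S A act \<eta> \<zeta>) \<and>
               \<Phi> (rel_class \<pi> G X S A act 2 \<xi>) =
                 rel_ext_rel G X S A act `` {cocycle_rel_ext \<pi> G X S A act \<eta> \<zeta>}))"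
proof -
  interpret relative_pair G \<pi> X S A act using assms by unfold_locales
  obtain \<Phi> where bij: "bij_betw \<Phi> (carrier (rel_cohomology \<pi> G X S A act 2)) (rel_ext_classes G X S A act)"
    and \<Phi>: "\<And>\<eta> \<zeta>. admissible \<eta> \<zeta> \<Longrightarrow>
      \<Phi> (rel_class \<pi> G X S A act 2 (in_star \<pi> G X S 1 \<eta>)) = rel_ext_rel G X S A act `` {ext_of \<eta> \<zeta>}"
    using bijection by metis
  show ?thesis
    unfolding family_cochains_carrier cochains_carrier
  proof (intro conjI ballI impI exI[of _ \<Phi>] bij)
    fix \<xi> assume \<xi>: "\<xi> \<in> carrier (rel_cocycles \<pi> G X S A act 2)"
    show "\<exists>\<eta>\<in>Fam 1. in_star \<pi> G X S 1 \<eta> = \<xi>"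
      using admissible_exists[OF \<xi>] unfolding admissible_def by metis
    fix \<eta> assume \<eta>: "\<eta> \<in> Fam 1" "in_star \<pi> G X S 1 \<eta> = \<xi>"
    obtain \<zeta> where "\<zeta> \<in> Coch 2" "ev_star \<pi> G X S A 2 \<zeta> = cobdry \<pi> G 1 \<eta>"
      by (rule zeta_exists[OF \<eta>(1)]) (use \<xi> \<eta>(2) in simp)
    then show "\<exists>!\<zeta>. \<zeta> \<in> Coch 2 \<and> ev_star \<pi> G X S A 2 \<zeta> = cobdry \<pi> G 1 \<eta>"
      using ev_star_inject by metis
  next
    fix \<xi> \<eta> \<zeta> assume "\<eta> \<in> Fam 1" "\<zeta> \<in> Coch 2"
      and *: "in_star \<pi> G X S 1 \<eta> = \<xi> \<and> ev_star \<pi> G X S A 2 \<zeta> = cobdry \<pi> G 1 \<eta>"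
    then have a: "admissible \<eta> \<zeta>" by (simp add: admissible_def)
    show "relative_extension G X S A act (ext_of \<eta> \<zeta>)" by (rule admissible_relative_extension[OF a])
    show "\<Phi> (rel_class \<pi> G X S A act 2 \<xi>) = rel_ext_rel G X S A act `` {ext_of \<eta> \<zeta>}"
      using \<Phi>[OF a] * by simp
  qed
qed

end
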